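(* Let $\alpha\in(0,2]$, $2^*=2N/(N-\alpha)$, and let $-\mathfrak{L}$ be an operator as in the context. The following statements are equivalent (with constants $C>0$ that may differ between the statements and do not depend on $u$, $u_0$, $f$, $x$, $x_0$, $t$): (a) ($L^1$–$L^\infty$-smoothing) If $u$ is the solution of $\partial_tu+(-\mathfrak{L})[u]=0$ with initial data $u_0\in L^1(\mathbb{R}^N)$, then for all $t>0$ $$\|u(\cdot,t)\|_{L^\infty(\mathbb{R}^N)}\le Ct^{-\frac N\alpha}\|u_0\|_{L^1(\mathbb{R}^N)}.$$ (b) (Sobolev) For all $f\in L^1(\mathbb{R}^N)\cap\mathrm{dom}(\mathcal{Q}_{-\mathfrak{L}})$, $$\|f\|_{L^{2^*}(\mathbb{R}^N)}\le C\mathcal{Q}_{-\mathfrak{L}}[f]^{\frac12}.$$ (c) (Nash) For all $f\in L^1(\mathbb{R}^N)\cap\mathrm{dom}(\mathcal{Q}_{-\mathfrak{L}})$, $$\|f\|_{L^2(\mathbb{R}^N)}\le C\|f\|_{L^1(\mathbb{R}^N)}^{\vartheta}\,\mathcal{Q}_{-\mathfrak{L}}[f]^{\frac12(1-\vartheta)}\qquad\text{where }\ \vartheta:=\frac12\,\frac{2^*-2}{2^*-1}.$$ (d) (On-diagonal heat kernel bounds) The heat kernel $\mathbb{H}_{-\mathfrak{L}}^{x_0}$ satisfies, for all $t>0$, $$0\le\mathbb{H}_{-\mathfrak{L}}^{x_0}(x,t)\le Ct^{-\frac N\alpha}.$$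
   Context: Throughout $N\ge3$. Operator. $-\mathfrak{L}$ is a linear, symmetric, nonnegative operator which is densely defined, $\mathfrak m$-accretive and Dirichlet in $L^1(\mathbb{R}^N)$: writing $A=-\mathfrak{L}$ with domain $D(A)\subset L^1(\mathbb{R}^N)$, $D(A)$ is dense in $L^1$; $\|u\|_{L^1}\le\|u+\lambda A[u]\|_{L^1}$ for all $u\in D(A)$, $\lambda>0$; the range of $I+\lambda A$ is $L^1(\mathbb{R}^N)$ for all $\lambda>0$; and if $f\in L^1$, $a\le f\le b$ a.e. ($a,b\in\mathbb{R}$), then $a\le(I+\lambda A)^{-1}f\le b$ a.e. By symmetry the associated contraction semigroup on $L^1$ extends to a self-adjoint sub-Markovian semigroup on $L^2(\mathbb{R}^N)$, whose generator is still denoted $\mathfrak{L}$. Solutions of the linear equation are those given by the semigroup. The heat kernel $\mathbb{H}_{-\mathfrak{L}}^{x_0}(x,t)=\mathbb{H}_{-\mathfrak{L}}^{0}(x-x_0,t)$ is the (convolution) kernel of this semigroup, i.e. the solution with initial data $\delta_{x_0}$. Quadratic form: $\mathcal{Q}_{-\mathfrak{L}}[f]:=\int_{\mathbb{R}^N}f\,(-\mathfrak{L})[f]\,dx=\|(-\mathfrak{L})^{1/2}[f]\|_{L^2(\mathbb{R}^N)}^2$, with domain $\mathrm{dom}(\mathcal{Q}_{-\mathfrak{L}})$ the domain of $(-\mathfrak{L})^{1/2}$ in $L^2$. *)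

theory Defs
  imports "HOL-Analysis.Analysis" "HOL-Probability.Essential_Supremum"
begin

text \<open>
  Elements of $L^p(R^N)$ are represented by Borel functions, with equality almost everywhere
  with respect to Lebesgue measure (every Lebesgue class has a Borel representative).
\<close>

definition Lp :: "real \<Rightarrow> ('a::euclidean_space \<Rightarrow> real) set" where
  "Lp p = {f \<in> borel_measurable lborel. integrable lborel (\<lambda>x. \<bar>f x\<bar> powr p)}"

definition Lp_norm :: "real \<Rightarrow> ('a::euclidean_space \<Rightarrow> real) \<Rightarrow> real" where
  "Lp_norm p f = (LINT x|lborel. \<bar>f x\<bar> powr p) powr (1 / p)"

definition Linf_norm :: "('a::euclidean_space \<Rightarrow> real) \<Rightarrow> ereal" where
  "Linf_norm f = esssup lborel (\<lambda>x. ereal \<bar>f x\<bar>)"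

definition L2_inner :: "('a::euclidean_space \<Rightarrow> real) \<Rightarrow> ('a \<Rightarrow> real) \<Rightarrow> real" where
  "L2_inner f g = (LINT x|lborel. f x * g x)"

definition ae_eq :: "('a::euclidean_space \<Rightarrow> real) \<Rightarrow> ('a \<Rightarrow> real) \<Rightarrow> bool" where
  "ae_eq f g \<longleftrightarrow> (AE x in lborel. f x = g x)"

text \<open>
  An (unbounded) operator is represented by its graph, so its domain is the library's Domain and
  composition of operators is relational composition. Graphs are saturated under almost everywhere
  equality: equal operators on $L^p$ have equal graphs.
\<close>

type_synonym 'a operator = "(('a \<Rightarrow> real) \<times> ('a \<Rightarrow> real)) set"

definition linear_operator :: "real \<Rightarrow> 'a::euclidean_space operator \<Rightarrow> bool" where
  "linear_operator p A \<longleftrightarrow>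
     A \<subseteq> Lp p \<times> Lp p \<and>
     (\<forall>f g f' g'. (f, g) \<in> A \<and> f' \<in> Lp p \<and> g' \<in> Lp p \<and> ae_eq f f' \<and> ae_eq g g' \<longrightarrow> (f', g') \<in> A) \<and>
     (\<forall>f g g'. (f, g) \<in> A \<and> (f, g') \<in> A \<longrightarrow> ae_eq g g') \<and>
     (\<lambda>x. 0, \<lambda>x. 0) \<in> A \<and>
     (\<forall>f g f' g' a b. (f, g) \<in> A \<and> (f', g') \<in> A \<longrightarrow>
        (\<lambda>x. a * f x + b * f' x, \<lambda>x. a * g x + b * g' x) \<in> A)"

definition densely_defined :: "real \<Rightarrow> 'a::euclidean_space operator \<Rightarrow> bool" where
  "densely_defined p A \<longleftrightarrow>
     (\<forall>f\<in>Lp p. \<forall>\<epsilon>>0. \<exists>g\<in>Domain A. Lp_norm p (\<lambda>x. f x - g x) < \<epsilon>)"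

text \<open>
  For an operator in $L^1$ the pairings expressing symmetry and nonnegativity are
  only meaningful where the functions involved are also square integrable.
\<close>

definition symmetric_operator :: "'a::euclidean_space operator \<Rightarrow> bool" where
  "symmetric_operator A \<longleftrightarrow>
     (\<forall>(u, Au)\<in>A. \<forall>(v, Av)\<in>A. u \<in> Lp 2 \<and> Au \<in> Lp 2 \<and> v \<in> Lp 2 \<and> Av \<in> Lp 2 \<longrightarrow>
        L2_inner Au v = L2_inner u Av)"

definition nonneg_operator :: "'a::euclidean_space operator \<Rightarrow> bool" where
  "nonneg_operator A \<longleftrightarrow>
     (\<forall>(u, Au)\<in>A. u \<in> Lp 2 \<and> Au \<in> Lp 2 \<longrightarrow> 0 \<le> L2_inner u Au)"

definition m_accretive :: "'a::euclidean_space operator \<Rightarrow> bool" where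
  "m_accretive A \<longleftrightarrow>
     (\<forall>(u, Au)\<in>A. \<forall>\<mu>>0. Lp_norm 1 u \<le> Lp_norm 1 (\<lambda>x. u x + \<mu> * Au x)) \<and>
     (\<forall>\<mu>>0. \<forall>f\<in>Lp 1. \<exists>(u, Au)\<in>A. ae_eq (\<lambda>x. u x + \<mu> * Au x) f)"

text \<open>By accretivity, \<open>u\<close> below is the resolvent $(I + \mu A)^{-1}$ applied to \<open>f\<close>.\<close>

definition dirichlet_operator :: "'a::euclidean_space operator \<Rightarrow> bool" where
  "dirichlet_operator A \<longleftrightarrow>
     (\<forall>\<mu>>0. \<forall>f\<in>Lp 1. \<forall>(u, Au)\<in>A. \<forall>a b.
        ae_eq (\<lambda>x. u x + \<mu> * Au x) f \<and> (AE x in lborel. a \<le> f x \<and> f x \<le> b) \<longrightarrow>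
        (AE x in lborel. a \<le> u x \<and> u x \<le> b))"

definition admissible_operator :: "'a::euclidean_space operator \<Rightarrow> bool" where
  "admissible_operator A \<longleftrightarrow>
     linear_operator 1 A \<and> symmetric_operator A \<and> nonneg_operator A \<and>
     densely_defined 1 A \<and> m_accretive A \<and> dirichlet_operator A"

definition contraction_semigroup ::
    "real \<Rightarrow> (real \<Rightarrow> ('a::euclidean_space \<Rightarrow> real) \<Rightarrow> ('a \<Rightarrow> real)) \<Rightarrow> bool" where
  "contraction_semigroup p S \<longleftrightarrow>
     (\<forall>t\<ge>0. \<forall>f\<in>Lp p. S t f \<in> Lp p \<and> Lp_norm p (S t f) \<le> Lp_norm p f) \<and>
     (\<forall>t\<ge>0. \<forall>f\<in>Lp p. \<forall>g\<in>Lp p. \<forall>a b.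
        ae_eq (S t (\<lambda>x. a * f x + b * g x)) (\<lambda>x. a * S t f x + b * S t g x)) \<and>
     (\<forall>f\<in>Lp p. ae_eq (S 0 f) f) \<and>
     (\<forall>s\<ge>0. \<forall>t\<ge>0. \<forall>f\<in>Lp p. ae_eq (S (s + t) f) (S s (S t f))) \<and>
     (\<forall>f\<in>Lp p. ((\<lambda>t. Lp_norm p (\<lambda>x. S t f x - f x)) \<longlongrightarrow> 0) (at_right 0))"

text \<open>The negative of the infinitesimal generator.\<close>

definition neg_generator ::
    "real \<Rightarrow> (real \<Rightarrow> ('a::euclidean_space \<Rightarrow> real) \<Rightarrow> ('a \<Rightarrow> real)) \<Rightarrow> 'a operator" where
  "neg_generator p S =
     {(f, g). f \<in> Lp p \<and> g \<in> Lp p \<and>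
        ((\<lambda>t. Lp_norm p (\<lambda>x. (f x - S t f x) / t - g x)) \<longlongrightarrow> 0) (at_right 0)}"

text \<open>
  The semigroup on $L^1$ associated with \<open>A\<close> and its extension to $L^2$ are determined up to
  almost everywhere equality; existence is the Hille-Yosida theorem, and symmetry for the extension.
\<close>

definition heat_semigroup ::
    "'a::euclidean_space operator \<Rightarrow> real \<Rightarrow> ('a \<Rightarrow> real) \<Rightarrow> ('a \<Rightarrow> real)" where
  "heat_semigroup A = (SOME S. contraction_semigroup 1 S \<and> neg_generator 1 S = A)"

definition L2_semigroup ::
    "'a::euclidean_space operator \<Rightarrow> real \<Rightarrow> ('a \<Rightarrow> real) \<Rightarrow> ('a \<Rightarrow> real)" where
  "L2_semigroup A = (SOME T. contraction_semigroup 2 T \<and>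
     (\<forall>t\<ge>0. \<forall>f\<in>Lp 1 \<inter> Lp 2. ae_eq (T t f) (heat_semigroup A t f)))"

definition L2_operator :: "'a::euclidean_space operator \<Rightarrow> 'a operator" where
  "L2_operator A = neg_generator 2 (L2_semigroup A)"

definition adjoint_operator :: "'a::euclidean_space operator \<Rightarrow> 'a operator" where
  "adjoint_operator B =
     {(f, g). f \<in> Lp 2 \<and> g \<in> Lp 2 \<and> (\<forall>(h, Bh)\<in>B. L2_inner Bh f = L2_inner h g)}"

definition self_adjoint :: "'a::euclidean_space operator \<Rightarrow> bool" where
  "self_adjoint B \<longleftrightarrow> densely_defined 2 B \<and> adjoint_operator B = B"

definition sqrt_operator :: "'a::euclidean_space operator \<Rightarrow> 'a operator" where
  "sqrt_operator T = (THE B. self_adjoint B \<and> nonneg_operator B \<and> B O B = T)"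

definition dom_Q :: "'a::euclidean_space operator \<Rightarrow> ('a \<Rightarrow> real) set" where
  "dom_Q A = Domain (sqrt_operator (L2_operator A))"

definition Q_form :: "'a::euclidean_space operator \<Rightarrow> ('a \<Rightarrow> real) \<Rightarrow> real" where
  "Q_form A f = (Lp_norm 2 (SOME g. (f, g) \<in> sqrt_operator (L2_operator A)))\<^sup>2"

definition translation_invariant :: "'a::euclidean_space operator \<Rightarrow> bool" where
  "translation_invariant A \<longleftrightarrow>
     (\<forall>(f, g)\<in>A. \<forall>y. (\<lambda>x. f (x - y), \<lambda>x. g (x - y)) \<in> A)"

text \<open>
  \<open>H x0 x t\<close> is the value at \<open>(x, t)\<close> of the kernel with pole \<open>x0\<close>. It is a convolution
  kernel exactly when the operator commutes with translations, so the convolution form is part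
  of the definition in that case; no translation invariance is imposed on the operator itself.
  For fixed \<open>t\<close> the kernel is determined up to a null set.
\<close>

definition heat_kernel ::
    "'a::euclidean_space operator \<Rightarrow> ('a \<Rightarrow> 'a \<Rightarrow> real \<Rightarrow> real) \<Rightarrow> bool" where
  "heat_kernel A H \<longleftrightarrow>
     (\<forall>t>0. (\<lambda>(x0, x). H x0 x t) \<in> borel_measurable (lborel \<Otimes>\<^sub>M lborel)) \<and>
     (\<forall>t>0. \<forall>u0\<in>Lp 1. AE x in lborel.
        integrable lborel (\<lambda>x0. H x0 x t * u0 x0) \<and>
        heat_semigroup A t u0 x = (LINT x0|lborel. H x0 x t * u0 x0)) \<and>
     (translation_invariant A \<longrightarrow> (\<forall>x0 x t. H x0 x t = H 0 (x - x0) t))"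

end

theory Submission
  imports Defs
begin

text \<open>
  The resolvents of \<open>A\<close> on $L^1$ are sub-Markovian and symmetric, so they act compatibly on $L^1$ and $L^2$;
  the dyadic limits $\lim_n J_{t/2^n}^{2^n}$ give both semigroups, and the form is the monotone limit of
  the Yosida energies $\mu^{-1} \langle (1 - J_\mu) f, f\rangle$. Smoothing gives
  $\langle S_t f, f\rangle \le C t^{-\kappa} \|f\|_1^2$ with $\kappa = N/\alpha$, while
  $\|f\|_2^2 - \langle S_t f, f\rangle \le t \, Q[f]$; optimizing in $t$ yields the Nash inequality for all bounds
  of the Yosida energies. Since these energies are additive under slicing at dyadic levels, up to
  inequality, the Nash inequality self-improves to the Sobolev inequality, and Sobolev gives Nash back
  by interpolation. Nash implies decay of $\|S_t f\|_2$ in terms of $\|f\|_1$, and duality gives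
  smoothing. Finally a positive operator bounded from $L^1$ to $L^\infty$ has a bounded kernel, obtained as the
  limit of a bounded martingale of cell averages.
\<close>

section \<open>Generation of contraction semigroups in Banach spaces\<close>

text \<open>The heat semigroup, its extension to L2, the square root and the value of the form are
  all defined by \<open>SOME\<close> or \<open>THE\<close>, so constructing good objects does not
  suffice. Each construction comes with a uniqueness statement that identifies the chosen object
  with the constructed one: a generator determines its contraction semigroup, and a nonnegative
  self-adjoint root is unique. Symmetry and nonnegativity are assumed only for pairs of
  \<open>A\<close> that are square integrable. The Dirichlet property supplies enough such pairs,
  because resolvents preserve bounds and so map integrable bounded functions to integrable bounded
  functions. All exponents depend on \<kappa> = N/\<alpha> alone: 2^* = 2\<kappa>/(\<kappa>-1) and
  \<theta> = 1/(1+\<kappa>), whence 1/2 = \<theta> + (1-\<theta>)/2^*. That relation is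
  interpolation and yields Nash from Sobolev. The converse is nonlinear and again rests on the
  Dirichlet property, through the decrease of energies under truncation. The abstract theory needs
  spaces that are types, while \<open>A\<close> acts on functions; \<open>lift_graph\<close>
  translates between classes and functions.\<close>

lemma funpow_contraction:
  fixes X :: "'b::real_normed_vector \<Rightarrow> 'b"
  assumes "\<And>f. norm (X f) \<le> norm f"
  shows "norm ((X ^^ n) f) \<le> norm f"
  by (induction n) (auto intro: order_trans[OF assms])

lemma linear_funpow:
  fixes X :: "'b::real_vector \<Rightarrow> 'b"
  assumes "linear X"
  shows "linear (X ^^ n)"
proof (induction n)
  case (Suc n)
  then show ?case using linear_compose[OF Suc assms] by (simp add: comp_def)
qed (simp add: linear_iff)

lemma funpow_commute:
  assumes "\<And>f. X (Y f) = Y (X f)"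
  shows "(X ^^ n) (Y f) = Y ((X ^^ n) f)"
  by (induction n) (auto simp: assms)

text \<open>Telescoping: \<open>X^n - Y^n\<close> is the sum of the products
  \<open>X^(n-1-k) Y^k (X - Y)\<close>, where commutation lets the difference act first and
  contractivity removes the other factors. Only the one-step error at \<open>f\<close> itself
  counts, and that is small when \<open>f\<close> is regular.\<close>

lemma funpow_diff_contraction:
  fixes X Y :: "'b::real_normed_vector \<Rightarrow> 'b"
  assumes X: "linear X" "\<And>f. norm (X f) \<le> norm f"
    and Y: "linear Y" "\<And>f. norm (Y f) \<le> norm f"
    and comm: "\<And>f. X (Y f) = Y (X f)"
  shows "norm ((X ^^ n) f - (Y ^^ n) f) \<le> real n * norm (X f - Y f)"
proof (induction n)
  case 0
  then show ?case by simp
next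
  case (Suc n)
  have 1: "(X ^^ Suc n) f - (Y ^^ Suc n) f = (X ^^ n) (X f - Y f) + Y ((X ^^ n) f - (Y ^^ n) f)"
    unfolding funpow_Suc_right comp_def
    by (simp add: linear_diff[OF Y(1)] linear_diff[OF linear_funpow[OF X(1)]] funpow_commute[of X Y, OF comm]
        funpow_swap1)
  have "norm ((X ^^ Suc n) f - (Y ^^ Suc n) f) \<le> norm (X f - Y f) + norm ((X ^^ n) f - (Y ^^ n) f)"
    unfolding 1 by (rule order_trans[OF norm_triangle_ineq]) (intro add_mono funpow_contraction X Y)
  with Suc show ?case by (simp add: algebra_simps)
qed

lemma convergent_contractions_dense:
  fixes L :: "nat \<Rightarrow> 'b::banach \<Rightarrow> 'b"
  assumes lin: "\<And>n. linear (L n)" and contr: "\<And>n f. norm (L n f) \<le> norm f"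
    and conv: "\<And>f. f \<in> D \<Longrightarrow> convergent (\<lambda>n. L n f)" and dense: "closure D = UNIV"
  shows "convergent (\<lambda>n. L n f)"
proof -
  have "Cauchy (\<lambda>n. L n f)"
  proof (rule CauchyI)
    fix e :: real assume e: "e > 0"
    have "f \<in> closure D" by (simp add: dense)
    then obtain d where d: "d \<in> D" "dist d f < e/3"
      unfolding closure_approachable using e by (metis divide_pos_pos zero_less_numeral)
    have "Cauchy (\<lambda>n. L n d)" using conv[OF d(1)] by (rule convergent_Cauchy)
    then obtain M where M: "\<And>m n. m \<ge> M \<Longrightarrow> n \<ge> M \<Longrightarrow> norm (L m d - L n d) < e/3"
      using CauchyD[of "\<lambda>n. L n d" "e/3"] e by auto
    have "norm (L m f - L n f) < e" if "m \<ge> M" "n \<ge> M" for m n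
    proof -
      have "L m f - L n f = L m (f - d) + (L m d - L n d) + L n (d - f)"
        by (simp add: linear_diff[OF lin])
      also have "norm \<dots> \<le> norm (L m (f - d)) + norm (L m d - L n d) + norm (L n (d - f))"
        by (meson norm_triangle_ineq norm_triangle_le order_refl add_mono order_trans)
      also have "\<dots> < norm (f - d) + e/3 + norm (d - f)"
        using contr[of m "f - d"] contr[of n "d - f"] M[OF that] by linarith
      also have "\<dots> < e" using d(2) by (simp add: dist_norm norm_minus_commute)
      finally show ?thesis .
    qed
    then show "\<exists>M. \<forall>m\<ge>M. \<forall>n\<ge>M. norm (L m f - L n f) < e" by blast
  qed
  then show ?thesis by (rule Cauchy_convergent)
qed

text \<open>A three-epsilon argument along a filter. Linearity and contractivity are asked for only
  eventually, because the operators \<open>S t\<close> have them for \<open>t \<ge> 0\<close> and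
  the filter of interest is \<open>at_right 0\<close>.\<close>

lemma tendsto_contractions_dense:
  fixes L :: "'i \<Rightarrow> 'b::real_normed_vector \<Rightarrow> 'b"
  assumes lin: "\<forall>\<^sub>F i in F. linear (L i)" and contr: "\<forall>\<^sub>F i in F. \<forall>f. norm (L i f) \<le> norm f"
    and lin': "linear L'" and contr': "\<And>f. norm (L' f) \<le> norm f"
    and conv: "\<And>f. f \<in> D \<Longrightarrow> ((\<lambda>i. L i f) \<longlongrightarrow> L' f) F" and dense: "closure D = UNIV"
  shows "((\<lambda>i. L i f) \<longlongrightarrow> L' f) F"
proof (rule tendstoI)
  fix e :: real assume e: "e > 0"
  have "f \<in> closure D" by (simp add: dense)
  then obtain d where d: "d \<in> D" "dist d f < e/3"
    unfolding closure_approachable using e by (metis divide_pos_pos zero_less_numeral)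
  have "\<forall>\<^sub>F i in F. dist (L i d) (L' d) < e/3"
    using conv[OF d(1)] e by (intro tendstoD) auto
  then show "\<forall>\<^sub>F i in F. dist (L i f) (L' f) < e"
    using lin contr
  proof eventually_elim
    case (elim i)
    have "L i f - L' f = L i (f - d) + (L i d - L' d) + L' (d - f)"
      by (simp add: linear_diff[OF elim(2)] linear_diff[OF lin'])
    also have "norm \<dots> \<le> norm (L i (f - d)) + norm (L i d - L' d) + norm (L' (d - f))"
      by (meson norm_triangle_ineq norm_triangle_le order_refl add_mono order_trans)
    also have "\<dots> < norm (f - d) + e/3 + norm (d - f)"
      using elim(3)[rule_format, of "f - d"] contr'[of "d - f"] elim(1) unfolding dist_norm by linarith
    also have "\<dots> < e" using d(2) by (simp add: dist_norm norm_minus_commute)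
    finally show ?case by (simp add: dist_norm)
  qed
qed

definition contraction_sg :: "(real \<Rightarrow> 'b::real_normed_vector \<Rightarrow> 'b) \<Rightarrow> bool" where
  "contraction_sg S \<longleftrightarrow> (\<forall>t\<ge>0. linear (S t) \<and> (\<forall>f. norm (S t f) \<le> norm f)) \<and> (\<forall>f. S 0 f = f) \<and>
     (\<forall>s\<ge>0. \<forall>t\<ge>0. \<forall>f. S (s + t) f = S s (S t f)) \<and> (\<forall>f. ((\<lambda>t. S t f) \<longlongrightarrow> f) (at_right 0))"

definition neg_gen :: "(real \<Rightarrow> 'b::real_normed_vector \<Rightarrow> 'b) \<Rightarrow> ('b \<times> 'b) set" where
  "neg_gen S = {(f, g). ((\<lambda>t. (1 / t) *\<^sub>R (f - S t f)) \<longlongrightarrow> g) (at_right 0)}"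

section \<open>Resolvents of m-accretive graphs\<close>

locale maccretive =
  fixes G :: "('b::banach \<times> 'b) set"
  assumes subspace: "subspace G"
    and accretive: "(u, v) \<in> G \<Longrightarrow> 0 < \<mu> \<Longrightarrow> norm u \<le> norm (u + \<mu> *\<^sub>R v)"
    and range: "0 < \<mu> \<Longrightarrow> \<exists>u v. (u, v) \<in> G \<and> u + \<mu> *\<^sub>R v = f"
    and dense_domain: "closure (Domain G) = UNIV"
begin

lemma G_lincomb: "(u, v) \<in> G \<Longrightarrow> (u', v') \<in> G \<Longrightarrow> (a *\<^sub>R u + b *\<^sub>R u', a *\<^sub>R v + b *\<^sub>R v') \<in> G"
  using subspace_add[OF subspace subspace_scale[OF subspace] subspace_scale[OF subspace], of "(u,v)" "(u',v')" a b] by simp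

lemma G_diff: "(u, v) \<in> G \<Longrightarrow> (u', v') \<in> G \<Longrightarrow> (u - u', v - v') \<in> G"
  using G_lincomb[of u v u' v' 1 "-1"] by simp

lemma G_scale: "(u, v) \<in> G \<Longrightarrow> (a *\<^sub>R u, a *\<^sub>R v) \<in> G"
  using G_lincomb[of u v u v a 0] by simp

text \<open>For \<open>\<mu> \<le> 0\<close> the resolvent is the identity, so that the estimates below include step length zero.\<close>

definition J :: "real \<Rightarrow> 'b \<Rightarrow> 'b" where
  "J \<mu> f = (if \<mu> \<le> 0 then f else THE u. \<exists>v. (u, v) \<in> G \<and> u + \<mu> *\<^sub>R v = f)"

lemma resolvent_unique:
  assumes "0 < \<mu>" "(u, v) \<in> G" "(u', v') \<in> G" "u + \<mu> *\<^sub>R v = u' + \<mu> *\<^sub>R v'"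
  shows "u = u'"
proof -
  have "(u - u') + \<mu> *\<^sub>R (v - v') = 0" using assms(4) by (simp add: algebra_simps)
  then have "norm (u - u') \<le> 0" using accretive[OF G_diff[OF assms(2,3)] assms(1)] by simp
  then show ?thesis by simp
qed

lemma J_eqI: "0 < \<mu> \<Longrightarrow> (u, v) \<in> G \<Longrightarrow> u + \<mu> *\<^sub>R v = f \<Longrightarrow> J \<mu> f = u"
  unfolding J_def using resolvent_unique by (auto intro!: the_equality)

lemma J_0: "J 0 f = f" by (simp add: J_def)

lemma J_in: assumes "0 < \<mu>" shows "(J \<mu> f, (1 / \<mu>) *\<^sub>R (f - J \<mu> f)) \<in> G"
proof -
  obtain u v where uv: "(u, v) \<in> G" "u + \<mu> *\<^sub>R v = f" using range[OF assms] by blast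
  have "J \<mu> f = u" using J_eqI[OF assms uv] .
  moreover have "v = (1 / \<mu>) *\<^sub>R (f - u)" using uv(2) assms by auto
  ultimately show ?thesis using uv(1) by simp
qed

lemma norm_J: "norm (J \<mu> f) \<le> norm f"
proof (cases "\<mu> > 0")
  case True
  then show ?thesis using accretive[OF J_in[OF True, of f] True] by simp
qed (simp add: J_def)

lemma linear_J: "linear (J \<mu>)"
proof (cases "\<mu> > 0")
  case True
  have *: "J \<mu> (a *\<^sub>R f + b *\<^sub>R g) = a *\<^sub>R J \<mu> f + b *\<^sub>R J \<mu> g" for a b f g
    by (rule J_eqI[OF True G_lincomb[OF J_in[OF True] J_in[OF True]]]) (use True in \<open>simp add: algebra_simps\<close>)
  show ?thesis
    by (rule linearI) (use *[of 1 _ 1] *[of _ _ 0] in auto)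
qed (auto simp: J_def intro: linearI)

lemmas J_diff = linear_diff[OF linear_J] and J_add = linear_add[OF linear_J] and J_scale = linear_cmul[OF linear_J]

lemma linear_Jpow: "linear (J \<mu> ^^ n)" by (rule linear_funpow[OF linear_J])

lemma norm_Jpow: "norm ((J \<mu> ^^ n) f) \<le> norm f" by (rule funpow_contraction[OF norm_J])

text \<open>The Yosida quotient \<open>z = (u - J \<mu> u) / \<mu>\<close> is the second component
  over \<open>J \<mu> u\<close>. By linearity \<open>(z, (v - z) / \<mu>)\<close> also lies in
  \<open>G\<close>, so \<open>z\<close> solves the resolvent equation with datum \<open>v\<close>,
  that is \<open>z = J \<mu> v\<close>.\<close>

lemma J_graph: assumes "(u, v) \<in> G" shows "(J \<mu> u, J \<mu> v) \<in> G"
proof (cases "\<mu> > 0")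
  case True
  define z where "z = (1 / \<mu>) *\<^sub>R (u - J \<mu> u)"
  have "(u - J \<mu> u, v - z) \<in> G" unfolding z_def by (intro G_diff assms J_in[OF True])
  from G_scale[OF this, of "1 / \<mu>"] have "(z, (1 / \<mu>) *\<^sub>R (v - z)) \<in> G" unfolding z_def .
  then have "J \<mu> v = z" by (rule J_eqI[OF True]) (use True in simp)
  then show ?thesis using J_in[OF True, of u] by (simp add: z_def)
qed (use assms in \<open>simp add: J_def\<close>)

lemma diff_J: assumes "(u, v) \<in> G" "\<mu> \<ge> 0" shows "u - J \<mu> u = \<mu> *\<^sub>R J \<mu> v"
proof (cases "\<mu> > 0")
  case True
  have "J \<mu> (u + \<mu> *\<^sub>R v) = u" by (rule J_eqI[OF True assms(1)]) simp
  then show ?thesis by (simp add: J_add J_scale algebra_simps)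
qed (use assms in \<open>simp add: J_def\<close>)

text \<open>A linear map that preserves \<open>G\<close> carries the solution of the resolvent
  equation for \<open>f\<close> to the solution for \<open>X f\<close>. It is applied to resolvents,
  to the operators of a semigroup and to translations.\<close>

lemma J_commute: assumes "\<And>u v. (u, v) \<in> G \<Longrightarrow> (X u, X v) \<in> G" "linear X"
  shows "X (J \<mu> f) = J \<mu> (X f)"
proof (cases "\<mu> > 0")
  case True
  have "J \<mu> (X f) = X (J \<mu> f)"
    by (rule J_eqI[OF True assms(1)[OF J_in[OF True]]])
      (use True in \<open>simp add: linear_cmul[OF assms(2)] linear_diff[OF assms(2)]\<close>)
  then show ?thesis by simp
qed (simp add: J_def)

lemma J_comm: "J \<mu> (J \<nu> f) = J \<nu> (J \<mu> f)"
  by (rule J_commute[OF J_graph linear_J])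

lemma norm_diff_Jpow: assumes "(u, v) \<in> G" "\<mu> \<ge> 0" shows "norm (u - (J \<mu> ^^ n) u) \<le> real n * \<mu> * norm v"
proof -
  have "norm ((id ^^ n) u - (J \<mu> ^^ n) u) \<le> real n * norm (id u - J \<mu> u)"
    by (rule funpow_diff_contraction) (auto simp: linear_J norm_J linear_id)
  also have "norm (id u - J \<mu> u) \<le> \<mu> * norm v"
    using diff_J[OF assms] norm_J[of \<mu> v] assms(2) by (simp add: mult_left_mono)
  finally show ?thesis using assms(2) by (simp add: mult.assoc mult_left_mono)
qed

lemma J_tendsto: "((\<lambda>\<mu>. J \<mu> f) \<longlongrightarrow> f) (at_right 0)"
proof (rule tendsto_contractions_dense[where L' = "\<lambda>f. f" and D = "Domain G"])
  show "((\<lambda>\<mu>. J \<mu> u) \<longlongrightarrow> u) (at_right 0)" if u: "u \<in> Domain G" for u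
  proof -
    obtain v where v: "(u, v) \<in> G" using u by auto
    show ?thesis
    proof (rule Lim_null[THEN iffD2, OF Lim_null_comparison])
      show "\<forall>\<^sub>F \<mu> in at_right 0. norm (J \<mu> u - u) \<le> \<mu> * norm v"
        using norm_diff_Jpow[OF v, of _ 1] by (auto simp: eventually_at_filter norm_minus_commute)
      show "((\<lambda>\<mu>. \<mu> * norm v) \<longlongrightarrow> 0) (at_right 0)" by (auto intro!: tendsto_eq_intros)
    qed
  qed
qed (auto simp: linear_J norm_J dense_domain intro: linearI)


text \<open>Formally \<open>(1 + sG)(1 + tG) = 1 + (s + t)G + stG^2\<close>. The two-step and the
  one-step scheme therefore differ by \<open>s * t\<close> times a product of resolvents applied to
  \<open>h = G^2 f\<close>; this local error of second order is why \<open>f\<close> must lie in the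
  domain of the square.\<close>

lemma JJ_estimate:
  assumes "(f, g) \<in> G" "(g, h) \<in> G" "s \<ge> 0" "t \<ge> 0"
  shows "norm (J (s + t) f - J s (J t f)) \<le> s * t * norm h"
proof (cases "s = 0 \<or> t = 0")
  case True
  then show ?thesis using assms by (auto simp: J_0)
next
  case False
  then have st: "s > 0" "t > 0" using assms by auto
  define X where "X = (\<lambda>f. J s (J t f))"
  have lin: "linear X" unfolding X_def using linear_compose[OF linear_J linear_J] by (simp add: comp_def)
  have Xf: "(X f, X g) \<in> G" unfolding X_def by (intro J_graph assms)
  have eq: "f + (s + t) *\<^sub>R g + (s * t) *\<^sub>R h = (f + s *\<^sub>R g) + t *\<^sub>R (g + s *\<^sub>R h)"
    by (simp add: algebra_simps)
  have "(f + s *\<^sub>R g, g + s *\<^sub>R h) \<in> G" using G_lincomb[OF assms(1,2), of 1 s] by simp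
  then have "J t (f + (s + t) *\<^sub>R g + (s * t) *\<^sub>R h) = f + s *\<^sub>R g"
    unfolding eq by (rule J_eqI[OF st(2)]) simp
  moreover have "J s (f + s *\<^sub>R g) = f" by (rule J_eqI[OF st(1) assms(1)]) simp
  ultimately have "X (f + (s + t) *\<^sub>R g + (s * t) *\<^sub>R h) = f" by (simp add: X_def)
  then have "X f + (s + t) *\<^sub>R X g = f - (s * t) *\<^sub>R X h"
    by (simp add: linear_add[OF lin] linear_cmul[OF lin] algebra_simps)
  then have "J (s + t) (f - (s * t) *\<^sub>R X h) = X f" using J_eqI[OF _ Xf, of "s + t"] st by simp
  then have "J (s + t) f - X f = (s * t) *\<^sub>R J (s + t) (X h)" by (simp add: J_diff J_scale diff_eq_eq add.commute)
  then have "norm (J (s + t) f - X f) \<le> \<bar>s * t\<bar> * norm (J (s + t) (X h))" by simp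
  also have "norm (J (s + t) (X h)) \<le> norm h"
    unfolding X_def by (intro order_trans[OF norm_J] order_refl)
  finally show ?thesis using st by (simp add: X_def mult_left_mono)
qed

section \<open>Convergence of the dyadic Euler scheme\<close>

definition V :: "nat \<Rightarrow> real \<Rightarrow> 'b \<Rightarrow> 'b" where
  "V n t f = (J (t / 2 ^ n) ^^ 2 ^ n) f"

lemma linear_V: "linear (V n t)" unfolding V_def by (rule linear_Jpow)

lemma norm_V: "norm (V n t f) \<le> norm f" unfolding V_def by (rule norm_Jpow)

abbreviation "D2 \<equiv> {f. \<exists>g h. (f, g) \<in> G \<and> (g, h) \<in> G}"

text \<open>One resolvent gains one order of regularity: for \<open>(f, g)\<close> in
  \<open>G\<close>, the element \<open>J \<mu> f\<close> lies in the domain of the square and tends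
  to \<open>f\<close> as \<mu> decreases to 0. The domain of \<open>G\<close> is dense in
  turn.\<close>

lemma dense_D2: "closure D2 = UNIV"
proof -
  have "f \<in> closure D2" for f
  proof -
    have D: "Domain G \<subseteq> closure D2"
    proof
      fix f assume "f \<in> Domain G"
      then obtain g where fg: "(f, g) \<in> G" by auto
      have ev: "\<forall>\<^sub>F \<mu> in at_right 0. J \<mu> f \<in> closure D2"
        unfolding eventually_at_filter
      proof (rule always_eventually, intro allI impI)
        fix \<mu> :: real assume "\<mu> \<noteq> 0" "\<mu> \<in> {0<..}"
        then have \<mu>: "\<mu> > 0" by simp
        have "(J \<mu> f, J \<mu> g) \<in> G" "(J \<mu> g, (1 / \<mu>) *\<^sub>R (g - J \<mu> g)) \<in> G"
          by (intro J_graph fg, intro J_in \<mu>)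
        then show "J \<mu> f \<in> closure D2" by (intro subsetD[OF closure_subset]) blast
      qed
      show "f \<in> closure D2" by (rule Lim_in_closed_set[OF closed_closure ev _ J_tendsto]) simp
    qed
    have "closure (Domain G) \<subseteq> closure D2" by (rule closure_minimal[OF D closed_closure])
    then show ?thesis unfolding dense_domain by blast
  qed
  then show ?thesis by blast
qed

text \<open>Halving the step makes \<open>V (Suc n)\<close> a product of \<open>2^n\<close> double
  steps, each compared with a single step of \<open>V n\<close> by \<open>JJ_estimate\<close>. An
  error of order \<open>4^-n\<close> in each of \<open>2^n\<close> steps leaves a geometric series;
  the dyadic numbers of steps make this comparison possible.\<close>

lemma convergent_V: assumes "t \<ge> 0" shows "convergent (\<lambda>n. V n t f)"
proof (rule convergent_contractions_dense[OF linear_V norm_V _ dense_D2])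
  fix f assume "f \<in> D2"
  then obtain g h where fgh: "(f, g) \<in> G" "(g, h) \<in> G" by auto
  have bd: "norm (V (Suc n) t f - V n t f) \<le> t\<^sup>2 * norm h * (1/2) ^ n" for n
  proof -
    let ?s = "t / 2 ^ Suc n"
    have 1: "V (Suc n) t f = ((\<lambda>f. J ?s (J ?s f)) ^^ 2 ^ n) f"
      unfolding V_def power_Suc[of _ n] by (subst funpow_mult[symmetric]) (simp add: numeral_2_eq_2 comp_def)
    have "norm (((\<lambda>f. J ?s (J ?s f)) ^^ 2 ^ n) f - (J (t / 2 ^ n) ^^ 2 ^ n) f)
        \<le> real (2 ^ n) * norm (J ?s (J ?s f) - J (t / 2 ^ n) f)"
    proof (rule funpow_diff_contraction)
      show "linear (\<lambda>f. J ?s (J ?s f))" using linear_compose[OF linear_J linear_J] by (simp add: comp_def)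
      show "J ?s (J ?s (J (t / 2 ^ n) f)) = J (t / 2 ^ n) (J ?s (J ?s f))" for f by (metis J_comm)
    qed (auto simp: linear_J norm_J intro: order_trans[OF norm_J])
    also have "norm (J ?s (J ?s f) - J (t / 2 ^ n) f) \<le> ?s * ?s * norm h"
      using JJ_estimate[OF fgh, of ?s ?s] assms by (simp add: norm_minus_commute)
    finally have "norm (V (Suc n) t f - V n t f) \<le> 2 ^ n * (?s * ?s * norm h)"
      unfolding 1 unfolding V_def by simp
    also have "\<dots> = (t\<^sup>2 * norm h * (1/2) ^ n) / 4"
      by (simp add: field_simps power2_eq_square)
    also have "\<dots> \<le> t\<^sup>2 * norm h * (1/2) ^ n" by simp
    finally show ?thesis .
  qed
  have "summable (\<lambda>n. norm (V (Suc n) t f - V n t f))"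
    by (rule summable_comparison_test'[where N = 0, OF summable_mult[OF summable_geometric[of "1/2::real"]]])
      (use bd in auto)
  then have "summable (\<lambda>n. V (Suc n) t f - V n t f)" by (rule summable_norm_cancel)
  then have "convergent (\<lambda>n. \<Sum>i<n. V (Suc i) t f - V i t f)" by (simp add: summable_iff_convergent)
  then have "convergent (\<lambda>n. V n t f - V 0 t f)" by (simp only: sum_lessThan_telescope[where f = "\<lambda>i. V i t f"])
  then show "convergent (\<lambda>n. V n t f)"
    using convergent_add[OF _ convergent_const[of "V 0 t f"]] by fastforce
qed

definition S :: "real \<Rightarrow> 'b \<Rightarrow> 'b" where "S t f = lim (\<lambda>n. V n t f)"

lemma V_tendsto_S: "t \<ge> 0 \<Longrightarrow> (\<lambda>n. V n t f) \<longlonglongrightarrow> S t f"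
  unfolding S_def using convergent_V convergent_LIMSEQ_iff by blast

lemma linear_S: assumes "t \<ge> 0" shows "linear (S t)"
proof (rule linearI)
  show "S t (f + g) = S t f + S t g" for f g
    by (rule LIMSEQ_unique[OF V_tendsto_S[OF assms]])
      (simp add: linear_add[OF linear_V] tendsto_add V_tendsto_S assms)
  show "S t (r *\<^sub>R f) = r *\<^sub>R S t f" for r f
    by (rule LIMSEQ_unique[OF V_tendsto_S[OF assms]])
      (simp add: linear_cmul[OF linear_V] tendsto_scaleR V_tendsto_S assms)
qed

lemma norm_S: "t \<ge> 0 \<Longrightarrow> norm (S t f) \<le> norm f"
  by (rule Lim_norm_ubound[OF _ V_tendsto_S]) (auto simp: norm_V)

lemma S_0: "S 0 f = f"
proof -
  have "(J 0 ^^ n) f = f" for n by (induction n) (auto simp: J_0)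
  then have "V n 0 f = f" for n by (simp add: V_def)
  then show ?thesis using V_tendsto_S[of 0 f] LIMSEQ_unique[OF _ tendsto_const] by simp
qed

lemma norm_diff_S: assumes "(u, v) \<in> G" "t \<ge> 0" shows "norm (u - S t u) \<le> t * norm v"
proof (rule Lim_norm_ubound[OF _ tendsto_diff[OF tendsto_const V_tendsto_S[OF assms(2)]]])
  show "\<forall>\<^sub>F n in sequentially. norm (u - V n t u) \<le> t * norm v"
    using norm_diff_Jpow[OF assms(1), of "t / 2 ^ n" "2 ^ n" for n] assms(2) by (simp add: V_def)
qed simp

lemma S_tendsto: "((\<lambda>t. S t f) \<longlongrightarrow> f) (at_right 0)"
proof (rule tendsto_contractions_dense[where L' = "\<lambda>f. f" and D = "Domain G"])
  show "((\<lambda>\<mu>. S \<mu> u) \<longlongrightarrow> u) (at_right 0)" if u: "u \<in> Domain G" for u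
  proof -
    obtain v where v: "(u, v) \<in> G" using u by auto
    show ?thesis
    proof (rule Lim_null[THEN iffD2, OF Lim_null_comparison])
      show "\<forall>\<^sub>F \<mu> in at_right 0. norm (S \<mu> u - u) \<le> \<mu> * norm v"
        using norm_diff_S[OF v] by (auto simp: eventually_at_filter norm_minus_commute)
      show "((\<lambda>\<mu>. \<mu> * norm v) \<longlongrightarrow> 0) (at_right 0)" by (auto intro!: tendsto_eq_intros)
    qed
  qed
qed (auto simp: linear_S norm_S dense_domain eventually_at_filter intro: linearI)

text \<open>The approximations of \<open>S s\<close> and \<open>S t\<close> use different step
  lengths, so their product is no instance of the scheme. Interleaving the commuting steps compares
  it with the scheme for \<open>s + t\<close>, step by step, through
  \<open>JJ_estimate\<close>.\<close>

lemma S_add: assumes "s \<ge> 0" "t \<ge> 0" shows "S (s + t) f = S s (S t f)"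
proof -
  define W where "W n f = V n s (V n t f)" for n f
  have linW: "linear (W n)" for n
    unfolding W_def using linear_compose[OF linear_V linear_V] by (simp add: comp_def)
  have normW: "norm (W n f) \<le> norm f" for n f unfolding W_def by (intro order_trans[OF norm_V] norm_V)
  have lim1: "(\<lambda>n. W n f) \<longlonglongrightarrow> S s (S t f)" for f
  proof -
    have "(\<lambda>n. V n s (V n t f - S t f) + V n s (S t f)) \<longlonglongrightarrow> 0 + S s (S t f)"
    proof (intro tendsto_add V_tendsto_S assms)
      show "(\<lambda>n. V n s (V n t f - S t f)) \<longlonglongrightarrow> 0"
        by (rule Lim_null_comparison[where g = "\<lambda>n. norm (V n t f - S t f)"])
          (auto simp: norm_V intro!: tendsto_norm_zero LIM_zero V_tendsto_S assms)
    qed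
    then show ?thesis by (simp add: W_def linear_diff[OF linear_V])
  qed
  have "(\<lambda>n. W n f) \<longlonglongrightarrow> S (s + t) f"
  proof (rule tendsto_contractions_dense[where L = W and L' = "S (s + t)" and D = D2, OF always_eventually always_eventually])
    fix f assume "f \<in> D2"
    then obtain g h where fgh: "(f, g) \<in> G" "(g, h) \<in> G" by auto
    have W_eq: "W n f = ((\<lambda>f. J (s / 2 ^ n) (J (t / 2 ^ n) f)) ^^ 2 ^ n) f" for n f
    proof -
      have "(J a ^^ k) ((J b ^^ k) f) = ((\<lambda>f. J a (J b f)) ^^ k) f" for a b k
      proof (induction k)
        case (Suc k)
        have "(J a ^^ Suc k) ((J b ^^ Suc k) f) = J a (J b ((J a ^^ k) ((J b ^^ k) f)))"
          using funpow_commute[of "J a" "J b" k "(J b ^^ k) f"] by (simp add: J_comm)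
        then show ?case using Suc by simp
      qed simp
      then show ?thesis by (simp add: W_def V_def)
    qed
    have bd: "norm (W n f - V n (s + t) f) \<le> s * t * norm h * (1 / 2) ^ n" for n
    proof -
      let ?s = "s / 2 ^ n" and ?t = "t / 2 ^ n"
      have "norm (((\<lambda>f. J ?s (J ?t f)) ^^ 2 ^ n) f - (J (?s + ?t) ^^ 2 ^ n) f)
          \<le> real (2 ^ n) * norm (J ?s (J ?t f) - J (?s + ?t) f)"
      proof (rule funpow_diff_contraction)
        show "linear (\<lambda>f. J ?s (J ?t f))" using linear_compose[OF linear_J linear_J] by (simp add: comp_def)
        show "J ?s (J ?t (J (?s + ?t) f)) = J (?s + ?t) (J ?s (J ?t f))" for f
          by (metis J_comm)
      qed (auto simp: linear_J norm_J intro: order_trans[OF norm_J])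
      also have "norm (J ?s (J ?t f) - J (?s + ?t) f) \<le> ?s * ?t * norm h"
        using JJ_estimate[OF fgh, of ?s ?t] assms by (simp add: norm_minus_commute)
      finally have "norm (W n f - V n (s + t) f) \<le> 2 ^ n * (?s * ?t * norm h)"
        unfolding W_eq V_def by (simp add: add_divide_distrib)
      also have "\<dots> = s * t * norm h * (1/2) ^ n"
        by (simp add: field_simps)
      finally show ?thesis .
    qed
    have "(\<lambda>n. W n f - V n (s + t) f) \<longlonglongrightarrow> 0"
      by (rule Lim_null_comparison[OF always_eventually[OF allI[OF bd]]])
        (auto intro!: tendsto_mult_right_zero LIMSEQ_power_zero)
    from tendsto_add[OF this V_tendsto_S[of "s + t" f]] show "(\<lambda>n. W n f) \<longlonglongrightarrow> S (s + t) f"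
      using assms by simp
  qed (use normW dense_D2 in \<open>auto simp: linW linear_S norm_S assms simp del: Collect_empty_eq\<close>)
  from LIMSEQ_unique[OF this lim1] show ?thesis .
qed

lemma contraction_sg_S: "contraction_sg S"
  unfolding contraction_sg_def using linear_S norm_S S_0 S_add S_tendsto by auto

text \<open>\<open>f\<close> minus its \<open>j\<close>-th Euler iterate is a Riemann sum of the
  iterates of \<open>g\<close>, so the difference quotient is an average of vectors close to
  \<open>g\<close>. Closeness has a rate only on the domain of \<open>G\<close>; replacing
  \<open>g\<close> by \<open>h\<close> from the domain costs \<open>norm (g - h)\<close>
  twice.\<close>

lemma generator_estimate:
  assumes "(f, g) \<in> G" "(h, k) \<in> G" "t > 0"
  shows "norm ((1 / t) *\<^sub>R (f - S t f) - g) \<le> t * norm k + 2 * norm (g - h)"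
proof -
  have Jg: "norm ((J \<mu> ^^ j) g - g) \<le> real j * \<mu> * norm k + 2 * norm (g - h)" if "\<mu> \<ge> 0" for \<mu> :: real and j :: nat
  proof -
    have "(J \<mu> ^^ j) g - g = (J \<mu> ^^ j) (g - h) + ((J \<mu> ^^ j) h - h) + (h - g)"
      by (simp add: linear_diff[OF linear_Jpow])
    also have "norm \<dots> \<le> norm ((J \<mu> ^^ j) (g - h)) + norm ((J \<mu> ^^ j) h - h) + norm (h - g)"
      by (meson norm_triangle_ineq norm_triangle_le order_refl add_mono order_trans)
    finally show ?thesis
      using norm_Jpow[of j \<mu> "g - h"] norm_diff_Jpow[OF assms(2) that, of j]
      by (simp add: norm_minus_commute)
  qed
  have "norm ((f - (J \<mu> ^^ j) f) - (real j * \<mu>) *\<^sub>R g) \<le> (real j * \<mu>) * (t * norm k + 2 * norm (g - h))"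
    if "\<mu> \<ge> 0" "real j * \<mu> \<le> t" for \<mu> :: real and j :: nat
    using that(2)
  proof (induction j)
    case (Suc j)
    have le: "real j * \<mu> \<le> t" using Suc.prems that(1) by (simp add: algebra_simps)
    have "(J \<mu> ^^ j) f - J \<mu> ((J \<mu> ^^ j) f) = \<mu> *\<^sub>R (J \<mu> ^^ Suc j) g"
    proof -
      have "((J \<mu> ^^ j) f, (J \<mu> ^^ j) g) \<in> G" by (induction j) (auto simp: assms(1) J_graph)
      from diff_J[OF this that(1)] show ?thesis by simp
    qed
    then have "(f - (J \<mu> ^^ Suc j) f) - (real (Suc j) * \<mu>) *\<^sub>R g
        = ((f - (J \<mu> ^^ j) f) - (real j * \<mu>) *\<^sub>R g) + \<mu> *\<^sub>R ((J \<mu> ^^ Suc j) g - g)"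
      by (simp add: algebra_simps)
    also have "norm \<dots> \<le> norm ((f - (J \<mu> ^^ j) f) - (real j * \<mu>) *\<^sub>R g) + \<mu> * norm ((J \<mu> ^^ Suc j) g - g)"
      using norm_triangle_ineq[of "(f - (J \<mu> ^^ j) f) - (real j * \<mu>) *\<^sub>R g" "\<mu> *\<^sub>R ((J \<mu> ^^ Suc j) g - g)"] that(1)
      by simp
    also have "\<dots> \<le> (real j * \<mu>) * (t * norm k + 2 * norm (g - h)) + \<mu> * (t * norm k + 2 * norm (g - h))"
    proof (intro add_mono Suc.IH le mult_left_mono that(1))
      have "norm ((J \<mu> ^^ Suc j) g - g) \<le> real (Suc j) * \<mu> * norm k + 2 * norm (g - h)"
        by (rule Jg[OF that(1)])
      also have "\<dots> \<le> t * norm k + 2 * norm (g - h)"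
        using Suc.prems by (intro add_right_mono mult_right_mono) auto
      finally show "norm ((J \<mu> ^^ Suc j) g - g) \<le> t * norm k + 2 * norm (g - h)" .
    qed
    finally show ?case by (simp add: algebra_simps)
  qed simp
  from this[of "t / 2 ^ n" "2 ^ n" for n]
  have V: "norm ((f - V n t f) - t *\<^sub>R g) \<le> t * (t * norm k + 2 * norm (g - h))" for n
    using assms(3) by (simp add: V_def)
  have "norm ((f - S t f) - t *\<^sub>R g) \<le> t * (t * norm k + 2 * norm (g - h))"
    by (rule Lim_norm_ubound[OF _ tendsto_diff[OF tendsto_diff[OF tendsto_const V_tendsto_S] tendsto_const]])
      (use V assms in auto)
  moreover have "(1 / t) *\<^sub>R (f - S t f) - g = (1 / t) *\<^sub>R ((f - S t f) - t *\<^sub>R g)"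
    using assms(3) by (simp add: algebra_simps)
  ultimately show ?thesis using assms(3) by (simp add: divide_le_eq mult.commute)
qed

lemma neg_gen_S_superset: "G \<subseteq> neg_gen S"
proof
  fix p assume "p \<in> G"
  then obtain f g where fg: "p = (f, g)" "(f, g) \<in> G" by (cases p) auto
  have "((\<lambda>t. (1 / t) *\<^sub>R (f - S t f)) \<longlongrightarrow> g) (at_right 0)"
  proof (rule tendstoI)
    fix e :: real assume e: "e > 0"
    have "g \<in> closure (Domain G)" by (simp add: dense_domain)
    then obtain h where "h \<in> Domain G" "dist h g < e / 4"
      unfolding closure_approachable using e by (metis divide_pos_pos zero_less_numeral)
    then obtain k where hk: "(h, k) \<in> G" "norm (g - h) < e / 4" by (auto simp: dist_norm norm_minus_commute)
    have "((\<lambda>t. t * norm k) \<longlongrightarrow> 0) (at_right 0)" by (auto intro!: tendsto_eq_intros)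
    then have "\<forall>\<^sub>F t in at_right 0. t * norm k < e / 2" by (rule order_tendstoD) (use e in simp)
    moreover have "\<forall>\<^sub>F t in at_right (0::real). t > 0" by (simp add: eventually_at_filter)
    ultimately show "\<forall>\<^sub>F t in at_right 0. dist ((1 / t) *\<^sub>R (f - S t f)) g < e"
    proof eventually_elim
      case (elim t)
      show ?case using generator_estimate[OF fg(2) hk(1) elim(2)] elim(1) hk(2) unfolding dist_norm by linarith
    qed
  qed
  then show "p \<in> neg_gen S" by (simp add: neg_gen_def fg)
qed

text \<open>Write \<open>(1 + \<mu>/t) f\<close> as the sum of
  \<open>f + (\<mu>/t) (f - T t f)\<close> and \<open>(\<mu>/t) T t f\<close>. Contractivity bounds
  the second summand by \<open>(\<mu>/t) norm f\<close>, and the limit in \<open>t\<close> gives the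
  claim.\<close>

lemma neg_gen_accretive:
  fixes T :: "real \<Rightarrow> 'b \<Rightarrow> 'b"
  assumes "contraction_sg T" "(f, g) \<in> neg_gen T" "\<mu> > 0"
  shows "norm f \<le> norm (f + \<mu> *\<^sub>R g)"
proof (rule tendsto_le[OF _ _ tendsto_const])
  show "((\<lambda>t. norm (f + \<mu> *\<^sub>R ((1 / t) *\<^sub>R (f - T t f)))) \<longlongrightarrow> norm (f + \<mu> *\<^sub>R g)) (at_right 0)"
    using assms(2) unfolding neg_gen_def
    by (intro tendsto_norm tendsto_add tendsto_const tendsto_scaleR) simp_all
  have "norm f \<le> norm (f + \<mu> *\<^sub>R ((1 / t) *\<^sub>R (f - T t f)))" if "t > 0" for t
  proof -
    have "norm ((1 + \<mu> / t) *\<^sub>R f) \<le> norm (f + \<mu> *\<^sub>R ((1 / t) *\<^sub>R (f - T t f))) + norm ((\<mu> / t) *\<^sub>R T t f)"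
      by (rule order_trans[OF _ norm_triangle_ineq]) (simp add: algebra_simps)
    moreover have "norm ((\<mu> / t) *\<^sub>R T t f) \<le> (\<mu> / t) * norm f"
      using assms that by (simp add: contraction_sg_def mult_left_mono divide_right_mono)
    moreover have "norm ((1 + \<mu> / t) *\<^sub>R f) = norm f + (\<mu> / t) * norm f"
      using assms(3) that unfolding norm_scaleR by (simp add: distrib_right)
    ultimately show ?thesis by linarith
  qed
  then show "\<forall>\<^sub>F t in at_right 0. norm f \<le> norm (f + \<mu> *\<^sub>R ((1 / t) *\<^sub>R (f - T t f)))"
    by (simp add: eventually_at_filter)
qed simp

text \<open>Maximality: if \<open>(f, g)\<close> belongs to the generator,
  \<open>u + v = f + g\<close> is solvable in \<open>G\<close>, and accretivity of the generator at
  the difference \<open>(f - u, g - v)\<close> forces it to vanish.\<close>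

lemma neg_gen_S: "neg_gen S = G"
proof
  show "neg_gen S \<subseteq> G"
  proof
    fix p assume p: "p \<in> neg_gen S"
    obtain f g where fg: "p = (f, g)" by (cases p)
    obtain u v where uv: "(u, v) \<in> G" "u + 1 *\<^sub>R v = f + g" using range[of 1 "f + g"] by auto
    have "((\<lambda>t. (1 / t) *\<^sub>R (f - S t f) - (1 / t) *\<^sub>R (u - S t u)) \<longlongrightarrow> g - v) (at_right 0)"
      using p neg_gen_S_superset uv(1) unfolding fg neg_gen_def by (intro tendsto_diff) auto
    moreover have "\<forall>\<^sub>F t in at_right 0. (1 / t) *\<^sub>R (f - S t f) - (1 / t) *\<^sub>R (u - S t u)
        = (1 / t) *\<^sub>R ((f - u) - S t (f - u))"
      by (auto simp: eventually_at_filter linear_diff[OF linear_S] algebra_simps)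
    ultimately have "(f - u, g - v) \<in> neg_gen S"
      unfolding neg_gen_def using tendsto_cong by fastforce
    from neg_gen_accretive[OF contraction_sg_S this, of 1] uv(2) have "f = u" "g = v"
      by (simp_all add: algebra_simps)
    then show "p \<in> G" using uv fg by simp
  qed
qed (rule neg_gen_S_superset)

text \<open>This makes the semigroup generated by \<open>-G\<close> unique, hence independent of the choice in
  the definition of the heat semigroup.\<close>

lemma exponential_formula:
  assumes T: "contraction_sg T" and gen: "neg_gen T = G" and t: "t \<ge> 0"
  shows "(\<lambda>n. V n t f) \<longlonglongrightarrow> T t f"
proof (rule tendsto_contractions_dense[where L = "\<lambda>n. V n t" and L' = "T t" and D = "Domain G", OF always_eventually always_eventually])
  have linT: "linear (T s)" and normT: "norm (T s f) \<le> norm f" if "s \<ge> 0" for s f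
    using T that by (auto simp: contraction_sg_def)
  have Tadd: "T (r + s) f = T r (T s f)" if "s \<ge> 0" "r \<ge> 0" for r s f
    using T that by (auto simp: contraction_sg_def)
  show "linear (T t)" "norm (T t f) \<le> norm f" for f using linT normT t by auto
  fix f assume "f \<in> Domain G"
  then obtain g where fg: "(f, g) \<in> G" by auto
  \<comment> \<open>A bounded operator commuting with the difference quotients preserves the
    generator. By \<open>J_commute\<close> it then commutes with the resolvents, which the
    telescoping estimate below requires.\<close>
  have graph: "(T s u, T s v) \<in> G" if "(u, v) \<in> G" "s \<ge> 0" for u v s
  proof -
    have "bounded_linear (T s)"
      using linT[OF that(2)] normT[OF that(2)] by (auto simp: bounded_linear_def bounded_linear_axioms_def intro!: exI[of _ 1])
    then have "((\<lambda>r. T s ((1 / r) *\<^sub>R (u - T r u))) \<longlongrightarrow> T s v) (at_right 0)"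
      using that(1) unfolding gen[symmetric] neg_gen_def by (auto intro: bounded_linear.tendsto)
    moreover have "\<forall>\<^sub>F r in at_right 0. T s ((1 / r) *\<^sub>R (u - T r u)) = (1 / r) *\<^sub>R (T s u - T r (T s u))"
      using that(2) Tadd[of _ s u] Tadd[of s _ u]
      by (auto simp: eventually_at_filter linear_diff[OF linT] linear_cmul[OF linT] add.commute)
    ultimately show ?thesis unfolding gen[symmetric] neg_gen_def using tendsto_cong by fastforce
  qed
  have Tpow: "T (real k * s) f = (T s ^^ k) f" if "s \<ge> 0" for s k
  proof (induction k)
    case (Suc k)
    have "T (real (Suc k) * s) f = T (s + real k * s) f" by (simp add: algebra_simps)
    then show ?case using Tadd[of "real k * s" s f] that Suc by simp
  qed (use T in \<open>simp add: contraction_sg_def\<close>)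
  show "(\<lambda>n. V n t f) \<longlonglongrightarrow> T t f"
  proof (cases "t = 0")
    case True
    then show ?thesis using V_tendsto_S[of 0 f] T by (simp add: S_0 contraction_sg_def)
  next
    case False
    with t have t: "t > 0" by simp
    \<comment> \<open>The one-step error is \<open>J s f - T s f = s d(s)\<close>, and both
      \<open>(f - T s f) / s\<close> and \<open>J s g\<close> tend to \<open>g\<close>. Multiplied
      by \<open>2^n\<close> steps of length \<open>t / 2^n\<close>, the error is at most
      \<open>t * norm (d (t / 2^n))\<close>, which vanishes.\<close>
    define d where "d s = (1 / s) *\<^sub>R (f - T s f) - J s g" for s
    have d0: "(d \<longlongrightarrow> 0) (at_right 0)"
    proof -
      have "((\<lambda>s. (1 / s) *\<^sub>R (f - T s f)) \<longlongrightarrow> g) (at_right 0)"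
        using fg unfolding gen[symmetric] neg_gen_def by simp
      from tendsto_diff[OF this J_tendsto[of g]] show ?thesis by (simp add: d_def[abs_def])
    qed
    have "filterlim (\<lambda>n. t / 2 ^ n) (at_right 0) sequentially"
    proof (rule tendsto_imp_filterlim_at_right)
      show "(\<lambda>n. t / 2 ^ n) \<longlonglongrightarrow> 0"
        using tendsto_mult_right_zero[OF LIMSEQ_power_zero[of "1/2::real"], of t] by (simp add: power_divide)
    qed (use t in simp)
    with d0 have d1: "(\<lambda>n. t * norm (d (t / 2 ^ n))) \<longlonglongrightarrow> 0"
      by (intro tendsto_mult_right_zero tendsto_norm_zero) (rule filterlim_compose)
    have "norm (V n t f - T t f) \<le> t * norm (d (t / 2 ^ n))" for n
    proof -
      let ?s = "t / 2 ^ n"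
      have s: "?s > 0" using t by simp
      have "norm ((J ?s ^^ 2 ^ n) f - (T ?s ^^ 2 ^ n) f) \<le> real (2 ^ n) * norm (J ?s f - T ?s f)"
      proof (rule funpow_diff_contraction)
        show "J ?s (T ?s f) = T ?s (J ?s f)" for f
          using J_commute[of "T ?s" ?s f] graph linT s by auto
      qed (use linT normT s linear_J norm_J in auto)
      also have "J ?s f - T ?s f = ?s *\<^sub>R d ?s"
        using diff_J[OF fg, of ?s] s t by (simp add: d_def algebra_simps)
      finally show ?thesis using Tpow[of ?s "2 ^ n"] s t by (simp add: V_def)
    qed
    then show ?thesis
      by (intro Lim_null[THEN iffD2, OF Lim_null_comparison[OF always_eventually d1]]) blast
  qed
qed (auto simp: linear_V norm_V dense_domain)

end

text \<open>Accretivity makes the solutions for a convergent sequence of data a Cauchy sequence, so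
  a dense range becomes the full range after closing the graph. This serves the operator in L2,
  where the resolvent equation is at first solvable only for bounded integrable data.\<close>

lemma maccretive_closure:
  fixes G :: "('b::banach \<times> 'b) set"
  assumes sub: "subspace G"
    and acc: "\<And>u v \<mu>. (u, v) \<in> G \<Longrightarrow> 0 < \<mu> \<Longrightarrow> norm u \<le> norm (u + \<mu> *\<^sub>R v)"
    and ran: "\<And>\<mu>. 0 < \<mu> \<Longrightarrow> closure {u + \<mu> *\<^sub>R v |u v. (u, v) \<in> G} = UNIV"
    and dom: "closure (Domain G) = UNIV"
  shows "maccretive (closure G)"
proof
  show "subspace (closure G)"
    unfolding subspace_def
  proof (intro conjI ballI allI)
    show "0 \<in> closure G" using subspace_0[OF sub] closure_subset by blast
    show "x + y \<in> closure G" if xy: "x \<in> closure G" "y \<in> closure G" for x y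
    proof -
      obtain X where "\<And>n. X n \<in> G" "X \<longlonglongrightarrow> x"
        using xy(1) unfolding closure_sequential by blast
      moreover obtain Y where "\<And>n. Y n \<in> G" "Y \<longlonglongrightarrow> y"
        using xy(2) unfolding closure_sequential by blast
      ultimately show ?thesis unfolding closure_sequential
        by (intro exI[of _ "\<lambda>n. X n + Y n"]) (auto intro: tendsto_add subspace_add[OF sub])
    qed
    show "c *\<^sub>R x \<in> closure G" if x: "x \<in> closure G" for x c
    proof -
      obtain X where "\<And>n. X n \<in> G" "X \<longlonglongrightarrow> x"
        using x unfolding closure_sequential by blast
      then show ?thesis unfolding closure_sequential
        by (intro exI[of _ "\<lambda>n. c *\<^sub>R X n"]) (auto intro: tendsto_intros subspace_scale[OF sub])
    qed
  qed
  show "norm u \<le> norm (u + \<mu> *\<^sub>R v)" if uv: "(u, v) \<in> closure G" and \<mu>: "0 < \<mu>" for u v \<mu>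
  proof -
    obtain X where X: "\<And>n. X n \<in> G" "X \<longlonglongrightarrow> (u, v)"
      using uv unfolding closure_sequential by blast
    have "(\<lambda>n. norm (fst (X n))) \<longlonglongrightarrow> norm u" "(\<lambda>n. norm (fst (X n) + \<mu> *\<^sub>R snd (X n))) \<longlonglongrightarrow> norm (u + \<mu> *\<^sub>R v)"
      using tendsto_fst[OF X(2)] tendsto_snd[OF X(2)] by (auto intro!: tendsto_intros)
    moreover have "norm (fst (X n)) \<le> norm (fst (X n) + \<mu> *\<^sub>R snd (X n))" for n
      using acc[of "fst (X n)" "snd (X n)" \<mu>] X(1)[of n] \<mu> by simp
    ultimately show ?thesis by (blast intro: LIMSEQ_le)
  qed
  show "\<exists>u v. (u, v) \<in> closure G \<and> u + \<mu> *\<^sub>R v = f" if \<mu>: "0 < \<mu>" for \<mu> f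
  proof -
    have "f \<in> closure {u + \<mu> *\<^sub>R v |u v. (u, v) \<in> G}" using ran[OF \<mu>] by simp
    then obtain F where F: "\<And>n. \<exists>u v. (u, v) \<in> G \<and> F n = u + \<mu> *\<^sub>R v" "F \<longlonglongrightarrow> f"
      unfolding closure_sequential by blast
    then obtain U W where UW: "\<And>n. (U n, W n) \<in> G" "\<And>n. F n = U n + \<mu> *\<^sub>R W n" by metis
    have "norm (U m - U n) \<le> norm (F m - F n)" for m n
      using acc[of "U m - U n" "W m - W n" \<mu>] subspace_diff[OF sub UW(1)[of m] UW(1)[of n]] \<mu>
      by (simp add: UW(2) algebra_simps)
    moreover have "Cauchy F" using F(2) by (rule LIMSEQ_imp_Cauchy)
    ultimately have "Cauchy U" unfolding Cauchy_iff by (meson order.strict_trans1)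
    then obtain u where u: "U \<longlonglongrightarrow> u" using Cauchy_convergent convergent_def by blast
    have W: "W n = (1 / \<mu>) *\<^sub>R (F n - U n)" for n using UW(2)[of n] \<mu> by simp
    have "W \<longlonglongrightarrow> (1 / \<mu>) *\<^sub>R (f - u)" unfolding W[abs_def] by (intro tendsto_intros F u)
    then have "(\<lambda>n. (U n, W n)) \<longlonglongrightarrow> (u, (1 / \<mu>) *\<^sub>R (f - u))" by (intro tendsto_Pair u)
    then have "(u, (1 / \<mu>) *\<^sub>R (f - u)) \<in> closure G" unfolding closure_sequential
      using UW(1) by (intro exI[of _ "\<lambda>n. (U n, W n)"]) simp
    moreover have "u + \<mu> *\<^sub>R ((1 / \<mu>) *\<^sub>R (f - u)) = f" using \<mu> by simp
    ultimately show ?thesis by blast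
  qed
  have "Domain G \<subseteq> Domain (closure G)" using closure_subset[of G] by (rule Domain_mono)
  then show "closure (Domain (closure G)) = UNIV" using closure_mono[of "Domain G"] dom by blast
qed

section \<open>Square roots of nonnegative self-adjoint operators\<close>

definition self_adj :: "('b::real_inner \<Rightarrow> 'b) \<Rightarrow> bool" where
  "self_adj M \<longleftrightarrow> (\<forall>x y. M x \<bullet> y = x \<bullet> M y)"

lemma self_adjD: "self_adj M \<Longrightarrow> M x \<bullet> y = x \<bullet> M y"
  by (simp add: self_adj_def)

lemma bounded_linear_contraction: "linear M \<Longrightarrow> (\<And>x. norm (M x) \<le> norm x) \<Longrightarrow> bounded_linear M"
  by (auto simp: bounded_linear_def bounded_linear_axioms_def intro!: exI[of _ 1])

text \<open>If \<open>norm X \<le> 1\<close>, the iterates converge to \<open>1 - sqrt (1 - X)\<close>; their increments are dominated by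
  those of the scalar iteration with \<open>X = 1\<close>.\<close>

primrec sqrt_seq :: "'b::real_normed_vector \<Rightarrow>\<^sub>L 'b \<Rightarrow> nat \<Rightarrow> 'b \<Rightarrow>\<^sub>L 'b" where
  "sqrt_seq X 0 = 0"
| "sqrt_seq X (Suc n) = (1/2) *\<^sub>R (X + (sqrt_seq X n o\<^sub>L sqrt_seq X n))"

primrec sqrt_bound :: "nat \<Rightarrow> real" where
  "sqrt_bound 0 = 0"
| "sqrt_bound (Suc n) = (1/2) * (1 + (sqrt_bound n)\<^sup>2)"

lemma sqrt_bound: "0 \<le> sqrt_bound n" "sqrt_bound n \<le> 1" "sqrt_bound n \<le> sqrt_bound (Suc n)"
proof -
  show 0: "0 \<le> sqrt_bound n" for n by (induction n) auto
  show 1: "sqrt_bound n \<le> 1" for n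
    using 0 by (induction n) (auto simp: power_le_one)
  show "sqrt_bound n \<le> sqrt_bound (Suc n)"
    using sum_squares_bound[of "sqrt_bound n" 1] by simp
qed

lemma sqrt_seq_commute:
  assumes "K o\<^sub>L X = X o\<^sub>L K"
  shows "K o\<^sub>L sqrt_seq X n = sqrt_seq X n o\<^sub>L K"
proof (induction n)
  case (Suc n)
  have X: "blinfun_apply K (X x) = X (K x)" for x using assms by (metis blinfun_apply_blinfun_compose)
  have S: "blinfun_apply K (sqrt_seq X n x) = sqrt_seq X n (K x)" for x using Suc by (metis blinfun_apply_blinfun_compose)
  show ?case
    by (rule blinfun_eqI) (simp add: blinfun.bilinear_simps X S)
qed (simp add: blinfun_eqI)

text \<open>All iterates are polynomials in \<open>X\<close> and commute, so the difference of two
  successors is half of the sum times the difference of their predecessors. The scalar sequence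
  satisfies the same factorization with equality, and induction compares the norms.\<close>

lemma sqrt_seq_bounds:
  fixes X :: "'b::real_normed_vector \<Rightarrow>\<^sub>L 'b"
  assumes X: "norm X \<le> 1"
  shows "norm (sqrt_seq X n) \<le> sqrt_bound n"
    and "n \<le> m \<Longrightarrow> norm (sqrt_seq X m - sqrt_seq X n) \<le> sqrt_bound m - sqrt_bound n"
proof -
  show nb: "norm (sqrt_seq X n) \<le> sqrt_bound n" for n
  proof (induction n)
    case (Suc n)
    have "norm (sqrt_seq X (Suc n)) \<le> (1/2) * (norm X + norm (sqrt_seq X n o\<^sub>L sqrt_seq X n))"
      using norm_triangle_ineq[of X "sqrt_seq X n o\<^sub>L sqrt_seq X n"] by simp
    also have "norm (sqrt_seq X n o\<^sub>L sqrt_seq X n) \<le> sqrt_bound n * sqrt_bound n"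
      by (intro order_trans[OF norm_blinfun_compose] mult_mono Suc sqrt_bound) auto
    finally show ?case using X by (simp add: power2_eq_square)
  qed simp
  show "n \<le> m \<Longrightarrow> norm (sqrt_seq X m - sqrt_seq X n) \<le> sqrt_bound m - sqrt_bound n"
  proof (induction n arbitrary: m)
    case 0
    then show ?case using nb by simp
  next
    case (Suc n)
    then obtain k where m: "m = Suc k" "n \<le> k" by (cases m) auto
    have comm: "sqrt_seq X n o\<^sub>L sqrt_seq X k = sqrt_seq X k o\<^sub>L sqrt_seq X n"
      by (intro sqrt_seq_commute sqrt_seq_commute[symmetric]) simp
    have "blinfun_apply (sqrt_seq X n) (sqrt_seq X k x) = sqrt_seq X k (sqrt_seq X n x)" for x
      using comm by (metis blinfun_apply_blinfun_compose)
    then have "sqrt_seq X m - sqrt_seq X (Suc n)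
      = (1/2) *\<^sub>R ((sqrt_seq X k + sqrt_seq X n) o\<^sub>L (sqrt_seq X k - sqrt_seq X n))"
      by (intro blinfun_eqI) (simp add: m blinfun.bilinear_simps algebra_simps)
    also have "norm \<dots> \<le> (1/2) * (norm (sqrt_seq X k + sqrt_seq X n) * norm (sqrt_seq X k - sqrt_seq X n))"
      by (simp add: norm_blinfun_compose)
    also have "\<dots> \<le> (1/2) * ((sqrt_bound k + sqrt_bound n) * (sqrt_bound k - sqrt_bound n))"
      by (intro mult_left_mono mult_mono Suc.IH[OF m(2)] order_trans[OF norm_triangle_ineq] add_mono nb add_nonneg_nonneg sqrt_bound) auto
    finally show ?case by (simp add: m power2_eq_square algebra_simps)
  qed
qed

text \<open>With \<open>X = 1 - M\<close> the limit \<open>C\<close> of the iteration satisfies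
  \<open>2 C = X + C^2\<close>, which says \<open>(1 - C)^2 = M\<close>. The root inherits the bound
  on its distance from the identity, hence nonnegativity and the possibility of taking a further
  root. Commutation with everything that commutes with \<open>M\<close> passes to the limit from the
  iterates.\<close>

theorem operator_sqrt_exists:
  fixes M :: "'b::{real_inner,banach} \<Rightarrow> 'b"
  assumes lin: "linear M" and sa: "self_adj M" and near: "\<And>x. norm (x - M x) \<le> norm x"
  obtains P where "linear P" "self_adj P" "\<And>x. norm (x - P x) \<le> norm x" "\<And>x. P (P x) = M x"
    "\<forall>K. bounded_linear K \<longrightarrow> (\<forall>x. K (M x) = M (K x)) \<longrightarrow> (\<forall>x. K (P x) = P (K x))"
proof -
  define X where "X = Blinfun (\<lambda>x. x - M x)"
  have linX: "linear (\<lambda>x. x - M x)" using lin by (intro linear_compose_sub linear_ident)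
  have X: "blinfun_apply X x = x - M x" for x
    unfolding X_def using bounded_linear_contraction[OF linX near] by (simp add: bounded_linear_Blinfun_apply)
  have nX: "norm X \<le> 1" by (rule norm_blinfun_bound) (auto simp: X near)
  have mono: "incseq sqrt_bound" by (rule incseq_SucI) (rule sqrt_bound)
  have "convergent sqrt_bound"
    by (rule Bseq_mono_convergent[OF BseqI'[of _ 1]]) (use mono sqrt_bound in \<open>auto simp: monoD\<close>)
  then have "Cauchy sqrt_bound" by (rule convergent_Cauchy)
  have "Cauchy (sqrt_seq X)"
  proof (rule CauchyI)
    fix e :: real assume "e > 0"
    then obtain N where N: "\<And>m n. m \<ge> N \<Longrightarrow> n \<ge> N \<Longrightarrow> norm (sqrt_bound m - sqrt_bound n) < e"
      using CauchyD[OF \<open>Cauchy sqrt_bound\<close>] by blast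
    have le: "norm (sqrt_seq X m - sqrt_seq X n) < e" if "N \<le> n" "n \<le> m" for m n
      using sqrt_seq_bounds(2)[OF nX that(2)] N[of m n] that by simp
    have "norm (sqrt_seq X m - sqrt_seq X n) < e" if "N \<le> n" "N \<le> m" for m n
      using le[of n m] le[of m n] that by (cases "n \<le> m") (auto simp: norm_minus_commute)
    then show "\<exists>N. \<forall>m\<ge>N. \<forall>n\<ge>N. norm (sqrt_seq X m - sqrt_seq X n) < e" by blast
  qed
  then obtain C where C: "sqrt_seq X \<longlonglongrightarrow> C" using Cauchy_convergent convergent_def by blast
  have nC: "norm C \<le> 1"
    by (rule Lim_norm_ubound[OF _ C always_eventually[OF allI[OF order_trans[OF sqrt_seq_bounds(1)[OF nX] sqrt_bound(2)]]]]) simp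
  have Capp: "(\<lambda>n. sqrt_seq X n x) \<longlonglongrightarrow> C x" for x by (intro tendsto_intros C)
  have "(\<lambda>n. sqrt_seq X (Suc n)) \<longlonglongrightarrow> (1/2) *\<^sub>R (X + (C o\<^sub>L C))"
    unfolding sqrt_seq.simps
    by (intro tendsto_intros C bounded_bilinear.tendsto[OF bounded_bilinear_blinfun_compose])
  then have "C = (1/2) *\<^sub>R (X + (C o\<^sub>L C))" using LIMSEQ_unique[OF LIMSEQ_Suc[OF C]] by blast
  then have "2 *\<^sub>R C = 2 *\<^sub>R ((1/2) *\<^sub>R (X + (C o\<^sub>L C)))" by (rule arg_cong)
  then have CC: "2 *\<^sub>R C x = X x + C (C x)" for x
    by (drule_tac arg_cong[where f = "\<lambda>F. blinfun_apply F x"]) (simp add: blinfun.bilinear_simps)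
  have Xsa: "blinfun_apply X x \<bullet> y = x \<bullet> X y" for x y by (simp add: X inner_diff self_adjD[OF sa])
  have Ssa: "blinfun_apply (sqrt_seq X n) x \<bullet> y = x \<bullet> sqrt_seq X n y" for n x y
    by (induction n arbitrary: x y) (simp_all add: blinfun.bilinear_simps inner_add Xsa)
  have Csa: "C x \<bullet> y = x \<bullet> C y" for x y
    using tendsto_inner[OF Capp tendsto_const[of y], of x] tendsto_inner[OF tendsto_const[of x] Capp, of y]
    unfolding Ssa by (rule LIMSEQ_unique)
  show ?thesis
  proof (rule that[of "\<lambda>x. x - C x"])
    show "linear (\<lambda>x. x - C x)" by (intro linear_compose_sub linear_ident bounded_linear.linear[OF blinfun.bounded_linear_right])
    show "self_adj (\<lambda>x. x - C x)" by (simp add: self_adj_def inner_diff Csa)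
    show "norm (x - (x - C x)) \<le> norm x" for x
      using norm_blinfun[of C x] nC mult_right_mono[of "norm C" 1 "norm x"] by simp
    show "x - C x - C (x - C x) = M x" for x
      using CC[of x] by (simp add: blinfun.diff_right X scaleR_2 algebra_simps)
    show "\<forall>K. bounded_linear K \<longrightarrow> (\<forall>x. K (M x) = M (K x)) \<longrightarrow> (\<forall>x. K (x - C x) = K x - C (K x))"
    proof (intro allI impI)
      fix K x assume K: "bounded_linear K" and K': "\<forall>x. K (M x) = M (K x)"
      have linK: "linear K" using K bounded_linear.linear by blast
      have "Blinfun K o\<^sub>L X = X o\<^sub>L Blinfun K"
        by (rule blinfun_eqI) (simp add: bounded_linear_Blinfun_apply K K' X linear_diff[OF linK])
      then have "Blinfun K (sqrt_seq X n x) = sqrt_seq X n (Blinfun K x)" for n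
        using sqrt_seq_commute[of "Blinfun K" X n] by (metis blinfun_apply_blinfun_compose)
      then have "K (sqrt_seq X n x) = sqrt_seq X n (K x)" for n
        by (simp add: bounded_linear_Blinfun_apply K)
      then have "K (C x) = C (K x)"
        using bounded_linear.tendsto[OF K Capp[of x]] Capp[of "K x"] LIMSEQ_unique by simp
      then show "K (x - C x) = K x - C (K x)" by (simp add: linear_diff[OF linK])
    qed
  qed
qed

lemma near_identity_nonneg:
  assumes "norm (x - M x) \<le> norm x"
  shows "0 \<le> M x \<bullet> (x::'b::real_inner)"
proof -
  have "(x - M x) \<bullet> x \<le> norm (x - M x) * norm x" by (rule norm_cauchy_schwarz)
  also have "\<dots> \<le> norm x * norm x" using assms by (intro mult_right_mono) auto
  finally show ?thesis by (simp add: inner_diff dot_square_norm power2_eq_square)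
qed

text \<open>The equality case of the Cauchy-Schwarz inequality for the form of \<open>D\<close>: at
  \<open>y + t D y\<close> the form is a nonnegative quadratic polynomial in \<open>t\<close>
  without constant term, so its linear coefficient, twice the square of \<open>norm (D y)\<close>,
  is zero.\<close>

lemma nonneg_form_zero:
  assumes lin: "linear D" and sa: "self_adj D" and pos: "\<And>x. 0 \<le> D x \<bullet> x" and zero: "D y \<bullet> y = 0"
  shows "D y = (0::'b::real_inner)"
proof (rule ccontr)
  assume "D y \<noteq> 0"
  define a b where "a = D y \<bullet> D y" and "b = D (D y) \<bullet> D y"
  have a: "a > 0" using \<open>D y \<noteq> 0\<close> by (simp add: a_def)
  have b: "b \<ge> 0" unfolding b_def by (rule pos)
  have le: "0 \<le> 2 * t * a + t\<^sup>2 * b" for t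
  proof -
    have "0 \<le> D (y + t *\<^sub>R D y) \<bullet> (y + t *\<^sub>R D y)" by (rule pos)
    also have "\<dots> = D y \<bullet> y + t * (D y \<bullet> D y) + t * (D (D y) \<bullet> y) + t * t * b"
      by (simp add: linear_add[OF lin] linear_cmul[OF lin] inner_add b_def algebra_simps)
    also have "\<dots> = 2 * t * a + t\<^sup>2 * b"
      by (simp add: zero a_def self_adjD[OF sa, of "D y" y] power2_eq_square)
    finally show ?thesis .
  qed
  show False
  proof (cases "b = 0")
    case True
    then show False using le[of "-1"] a by simp
  next
    case False
    then have "2 * (- a / b) * a + (- a / b)\<^sup>2 * b = - (a * a / b)" by (simp add: field_simps power2_eq_square)
    moreover have "a * a / b > 0" using a b False by simp
    ultimately show False using le[of "- a / b"] by linarith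
  qed
qed

text \<open>For \<open>y = (C - D) x\<close> commutation gives
  \<open>(C + D) y = (C^2 - D^2) x = 0\<close>. Two nonnegative forms with sum zero at
  \<open>y\<close> both vanish there, so \<open>C y = D y = 0\<close>, and \<open>y\<close> is
  orthogonal to itself by symmetry.\<close>

lemma commuting_nonneg_sqrt_unique:
  assumes C: "linear C" "self_adj C" "\<And>x. 0 \<le> C x \<bullet> x"
    and D: "linear D" "self_adj D" "\<And>x. 0 \<le> D x \<bullet> x"
    and sq: "\<And>x. C (C x) = D (D x)" and comm: "\<And>x. C (D x) = D (C x)"
  shows "C x = D (x::'b::real_inner)"
proof -
  define y where "y = C x - D x"
  have "C y + D y = 0"
    unfolding y_def by (simp add: linear_diff[OF C(1)] linear_diff[OF D(1)] sq comm)
  then have "C y \<bullet> y + D y \<bullet> y = 0" by (metis inner_add_left inner_zero_left)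
  then have "C y \<bullet> y = 0" "D y \<bullet> y = 0" using C(3)[of y] D(3)[of y] by linarith+
  then have "C y = 0" "D y = 0" using nonneg_form_zero C D by blast+
  moreover have "y \<bullet> y = x \<bullet> (C y - D y)"
    using self_adjD[OF C(2), of x y] self_adjD[OF D(2), of x y] by (simp add: y_def inner_diff)
  ultimately have "y \<bullet> y = 0" by simp
  then show ?thesis by (simp add: y_def)
qed

definition adjoint_graph :: "('b::real_inner \<times> 'b) set \<Rightarrow> ('b \<times> 'b) set" where
  "adjoint_graph B = {(f, g). \<forall>(h, k)\<in>B. k \<bullet> f = h \<bullet> g}"

text \<open>These are the conditions that single out \<open>sqrt_operator\<close>, read on classes
  instead of functions.\<close>

definition sqrt_graph :: "('b::real_inner \<times> 'b) set \<Rightarrow> ('b \<times> 'b) set \<Rightarrow> bool" where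
  "sqrt_graph G B \<longleftrightarrow> adjoint_graph B = B \<and> closure (Domain B) = UNIV \<and>
     (\<forall>(u, v)\<in>B. 0 \<le> u \<bullet> v) \<and> B O B = G"

locale nonneg_symmetric = maccretive G for G :: "('b::{real_inner,banach} \<times> 'b) set" +
  assumes symmetric: "(u, v) \<in> G \<Longrightarrow> (u', v') \<in> G \<Longrightarrow> v \<bullet> u' = u \<bullet> v'"
    and nonneg: "(u, v) \<in> G \<Longrightarrow> 0 \<le> u \<bullet> v"
begin

lemma J_self_adj: "self_adj (J \<mu>)"
proof (cases "\<mu> > 0")
  case True
  have "J \<mu> x \<bullet> y = x \<bullet> J \<mu> y" for x y
    using symmetric[OF J_in[OF True, of x] J_in[OF True, of y]] True by (simp add: inner_diff)
  then show ?thesis by (simp add: self_adj_def)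
qed (simp add: self_adj_def J_def)

lemma J_nonneg: "0 \<le> J \<mu> x \<bullet> x"
proof (cases "\<mu> > 0")
  case True
  have "0 \<le> J \<mu> x \<bullet> (x - J \<mu> x)"
    using nonneg[OF J_in[OF True, of x]] True by (simp add: zero_le_divide_iff)
  then have "J \<mu> x \<bullet> J \<mu> x \<le> J \<mu> x \<bullet> x" by (simp add: inner_diff)
  then show ?thesis using inner_ge_zero[of "J \<mu> x"] by linarith
qed (simp add: J_def)

text \<open>The resolvent lies between 0 and 1 in the sense of forms, so \<open>1 - J\<close> is a
  contraction. This is the hypothesis under which \<open>operator_sqrt_exists\<close> provides a
  root of the resolvent.\<close>

lemma diff_J_le: "norm (x - J \<mu> x) \<le> norm x"
proof (cases "\<mu> > 0")
  case True
  have "0 \<le> J \<mu> x \<bullet> (x - J \<mu> x)"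
    using nonneg[OF J_in[OF True, of x]] True by (simp add: zero_le_divide_iff)
  then have "J \<mu> x \<bullet> J \<mu> x \<le> x \<bullet> J \<mu> x" by (simp add: inner_diff inner_commute)
  then have "(x - J \<mu> x) \<bullet> (x - J \<mu> x) \<le> x \<bullet> x"
    using J_nonneg[of \<mu> x] by (simp add: inner_diff inner_commute)
  then show ?thesis by (simp add: norm_le)
qed (simp add: J_def)

text \<open>With \<open>R = (1 + G)\<inverse>\<close> the graph of the root is \<open>{(sqrt R x, sqrt (1 - R) x)}\<close>, which avoids the
  spectral theorem.\<close>

lemma sqrt_graph_exists: "\<exists>B. sqrt_graph G B"
  and sqrt_graph_unique: "sqrt_graph G B \<Longrightarrow> sqrt_graph G B' \<Longrightarrow> B = B'"
proof -
  define R where "R = J 1"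
  have R: "linear R" "self_adj R" "norm (R x) \<le> norm x" "norm (x - R x) \<le> norm x" for x
    unfolding R_def by (auto simp: linear_J J_self_adj norm_J diff_J_le)
  have G_R: "G = {(R x, x - R x) |x. True}"
  proof (intro equalityI subsetI)
    fix p assume "p \<in> G"
    moreover obtain u v where p: "p = (u, v)" by (cases p)
    ultimately have "J 1 (u + v) = u" by (intro J_eqI[of 1 u v]) auto
    then show "p \<in> {(R x, x - R x) |x. True}" unfolding p R_def by (auto intro!: exI[of _ "u + v"])
  next
    fix p assume "p \<in> {(R x, x - R x) |x. True}"
    then show "p \<in> G" using J_in[of 1] by (auto simp: R_def)
  qed
  obtain P where P: "linear P" "self_adj P" "\<And>x. norm (x - P x) \<le> norm x" "\<And>x. P (P x) = R x"
    "\<forall>K. bounded_linear K \<longrightarrow> (\<forall>x. K (R x) = R (K x)) \<longrightarrow> (\<forall>x. K (P x) = P (K x))"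
    using operator_sqrt_exists[OF R(1,2,4)] by blast
  have "linear (\<lambda>x. x - R x)" "self_adj (\<lambda>x. x - R x)"
    using R(1,2) by (auto simp: self_adj_def inner_diff intro: linear_compose_sub linear_ident)
  then obtain Q where Q: "linear Q" "self_adj Q" "\<And>x. norm (x - Q x) \<le> norm x" "\<And>x. Q (Q x) = x - R x"
    "\<forall>K. bounded_linear K \<longrightarrow> (\<forall>x. K (x - R x) = K x - R (K x)) \<longrightarrow> (\<forall>x. K (Q x) = Q (K x))"
    using operator_sqrt_exists[of "\<lambda>x. x - R x"] R(3) by auto
  have isom: "norm (P x) ^ 2 + norm (Q x) ^ 2 = norm x ^ 2" for x
  proof -
    have "P x \<bullet> P x + Q x \<bullet> Q x = x \<bullet> x"
      using self_adjD[OF P(2), of x "P x"] self_adjD[OF Q(2), of x "Q x"] P(4)[of x] Q(4)[of x]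
      by (simp add: inner_diff)
    then show ?thesis by (simp add: dot_square_norm)
  qed
  have "norm (P x) ^ 2 \<le> norm x ^ 2" "norm (Q x) ^ 2 \<le> norm x ^ 2" for x
    unfolding isom[of x, symmetric] by simp_all
  then have "norm (P x) \<le> norm x" "norm (Q x) \<le> norm x" for x by simp_all
  then have blP: "bounded_linear P" and blQ: "bounded_linear Q"
    by (simp_all add: bounded_linear_contraction P(1) Q(1))
  have commPQ: "P (Q x) = Q (P x)" for x
    using Q(5) blP by (simp add: P(4)[symmetric] linear_diff[OF P(1)])
  \<comment> \<open>A root of \<open>Q\<close> that commutes with \<open>P\<close> moves half of
    \<open>Q\<close> to the other side of the inner product, so that
    \<open>P x \<bullet> Q x\<close> becomes the form of \<open>P\<close> at \<open>q x\<close> and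
    is nonnegative.\<close>
  obtain q where q: "linear q" "self_adj q" "\<And>x. q (q x) = Q x" "\<And>x. P (q x) = q (P x)"
  proof -
    show ?thesis
    proof (rule operator_sqrt_exists[OF Q(1-3)])
      fix q assume "linear q" "self_adj q" "\<And>x. q (q x) = Q x"
        "\<forall>K. bounded_linear K \<longrightarrow> (\<forall>x. K (Q x) = Q (K x)) \<longrightarrow> (\<forall>x. K (q x) = q (K x))"
      then show ?thesis using blP commPQ by (intro that[of q]) auto
    qed
  qed
  have posPQ: "0 \<le> P x \<bullet> Q x" for x
  proof -
    have "P x \<bullet> Q x = P (q x) \<bullet> q x"
      using self_adjD[OF q(2), of "P x" "q x"] q(3)[of x] q(4)[of x] by simp
    then show ?thesis using near_identity_nonneg[of _ P, OF P(3)[of "q x"]] by simp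
  qed
  define B0 where "B0 = {(P x, Q x) |x. True}"
  \<comment> \<open>Since \<open>P^2 + Q^2 = 1\<close>, the candidate \<open>x = P a + Q b\<close>
    recovers \<open>a\<close> and \<open>b\<close> from the relation \<open>Q a = P b\<close>. That
    relation characterizes the graph; it occurs both in the computation of the adjoint and in the
    composition of the graph with itself.\<close>
  have pair: "\<exists>x. a = P x \<and> b = Q x" if "Q a = P b" for a b
  proof (intro exI conjI)
    show "a = P (P a + Q b)"
      by (simp add: linear_add[OF P(1)] P(4) commPQ that[symmetric] Q(4))
    show "b = Q (P a + Q b)"
      by (simp add: linear_add[OF Q(1)] Q(4) commPQ[symmetric] that P(4))
  qed
  have adj0: "adjoint_graph B0 = B0"
  proof (intro equalityI subsetI)
    fix p assume p: "p \<in> adjoint_graph B0"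
    obtain a b where ab: "p = (a, b)" by (cases p)
    have "Q x \<bullet> a = P x \<bullet> b" for x using p by (auto simp: ab adjoint_graph_def B0_def)
    then have "x \<bullet> (Q a - P b) = 0" for x
      by (simp add: inner_diff self_adjD[OF P(2), symmetric] self_adjD[OF Q(2), symmetric])
    from this[of "Q a - P b"] have "Q a - P b = 0" by simp
    then show "p \<in> B0" using pair[of a b] by (auto simp: ab B0_def)
  next
    fix p assume "p \<in> B0"
    then obtain y where p: "p = (P y, Q y)" by (auto simp: B0_def)
    have "Q x \<bullet> P y = P x \<bullet> Q y" for x
      using self_adjD[OF Q(2), of x "P y"] self_adjD[OF P(2), of x "Q y"] commPQ[of y] by simp
    then show "p \<in> adjoint_graph B0" by (auto simp: p adjoint_graph_def B0_def)
  qed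
  have Pdense: "closure (range P) = UNIV"
  proof -
    have "Domain G \<subseteq> range P" unfolding G_R by (auto simp: P(4)[symmetric])
    from closure_mono[OF this] show ?thesis unfolding dense_domain by blast
  qed
  have dom0: "Domain B0 = range P" by (auto simp: B0_def)
  have BB0: "B0 O B0 = G"
  proof (intro equalityI subsetI)
    fix p assume "p \<in> B0 O B0"
    then obtain a b where p: "p = (P a, Q b)" "Q a = P b" by (auto simp: B0_def)
    obtain x where "a = P x" "b = Q x" using pair[OF p(2)] by blast
    then show "p \<in> G" unfolding G_R p using P(4) Q(4) by auto
  next
    fix p assume "p \<in> G"
    then obtain x where p: "p = (R x, x - R x)" unfolding G_R by auto
    have "(P (P x), Q (P x)) \<in> B0" "(P (Q x), Q (Q x)) \<in> B0" by (auto simp: B0_def)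
    then show "p \<in> B0 O B0" unfolding p P(4) Q(4) commPQ by blast
  qed
  have "sqrt_graph G B0"
    unfolding sqrt_graph_def using adj0 dom0 Pdense BB0 posPQ by (auto simp: B0_def)
  then show "\<exists>B. sqrt_graph G B" by blast
  have unique: "B = B0" if B: "sqrt_graph G B" for B
  proof -
    have adjB: "(f, g) \<in> B \<longleftrightarrow> (\<forall>h k. (h, k) \<in> B \<longrightarrow> k \<bullet> f = h \<bullet> g)" for f g
    proof -
      have "(f, g) \<in> B \<longleftrightarrow> (f, g) \<in> adjoint_graph B" using B by (simp add: sqrt_graph_def)
      then show ?thesis by (auto simp: adjoint_graph_def)
    qed
    have sym: "v \<bullet> u' = u \<bullet> v'" if "(u, v) \<in> B" "(u', v') \<in> B" for u v u' v'
      using adjB that by blast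
    have Bpos: "0 \<le> u \<bullet> v" if "(u, v) \<in> B" for u v using B that by (auto simp: sqrt_graph_def)
    have B_add: "(u + u', v + v') \<in> B" if "(u, v) \<in> B" "(u', v') \<in> B" for u v u' v'
      unfolding adjB[of "u + u'"] by (simp add: inner_add that[THEN sym[rotated]])
    have B_scale: "(c *\<^sub>R u, c *\<^sub>R v) \<in> B" if "(u, v) \<in> B" for u v c
      unfolding adjB[of "c *\<^sub>R u"] by (simp add: that[THEN sym[rotated]])
    have B_diff: "(u - u', v - v') \<in> B" if "(u, v) \<in> B" "(u', v') \<in> B" for u v u' v'
      using B_add[OF that(1) B_scale[OF that(2), of "-1"]] by simp
    have B0: "v = 0" if "(0, v) \<in> B" for v
    proof -
      have "k \<bullet> 0 = h \<bullet> v" if "(h, k) \<in> B" for h k using adjB \<open>(0, v) \<in> B\<close> that by blast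
      then have "Domain B \<subseteq> {h. h \<bullet> v = 0}" by auto
      moreover have "closed {h. h \<bullet> v = 0}" by (intro closed_Collect_eq continuous_intros)
      ultimately have "closure (Domain B) \<subseteq> {h. h \<bullet> v = 0}" by (rule closure_minimal)
      then show ?thesis using B unfolding sqrt_graph_def by (auto dest!: spec[of _ v] subsetD[of _ _ v])
    qed
    have B_fun: "v = v'" if "(u, v) \<in> B" "(u, v') \<in> B" for u v v'
      using B0[of "v - v'"] B_diff[OF that] by simp
    \<comment> \<open>For an arbitrary root \<open>B\<close> this is the operator
      \<open>B R\<close>, everywhere defined because the range of \<open>R\<close> is the domain of
      \<open>G = B O B\<close>. It is to be identified with \<open>P Q\<close>: both are nonnegative
      square roots of \<open>R (1 - R)\<close>.\<close>
    define D where "D x = (THE w. (R x, w) \<in> B \<and> (w, x - R x) \<in> B)" for x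
    have D: "(R x, D x) \<in> B" "(D x, x - R x) \<in> B" for x
    proof -
      have "(R x, x - R x) \<in> B O B" using B G_R by (auto simp: sqrt_graph_def)
      then obtain w where w: "(R x, w) \<in> B \<and> (w, x - R x) \<in> B" by blast
      then have "D x = w" unfolding D_def using B_fun by (intro the_equality) blast+
      then show "(R x, D x) \<in> B" "(D x, x - R x) \<in> B" using w by auto
    qed
    have D_eq: "D x = w" if "(R x, w) \<in> B" for x w using B_fun[OF D(1) that] .
    have Dlin: "linear D"
    proof (rule linearI)
      show "D (x + y) = D x + D y" for x y
        by (rule D_eq) (use B_add[OF D(1) D(1)] linear_add[OF R(1)] in simp)
      show "D (c *\<^sub>R x) = c *\<^sub>R D x" for c x
        by (rule D_eq) (use B_scale[OF D(1)] linear_cmul[OF R(1)] in simp)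
    qed
    have Dsa: "self_adj D"
    proof -
      have "D x \<bullet> y = x \<bullet> D y" for x y
      proof -
        have "D x \<bullet> R y = R x \<bullet> D y" by (rule sym[OF D(1) D(1)])
        moreover have "D x \<bullet> (y - R y) = (x - R x) \<bullet> D y" using sym[OF D(2)[of x] D(2)[of y]] by simp
        ultimately show ?thesis by (simp add: inner_diff)
      qed
      then show ?thesis by (simp add: self_adj_def)
    qed
    have Dpos: "0 \<le> D x \<bullet> x" for x
      using Bpos[OF D(1)[of x]] Bpos[OF D(2)[of x]] by (simp add: inner_diff inner_commute)
    \<comment> \<open>Both \<open>(D u, u - R u)\<close> and \<open>(u - R u, v - D u)\<close> lie
      in \<open>B\<close>, hence \<open>(D u, v - D u)\<close> lies in \<open>G\<close>. The two
      components add up to \<open>v\<close>, so \<open>R v = D u\<close>.\<close>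
    have RB: "(R u, R v) \<in> B" if uv: "(u, v) \<in> B" for u v
    proof -
      have *: "(D u, u - R u) \<in> B" by (rule D(2))
      obtain w where w: "(u - R u, w) \<in> B" using B_diff[OF uv D(1)[of u]] by blast
      have w_eq: "w = v - D u" using B_fun[OF w B_diff[OF uv D(1)[of u]]] .
      have "(D u, v - D u) \<in> G" using * w B unfolding w_eq sqrt_graph_def by blast
      then have "R v = D u" unfolding R_def by (intro J_eqI) auto
      then show ?thesis using D(1)[of u] by simp
    qed
    have DR: "D (R x) = R (D x)" for x by (rule D_eq[OF RB[OF D(1)]])
    have DD: "D (D x) = R (x - R x)" for x
    proof (rule D_eq)
      show "(R (D x), R (x - R x)) \<in> B" by (rule RB[OF D(2)])
    qed
    have blD: "bounded_linear D"
    proof (rule bounded_linear_contraction[OF Dlin], rule power2_le_imp_le)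
      fix x
      have "(D x) \<bullet> (D x) = R (x - R x) \<bullet> x" using self_adjD[OF Dsa, of "D x" x] DD by (simp add: inner_commute)
      also have "\<dots> \<le> norm (R (x - R x)) * norm x" by (rule norm_cauchy_schwarz)
      also have "\<dots> \<le> norm x * norm x" by (intro mult_right_mono order_trans[OF R(3)] R(4)) auto
      finally show "(norm (D x))\<^sup>2 \<le> (norm x)\<^sup>2" by (simp add: dot_square_norm power2_eq_square)
    qed simp
    have DP: "D (P x) = P (D x)" for x using P(5) blD DR by blast
    have DQ: "D (Q x) = Q (D x)" for x using Q(5) blD by (simp add: linear_diff[OF Dlin] DR)
    have "P (Q x) = D x" for x
    proof (rule commuting_nonneg_sqrt_unique[where C = "\<lambda>x. P (Q x)"])
      show "linear (\<lambda>x. P (Q x))" using linear_compose[OF Q(1) P(1)] by (simp add: comp_def)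
      show "self_adj (\<lambda>x. P (Q x))"
        using P(2) Q(2) commPQ by (simp add: self_adj_def)
      show "0 \<le> P (Q x) \<bullet> x" for x using posPQ[of x] self_adjD[OF Q(2), of "P x" x] by (simp add: commPQ)
      show "P (Q (P (Q x))) = D (D x)" for x
        by (simp add: DD commPQ[symmetric] P(4) Q(4)) 
      show "P (Q (D x)) = D (P (Q x))" for x by (simp add: DP DQ)
    qed (use Dlin Dsa Dpos in auto)
    \<comment> \<open>At this point \<open>B\<close> contains the pairs \<open>(P y, Q y)\<close>
      with \<open>y\<close> in the range of \<open>P\<close>. The range is dense, and membership in
      \<open>B\<close>, its own adjoint, is a family of closed conditions on
      \<open>y\<close>.\<close>
    then have PP: "(P (P x), Q (P x)) \<in> B" for x using D(1)[of x] by (simp add: P(4) commPQ)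
    have "(P y, Q y) \<in> B" for y
    proof -
      have "k \<bullet> P y = h \<bullet> Q y" if hk: "(h, k) \<in> B" for h k
      proof -
        have "range P \<subseteq> {y. k \<bullet> P y = h \<bullet> Q y}" using sym[OF hk PP] by auto
        moreover have "closed {y. k \<bullet> P y = h \<bullet> Q y}"
          by (intro closed_Collect_eq continuous_intros bounded_linear.continuous_on[OF blP] bounded_linear.continuous_on[OF blQ])
        ultimately have "closure (range P) \<subseteq> {y. k \<bullet> P y = h \<bullet> Q y}" by (rule closure_minimal)
        then show ?thesis unfolding Pdense by blast
      qed
      then show ?thesis using adjB[of "P y" "Q y"] by blast
    qed
    then have sub: "B0 \<subseteq> B" by (auto simp: B0_def)
    \<comment> \<open>Adjoints reverse inclusions, so a self-adjoint graph has no proper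
      self-adjoint extension.\<close>
    then have "adjoint_graph B \<subseteq> adjoint_graph B0" by (auto simp: adjoint_graph_def)
    then have "B \<subseteq> B0" using adj0 B by (simp add: sqrt_graph_def)
    with sub show ?thesis by blast
  qed
  show "sqrt_graph G B \<Longrightarrow> sqrt_graph G B' \<Longrightarrow> B = B'" using unique[of B] unique[of B'] by simp
qed

end

section \<open>The Banach space \<open>L\<^sup>1\<close> and the Hilbert space \<open>L\<^sup>2\<close>\<close>

text \<open>A rapidly Cauchy subsequence converges almost everywhere, and Fatou's lemma bounds the
  distance to its limit. Functions and a general measure are used so that one statement gives
  completeness of L1 and L2 and also the limit of the martingale on a product space.\<close>

theorem riesz_fischer:
  fixes f :: "nat \<Rightarrow> 'a \<Rightarrow> real" and q :: nat
  assumes meas: "\<And>n. f n \<in> borel_measurable M" and q: "q > 0"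
    and cauchy: "\<And>e. e > 0 \<Longrightarrow> \<exists>N. \<forall>m\<ge>N. \<forall>n\<ge>N. (\<integral>\<^sup>+x. ennreal (\<bar>f m x - f n x\<bar> ^ q) \<partial>M) \<le> ennreal e"
  obtains g where "g \<in> borel_measurable M"
    "\<And>e. e > 0 \<Longrightarrow> \<exists>N. \<forall>n\<ge>N. (\<integral>\<^sup>+x. ennreal (\<bar>f n x - g x\<bar> ^ q) \<partial>M) \<le> ennreal e"
proof -
  \<comment> \<open>The rate is chosen so that the weight \<open>2^(q k)\<close> in front of the
    \<open>q\<close>-th powers still leaves the summable bound \<open>2^-k\<close>. Almost
    everywhere the increments are then eventually below \<open>2^-k\<close>.\<close>
  have "\<exists>N. \<forall>k. \<forall>m\<ge>N k. \<forall>n\<ge>N k. (\<integral>\<^sup>+x. ennreal (\<bar>f m x - f n x\<bar> ^ q) \<partial>M) \<le> ennreal ((1 / 2 ^ Suc q) ^ k)"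
    by (rule choice) (use cauchy in auto)
  then obtain N where N: "\<And>k m n. m \<ge> N k \<Longrightarrow> n \<ge> N k \<Longrightarrow>
      (\<integral>\<^sup>+x. ennreal (\<bar>f m x - f n x\<bar> ^ q) \<partial>M) \<le> ennreal ((1 / 2 ^ Suc q) ^ k)" by blast
  define r where "r k = k + (\<Sum>i\<le>k. N i)" for k
  have r_ge: "r k \<ge> N k" "r (Suc k) \<ge> N k" "r k \<ge> k" for k
  proof -
    have "N k \<le> (\<Sum>i\<le>k. N i)" by (rule member_le_sum) auto
    then show "r k \<ge> N k" "r (Suc k) \<ge> N k" "r k \<ge> k" unfolding r_def by auto
  qed
  define d where "d k x = \<bar>f (r (Suc k)) x - f (r k) x\<bar>" for k x
  have [measurable]: "f n \<in> borel_measurable M" for n by (rule meas)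
  have d_meas [measurable]: "d k \<in> borel_measurable M" for k unfolding d_def by measurable
  have "(\<integral>\<^sup>+x. (\<Sum>k. ennreal (2 ^ (q * k) * d k x ^ q)) \<partial>M) = (\<Sum>k. \<integral>\<^sup>+x. ennreal (2 ^ (q * k) * d k x ^ q) \<partial>M)"
    by (rule nn_integral_suminf) measurable
  also have "\<dots> \<le> (\<Sum>k. ennreal ((1 / 2) ^ k))"
  proof (intro suminf_le summableI)
    fix k
    have "(\<integral>\<^sup>+x. ennreal (2 ^ (q * k) * d k x ^ q) \<partial>M) = ennreal (2 ^ (q * k)) * (\<integral>\<^sup>+x. ennreal (d k x ^ q) \<partial>M)"
      by (subst nn_integral_cmult[symmetric]) (auto simp: ennreal_mult d_def)
    also have "\<dots> \<le> ennreal (2 ^ (q * k)) * ennreal ((1 / 2 ^ Suc q) ^ k)"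
      unfolding d_def by (intro mult_left_mono N r_ge) auto
    also have "\<dots> = ennreal (2 ^ (q * k) * (1 / 2 ^ Suc q) ^ k)" by (simp add: ennreal_mult)
    also have "2 ^ (q * k) * (1 / 2 ^ Suc q) ^ k = (1 / 2 :: real) ^ k"
      unfolding power_mult power_mult_distrib[symmetric] by simp
    finally show "(\<integral>\<^sup>+x. ennreal (2 ^ (q * k) * d k x ^ q) \<partial>M) \<le> ennreal ((1 / 2) ^ k)" .
  qed
  also have "\<dots> < \<infinity>"
    using summable_geometric[of "1/2::real"] by (subst suminf_ennreal2) (auto simp: power_one_over)
  finally have "AE x in M. (\<Sum>k. ennreal (2 ^ (q * k) * d k x ^ q)) \<noteq> \<infinity>"
    by (intro nn_integral_PInf_AE) auto
  then have conv: "AE x in M. convergent (\<lambda>k. f (r k) x)"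
  proof eventually_elim
    case (elim x)
    have "summable (\<lambda>k. 2 ^ (q * k) * d k x ^ q)"
      by (rule summable_suminf_not_top) (use elim in \<open>auto simp: d_def\<close>)
    then have "(\<lambda>k. 2 ^ (q * k) * d k x ^ q) \<longlonglongrightarrow> 0" by (rule summable_LIMSEQ_zero)
    then have "\<forall>\<^sub>F k in sequentially. 2 ^ (q * k) * d k x ^ q < 1" by (rule order_tendstoD) simp
    then have "\<forall>\<^sub>F k in sequentially. norm (f (r (Suc k)) x - f (r k) x) \<le> (1/2) ^ k"
    proof eventually_elim
      case (elim k)
      have "(2 ^ k * d k x) ^ q < 1 ^ q" using elim by (simp add: power_mult_distrib power_mult[symmetric] mult.commute)
      then have "2 ^ k * d k x < 1" by (rule power_less_imp_less_base) simp
      then show ?case by (simp add: d_def field_simps power_one_over)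
    qed
    then have "summable (\<lambda>k. f (r (Suc k)) x - f (r k) x)"
      by (rule summable_comparison_test_ev) (simp add: summable_geometric)
    then have "convergent (\<lambda>n. \<Sum>k<n. f (r (Suc k)) x - f (r k) x)" by (simp add: summable_iff_convergent)
    then have "convergent (\<lambda>n. f (r n) x - f (r 0) x)"
      by (simp only: sum_lessThan_telescope[where f = "\<lambda>k. f (r k) x"])
    then show ?case using convergent_add[OF _ convergent_const[of "f (r 0) x"]] by fastforce
  qed
  define g where "g x = lim (\<lambda>k. f (r k) x)" for x
  have [measurable]: "g \<in> borel_measurable M" unfolding g_def by measurable
  show ?thesis
  proof (rule that)
    show "g \<in> borel_measurable M" by measurable
    fix e :: real assume "e > 0"
    then obtain K where K: "\<And>m n. m \<ge> K \<Longrightarrow> n \<ge> K \<Longrightarrow> (\<integral>\<^sup>+x. ennreal (\<bar>f m x - f n x\<bar> ^ q) \<partial>M) \<le> ennreal e"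
      using cauchy by blast
    have "(\<integral>\<^sup>+x. ennreal (\<bar>f n x - g x\<bar> ^ q) \<partial>M) \<le> ennreal e" if n: "n \<ge> K" for n
    proof -
      have "(\<integral>\<^sup>+x. ennreal (\<bar>f n x - g x\<bar> ^ q) \<partial>M)
          = (\<integral>\<^sup>+x. liminf (\<lambda>k. ennreal (\<bar>f n x - f (r k) x\<bar> ^ q)) \<partial>M)"
      proof (rule nn_integral_cong_AE, use conv in eventually_elim)
        case (elim x)
        then have "(\<lambda>k. f (r k) x) \<longlonglongrightarrow> g x" unfolding g_def by (simp add: convergent_LIMSEQ_iff)
        then have "(\<lambda>k. ennreal (\<bar>f n x - f (r k) x\<bar> ^ q)) \<longlonglongrightarrow> ennreal (\<bar>f n x - g x\<bar> ^ q)"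
          by (intro tendsto_intros)
        then show ?case by (intro lim_imp_Liminf[symmetric]) auto
      qed
      also have "\<dots> \<le> liminf (\<lambda>k. \<integral>\<^sup>+x. ennreal (\<bar>f n x - f (r k) x\<bar> ^ q) \<partial>M)"
        by (rule nn_integral_liminf) measurable
      also have "\<dots> \<le> ennreal e"
      proof -
        have "\<forall>\<^sub>F k in sequentially. (\<integral>\<^sup>+x. ennreal (\<bar>f n x - f (r k) x\<bar> ^ q) \<partial>M) \<le> ennreal e"
          unfolding eventually_sequentially using K[OF n] r_ge(3) order_trans by blast
        then show ?thesis by (intro Liminf_le) auto
      qed
      finally show ?thesis .
    qed
    then show "\<exists>N. \<forall>n\<ge>N. (\<integral>\<^sup>+x. ennreal (\<bar>f n x - g x\<bar> ^ q) \<partial>M) \<le> ennreal e" by blast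
  qed
qed

section \<open>Classes modulo null sets as Banach and Hilbert spaces\<close>

lemma Lp1_iff: "f \<in> Lp 1 \<longleftrightarrow> integrable lborel f"
  unfolding Lp_def by (auto simp: integrable_abs_iff)

lemma Lp2_iff: "f \<in> Lp 2 \<longleftrightarrow> f \<in> borel_measurable lborel \<and> integrable lborel (\<lambda>x. (f x)\<^sup>2)"
  unfolding Lp_def by (simp add: powr_numeral)

lemma Lp_norm1: "Lp_norm 1 f = (LINT x|lborel. \<bar>f x\<bar>)"
  unfolding Lp_norm_def by simp

lemma Lp_norm2: "Lp_norm 2 f = sqrt (LINT x|lborel. (f x)\<^sup>2)"
  unfolding Lp_norm_def by (simp add: powr_numeral powr_half_sqrt)

lemma Lp2_mult_integrable:
  assumes "f \<in> Lp 2" "g \<in> Lp 2"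
  shows "integrable lborel (\<lambda>x. f x * g x)"
proof (rule Bochner_Integration.integrable_bound)
  show "integrable lborel (\<lambda>x. (f x)\<^sup>2 + (g x)\<^sup>2)" using assms by (auto simp: Lp2_iff)
  show "(\<lambda>x. f x * g x) \<in> borel_measurable lborel" using assms by (auto simp: Lp2_iff)
  have "norm (a * b) \<le> norm (a\<^sup>2 + b\<^sup>2)" for a b :: real
    using sum_squares_bound[of a b] sum_squares_bound[of a "-b"] zero_le_power2[of a] zero_le_power2[of b]
    unfolding real_norm_def abs_if by (simp add: power2_eq_square)
  then show "AE x in lborel. norm (f x * g x) \<le> norm ((f x)\<^sup>2 + (g x)\<^sup>2)" by simp
qed

lemma Lp2_lincomb:
  assumes "f \<in> Lp 2" "g \<in> Lp 2"
  shows "(\<lambda>x. a * f x + b * g x) \<in> Lp 2"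
proof -
  have "integrable lborel (\<lambda>x. a\<^sup>2 * (f x)\<^sup>2 + b\<^sup>2 * (g x)\<^sup>2 + 2 * a * b * (f x * g x))"
    using assms Lp2_mult_integrable[OF assms] by (auto simp: Lp2_iff)
  then show ?thesis using assms by (auto simp: Lp2_iff power2_sum power_mult_distrib algebra_simps)
qed

lemma Lp1_lincomb: "f \<in> Lp 1 \<Longrightarrow> g \<in> Lp 1 \<Longrightarrow> (\<lambda>x. a * f x + b * g x) \<in> Lp 1"
  by (simp add: Lp1_iff)

lemma Lp_add: "f \<in> Lp p \<Longrightarrow> g \<in> Lp p \<Longrightarrow> p = 1 \<or> p = 2 \<Longrightarrow> (\<lambda>x. f x + g x) \<in> Lp p"
  and Lp_diff: "f \<in> Lp p \<Longrightarrow> g \<in> Lp p \<Longrightarrow> p = 1 \<or> p = 2 \<Longrightarrow> (\<lambda>x. f x - g x) \<in> Lp p"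
  and Lp_scale: "f \<in> Lp p \<Longrightarrow> p = 1 \<or> p = 2 \<Longrightarrow> (\<lambda>x. c * f x) \<in> Lp p"
  and Lp_minus: "f \<in> Lp p \<Longrightarrow> p = 1 \<or> p = 2 \<Longrightarrow> (\<lambda>x. - f x) \<in> Lp p"
  using Lp1_lincomb[of f g 1 1] Lp2_lincomb[of f g 1 1] Lp1_lincomb[of f g 1 "-1"] Lp2_lincomb[of f g 1 "-1"]
    Lp1_lincomb[of f f c 0] Lp2_lincomb[of f f c 0] Lp1_lincomb[of f f "-1" 0] Lp2_lincomb[of f f "-1" 0]
  by auto

lemma Lp_zero: "(\<lambda>x. 0) \<in> Lp p"
  by (simp add: Lp_def)

lemma Lp_measurable: "f \<in> Lp p \<Longrightarrow> f \<in> borel_measurable lborel"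
  by (simp add: Lp_def)

lemma ae_eq_refl: "ae_eq f f" and ae_eq_sym: "ae_eq f g \<Longrightarrow> ae_eq g f"
  and ae_eq_trans: "ae_eq f g \<Longrightarrow> ae_eq g h \<Longrightarrow> ae_eq f h"
  unfolding ae_eq_def by (auto elim: eventually_elim2)

lemma Lp_cong: "f \<in> Lp p \<Longrightarrow> ae_eq f g \<Longrightarrow> g \<in> borel_measurable lborel \<Longrightarrow> g \<in> Lp p"
  unfolding Lp_def ae_eq_def
  by (auto intro!: integrable_cong_AE_imp[of lborel "\<lambda>x. \<bar>f x\<bar> powr p"] elim!: eventually_mono)

lemma Lp_norm_cong:
  "f \<in> Lp p \<Longrightarrow> g \<in> Lp p \<Longrightarrow> ae_eq f g \<Longrightarrow> Lp_norm p f = Lp_norm p g"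
  unfolding Lp_norm_def Lp_def ae_eq_def
  by (intro arg_cong2[where f = "(powr)"] integral_cong_AE refl) auto

\<comment> \<open>Classes form a type so that \<open>banach\<close>, and \<open>real_inner\<close>
  for \<open>l2\<close>, can be instantiated and the abstract generation theory applies. The
  relation is partial: functions outside the space belong to no class.\<close>
quotient_type (overloaded) 'a l1 = "'a::euclidean_space \<Rightarrow> real" /
  partial: "\<lambda>f g. f \<in> Lp 1 \<and> g \<in> Lp 1 \<and> ae_eq f g"
  by (rule part_equivpI) (auto intro!: exI[of _ "\<lambda>x. 0"] sympI transpI Lp_zero simp: ae_eq_refl intro: ae_eq_sym ae_eq_trans)

quotient_type (overloaded) 'a l2 = "'a::euclidean_space \<Rightarrow> real" /
  partial: "\<lambda>f g. f \<in> Lp 2 \<and> g \<in> Lp 2 \<and> ae_eq f g"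
  by (rule part_equivpI) (auto intro!: exI[of _ "\<lambda>x. 0"] sympI transpI Lp_zero simp: ae_eq_refl intro: ae_eq_sym ae_eq_trans)

lemma rep_l1_Lp: "rep_l1 x \<in> Lp 1"
  using Quotient3_rep_reflp[OF Quotient3_l1, of x] by simp

lemma rep_l2_Lp: "rep_l2 x \<in> Lp 2"
  using Quotient3_rep_reflp[OF Quotient3_l2, of x] by simp

lemma abs_rep_l1: "abs_l1 (rep_l1 x) = x" by (rule Quotient3_abs_rep[OF Quotient3_l1])
lemma abs_rep_l2: "abs_l2 (rep_l2 x) = x" by (rule Quotient3_abs_rep[OF Quotient3_l2])

lemma abs_l1_eq_iff: "f \<in> Lp 1 \<Longrightarrow> g \<in> Lp 1 \<Longrightarrow> abs_l1 f = abs_l1 g \<longleftrightarrow> ae_eq f g"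
  using Quotient3_rel[OF Quotient3_l1, of f g] by (auto simp: ae_eq_refl)

lemma abs_l2_eq_iff: "f \<in> Lp 2 \<Longrightarrow> g \<in> Lp 2 \<Longrightarrow> abs_l2 f = abs_l2 g \<longleftrightarrow> ae_eq f g"
  using Quotient3_rel[OF Quotient3_l2, of f g] by (auto simp: ae_eq_refl)

lemma rep_abs_l1: "f \<in> Lp 1 \<Longrightarrow> ae_eq (rep_l1 (abs_l1 f)) f"
  using abs_l1_eq_iff[OF rep_l1_Lp, of f "abs_l1 f"] by (simp add: abs_rep_l1)

lemma rep_abs_l2: "f \<in> Lp 2 \<Longrightarrow> ae_eq (rep_l2 (abs_l2 f)) f"
  using abs_l2_eq_iff[OF rep_l2_Lp, of f "abs_l2 f"] by (simp add: abs_rep_l2)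

lemma l1_induct: "(\<And>f. f \<in> Lp 1 \<Longrightarrow> P (abs_l1 f)) \<Longrightarrow> P x"
  using rep_l1_Lp abs_rep_l1 by metis

lemma l2_induct: "(\<And>f. f \<in> Lp 2 \<Longrightarrow> P (abs_l2 f)) \<Longrightarrow> P x"
  using rep_l2_Lp abs_rep_l2 by metis

lemma L2_inner_cong:
  assumes "f \<in> Lp 2" "f' \<in> Lp 2" "g \<in> Lp 2" "g' \<in> Lp 2" "ae_eq f f'" "ae_eq g g'"
  shows "L2_inner f g = L2_inner f' g'"
  unfolding L2_inner_def using assms
  by (intro integral_cong_AE) (auto simp: ae_eq_def dest!: Lp_measurable elim: eventually_elim2)

instantiation l1 :: (euclidean_space) real_normed_vector
begin

lift_definition zero_l1 :: "'a l1" is "\<lambda>x. 0" by (simp add: Lp_zero ae_eq_refl)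
lift_definition plus_l1 :: "'a l1 \<Rightarrow> 'a l1 \<Rightarrow> 'a l1" is "\<lambda>f g x. f x + g x"
  by (auto intro: Lp_add simp: ae_eq_def elim: eventually_elim2)
lift_definition minus_l1 :: "'a l1 \<Rightarrow> 'a l1 \<Rightarrow> 'a l1" is "\<lambda>f g x. f x - g x"
  by (auto intro: Lp_diff simp: ae_eq_def elim: eventually_elim2)
lift_definition uminus_l1 :: "'a l1 \<Rightarrow> 'a l1" is "\<lambda>f x. - f x"
  by (auto intro: Lp_minus simp: ae_eq_def)
lift_definition scaleR_l1 :: "real \<Rightarrow> 'a l1 \<Rightarrow> 'a l1" is "\<lambda>c f x. c * f x"
  by (auto intro: Lp_scale simp: ae_eq_def elim: eventually_mono)
lift_definition norm_l1 :: "'a l1 \<Rightarrow> real" is "Lp_norm 1"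
  by (auto intro: Lp_norm_cong)

definition dist_l1 :: "'a l1 \<Rightarrow> 'a l1 \<Rightarrow> real" where "dist_l1 x y = norm (x - y)"
definition sgn_l1 :: "'a l1 \<Rightarrow> 'a l1" where "sgn_l1 x = inverse (norm x) *\<^sub>R x"
definition uniformity_l1 :: "('a l1 \<times> 'a l1) filter" where
  "uniformity_l1 = (INF e\<in>{0<..}. principal {(x, y). dist x y < e})"
definition open_l1 :: "'a l1 set \<Rightarrow> bool" where
  "open_l1 U \<longleftrightarrow> (\<forall>x\<in>U. \<forall>\<^sub>F (x', y) in uniformity. x' = x \<longrightarrow> y \<in> U)"

instance
proof
  fix a b c :: "'a l1" and r s :: real
  show "a + b + c = a + (b + c)" by transfer (auto intro!: Lp_add simp: ae_eq_def add.assoc)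
  show "a + b = b + a" by transfer (auto intro!: Lp_add simp: ae_eq_def add.commute)
  show "0 + a = a" by transfer (auto simp: ae_eq_def)
  show "- a + a = 0" by transfer (auto simp: ae_eq_def Lp_zero)
  show "a - b = a + - b" by transfer (auto intro!: Lp_diff simp: ae_eq_def)
  show "r *\<^sub>R (a + b) = r *\<^sub>R a + r *\<^sub>R b" by transfer (auto intro!: Lp_add Lp_scale simp: ae_eq_def distrib_left)
  show "(r + s) *\<^sub>R a = r *\<^sub>R a + s *\<^sub>R a" by transfer (auto intro!: Lp_add Lp_scale simp: ae_eq_def distrib_right)
  show "r *\<^sub>R s *\<^sub>R a = (r * s) *\<^sub>R a" by transfer (auto intro!: Lp_scale simp: ae_eq_def mult.assoc)
  show "1 *\<^sub>R a = a" by transfer (auto simp: ae_eq_def)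
  show "dist a b = norm (a - b)" by (rule dist_l1_def)
  show "sgn a = inverse (norm a) *\<^sub>R a" by (rule sgn_l1_def)
  show "uniformity = (INF e\<in>{0<..}. principal {(x, y :: 'a l1). dist x y < e})" by (rule uniformity_l1_def)
  show "open U \<longleftrightarrow> (\<forall>x\<in>U. \<forall>\<^sub>F (x', y) in uniformity. x' = x \<longrightarrow> y \<in> U)" for U :: "'a l1 set" by (rule open_l1_def)
  show "norm a = 0 \<longleftrightarrow> a = 0"
    by transfer (auto simp: Lp1_iff Lp_norm1 ae_eq_def integral_nonneg_eq_0_iff_AE)
  show "norm (a + b) \<le> norm a + norm b"
    by transfer (auto simp: Lp1_iff Lp_norm1 Bochner_Integration.integral_add[symmetric]
        simp del: Bochner_Integration.integral_add intro!: integral_mono)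
  show "norm (r *\<^sub>R a) = \<bar>r\<bar> * norm a"
    by transfer (auto simp: Lp1_iff Lp_norm1 abs_mult)
qed

end

instantiation l2 :: (euclidean_space) real_inner
begin

lift_definition zero_l2 :: "'a l2" is "\<lambda>x. 0" by (simp add: Lp_zero ae_eq_refl)
lift_definition plus_l2 :: "'a l2 \<Rightarrow> 'a l2 \<Rightarrow> 'a l2" is "\<lambda>f g x. f x + g x"
  by (auto intro: Lp_add simp: ae_eq_def elim: eventually_elim2)
lift_definition minus_l2 :: "'a l2 \<Rightarrow> 'a l2 \<Rightarrow> 'a l2" is "\<lambda>f g x. f x - g x"
  by (auto intro: Lp_diff simp: ae_eq_def elim: eventually_elim2)
lift_definition uminus_l2 :: "'a l2 \<Rightarrow> 'a l2" is "\<lambda>f x. - f x"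
  by (auto intro: Lp_minus simp: ae_eq_def)
lift_definition scaleR_l2 :: "real \<Rightarrow> 'a l2 \<Rightarrow> 'a l2" is "\<lambda>c f x. c * f x"
  by (auto intro: Lp_scale simp: ae_eq_def elim: eventually_mono)
lift_definition inner_l2 :: "'a l2 \<Rightarrow> 'a l2 \<Rightarrow> real" is L2_inner
  by (auto intro: L2_inner_cong)

definition norm_l2 :: "'a l2 \<Rightarrow> real" where "norm_l2 x = sqrt (inner x x)"
definition dist_l2 :: "'a l2 \<Rightarrow> 'a l2 \<Rightarrow> real" where "dist_l2 x y = norm (x - y)"
definition sgn_l2 :: "'a l2 \<Rightarrow> 'a l2" where "sgn_l2 x = inverse (norm x) *\<^sub>R x"
definition uniformity_l2 :: "('a l2 \<times> 'a l2) filter" where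
  "uniformity_l2 = (INF e\<in>{0<..}. principal {(x, y). dist x y < e})"
definition open_l2 :: "'a l2 set \<Rightarrow> bool" where
  "open_l2 U \<longleftrightarrow> (\<forall>x\<in>U. \<forall>\<^sub>F (x', y) in uniformity. x' = x \<longrightarrow> y \<in> U)"

instance
proof
  fix a b c :: "'a l2" and r s :: real
  show "a + b + c = a + (b + c)" by transfer (auto intro!: Lp_add simp: ae_eq_def add.assoc)
  show "a + b = b + a" by transfer (auto intro!: Lp_add simp: ae_eq_def add.commute)
  show "0 + a = a" by transfer (auto simp: ae_eq_def)
  show "- a + a = 0" by transfer (auto simp: ae_eq_def Lp_zero)
  show "a - b = a + - b" by transfer (auto intro!: Lp_diff simp: ae_eq_def)
  show "r *\<^sub>R (a + b) = r *\<^sub>R a + r *\<^sub>R b" by transfer (auto intro!: Lp_add Lp_scale simp: ae_eq_def distrib_left)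
  show "(r + s) *\<^sub>R a = r *\<^sub>R a + s *\<^sub>R a" by transfer (auto intro!: Lp_add Lp_scale simp: ae_eq_def distrib_right)
  show "r *\<^sub>R s *\<^sub>R a = (r * s) *\<^sub>R a" by transfer (auto intro!: Lp_scale simp: ae_eq_def mult.assoc)
  show "1 *\<^sub>R a = a" by transfer (auto simp: ae_eq_def)
  show "dist a b = norm (a - b)" by (rule dist_l2_def)
  show "sgn a = inverse (norm a) *\<^sub>R a" by (rule sgn_l2_def)
  show "uniformity = (INF e\<in>{0<..}. principal {(x, y :: 'a l2). dist x y < e})" by (rule uniformity_l2_def)
  show "open U \<longleftrightarrow> (\<forall>x\<in>U. \<forall>\<^sub>F (x', y) in uniformity. x' = x \<longrightarrow> y \<in> U)" for U :: "'a l2 set" by (rule open_l2_def)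
  show "norm a = sqrt (inner a a)" by (rule norm_l2_def)
  show "inner a b = inner b a" by transfer (simp add: L2_inner_def mult.commute)
  show "inner (a + b) c = inner a c + inner b c"
    by transfer (auto simp: L2_inner_def distrib_right Lp2_mult_integrable)
  show "inner (r *\<^sub>R a) b = r * inner a b"
    by transfer (auto simp: L2_inner_def mult.assoc)
  show "0 \<le> inner a a" by transfer (simp add: L2_inner_def)
  show "inner a a = 0 \<longleftrightarrow> a = 0"
    by transfer (auto simp: L2_inner_def Lp2_iff ae_eq_def integral_nonneg_eq_0_iff_AE power2_eq_square)
qed

end

lemma abs_l1_zero: "abs_l1 (\<lambda>x. 0) = 0" by (simp add: zero_l1_def)
lemma abs_l2_zero: "abs_l2 (\<lambda>x. 0) = 0" by (simp add: zero_l2_def)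

lemma abs_l1_lincomb: "f \<in> Lp 1 \<Longrightarrow> g \<in> Lp 1 \<Longrightarrow> abs_l1 (\<lambda>x. a * f x + b * g x) = a *\<^sub>R abs_l1 f + b *\<^sub>R abs_l1 g"
  by (simp add: plus_l1.abs_eq scaleR_l1.abs_eq ae_eq_refl Lp_scale)
lemma abs_l2_lincomb: "f \<in> Lp 2 \<Longrightarrow> g \<in> Lp 2 \<Longrightarrow> abs_l2 (\<lambda>x. a * f x + b * g x) = a *\<^sub>R abs_l2 f + b *\<^sub>R abs_l2 g"
  by (simp add: plus_l2.abs_eq scaleR_l2.abs_eq ae_eq_refl Lp_scale)

lemma abs_l1_diff: "f \<in> Lp 1 \<Longrightarrow> g \<in> Lp 1 \<Longrightarrow> abs_l1 (\<lambda>x. f x - g x) = abs_l1 f - abs_l1 g"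
  by (simp add: minus_l1.abs_eq ae_eq_refl)
lemma abs_l2_diff: "f \<in> Lp 2 \<Longrightarrow> g \<in> Lp 2 \<Longrightarrow> abs_l2 (\<lambda>x. f x - g x) = abs_l2 f - abs_l2 g"
  by (simp add: minus_l2.abs_eq ae_eq_refl)

lemma norm_abs_l1: "f \<in> Lp 1 \<Longrightarrow> norm (abs_l1 f) = Lp_norm 1 f"
  by (simp add: norm_l1.abs_eq ae_eq_refl)
lemma inner_abs_l2: "f \<in> Lp 2 \<Longrightarrow> g \<in> Lp 2 \<Longrightarrow> abs_l2 f \<bullet> abs_l2 g = L2_inner f g"
  by (simp add: inner_l2.abs_eq ae_eq_refl)
lemma norm_abs_l2: "f \<in> Lp 2 \<Longrightarrow> norm (abs_l2 f) = Lp_norm 2 f"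
  by (simp add: norm_eq_sqrt_inner inner_abs_l2 L2_inner_def Lp_norm2 power2_eq_square)

lemma nn_integral_l1: "(\<integral>\<^sup>+x. ennreal (\<bar>rep_l1 a x - rep_l1 b x\<bar> ^ 1) \<partial>lborel) = ennreal (norm (a - b))"
proof -
  have "norm (a - b) = Lp_norm 1 (\<lambda>x. rep_l1 a x - rep_l1 b x)"
    using abs_l1_diff[OF rep_l1_Lp rep_l1_Lp, of a b] norm_abs_l1[OF Lp_diff[OF rep_l1_Lp rep_l1_Lp], of a b]
    by (simp add: abs_rep_l1)
  then show ?thesis
    using Lp_diff[OF rep_l1_Lp rep_l1_Lp, of a b] by (simp add: Lp_norm1 Lp1_iff nn_integral_eq_integral)
qed

lemma nn_integral_l2: "(\<integral>\<^sup>+x. ennreal (\<bar>rep_l2 a x - rep_l2 b x\<bar> ^ 2) \<partial>lborel) = ennreal ((norm (a - b))\<^sup>2)"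
proof -
  have "norm (a - b) = Lp_norm 2 (\<lambda>x. rep_l2 a x - rep_l2 b x)"
    using abs_l2_diff[OF rep_l2_Lp rep_l2_Lp, of a b] norm_abs_l2[OF Lp_diff[OF rep_l2_Lp rep_l2_Lp], of a b]
    by (simp add: abs_rep_l2)
  then show ?thesis
    using Lp_diff[OF rep_l2_Lp rep_l2_Lp, of a b] by (simp add: Lp_norm2 Lp2_iff nn_integral_eq_integral)
qed

instance l1 :: (euclidean_space) banach
proof
  fix X :: "nat \<Rightarrow> 'a l1" assume X: "Cauchy X"
  obtain g where g: "g \<in> borel_measurable lborel"
    "\<And>e. e > 0 \<Longrightarrow> \<exists>N. \<forall>n\<ge>N. (\<integral>\<^sup>+x. ennreal (\<bar>rep_l1 (X n) x - g x\<bar> ^ 1) \<partial>lborel) \<le> ennreal e"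
  proof (rule riesz_fischer[of "\<lambda>n. rep_l1 (X n)" lborel 1])
    show "\<exists>N. \<forall>m\<ge>N. \<forall>n\<ge>N. (\<integral>\<^sup>+x. ennreal (\<bar>rep_l1 (X m) x - rep_l1 (X n) x\<bar> ^ 1) \<partial>lborel) \<le> ennreal e"
      if "e > 0" for e
      using CauchyD[OF X that] unfolding nn_integral_l1 by (meson ennreal_leI less_imp_le)
  qed (use Lp_measurable[OF rep_l1_Lp] in auto)
  obtain N where N: "\<And>n. n \<ge> N \<Longrightarrow> (\<integral>\<^sup>+x. ennreal (\<bar>rep_l1 (X n) x - g x\<bar> ^ 1) \<partial>lborel) \<le> ennreal 1"
    using g(2)[of 1] by auto
  have "integrable lborel (\<lambda>x. rep_l1 (X N) x - g x)"
    using le_less_trans[OF N[OF order_refl] ennreal_less_top] g(1) Lp_measurable[OF rep_l1_Lp[of "X N"]]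
    by (intro integrableI_bounded) auto
  then have gL: "g \<in> Lp 1" using Lp_diff[OF rep_l1_Lp[of "X N"], of "\<lambda>x. rep_l1 (X N) x - g x"] by (simp add: Lp1_iff)
  have eq: "(\<integral>\<^sup>+x. ennreal (\<bar>rep_l1 (X n) x - g x\<bar> ^ 1) \<partial>lborel) = ennreal (norm (X n - abs_l1 g))" for n
    unfolding nn_integral_l1[symmetric]
    by (rule nn_integral_cong_AE, rule eventually_mono[OF rep_abs_l1[OF gL, unfolded ae_eq_def]]) simp
  have "X \<longlonglongrightarrow> abs_l1 g"
  proof (rule LIMSEQ_I)
    fix r :: real assume r: "r > 0"
    then obtain N where "\<And>n. n \<ge> N \<Longrightarrow> ennreal (norm (X n - abs_l1 g)) \<le> ennreal (r / 2)"
      using g(2)[of "r / 2"] unfolding eq by auto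
    then show "\<exists>N. \<forall>n\<ge>N. norm (X n - abs_l1 g) < r"
      using r by (intro exI[of _ N]) (force simp: ennreal_le_iff)
  qed
  then show "convergent X" by (auto simp: convergent_def)
qed

instance l2 :: (euclidean_space) banach
proof
  fix X :: "nat \<Rightarrow> 'a l2" assume X: "Cauchy X"
  obtain g where g: "g \<in> borel_measurable lborel"
    "\<And>e. e > 0 \<Longrightarrow> \<exists>N. \<forall>n\<ge>N. (\<integral>\<^sup>+x. ennreal (\<bar>rep_l2 (X n) x - g x\<bar> ^ 2) \<partial>lborel) \<le> ennreal e"
  proof (rule riesz_fischer[of "\<lambda>n. rep_l2 (X n)" lborel 2])
    show "\<exists>N. \<forall>m\<ge>N. \<forall>n\<ge>N. (\<integral>\<^sup>+x. ennreal (\<bar>rep_l2 (X m) x - rep_l2 (X n) x\<bar> ^ 2) \<partial>lborel) \<le> ennreal e"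
      if e: "e > 0" for e
    proof -
      obtain N where "\<And>m n. m \<ge> N \<Longrightarrow> n \<ge> N \<Longrightarrow> norm (X m - X n) < sqrt e"
        using CauchyD[OF X, of "sqrt e"] e by auto
      then have "(norm (X m - X n))\<^sup>2 \<le> e" if "m \<ge> N" "n \<ge> N" for m n
        using that e by (metis less_imp_le norm_ge_zero power_mono real_sqrt_pow2)
      then show ?thesis unfolding nn_integral_l2 by (auto intro!: ennreal_leI)
    qed
  qed (use Lp_measurable[OF rep_l2_Lp] in auto)
  obtain N where N: "\<And>n. n \<ge> N \<Longrightarrow> (\<integral>\<^sup>+x. ennreal (\<bar>rep_l2 (X n) x - g x\<bar> ^ 2) \<partial>lborel) \<le> ennreal 1"
    using g(2)[of 1] by auto
  have "integrable lborel (\<lambda>x. (rep_l2 (X N) x - g x)\<^sup>2)"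
    using le_less_trans[OF N[OF order_refl] ennreal_less_top] g(1) Lp_measurable[OF rep_l2_Lp[of "X N"]]
    by (intro integrableI_bounded) auto
  then have gL: "g \<in> Lp 2" using Lp_diff[OF rep_l2_Lp[of "X N"], of "\<lambda>x. rep_l2 (X N) x - g x"] g(1)
      Lp_measurable[OF rep_l2_Lp[of "X N"]] by (simp add: Lp2_iff)
  have eq: "(\<integral>\<^sup>+x. ennreal (\<bar>rep_l2 (X n) x - g x\<bar> ^ 2) \<partial>lborel) = ennreal ((norm (X n - abs_l2 g))\<^sup>2)" for n
    unfolding nn_integral_l2[symmetric]
    by (rule nn_integral_cong_AE, rule eventually_mono[OF rep_abs_l2[OF gL, unfolded ae_eq_def]]) simp
  have "X \<longlonglongrightarrow> abs_l2 g"
  proof (rule LIMSEQ_I)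
    fix r :: real assume r: "r > 0"
    then obtain N where N: "\<And>n. n \<ge> N \<Longrightarrow> ennreal ((norm (X n - abs_l2 g))\<^sup>2) \<le> ennreal ((r / 2)\<^sup>2)"
      using g(2)[of "(r / 2)\<^sup>2"] unfolding eq by auto
    have "norm (X n - abs_l2 g) < r" if "n \<ge> N" for n
    proof -
      have "(norm (X n - abs_l2 g))\<^sup>2 \<le> (r / 2)\<^sup>2" using N[OF that] by (subst (asm) ennreal_le_iff) simp_all
      then have "norm (X n - abs_l2 g) \<le> r / 2" by (rule power2_le_imp_le) (use r in simp)
      then show ?thesis using r by linarith
    qed
    then show "\<exists>N. \<forall>n\<ge>N. norm (X n - abs_l2 g) < r" by blast
  qed
  then show "convergent X" by (auto simp: convergent_def)
qed

text \<open>Classes in L1 and L2 have different types, so "the same function" must be a relation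
  between them. Compatibility of the two resolvents and of the two semigroups is expressed by its
  preservation.\<close>

definition coherent :: "'a::euclidean_space l1 \<Rightarrow> 'a l2 \<Rightarrow> bool" where
  "coherent x y \<longleftrightarrow> ae_eq (rep_l1 x) (rep_l2 y)"

lemma coherent_abs: "f \<in> Lp 1 \<Longrightarrow> f \<in> Lp 2 \<Longrightarrow> coherent (abs_l1 f) (abs_l2 f)"
  unfolding coherent_def by (rule ae_eq_trans[OF rep_abs_l1 ae_eq_sym[OF rep_abs_l2]])

lemma coherentE:
  assumes "coherent x y"
  obtains f where "f \<in> Lp 1" "f \<in> Lp 2" "x = abs_l1 f" "y = abs_l2 f"
proof
  show 1: "rep_l1 x \<in> Lp 1" by (rule rep_l1_Lp)
  show 2: "rep_l1 x \<in> Lp 2"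
    using assms unfolding coherent_def by (intro Lp_cong[OF rep_l2_Lp ae_eq_sym]) (use Lp_measurable[OF rep_l1_Lp] in auto)
  show "x = abs_l1 (rep_l1 x)" by (simp add: abs_rep_l1)
  show "y = abs_l2 (rep_l1 x)"
    using abs_l2_eq_iff[OF 2 rep_l2_Lp, of y] assms by (simp add: coherent_def abs_rep_l2)
qed

lemma coherent_lincomb:
  assumes "coherent x y" "coherent x' y'"
  shows "coherent (a *\<^sub>R x + b *\<^sub>R x') (a *\<^sub>R y + b *\<^sub>R y')"
proof -
  obtain f where f: "f \<in> Lp 1" "f \<in> Lp 2" "x = abs_l1 f" "y = abs_l2 f" using assms(1) by (rule coherentE)
  obtain g where g: "g \<in> Lp 1" "g \<in> Lp 2" "x' = abs_l1 g" "y' = abs_l2 g" using assms(2) by (rule coherentE)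
  show ?thesis
    using coherent_abs[of "\<lambda>x. a * f x + b * g x"] f g
    by (simp add: abs_l1_lincomb abs_l2_lincomb Lp1_lincomb Lp2_lincomb)
qed

lemma coherent_abs_iff: "f \<in> Lp 1 \<Longrightarrow> g \<in> Lp 2 \<Longrightarrow> coherent (abs_l1 f) (abs_l2 g) \<longleftrightarrow> ae_eq f g"
  unfolding coherent_def using rep_abs_l1[of f] rep_abs_l2[of g] ae_eq_trans ae_eq_sym by metis

lemma coherent_unique: "coherent x y \<Longrightarrow> coherent x y' \<Longrightarrow> y = y'"
  using abs_l2_eq_iff[OF rep_l2_Lp rep_l2_Lp, of y y'] unfolding coherent_def
  by (metis abs_rep_l2 ae_eq_sym ae_eq_trans)

lemma l1_subseq:
  assumes X: "X \<longlonglongrightarrow> x"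
  obtains r where "strict_mono r" "AE t in lborel. (\<lambda>n. rep_l1 (X (r n)) t) \<longlonglongrightarrow> rep_l1 x t"
proof -
  have "(\<lambda>n. LINT t|lborel. norm (rep_l1 (X n) t - rep_l1 x t)) \<longlonglongrightarrow> 0"
  proof -
    have "(LINT t|lborel. norm (rep_l1 (X n) t - rep_l1 x t)) = norm (X n - x)" for n
      using nn_integral_l1[of "X n" x] Lp_diff[OF rep_l1_Lp rep_l1_Lp, of "X n" x]
      by (subst integral_eq_nn_integral) (auto simp: Lp1_iff)
    then show ?thesis using LIM_zero[OF X] tendsto_norm_zero by auto
  qed
  moreover have "integrable lborel (\<lambda>t. rep_l1 (X n) t - rep_l1 x t)" for n
    using Lp_diff[OF rep_l1_Lp rep_l1_Lp, of "X n" x] by (simp add: Lp1_iff)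
  ultimately obtain r where r: "strict_mono r" "AE t in lborel. (\<lambda>n. rep_l1 (X (r n)) t - rep_l1 x t) \<longlonglongrightarrow> 0"
    using tendsto_L1_AE_subseq[of lborel "\<lambda>n t. rep_l1 (X n) t - rep_l1 x t"] by blast
  show ?thesis by (rule that[OF r(1)]) (use r(2) in \<open>simp add: LIM_zero_iff\<close>)
qed

lemma l1_limit_AE_bounds:
  assumes X: "X \<longlonglongrightarrow> x" and bd: "\<And>n. AE t in lborel. a \<le> rep_l1 (X n) t \<and> rep_l1 (X n) t \<le> b"
  shows "AE t in lborel. a \<le> rep_l1 x t \<and> rep_l1 x t \<le> b"
proof -
  obtain r where r: "AE t in lborel. (\<lambda>n. rep_l1 (X (r n)) t) \<longlonglongrightarrow> rep_l1 x t" using l1_subseq[OF X] by metis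
  have "AE t in lborel. \<forall>n. a \<le> rep_l1 (X n) t \<and> rep_l1 (X n) t \<le> b" using bd by (simp add: AE_all_countable)
  with r show ?thesis
    by eventually_elim (auto intro: LIMSEQ_le_const LIMSEQ_le_const2)
qed

lemma l1_limit_AE_nonneg:
  assumes X: "X \<longlonglongrightarrow> x" and bd: "\<And>n. AE t in lborel. 0 \<le> rep_l1 (X n) t"
  shows "AE t in lborel. 0 \<le> rep_l1 x t"
proof -
  obtain r where r: "AE t in lborel. (\<lambda>n. rep_l1 (X (r n)) t) \<longlonglongrightarrow> rep_l1 x t" using l1_subseq[OF X] by metis
  have "AE t in lborel. \<forall>n. 0 \<le> rep_l1 (X n) t" using bd by (simp add: AE_all_countable)
  with r show ?thesis by eventually_elim (auto intro: LIMSEQ_le_const)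
qed

text \<open>Convergence in L1 yields a subsequence converging almost everywhere, and convergence in
  L2 a further subsequence of it. Along the latter the representatives agree, so their limits
  do.\<close>

lemma coherent_limit:
  assumes X: "X \<longlonglongrightarrow> x" and Y: "Y \<longlonglongrightarrow> y" and c: "\<And>n. coherent (X n) (Y n)"
  shows "coherent x y"
proof -
  obtain r where r: "strict_mono r" "AE t in lborel. (\<lambda>n. rep_l1 (X (r n)) t) \<longlonglongrightarrow> rep_l1 x t"
    by (rule l1_subseq[OF X])
  have "(\<lambda>n. LINT t|lborel. norm ((rep_l2 (Y (r n)) t - rep_l2 y t)\<^sup>2)) \<longlonglongrightarrow> 0"
  proof -
    have "(LINT t|lborel. norm ((rep_l2 (Y n) t - rep_l2 y t)\<^sup>2)) = (norm (Y n - y))\<^sup>2" for n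
      using nn_integral_l2[of "Y n" y] Lp_diff[OF rep_l2_Lp rep_l2_Lp, of "Y n" y]
      by (subst integral_eq_nn_integral) (auto simp: Lp2_iff)
    moreover have "(\<lambda>n. (norm (Y (r n) - y))\<^sup>2) \<longlonglongrightarrow> 0"
      using tendsto_power[OF tendsto_norm_zero[OF LIM_zero[OF LIMSEQ_subseq_LIMSEQ[OF Y r(1)]]], of 2]
      by (simp add: comp_def)
    ultimately show ?thesis by simp
  qed
  moreover have "integrable lborel (\<lambda>t. (rep_l2 (Y (r n)) t - rep_l2 y t)\<^sup>2)" for n
    using Lp_diff[OF rep_l2_Lp rep_l2_Lp, of "Y (r n)" y] by (simp add: Lp2_iff)
  ultimately obtain s where s: "strict_mono s" "AE t in lborel. (\<lambda>n. (rep_l2 (Y (r (s n))) t - rep_l2 y t)\<^sup>2) \<longlonglongrightarrow> 0"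
    using tendsto_L1_AE_subseq[of lborel "\<lambda>n t. (rep_l2 (Y (r n)) t - rep_l2 y t)\<^sup>2"] by blast
  have "AE t in lborel. \<forall>n. rep_l1 (X n) t = rep_l2 (Y n) t"
    using c by (auto simp: coherent_def ae_eq_def AE_all_countable)
  with r(2) s(2) have "AE t in lborel. rep_l1 x t = rep_l2 y t"
  proof eventually_elim
    case (elim t)
    have "(\<lambda>n. rep_l1 (X (r (s n))) t) \<longlonglongrightarrow> rep_l1 x t"
      using LIMSEQ_subseq_LIMSEQ[OF elim(1) s(1)] by (simp add: comp_def)
    moreover have "(\<lambda>n. rep_l2 (Y (r (s n))) t - rep_l2 y t) \<longlonglongrightarrow> 0"
      using tendsto_real_sqrt[OF elim(2)] by (simp add: tendsto_rabs_zero_iff)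
    ultimately show ?case
      using elim(3) LIMSEQ_unique[OF _ LIM_zero_cancel, of "\<lambda>n. rep_l1 (X (r (s n))) t" "rep_l1 x t" "rep_l2 y t"]
      by simp
  qed
  then show ?thesis by (simp add: coherent_def ae_eq_def)
qed

text \<open>\<open>cls\<close> sends a function to its class; the two instances are \<open>l1\<close> and \<open>l2\<close>.\<close>

locale Lp_space =
  fixes p :: real and cls :: "('a::euclidean_space \<Rightarrow> real) \<Rightarrow> 'b::banach" and rp :: "'b \<Rightarrow> 'a \<Rightarrow> real"
  assumes p12: "p = 1 \<or> p = 2"
    and rep_Lp: "rp x \<in> Lp p"
    and cls_rep: "cls (rp x) = x"
    and cls_eq_iff: "f \<in> Lp p \<Longrightarrow> g \<in> Lp p \<Longrightarrow> cls f = cls g \<longleftrightarrow> ae_eq f g"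
    and cls_lincomb: "f \<in> Lp p \<Longrightarrow> g \<in> Lp p \<Longrightarrow> cls (\<lambda>x. a * f x + b * g x) = a *\<^sub>R cls f + b *\<^sub>R cls g"
    and norm_cls: "f \<in> Lp p \<Longrightarrow> norm (cls f) = Lp_norm p f"
begin

definition lift_graph :: "('b \<times> 'b) set \<Rightarrow> 'a operator" where
  "lift_graph G = {(f, g). f \<in> Lp p \<and> g \<in> Lp p \<and> (cls f, cls g) \<in> G}"

lemma Lp_lincomb: "f \<in> Lp p \<Longrightarrow> g \<in> Lp p \<Longrightarrow> (\<lambda>x. a * f x + b * g x) \<in> Lp p"
  using p12 Lp1_lincomb Lp2_lincomb by blast

lemma cls_diff: "f \<in> Lp p \<Longrightarrow> g \<in> Lp p \<Longrightarrow> cls (\<lambda>x. f x - g x) = cls f - cls g"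
  using cls_lincomb[of f g 1 "-1"] by simp

lemma cls_scale: "f \<in> Lp p \<Longrightarrow> cls (\<lambda>x. a * f x) = a *\<^sub>R cls f"
  using cls_lincomb[of f f a 0] by simp

lemma Lp_diff': "f \<in> Lp p \<Longrightarrow> g \<in> Lp p \<Longrightarrow> (\<lambda>x. f x - g x) \<in> Lp p"
  using Lp_lincomb[of f g 1 "-1"] by simp

lemma rep_cls: "f \<in> Lp p \<Longrightarrow> ae_eq (rp (cls f)) f"
  using cls_eq_iff[OF rep_Lp, of f "cls f"] by (simp add: cls_rep)

text \<open>Chosen representatives recover the graph on classes. Equalities of operators on
  functions, such as those in the definitions of the semigroup and of the root, can thus be read as
  equalities on classes.\<close>

lemma lift_graph_inj: assumes "lift_graph G = lift_graph G'" shows "G = G'"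
proof -
  have "G = {(x, y). (rp x, rp y) \<in> lift_graph G}" for G by (auto simp: lift_graph_def rep_Lp cls_rep)
  then show ?thesis using assms by metis
qed

lemma closure_cls:
  assumes "\<And>f e. f \<in> Lp p \<Longrightarrow> e > 0 \<Longrightarrow> \<exists>g\<in>D. g \<in> Lp p \<and> Lp_norm p (\<lambda>x. f x - g x) < e"
  shows "closure (cls ` D) = UNIV"
proof -
  have "y \<in> closure (cls ` D)" for y
    unfolding closure_approachable
  proof (intro allI impI)
    fix e :: real assume "e > 0"
    from assms[OF rep_Lp this, of y] obtain g where g: "g \<in> D" "g \<in> Lp p" "Lp_norm p (\<lambda>x. rp y x - g x) < e" by blast
    have "dist (cls g) y = Lp_norm p (\<lambda>x. rp y x - g x)"
      using norm_cls[OF Lp_diff'[OF rep_Lp g(2)], of y] by (simp add: cls_diff rep_Lp g cls_rep dist_norm norm_minus_commute)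
    then show "\<exists>z\<in>cls ` D. dist z y < e" using g by (intro bexI[of _ "cls g"]) simp_all
  qed
  then show ?thesis by blast
qed

lemma neg_generator_lift:
  assumes "\<And>t f. t \<ge> 0 \<Longrightarrow> f \<in> Lp p \<Longrightarrow> F t f \<in> Lp p \<and> cls (F t f) = S t (cls f)"
  shows "neg_generator p F = lift_graph (neg_gen S)"
proof -
  have "((\<lambda>t. Lp_norm p (\<lambda>x. (f x - F t f x) / t - g x)) \<longlongrightarrow> 0) (at_right 0) \<longleftrightarrow>
        ((\<lambda>t. (1 / t) *\<^sub>R (cls f - S t (cls f))) \<longlongrightarrow> cls g) (at_right 0)" if fg: "f \<in> Lp p" "g \<in> Lp p" for f g
  proof -
    have "Lp_norm p (\<lambda>x. (f x - F t f x) / t - g x) = norm ((1 / t) *\<^sub>R (cls f - S t (cls f)) - cls g)"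
      if t: "t > 0" for t
    proof -
      have F: "F t f \<in> Lp p" "cls (F t f) = S t (cls f)" using assms[of t f] t fg by auto
      have Ld: "(\<lambda>x. 1 / t * (f x - F t f x)) \<in> Lp p"
        using Lp_lincomb[OF Lp_diff'[OF fg(1) F(1)] fg(2), of "1 / t" 0] by simp
      have "Lp_norm p (\<lambda>x. (f x - F t f x) / t - g x) = Lp_norm p (\<lambda>x. 1 / t * (f x - F t f x) - g x)" by simp
      also have "\<dots> = norm (cls (\<lambda>x. 1 / t * (f x - F t f x) - g x))"
        by (rule norm_cls[symmetric, OF Lp_diff'[OF Ld fg(2)]])
      also have "cls (\<lambda>x. 1 / t * (f x - F t f x) - g x) = (1 / t) *\<^sub>R (cls f - S t (cls f)) - cls g"
        unfolding cls_diff[OF Ld fg(2)] cls_scale[OF Lp_diff'[OF fg(1) F(1)]] cls_diff[OF fg(1) F(1)] F(2) ..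
      finally show ?thesis .
    qed
    then have "((\<lambda>t. Lp_norm p (\<lambda>x. (f x - F t f x) / t - g x)) \<longlongrightarrow> 0) (at_right 0) \<longleftrightarrow>
        ((\<lambda>t. norm ((1 / t) *\<^sub>R (cls f - S t (cls f)) - cls g)) \<longlongrightarrow> 0) (at_right 0)"
      by (intro tendsto_cong) (auto simp: eventually_at_filter)
    then show ?thesis by (simp add: tendsto_norm_zero_iff LIM_zero_iff)
  qed
  then show ?thesis unfolding neg_generator_def lift_graph_def neg_gen_def by auto
qed

lemma semigroup_from_functions:
  assumes F: "contraction_semigroup p F" and S_def: "\<And>t x. S t x = cls (F t (rp x))"
  shows "contraction_sg S" and "\<And>t f. t \<ge> 0 \<Longrightarrow> f \<in> Lp p \<Longrightarrow> F t f \<in> Lp p \<and> cls (F t f) = S t (cls f)"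
proof -
  have FL: "F t f \<in> Lp p" and nrm: "Lp_norm p (F t f) \<le> Lp_norm p f" if "t \<ge> 0" "f \<in> Lp p" for t f
    using F that by (auto simp: contraction_semigroup_def)
  have lin: "ae_eq (F t (\<lambda>x. a * f x + b * g x)) (\<lambda>x. a * F t f x + b * F t g x)"
    if "t \<ge> 0" "f \<in> Lp p" "g \<in> Lp p" for t f g a b
    using F that by (auto simp: contraction_semigroup_def)
  have lin': "cls (F t (\<lambda>x. a * f x + b * g x)) = a *\<^sub>R cls (F t f) + b *\<^sub>R cls (F t g)"
    if "t \<ge> 0" "f \<in> Lp p" "g \<in> Lp p" for t f g a b
    using lin[OF that, of a b] that
    by (simp add: cls_lincomb[symmetric] FL) (subst cls_eq_iff; simp add: FL Lp_lincomb)
  \<comment> \<open>Nothing in \<open>contraction_semigroup\<close> says that functions equal almost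
    everywhere have equal images. It follows from linearity and contractivity applied to their
    difference, whose norm is zero, and makes \<open>S\<close> well defined on classes.\<close>
  have cong: "cls (F t f) = cls (F t g)" if "t \<ge> 0" "f \<in> Lp p" "g \<in> Lp p" "cls f = cls g" for t f g
  proof -
    have "norm (cls (F t f) - cls (F t g)) = norm (cls (F t (\<lambda>x. 1 * f x + (-1) * g x)))"
      unfolding lin'[OF that(1-3)] by simp
    also have "\<dots> \<le> norm (cls (\<lambda>x. 1 * f x + (-1) * g x))"
      using nrm[OF that(1) Lp_lincomb[OF that(2,3)]] FL[OF that(1) Lp_lincomb[OF that(2,3)]]
        Lp_lincomb[OF that(2,3)] by (simp only: norm_cls)
    also have "\<dots> = 0" unfolding cls_lincomb[OF that(2,3)] using that(4) by simp
    finally show ?thesis by simp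
  qed
  show 1: "F t f \<in> Lp p \<and> cls (F t f) = S t (cls f)" if "t \<ge> 0" "f \<in> Lp p" for t f
    unfolding S_def using FL[OF that] cong[OF that rep_Lp] by (simp add: cls_rep)
  show "contraction_sg S"
    unfolding contraction_sg_def
  proof (intro conjI allI impI)
    fix t :: real and f :: 'b assume t: "t \<ge> 0"
    have "S t (a *\<^sub>R x + b *\<^sub>R y) = a *\<^sub>R S t x + b *\<^sub>R S t y" for a b x y
      using 1[OF t Lp_lincomb[OF rep_Lp rep_Lp], of a x b y] lin'[OF t rep_Lp rep_Lp, of a x b y]
      by (simp add: cls_lincomb rep_Lp cls_rep) (simp add: S_def)
    from this[of 1 _ 1] this[of _ _ 0] show "linear (S t)" by (intro linearI) auto
    show "norm (S t f) \<le> norm f"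
      using nrm[OF t rep_Lp, of f] FL[OF t rep_Lp, of f] norm_cls[OF rep_Lp, of f]
      by (simp add: S_def norm_cls cls_rep)
  next
    fix f :: 'b
    have "ae_eq (F 0 (rp f)) (rp f)" using F rep_Lp by (auto simp: contraction_semigroup_def)
    then show "S 0 f = f" using cls_eq_iff[OF FL[OF order_refl rep_Lp] rep_Lp, of f f] by (simp add: S_def cls_rep)
    show "S (s + t) f = S s (S t f)" if st: "s \<ge> 0" "t \<ge> 0" for s t
    proof -
      have "ae_eq (F (s + t) (rp f)) (F s (F t (rp f)))"
        using F rep_Lp st by (auto simp: contraction_semigroup_def)
      then have "S (s + t) f = cls (F s (F t (rp f)))"
        using cls_eq_iff[of "F (s + t) (rp f)" "F s (F t (rp f))"] st by (simp add: S_def FL rep_Lp)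
      also have "\<dots> = S s (cls (F t (rp f)))" using 1[OF st(1) FL[OF st(2) rep_Lp]] by blast
      finally show ?thesis by (simp add: S_def)
    qed
    have lim: "((\<lambda>t. Lp_norm p (\<lambda>x. F t (rp f) x - rp f x)) \<longlongrightarrow> 0) (at_right 0)"
      using F rep_Lp by (auto simp: contraction_semigroup_def)
    have "((\<lambda>t. norm (S t f - f)) \<longlongrightarrow> 0) (at_right 0)"
    proof (rule Lim_transform_eventually[OF lim])
      have "Lp_norm p (\<lambda>x. F t (rp f) x - rp f x) = norm (S t f - f)" if "t > 0" for t
        using that norm_cls[OF Lp_diff'[OF FL[OF _ rep_Lp] rep_Lp], of t f f]
        by (simp add: cls_diff FL rep_Lp cls_rep S_def)
      then show "\<forall>\<^sub>F t in at_right 0. Lp_norm p (\<lambda>x. F t (rp f) x - rp f x) = norm (S t f - f)"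
        by (auto simp: eventually_at_filter)
    qed
    then show "((\<lambda>t. S t f) \<longlongrightarrow> f) (at_right 0)" by (simp add: tendsto_norm_zero_iff LIM_zero_iff)
  qed
qed

lemma semigroup_to_functions:
  assumes "contraction_sg S"
  shows "contraction_semigroup p (\<lambda>t f. rp (S t (cls f)))"
    and "neg_generator p (\<lambda>t f. rp (S t (cls f))) = lift_graph (neg_gen S)"
proof -
  have lin: "linear (S t)" and nrm: "norm (S t x) \<le> norm x" if "t \<ge> 0" for t x
    using assms that by (auto simp: contraction_sg_def)
  have S0: "S 0 x = x" and Sadd: "s \<ge> 0 \<Longrightarrow> t \<ge> 0 \<Longrightarrow> S (s + t) x = S s (S t x)" for s t x
    using assms by (auto simp: contraction_sg_def)
  have S_lim: "((\<lambda>t. S t x) \<longlongrightarrow> x) (at_right 0)" for x using assms by (auto simp: contraction_sg_def)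
  show "contraction_semigroup p (\<lambda>t f. rp (S t (cls f)))"
    unfolding contraction_semigroup_def
  proof (intro conjI allI ballI impI)
    fix t :: real and f g :: "'a \<Rightarrow> real" and a b assume t: "t \<ge> 0" and f: "f \<in> Lp p"
    show "rp (S t (cls f)) \<in> Lp p" by (rule rep_Lp)
    show "Lp_norm p (rp (S t (cls f))) \<le> Lp_norm p f"
      using nrm[OF t, of "cls f"] by (simp add: norm_cls[symmetric] f rep_Lp cls_rep)
    assume g: "g \<in> Lp p"
    show "ae_eq (rp (S t (cls (\<lambda>x. a * f x + b * g x)))) (\<lambda>x. a * rp (S t (cls f)) x + b * rp (S t (cls g)) x)"
      by (subst cls_eq_iff[symmetric])
        (simp_all add: rep_Lp Lp_lincomb cls_lincomb f g cls_rep linear_add[OF lin[OF t]] linear_cmul[OF lin[OF t]])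
  next
    fix f :: "'a \<Rightarrow> real" assume f: "f \<in> Lp p"
    show "ae_eq (rp (S 0 (cls f))) f" by (simp add: S0 rep_cls f)
    show "ae_eq (rp (S (s + t) (cls f))) (rp (S s (cls (rp (S t (cls f))))))" if "s \<ge> 0" "t \<ge> 0" for s t
      using that by (simp add: cls_rep Sadd ae_eq_refl)
    have "Lp_norm p (\<lambda>x. rp (S t (cls f)) x - f x) = norm (S t (cls f) - cls f)" for t
      by (simp add: norm_cls[symmetric] Lp_diff' rep_Lp f cls_diff cls_rep)
    then show "((\<lambda>t. Lp_norm p (\<lambda>x. rp (S t (cls f)) x - f x)) \<longlongrightarrow> 0) (at_right 0)"
      using tendsto_norm_zero[OF LIM_zero[OF S_lim[of "cls f"]]] by simp
  qed
qed (rule neg_generator_lift; simp add: rep_Lp cls_rep)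

end

interpretation L1: Lp_space 1 abs_l1 rep_l1
  by unfold_locales (auto simp: rep_l1_Lp abs_rep_l1 abs_l1_eq_iff abs_l1_lincomb norm_abs_l1)

interpretation L2: Lp_space 2 abs_l2 rep_l2
  by unfold_locales (auto simp: rep_l2_Lp abs_rep_l2 abs_l2_eq_iff abs_l2_lincomb norm_abs_l2)

section \<open>Truncation\<close>

text \<open>Large values are removed to obtain a bounded function, small ones to obtain an
  integrable function even when \<open>f\<close> is only square integrable. One truncation thus
  approximates in L1 and in L2 at the same time.\<close>

definition trunc :: "nat \<Rightarrow> ('a \<Rightarrow> real) \<Rightarrow> 'a \<Rightarrow> real" where
  "trunc n f x = (if 1 / real (Suc n) \<le> \<bar>f x\<bar> \<and> \<bar>f x\<bar> \<le> real (Suc n) then f x else 0)"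

lemma trunc_measurable [measurable]:
  assumes [measurable]: "f \<in> borel_measurable M" shows "trunc n f \<in> borel_measurable M"
  unfolding trunc_def[abs_def] by measurable

lemma trunc_bound: "\<bar>trunc n f x\<bar> \<le> real (Suc n)" "\<bar>trunc n f x\<bar> \<le> \<bar>f x\<bar>" "\<bar>f x - trunc n f x\<bar> \<le> \<bar>f x\<bar>"
  unfolding trunc_def by auto

lemma trunc_tendsto: "(\<lambda>n. f x - trunc n f x) \<longlonglongrightarrow> 0"
proof (cases "f x = 0")
  case False
  then obtain n1 where n1: "1 / \<bar>f x\<bar> < real n1" using reals_Archimedean2 by blast
  obtain n2 where n2: "\<bar>f x\<bar> < real n2" using reals_Archimedean2 by blast
  have "f x - trunc n f x = 0" if "n \<ge> max n1 n2" for n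
  proof -
    have "1 / \<bar>f x\<bar> \<le> real (Suc n)" "\<bar>f x\<bar> \<le> real (Suc n)" using that n1 n2 by linarith+
    then show ?thesis using False by (auto simp: trunc_def field_simps)
  qed
  then have "\<forall>\<^sub>F n in sequentially. f x - trunc n f x = 0" unfolding eventually_sequentially by blast
  then show ?thesis by (rule tendsto_eventually)
qed (simp add: trunc_def)

text \<open>Integrable, essentially bounded functions: contained in both spaces, dense in each by
  truncation, and invariant under resolvents by the Dirichlet property.\<close>

definition Lb :: "('a::euclidean_space \<Rightarrow> real) set" where
  "Lb = {f \<in> Lp 1. \<exists>c. AE x in lborel. \<bar>f x\<bar> \<le> c}"

lemma Lb_I: "f \<in> Lp 1 \<Longrightarrow> AE x in lborel. \<bar>f x\<bar> \<le> c \<Longrightarrow> f \<in> Lb"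
  by (auto simp: Lb_def)

lemma Lp2_bounded:
  assumes "f \<in> Lp 1" "AE x in lborel. \<bar>f x\<bar> \<le> c"
  shows "f \<in> Lp 2" "(LINT x|lborel. (f x)\<^sup>2) \<le> c * (LINT x|lborel. \<bar>f x\<bar>)"
proof -
  have int: "integrable lborel (\<lambda>x. c * \<bar>f x\<bar>)" using assms(1) by (simp add: Lp1_iff)
  have le: "AE x in lborel. (f x)\<^sup>2 \<le> c * \<bar>f x\<bar>"
    using assms(2)
  proof eventually_elim
    case (elim x)
    have "\<bar>f x\<bar> * \<bar>f x\<bar> \<le> c * \<bar>f x\<bar>" using elim by (rule mult_right_mono) simp
    then show ?case by (simp add: power2_eq_square)
  qed
  have int2: "integrable lborel (\<lambda>x. (f x)\<^sup>2)"
  proof (rule Bochner_Integration.integrable_bound[OF int])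
    show "(\<lambda>x. (f x)\<^sup>2) \<in> borel_measurable lborel" using assms(1) by (auto dest!: Lp_measurable)
    show "AE x in lborel. norm ((f x)\<^sup>2) \<le> norm (c * \<bar>f x\<bar>)" using le by eventually_elim simp
  qed
  then show "f \<in> Lp 2" using assms(1) by (simp add: Lp2_iff Lp1_iff)
  show "(LINT x|lborel. (f x)\<^sup>2) \<le> c * (LINT x|lborel. \<bar>f x\<bar>)"
    using integral_mono_AE[OF int2 int le] by simp
qed

lemma Lb_Lp: "f \<in> Lb \<Longrightarrow> f \<in> Lp 1" "f \<in> Lb \<Longrightarrow> f \<in> Lp 2"
  using Lp2_bounded by (auto simp: Lb_def)

lemma trunc_Lb:
  assumes "f \<in> Lp p" "p = 1 \<or> p = 2"
  shows "trunc n f \<in> Lb"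
proof (rule Lb_I[of _ "real (Suc n)"])
  have [measurable]: "f \<in> borel_measurable lborel" using assms(1) by (rule Lp_measurable)
  have "integrable lborel (trunc n f)"
    using assms(2)
  proof
    assume "p = 1"
    then have "integrable lborel f" using assms by (simp add: Lp1_iff)
    then show ?thesis by (rule Bochner_Integration.integrable_bound) (auto simp: trunc_bound)
  next
    assume "p = 2"
    then have "integrable lborel (\<lambda>x. real (Suc n) * (f x)\<^sup>2)" using assms by (simp add: Lp2_iff)
    then show ?thesis
    proof (rule Bochner_Integration.integrable_bound)
      have "\<bar>trunc n f x\<bar> \<le> real (Suc n) * (f x)\<^sup>2" for x
      proof (cases "1 / real (Suc n) \<le> \<bar>f x\<bar>")
        case True
        then have "1 \<le> real (Suc n) * \<bar>f x\<bar>" by (simp add: field_simps)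
        from mult_right_mono[OF this, of "\<bar>f x\<bar>"] show ?thesis
          using trunc_bound(2)[of n f x] by (simp add: power2_eq_square mult.assoc)
      qed (simp add: trunc_def)
      then show "AE x in lborel. norm (trunc n f x) \<le> norm (real (Suc n) * (f x)\<^sup>2)" by simp
    qed measurable
  qed
  then show "trunc n f \<in> Lp 1" by (simp add: Lp1_iff)
qed (intro always_eventually allI trunc_bound(1))

lemma trunc_l1: fixes f :: "'a::euclidean_space \<Rightarrow> real" assumes f: "f \<in> Lp 1" shows "(\<lambda>n. abs_l1 (trunc n f)) \<longlonglongrightarrow> abs_l1 f"
proof -
  have [measurable]: "f \<in> borel_measurable lborel" using f by (rule Lp_measurable)
  have "(\<lambda>n. LINT x|lborel. \<bar>f x - trunc n f x\<bar>) \<longlonglongrightarrow> (LINT x::'a|lborel. (0::real))"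
  proof (rule integral_dominated_convergence[where w = "\<lambda>x. \<bar>f x\<bar>"])
    show "AE x in lborel. (\<lambda>n. \<bar>f x - trunc n f x\<bar>) \<longlonglongrightarrow> 0"
      by (intro always_eventually allI tendsto_rabs_zero trunc_tendsto)
  qed (use f in \<open>auto simp: Lp1_iff trunc_bound\<close>)
  moreover have "norm (abs_l1 (trunc n f) - abs_l1 f) = (LINT x|lborel. \<bar>f x - trunc n f x\<bar>)" for n
    using norm_abs_l1[OF Lp_diff[OF f Lb_Lp(1)[OF trunc_Lb[OF f]]], of n] f Lb_Lp(1)[OF trunc_Lb[OF f]]
    by (simp add: abs_l1_diff Lp_norm1 norm_minus_commute)
  ultimately show ?thesis by (rule_tac LIM_zero_cancel[OF tendsto_norm_zero_cancel]) simp
qed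

lemma trunc_l2: fixes f :: "'a::euclidean_space \<Rightarrow> real" assumes f: "f \<in> Lp 2" shows "(\<lambda>n. abs_l2 (trunc n f)) \<longlonglongrightarrow> abs_l2 f"
proof -
  have [measurable]: "f \<in> borel_measurable lborel" using f by (rule Lp_measurable)
  have "(\<lambda>n. LINT x|lborel. (f x - trunc n f x)\<^sup>2) \<longlonglongrightarrow> (LINT x::'a|lborel. (0::real))"
  proof (rule integral_dominated_convergence[where w = "\<lambda>x. (f x)\<^sup>2"])
    show "AE x in lborel. (\<lambda>n. (f x - trunc n f x)\<^sup>2) \<longlonglongrightarrow> 0"
      by (intro always_eventually allI tendsto_null_power trunc_tendsto) simp
    show "AE x in lborel. norm ((f x - trunc n f x)\<^sup>2) \<le> (f x)\<^sup>2" for n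
      by (intro always_eventually allI) (simp add: abs_le_square_iff[symmetric] trunc_bound(3))
  qed (use f in \<open>auto simp: Lp2_iff\<close>)
  then have "(\<lambda>n. sqrt (LINT x|lborel. (f x - trunc n f x)\<^sup>2)) \<longlonglongrightarrow> 0"
    using tendsto_real_sqrt by fastforce
  moreover have "norm (abs_l2 (trunc n f) - abs_l2 f) = sqrt (LINT x|lborel. (f x - trunc n f x)\<^sup>2)" for n
    using norm_abs_l2[OF Lp_diff[OF f Lb_Lp(2)[OF trunc_Lb[OF f]]], of n] f Lb_Lp(2)[OF trunc_Lb[OF f]]
    by (simp add: abs_l2_diff Lp_norm2 norm_minus_commute)
  ultimately show ?thesis by (rule_tac LIM_zero_cancel[OF tendsto_norm_zero_cancel]) simp
qed

lemma closure_Lb_l2: "closure (abs_l2 ` Lb) = UNIV"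
proof -
  have "y \<in> closure (abs_l2 ` Lb)" for y :: "'a l2"
  proof (induction y rule: l2_induct)
    case (1 f)
    have "\<forall>n. abs_l2 (trunc n f) \<in> abs_l2 ` Lb" using trunc_Lb[OF 1] by simp
    then show ?case unfolding closure_sequential using trunc_l2[OF 1] by (intro exI[of _ "\<lambda>n. abs_l2 (trunc n f)"]) simp
  qed
  then show ?thesis by blast
qed

section \<open>Admissible operators\<close>

locale admissible =
  fixes A :: "'a::euclidean_space operator"
  assumes adm: "admissible_operator A"
begin

lemma A_Lp: "(u, v) \<in> A \<Longrightarrow> u \<in> Lp 1" "(u, v) \<in> A \<Longrightarrow> v \<in> Lp 1"
  using adm unfolding admissible_operator_def linear_operator_def by blast+

lemma A_cong: "(u, v) \<in> A \<Longrightarrow> ae_eq u u' \<Longrightarrow> ae_eq v v' \<Longrightarrow> u' \<in> Lp 1 \<Longrightarrow> v' \<in> Lp 1 \<Longrightarrow> (u', v') \<in> A"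
  using adm unfolding admissible_operator_def linear_operator_def by blast

lemma A_lincomb: "(u, v) \<in> A \<Longrightarrow> (u', v') \<in> A \<Longrightarrow> (\<lambda>x. a * u x + b * u' x, \<lambda>x. a * v x + b * v' x) \<in> A"
  using adm unfolding admissible_operator_def linear_operator_def by blast

definition G1 :: "('a l1 \<times> 'a l1) set" where "G1 = {(abs_l1 u, abs_l1 v) |u v. (u, v) \<in> A}"

lemma A_eq_lift: "A = L1.lift_graph G1"
proof -
  have "(f, g) \<in> A" if fg: "f \<in> Lp 1" "g \<in> Lp 1" "(abs_l1 f, abs_l1 g) \<in> G1" for f g
  proof -
    obtain u v where uv: "abs_l1 f = abs_l1 u" "abs_l1 g = abs_l1 v" "(u, v) \<in> A" using fg(3) by (auto simp: G1_def)
    then have "ae_eq u f" "ae_eq v g" using fg A_Lp[OF uv(3)] by (auto simp: abs_l1_eq_iff intro: ae_eq_sym)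
    then show ?thesis using A_cong[OF uv(3)] fg by blast
  qed
  then show ?thesis unfolding L1.lift_graph_def using A_Lp unfolding G1_def by blast
qed

sublocale A1: maccretive G1
proof
  show "subspace G1"
    unfolding subspace_def
  proof (intro conjI ballI allI)
    have "(\<lambda>x. 0, \<lambda>x. 0) \<in> A" using adm unfolding admissible_operator_def linear_operator_def by blast
    then show "0 \<in> G1" unfolding G1_def zero_prod_def using abs_l1_zero by fastforce
    have *: "(a *\<^sub>R abs_l1 u + b *\<^sub>R abs_l1 u', a *\<^sub>R abs_l1 v + b *\<^sub>R abs_l1 v') \<in> G1"
      if "(u, v) \<in> A" "(u', v') \<in> A" for u v u' v' a b
      unfolding abs_l1_lincomb[symmetric, OF A_Lp(1)[OF that(1)] A_Lp(1)[OF that(2)]]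
        abs_l1_lincomb[symmetric, OF A_Lp(2)[OF that(1)] A_Lp(2)[OF that(2)]] G1_def
      using A_lincomb[OF that] by blast
    show "x + y \<in> G1" if "x \<in> G1" "y \<in> G1" for x y
      using that *[of _ _ _ _ 1 1] by (auto simp: G1_def)
    show "c *\<^sub>R x \<in> G1" if x: "x \<in> G1" for x c
    proof -
      obtain u v where "x = (abs_l1 u, abs_l1 v)" "(u, v) \<in> A" using x by (auto simp: G1_def)
      then show ?thesis using *[of u v u v c 0] by simp
    qed
  qed
  have comb: "abs_l1 u + \<mu> *\<^sub>R abs_l1 v = abs_l1 (\<lambda>x. u x + \<mu> * v x)" "(\<lambda>x. u x + \<mu> * v x) \<in> Lp 1" if "(u, v) \<in> A" for u v \<mu>
    using abs_l1_lincomb[OF A_Lp[OF that], of 1 \<mu>] Lp1_lincomb[OF A_Lp[OF that], of 1 \<mu>] by simp_all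
  show "norm u \<le> norm (u + \<mu> *\<^sub>R v)" if uv: "(u, v) \<in> G1" and \<mu>: "0 < \<mu>" for u v \<mu>
  proof -
    obtain f g where fg: "u = abs_l1 f" "v = abs_l1 g" "(f, g) \<in> A" using uv by (auto simp: G1_def)
    have "Lp_norm 1 f \<le> Lp_norm 1 (\<lambda>x. f x + \<mu> * g x)"
      using adm \<mu> fg(3) unfolding admissible_operator_def m_accretive_def by blast
    then show ?thesis using comb[OF fg(3), of \<mu>] A_Lp[OF fg(3)] by (simp add: fg norm_abs_l1)
  qed
  show "\<exists>u v. (u, v) \<in> G1 \<and> u + \<mu> *\<^sub>R v = f" if \<mu>: "0 < \<mu>" for \<mu> f
  proof (induction f rule: l1_induct)
    case (1 f)
    then obtain u v where uv: "(u, v) \<in> A" "ae_eq (\<lambda>x. u x + \<mu> * v x) f"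
      using adm \<mu> unfolding admissible_operator_def m_accretive_def by blast
    then show ?case using comb[OF uv(1), of \<mu>] 1
      by (intro exI[of _ "abs_l1 u"] exI[of _ "abs_l1 v"]) (auto simp: abs_l1_eq_iff G1_def)
  qed
  have "closure (abs_l1 ` Domain A) = UNIV"
  proof (rule L1.closure_cls)
    fix f :: "'a \<Rightarrow> real" and e :: real assume "f \<in> Lp 1" "e > 0"
    then obtain g where "g \<in> Domain A" "Lp_norm 1 (\<lambda>x. f x - g x) < e"
      using adm unfolding admissible_operator_def densely_defined_def by blast
    then show "\<exists>g\<in>Domain A. g \<in> Lp 1 \<and> Lp_norm 1 (\<lambda>x. f x - g x) < e" using A_Lp by blast
  qed
  moreover have "abs_l1 ` Domain A \<subseteq> Domain G1" by (auto simp: G1_def)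
  ultimately show "closure (Domain G1) = UNIV" using closure_mono by blast
qed

lemma J1_dirichlet:
  assumes "0 < \<mu>" "f \<in> Lp 1" "AE x in lborel. a \<le> f x \<and> f x \<le> b"
  shows "AE x in lborel. a \<le> rep_l1 (A1.J \<mu> (abs_l1 f)) x \<and> rep_l1 (A1.J \<mu> (abs_l1 f)) x \<le> b"
proof -
  obtain u v where uv: "(u, v) \<in> A" "ae_eq (\<lambda>x. u x + \<mu> * v x) f"
    using adm assms unfolding admissible_operator_def m_accretive_def by blast
  have "AE x in lborel. a \<le> u x \<and> u x \<le> b"
    using adm uv assms unfolding admissible_operator_def dirichlet_operator_def by blast
  moreover have "A1.J \<mu> (abs_l1 f) = abs_l1 u"
  proof (rule A1.J_eqI[OF assms(1)])
    show "(abs_l1 u, abs_l1 v) \<in> G1" using uv by (auto simp: G1_def)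
    show "abs_l1 u + \<mu> *\<^sub>R abs_l1 v = abs_l1 f"
      using abs_l1_lincomb[OF A_Lp[OF uv(1)], of 1 \<mu>] uv assms Lp1_lincomb[OF A_Lp[OF uv(1)], of 1 \<mu>]
        abs_l1_eq_iff[of "\<lambda>x. u x + \<mu> * v x" f] by simp
  qed
  then have "ae_eq (rep_l1 (A1.J \<mu> (abs_l1 f))) u" using rep_abs_l1 A_Lp[OF uv(1)] by simp
  ultimately show ?thesis unfolding ae_eq_def by eventually_elim simp
qed

section \<open>The realization of the operator in L2\<close>

definition G20 :: "('a l2 \<times> 'a l2) set" where
  "G20 = {(abs_l2 u, abs_l2 v) |u v. (u, v) \<in> A \<and> u \<in> Lp 2 \<and> v \<in> Lp 2}"

text \<open>\<open>G20\<close> collects exactly the pairs for which symmetry and nonnegativity are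
  assumed. Its resolvent equation is known to be solvable for bounded integrable data only, so the
  generator in L2 is the closure.\<close>

definition G2 :: "('a l2 \<times> 'a l2) set" where "G2 = closure G20"

lemma resolvent_Lb:
  assumes "f \<in> Lb" "\<mu> > 0"
  obtains u v where "(u, v) \<in> A" "u \<in> Lb" "v \<in> Lp 2" "A1.J \<mu> (abs_l1 f) = abs_l1 u"
    "abs_l2 u + \<mu> *\<^sub>R abs_l2 v = abs_l2 f" "\<And>c. AE x in lborel. \<bar>f x\<bar> \<le> c \<Longrightarrow> AE x in lborel. \<bar>u x\<bar> \<le> c"
proof -
  have f: "f \<in> Lp 1" "f \<in> Lp 2" using assms Lb_Lp by auto
  define u where "u = rep_l1 (A1.J \<mu> (abs_l1 f))"
  define v where "v x = (1 / \<mu>) * f x + (- 1 / \<mu>) * u x" for x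
  have u: "u \<in> Lp 1" "abs_l1 u = A1.J \<mu> (abs_l1 f)" unfolding u_def by (auto simp: rep_l1_Lp abs_rep_l1)
  have v1: "v \<in> Lp 1" "abs_l1 v = (1 / \<mu>) *\<^sub>R (abs_l1 f - A1.J \<mu> (abs_l1 f))"
    unfolding v_def[abs_def] abs_l1_lincomb[OF f(1) u(1)] u(2)
    by (rule Lp1_lincomb[OF f(1) u(1)]) (simp add: scaleR_diff_right)
  have uv: "(u, v) \<in> A"
    using A1.J_in[OF assms(2), of "abs_l1 f"] u v1 by (subst A_eq_lift) (simp add: L1.lift_graph_def)
  have bd: "AE x in lborel. \<bar>u x\<bar> \<le> c" if "AE x in lborel. \<bar>f x\<bar> \<le> c" for c
  proof -
    have "AE x in lborel. - c \<le> f x \<and> f x \<le> c" using that by eventually_elim auto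
    from J1_dirichlet[OF assms(2) f(1) this] show ?thesis unfolding u_def by eventually_elim auto
  qed
  then have ub: "u \<in> Lb" using assms u by (auto simp: Lb_def)
  have v2: "v \<in> Lp 2" unfolding v_def[abs_def] using f Lb_Lp(2)[OF ub] by (intro Lp2_lincomb)
  have "abs_l2 v = (1 / \<mu>) *\<^sub>R abs_l2 f + (- 1 / \<mu>) *\<^sub>R abs_l2 u"
    unfolding v_def[abs_def] using f Lb_Lp(2)[OF ub] by (intro abs_l2_lincomb)
  then have "abs_l2 u + \<mu> *\<^sub>R abs_l2 v = abs_l2 f" using assms(2) by (simp add: scaleR_add_right scaleR_diff_right)
  then show ?thesis using that[OF uv ub v2 u(2)[symmetric]] bd by blast
qed

lemma inner_G20: "x \<in> G20 \<Longrightarrow> 0 \<le> fst x \<bullet> snd x"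
  "x \<in> G20 \<Longrightarrow> y \<in> G20 \<Longrightarrow> snd x \<bullet> fst y = fst x \<bullet> snd y"
proof -
  have "0 \<le> L2_inner u v" if "(u, v) \<in> A" "u \<in> Lp 2" "v \<in> Lp 2" for u v
    using adm that unfolding admissible_operator_def nonneg_operator_def by blast
  then show "x \<in> G20 \<Longrightarrow> 0 \<le> fst x \<bullet> snd x" by (auto simp: G20_def inner_abs_l2)
  have "L2_inner v u' = L2_inner u v'"
    if "(u, v) \<in> A" "u \<in> Lp 2" "v \<in> Lp 2" "(u', v') \<in> A" "u' \<in> Lp 2" "v' \<in> Lp 2" for u v u' v'
    using adm that unfolding admissible_operator_def symmetric_operator_def by blast
  then show "x \<in> G20 \<Longrightarrow> y \<in> G20 \<Longrightarrow> snd x \<bullet> fst y = fst x \<bullet> snd y"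
    by (auto simp: G20_def inner_abs_l2)
qed

text \<open>Accretivity in a Hilbert space is nonnegativity. The range contains the dense set of
  classes of bounded integrable functions by \<open>resolvent_Lb\<close>, and resolvents of such
  functions approximate them within the domain.\<close>

lemma maccretive_G2: "maccretive G2"
  unfolding G2_def
proof (rule maccretive_closure)
  show "subspace G20"
    unfolding subspace_def
  proof (intro conjI ballI allI)
    have "(\<lambda>x. 0, \<lambda>x. 0) \<in> A" using adm unfolding admissible_operator_def linear_operator_def by blast
    then show "0 \<in> G20" unfolding G20_def zero_prod_def using abs_l2_zero Lp_zero[of 2] by fastforce
    have *: "(a *\<^sub>R abs_l2 u + b *\<^sub>R abs_l2 u', a *\<^sub>R abs_l2 v + b *\<^sub>R abs_l2 v') \<in> G20"
      if "(u, v) \<in> A" "(u', v') \<in> A" "u \<in> Lp 2" "v \<in> Lp 2" "u' \<in> Lp 2" "v' \<in> Lp 2" for u v u' v' a b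
      unfolding abs_l2_lincomb[symmetric, OF that(3,5)] abs_l2_lincomb[symmetric, OF that(4,6)] G20_def
      using A_lincomb[OF that(1,2)] Lp2_lincomb[OF that(3,5)] Lp2_lincomb[OF that(4,6)] by blast
    show "x + y \<in> G20" if xy: "x \<in> G20" "y \<in> G20" for x y
    proof -
      obtain u v where "x = (abs_l2 u, abs_l2 v)" "(u, v) \<in> A" "u \<in> Lp 2" "v \<in> Lp 2" using xy(1) by (auto simp: G20_def)
      moreover obtain u' v' where "y = (abs_l2 u', abs_l2 v')" "(u', v') \<in> A" "u' \<in> Lp 2" "v' \<in> Lp 2"
        using xy(2) by (auto simp: G20_def)
      ultimately show ?thesis using *[of u v u' v' 1 1] by simp
    qed
    show "c *\<^sub>R x \<in> G20" if x: "x \<in> G20" for x c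
    proof -
      obtain u v where "x = (abs_l2 u, abs_l2 v)" "(u, v) \<in> A" "u \<in> Lp 2" "v \<in> Lp 2" using x by (auto simp: G20_def)
      then show ?thesis using *[of u v u v c 0] by simp
    qed
  qed
  show "norm u \<le> norm (u + \<mu> *\<^sub>R v)" if "(u, v) \<in> G20" "0 < \<mu>" for u v \<mu>
  proof -
    have "u \<bullet> u \<le> (u + \<mu> *\<^sub>R v) \<bullet> (u + \<mu> *\<^sub>R v)"
      using inner_G20(1)[OF that(1)] that(2) by (simp add: inner_add inner_commute)
    then show ?thesis by (simp add: norm_le)
  qed
  show "closure {u + \<mu> *\<^sub>R v |u v. (u, v) \<in> G20} = UNIV" if \<mu>: "0 < \<mu>" for \<mu>
  proof -
    have "abs_l2 ` Lb \<subseteq> {u + \<mu> *\<^sub>R v |u v. (u, v) \<in> G20}"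
    proof clarify
      fix f :: "'a \<Rightarrow> real" assume "f \<in> Lb"
      then obtain u v where "(u, v) \<in> A" "u \<in> Lb" "v \<in> Lp 2" "abs_l2 u + \<mu> *\<^sub>R abs_l2 v = abs_l2 f"
        using resolvent_Lb[OF _ \<mu>] by metis
      then show "\<exists>u v. abs_l2 f = u + \<mu> *\<^sub>R v \<and> (u, v) \<in> G20"
        using Lb_Lp(2) by (intro exI[of _ "abs_l2 u"] exI[of _ "abs_l2 v"]) (auto simp: G20_def)
    qed
    from closure_mono[OF this] show ?thesis unfolding closure_Lb_l2 by blast
  qed
  show "closure (Domain G20) = UNIV"
  proof -
    have "abs_l2 f \<in> closure (Domain G20)" if f: "f \<in> Lb" for f
    proof -
      obtain c where c: "AE x in lborel. \<bar>f x\<bar> \<le> c" using f by (auto simp: Lb_def)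
      define \<mu> where "\<mu> n = 1 / real (Suc n)" for n
      have \<mu>: "\<mu> n > 0" for n by (simp add: \<mu>_def)
      have "\<exists>u. abs_l2 u \<in> Domain G20 \<and> u \<in> Lb \<and> A1.J (\<mu> n) (abs_l1 f) = abs_l1 u \<and> (AE x in lborel. \<bar>u x\<bar> \<le> c)" for n
      proof -
        obtain u v where "(u, v) \<in> A" "u \<in> Lb" "v \<in> Lp 2" "A1.J (\<mu> n) (abs_l1 f) = abs_l1 u" "AE x in lborel. \<bar>u x\<bar> \<le> c"
          using resolvent_Lb[OF f \<mu>] c by metis
        then show ?thesis using Lb_Lp(2) by (intro exI[of _ u]) (auto simp: G20_def)
      qed
      then obtain u where u: "\<And>n. abs_l2 (u n) \<in> Domain G20" "\<And>n. u n \<in> Lb"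
        "\<And>n. A1.J (\<mu> n) (abs_l1 f) = abs_l1 (u n)" "\<And>n. AE x in lborel. \<bar>u n x\<bar> \<le> c" by metis
      \<comment> \<open>Both functions are bounded by the same \<open>c\<close>, so the squared L2
        distance is at most \<open>2 c\<close> times the L1 distance. Convergence of the resolvents
        in L1 is thereby upgraded to L2.\<close>
      have bd: "(norm (abs_l2 (u n) - abs_l2 f))\<^sup>2 \<le> 2 * c * norm (abs_l1 (u n) - abs_l1 f)" for n
      proof -
        have L1: "(\<lambda>x. u n x - f x) \<in> Lp 1" using Lb_Lp(1)[OF u(2)] Lb_Lp(1)[OF f] by (intro Lp_diff) auto
        have L2: "(\<lambda>x. u n x - f x) \<in> Lp 2" using Lb_Lp(2)[OF u(2)] Lb_Lp(2)[OF f] by (intro Lp_diff) auto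
        have "AE x in lborel. \<bar>u n x - f x\<bar> \<le> 2 * c" using c u(4)[of n] by eventually_elim linarith
        from Lp2_bounded(2)[OF L1 this] show ?thesis
          using Lb_Lp[OF u(2)] Lb_Lp[OF f] L1 L2
          by (simp add: abs_l1_diff[symmetric] abs_l2_diff[symmetric] norm_abs_l1 norm_abs_l2 Lp_norm1 Lp_norm2)
      qed
      have "filterlim \<mu> (at_right 0) sequentially"
        unfolding \<mu>_def by (intro tendsto_imp_filterlim_at_right LIMSEQ_Suc lim_const_over_n) simp
      then have "(\<lambda>n. abs_l1 (u n)) \<longlonglongrightarrow> abs_l1 f"
        unfolding u(3)[symmetric] by (rule filterlim_compose[OF A1.J_tendsto])
      then have "(\<lambda>n. 2 * c * norm (abs_l1 (u n) - abs_l1 f)) \<longlonglongrightarrow> 0"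
        by (intro tendsto_mult_right_zero tendsto_norm_zero LIM_zero)
      then have "(\<lambda>n. (norm (abs_l2 (u n) - abs_l2 f))\<^sup>2) \<longlonglongrightarrow> 0"
        by (rule tendsto_sandwich[OF _ _ tendsto_const, rotated 2]) (use bd in auto)
      then have "(\<lambda>n. abs_l2 (u n)) \<longlonglongrightarrow> abs_l2 f"
        by (simp add: tendsto_norm_zero_iff LIM_zero_iff)
      then show ?thesis unfolding closure_sequential using u(1) by (intro exI[of _ "\<lambda>n. abs_l2 (u n)"]) simp
    qed
    then have "closure (abs_l2 ` Lb) \<subseteq> closure (Domain G20)" by (intro closure_minimal) auto
    then show ?thesis unfolding closure_Lb_l2 by blast
  qed
qed

sublocale A2: nonneg_symmetric G2
proof (rule nonneg_symmetric.intro[OF maccretive_G2], unfold_locales)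
  show "v \<bullet> u' = u \<bullet> v'" if uv: "(u, v) \<in> G2" "(u', v') \<in> G2" for u v u' v'
  proof -
    obtain X where X: "\<And>n. X n \<in> G20" "X \<longlonglongrightarrow> (u, v)"
      using uv(1) unfolding closure_sequential G2_def by blast
    obtain Y where Y: "\<And>n. Y n \<in> G20" "Y \<longlonglongrightarrow> (u', v')"
      using uv(2) unfolding closure_sequential G2_def by blast
    have "(\<lambda>n. snd (X n) \<bullet> fst (Y n)) \<longlonglongrightarrow> v \<bullet> u'" "(\<lambda>n. fst (X n) \<bullet> snd (Y n)) \<longlonglongrightarrow> u \<bullet> v'"
      using tendsto_fst[OF X(2)] tendsto_snd[OF X(2)] tendsto_fst[OF Y(2)] tendsto_snd[OF Y(2)]
      by (auto intro!: tendsto_inner)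
    then show ?thesis using inner_G20(2)[OF X(1) Y(1)] LIMSEQ_unique by simp
  qed
  show "0 \<le> u \<bullet> v" if uv: "(u, v) \<in> G2" for u v
  proof -
    obtain X where X: "\<And>n. X n \<in> G20" "X \<longlonglongrightarrow> (u, v)"
      using uv unfolding closure_sequential G2_def by blast
    have "(\<lambda>n. fst (X n) \<bullet> snd (X n)) \<longlonglongrightarrow> u \<bullet> v"
      using tendsto_fst[OF X(2)] tendsto_snd[OF X(2)] by (auto intro!: tendsto_inner)
    then show ?thesis by (rule LIMSEQ_le_const) (use inner_G20(1)[OF X(1)] in auto)
  qed
qed

text \<open>For bounded integrable functions the pair from \<open>resolvent_Lb\<close> solves both
  resolvent equations at once. Truncations of a common representative converge in both norms and
  carry the statement to all coherent classes.\<close>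

lemma coherent_J: assumes "coherent x y" shows "coherent (A1.J \<mu> x) (A2.J \<mu> y)"
proof (cases "\<mu> > 0")
  case True
  have Lb: "coherent (A1.J \<mu> (abs_l1 f)) (A2.J \<mu> (abs_l2 f))" if f: "f \<in> Lb" for f
  proof -
    obtain u v where uv: "(u, v) \<in> A" "u \<in> Lb" "v \<in> Lp 2" "A1.J \<mu> (abs_l1 f) = abs_l1 u"
      "abs_l2 u + \<mu> *\<^sub>R abs_l2 v = abs_l2 f"
      using resolvent_Lb[OF f True] by metis
    have "(abs_l2 u, abs_l2 v) \<in> G2"
      unfolding G2_def using uv Lb_Lp(2) by (intro subsetD[OF closure_subset]) (auto simp: G20_def)
    then have "A2.J \<mu> (abs_l2 f) = abs_l2 u" using A2.J_eqI[OF True _ uv(5)] by blast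
    then show ?thesis using uv Lb_Lp[OF uv(2)] by (simp add: coherent_abs)
  qed
  obtain f where f: "f \<in> Lp 1" "f \<in> Lp 2" "x = abs_l1 f" "y = abs_l2 f" using assms by (rule coherentE)
  show ?thesis
  proof (rule coherent_limit)
    show "(\<lambda>n. A1.J \<mu> (abs_l1 (trunc n f))) \<longlonglongrightarrow> A1.J \<mu> x"
      unfolding f by (rule bounded_linear.tendsto[OF bounded_linear_contraction[OF A1.linear_J A1.norm_J] trunc_l1[OF f(1)]])
    show "(\<lambda>n. A2.J \<mu> (abs_l2 (trunc n f))) \<longlonglongrightarrow> A2.J \<mu> y"
      unfolding f by (rule bounded_linear.tendsto[OF bounded_linear_contraction[OF A2.linear_J A2.norm_J] trunc_l2[OF f(2)]])
    show "coherent (A1.J \<mu> (abs_l1 (trunc n f))) (A2.J \<mu> (abs_l2 (trunc n f)))" for n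
      by (rule Lb[OF trunc_Lb[OF f(1)]]) simp
  qed
qed (use assms in \<open>simp add: A1.J_def A2.J_def\<close>)

lemma coherent_Jpow: "coherent x y \<Longrightarrow> coherent ((A1.J \<mu> ^^ n) x) ((A2.J \<mu> ^^ n) y)"
  by (induction n) (auto intro: coherent_J)

lemma coherent_S: assumes "coherent x y" "t \<ge> 0" shows "coherent (A1.S t x) (A2.S t y)"
  by (rule coherent_limit[OF A1.V_tendsto_S A2.V_tendsto_S])
    (use assms in \<open>auto simp: A1.V_def A2.V_def coherent_Jpow\<close>)

text \<open>Whichever semigroup the choice returns, its version on classes has generator
  \<open>G1\<close>, and the exponential formula leaves only one possibility. The constructed
  semigroup shows that the choice is not vacuous.\<close>

lemma heat_semigroup:
  assumes "t \<ge> 0" "f \<in> Lp 1"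
  shows "heat_semigroup A t f \<in> Lp 1" "abs_l1 (heat_semigroup A t f) = A1.S t (abs_l1 f)"
proof -
  let ?H = "heat_semigroup A"
  have "contraction_semigroup 1 (\<lambda>t f. rep_l1 (A1.S t (abs_l1 f))) \<and> neg_generator 1 (\<lambda>t f. rep_l1 (A1.S t (abs_l1 f))) = A"
    using L1.semigroup_to_functions[OF A1.contraction_sg_S] A1.neg_gen_S A_eq_lift[symmetric] by simp
  then have H: "contraction_semigroup 1 ?H" "neg_generator 1 ?H = A"
    unfolding heat_semigroup_def by (metis (mono_tags, lifting) someI)+
  define S' where "S' = (\<lambda>t x. abs_l1 (?H t (rep_l1 x)))"
  have S'_app: "S' t x = abs_l1 (?H t (rep_l1 x))" for t x by (simp add: S'_def)
  note S' = L1.semigroup_from_functions[OF H(1) S'_app]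
  have "L1.lift_graph (neg_gen S') = L1.lift_graph G1"
    using L1.neg_generator_lift[of ?H S', OF S'(2)] H(2) A_eq_lift[symmetric] by simp
  then have "neg_gen S' = G1" by (rule L1.lift_graph_inj)
  then have "S' t x = A1.S t x" for x
    using LIMSEQ_unique[OF A1.exponential_formula[OF S'(1) _ assms(1)] A1.V_tendsto_S[OF assms(1)]] by blast
  then show "?H t f \<in> Lp 1" "abs_l1 (?H t f) = A1.S t (abs_l1 f)" using S'(2)[OF assms] by auto
qed

text \<open>The chosen extension agrees with the heat semigroup on functions in both spaces, and so
  does \<open>A2.S\<close> by coherence. Two contractions that agree on the dense classes of
  \<open>Lb\<close> are equal, hence so are the generators.\<close>

lemma L2_operator: "L2_operator A = L2.lift_graph G2"
proof -
  let ?T = "\<lambda>t f. rep_l2 (A2.S t (abs_l2 f))"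
  have "ae_eq (?T t f) (heat_semigroup A t f)" if t: "t \<ge> 0" and f: "f \<in> Lp 1 \<inter> Lp 2" for t f
  proof -
    have "coherent (A1.S t (abs_l1 f)) (A2.S t (abs_l2 f))" by (rule coherent_S[OF coherent_abs t]) (use f in simp_all)
    then have "coherent (abs_l1 (heat_semigroup A t f)) (abs_l2 (?T t f))"
      using heat_semigroup[OF t] f by (simp add: abs_rep_l2)
    moreover have "f \<in> Lp 1" using f by simp
    ultimately have "ae_eq (heat_semigroup A t f) (?T t f)"
      using coherent_abs_iff[OF heat_semigroup(1)[OF t] rep_l2_Lp] by simp
    then show ?thesis by (rule ae_eq_sym)
  qed
  then have "\<exists>T. contraction_semigroup 2 T \<and> (\<forall>t\<ge>0. \<forall>f\<in>Lp 1 \<inter> Lp 2. ae_eq (T t f) (heat_semigroup A t f))"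
    using L2.semigroup_to_functions(1)[OF A2.contraction_sg_S] by blast
  from someI_ex[OF this] have T: "contraction_semigroup 2 (L2_semigroup A)"
    "\<And>t f. t \<ge> 0 \<Longrightarrow> f \<in> Lp 1 \<Longrightarrow> f \<in> Lp 2 \<Longrightarrow> ae_eq (L2_semigroup A t f) (heat_semigroup A t f)"
    unfolding L2_semigroup_def by blast+
  define S' where "S' = (\<lambda>t x. abs_l2 (L2_semigroup A t (rep_l2 x)))"
  have S'_app: "S' t x = abs_l2 (L2_semigroup A t (rep_l2 x))" for t x by (simp add: S'_def)
  note S' = L2.semigroup_from_functions[OF T(1) S'_app]
  have eq: "S' t x = A2.S t x" if t: "t \<ge> 0" for t x
  proof -
    have Lb: "S' t (abs_l2 f) = A2.S t (abs_l2 f)" if f: "f \<in> Lb" for f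
    proof -
      have "ae_eq (heat_semigroup A t f) (L2_semigroup A t f)" using T(2)[OF t Lb_Lp[OF f]] by (rule ae_eq_sym)
      then have "coherent (A1.S t (abs_l1 f)) (S' t (abs_l2 f))"
        using coherent_abs_iff[of "heat_semigroup A t f" "L2_semigroup A t f"] conjunct1[OF S'(2)[OF t Lb_Lp(2)[OF f]]]
          heat_semigroup[OF t Lb_Lp(1)[OF f]] unfolding conjunct2[OF S'(2)[OF t Lb_Lp(2)[OF f]], symmetric] by simp
      moreover have "coherent (A1.S t (abs_l1 f)) (A2.S t (abs_l2 f))"
        by (rule coherent_S[OF coherent_abs[OF Lb_Lp[OF f]] t])
      ultimately show ?thesis by (rule coherent_unique)
    qed
    have lin: "linear (S' t)" and nrm: "norm (S' t x) \<le> norm x" for x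
      using S'(1) t by (auto simp: contraction_sg_def)
    have "(\<lambda>n::nat. S' t x) \<longlonglongrightarrow> A2.S t x"
      by (rule tendsto_contractions_dense[where L = "\<lambda>_. S' t" and D = "abs_l2 ` Lb"])
        (use lin nrm A2.linear_S[OF t] A2.norm_S[OF t] Lb closure_Lb_l2 in auto)
    then show ?thesis using LIMSEQ_unique tendsto_const by blast
  qed
  have "L2_operator A = L2.lift_graph (neg_gen A2.S)"
    unfolding L2_operator_def by (rule L2.neg_generator_lift) (use S'(2) eq in simp)
  then show ?thesis by (simp add: A2.neg_gen_S)
qed

end

section \<open>The quadratic form and its Yosida approximations\<close>

lemma sqrt_graph_cases:
  assumes "sqrt_graph G B"
  shows "\<And>u v u' v'. (u, v) \<in> B \<Longrightarrow> (u', v') \<in> B \<Longrightarrow> v \<bullet> u' = u \<bullet> v'"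
    and "\<And>u v v'. (u, v) \<in> B \<Longrightarrow> (u, v') \<in> B \<Longrightarrow> v = v'"
proof -
  have adj: "(u, v) \<in> adjoint_graph B" if "(u, v) \<in> B" for u v using assms that by (simp add: sqrt_graph_def)
  show sym: "v \<bullet> u' = u \<bullet> v'" if "(u, v) \<in> B" "(u', v') \<in> B" for u v u' v'
    using adj[OF that(2)] that(1) by (auto simp: adjoint_graph_def)
  show "v = v'" if "(u, v) \<in> B" "(u, v') \<in> B" for u v v'
  proof -
    have "h \<bullet> (v - v') = 0" if h: "h \<in> Domain B" for h
    proof -
      obtain k where "(h, k) \<in> B" using h by blast
      then show ?thesis using sym[of h k u v] sym[of h k u v'] \<open>(u, v) \<in> B\<close> \<open>(u, v') \<in> B\<close>
        by (simp add: inner_diff)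
    qed
    then have "closure (Domain B) \<subseteq> {h. h \<bullet> (v - v') = 0}"
      by (intro closure_minimal) (auto intro!: closed_Collect_eq continuous_intros)
    then have "(v - v') \<bullet> (v - v') = 0" using assms unfolding sqrt_graph_def by blast
    then show ?thesis by simp
  qed
qed

lemma adjoint_operator_lift: "adjoint_operator (L2.lift_graph B) = L2.lift_graph (adjoint_graph B)"
proof -
  have "(\<forall>(h, k)\<in>L2.lift_graph B. L2_inner k f = L2_inner h g) \<longleftrightarrow> (\<forall>(x, y)\<in>B. y \<bullet> abs_l2 f = x \<bullet> abs_l2 g)"
    if fg: "f \<in> Lp 2" "g \<in> Lp 2" for f g
  proof (intro iffI ballI; clarify)
    fix x y assume a: "\<forall>(h, k)\<in>L2.lift_graph B. L2_inner k f = L2_inner h g" and xy: "(x, y) \<in> B"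
    have "(rep_l2 x, rep_l2 y) \<in> L2.lift_graph B"
      using xy by (simp add: L2.lift_graph_def rep_l2_Lp abs_rep_l2)
    then have "L2_inner (rep_l2 y) f = L2_inner (rep_l2 x) g" using a by blast
    then show "y \<bullet> abs_l2 f = x \<bullet> abs_l2 g"
      by (simp add: inner_abs_l2[symmetric] fg rep_l2_Lp abs_rep_l2)
  next
    fix h k assume "\<forall>(x, y)\<in>B. y \<bullet> abs_l2 f = x \<bullet> abs_l2 g" "(h, k) \<in> L2.lift_graph B"
    then show "L2_inner k f = L2_inner h g"
      using fg by (auto simp: L2.lift_graph_def inner_abs_l2[symmetric])
  qed
  then show ?thesis unfolding adjoint_operator_def L2.lift_graph_def adjoint_graph_def by auto
qed

lemma lift_graph_relcomp: "L2.lift_graph B O L2.lift_graph C = L2.lift_graph (B O C)"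
proof (intro equalityI subsetI)
  fix p assume "p \<in> L2.lift_graph (B O C)"
  then obtain f h y where p: "p = (f, h)" "f \<in> Lp 2" "h \<in> Lp 2" "(abs_l2 f, y) \<in> B" "(y, abs_l2 h) \<in> C"
    by (auto simp: L2.lift_graph_def)
  then have "(f, rep_l2 y) \<in> L2.lift_graph B" "(rep_l2 y, h) \<in> L2.lift_graph C"
    by (simp_all add: L2.lift_graph_def rep_l2_Lp abs_rep_l2)
  then show "p \<in> L2.lift_graph B O L2.lift_graph C" unfolding p by blast
qed (auto simp: L2.lift_graph_def)

text \<open>An operator on functions that equals its adjoint is closed under changes on null sets,
  because the adjoint is defined by integrals. Every competitor for the root is therefore the lift
  of a graph on classes, where uniqueness is available.\<close>

lemma sqrt_operator_iff:
  "self_adjoint X \<and> nonneg_operator X \<and> X O X = L2.lift_graph G \<longleftrightarrow> (\<exists>B. X = L2.lift_graph B \<and> sqrt_graph G B)"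
proof (intro iffI)
  assume X: "self_adjoint X \<and> nonneg_operator X \<and> X O X = L2.lift_graph G"
  define B where "B = {(abs_l2 f, abs_l2 g) |f g. (f, g) \<in> X}"
  have adjX: "adjoint_operator X = X" using X by (simp add: self_adjoint_def)
  have XL: "f \<in> Lp 2" "g \<in> Lp 2" if "(f, g) \<in> X" for f g
  proof -
    have "(f, g) \<in> adjoint_operator X" using that adjX by simp
    then show "f \<in> Lp 2" "g \<in> Lp 2" by (auto simp: adjoint_operator_def)
  qed
  have cong: "(f', g') \<in> X" if fg: "(f, g) \<in> X" and eq: "ae_eq f f'" "ae_eq g g'" and L: "f' \<in> Lp 2" "g' \<in> Lp 2" for f g f' g'
  proof -
    have "L2_inner k f' = L2_inner h g'" if hk: "(h, k) \<in> X" for h k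
    proof -
      have "(f, g) \<in> adjoint_operator X" using fg adjX by simp
      then have "L2_inner k f = L2_inner h g" using hk unfolding adjoint_operator_def by auto
      moreover have "L2_inner k f = L2_inner k f'" "L2_inner h g = L2_inner h g'"
        using XL[OF fg] XL[OF hk] eq L by (auto intro!: L2_inner_cong ae_eq_refl)
      ultimately show ?thesis by simp
    qed
    then have "(f', g') \<in> adjoint_operator X" using L unfolding adjoint_operator_def by auto
    then show ?thesis using adjX by simp
  qed
  have XB: "X = L2.lift_graph B"
  proof (intro equalityI subsetI)
    fix p assume "p \<in> L2.lift_graph B"
    then obtain f' g' f g where p: "p = (f', g')" "f' \<in> Lp 2" "g' \<in> Lp 2" "(f, g) \<in> X"
      "abs_l2 f' = abs_l2 f" "abs_l2 g' = abs_l2 g" by (auto simp: L2.lift_graph_def B_def)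
    have "ae_eq f' f" "ae_eq g' g" using p XL[OF p(4)] by (simp_all add: abs_l2_eq_iff)
    then show "p \<in> X" unfolding p(1) using cong[OF p(4) _ _ p(2,3)] by (simp add: ae_eq_sym)
  next
    fix p assume "p \<in> X" then show "p \<in> L2.lift_graph B"
      using XL by (cases p) (auto simp: L2.lift_graph_def B_def)
  qed
  have "adjoint_graph B = B"
    using adjX unfolding XB adjoint_operator_lift by (rule L2.lift_graph_inj)
  moreover have "B O B = G" using X unfolding XB lift_graph_relcomp by (intro L2.lift_graph_inj) simp
  moreover have "closure (Domain B) = UNIV"
  proof -
    have "closure (abs_l2 ` Domain X) = UNIV"
    proof (rule L2.closure_cls)
      fix f :: "'a \<Rightarrow> real" and e :: real assume "f \<in> Lp 2" "e > 0"
      then obtain g where "g \<in> Domain X" "Lp_norm 2 (\<lambda>x. f x - g x) < e"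
        using X unfolding self_adjoint_def densely_defined_def by blast
      then show "\<exists>g\<in>Domain X. g \<in> Lp 2 \<and> Lp_norm 2 (\<lambda>x. f x - g x) < e" using XL by blast
    qed
    moreover have "abs_l2 ` Domain X \<subseteq> Domain B" by (auto simp: B_def)
    ultimately show ?thesis using closure_mono by blast
  qed
  moreover have "0 \<le> u \<bullet> v" if "(u, v) \<in> B" for u v
  proof -
    obtain f g where fg: "u = abs_l2 f" "v = abs_l2 g" "(f, g) \<in> X" using \<open>(u, v) \<in> B\<close> by (auto simp: B_def)
    then have "0 \<le> L2_inner f g" using X XL[OF fg(3)] unfolding nonneg_operator_def by blast
    then show ?thesis using XL[OF fg(3)] by (simp add: fg inner_abs_l2)
  qed
  ultimately have "sqrt_graph G B" by (auto simp: sqrt_graph_def)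
  then show "\<exists>B. X = L2.lift_graph B \<and> sqrt_graph G B" using XB by blast
next
  assume "\<exists>B. X = L2.lift_graph B \<and> sqrt_graph G B"
  then obtain B where XB: "X = L2.lift_graph B" and B: "sqrt_graph G B" by blast
  have "densely_defined 2 X"
    unfolding densely_defined_def
  proof (intro ballI allI impI)
    fix f :: "'a \<Rightarrow> real" and e :: real assume f: "f \<in> Lp 2" and e: "e > 0"
    have "abs_l2 f \<in> closure (Domain B)" using B by (simp add: sqrt_graph_def)
    then obtain u where u: "u \<in> Domain B" "dist u (abs_l2 f) < e" using e unfolding closure_approachable by blast
    then obtain v where v: "(u, v) \<in> B" by blast
    have "(rep_l2 u, rep_l2 v) \<in> X" using v by (simp add: XB L2.lift_graph_def rep_l2_Lp abs_rep_l2)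
    moreover have "dist u (abs_l2 f) = Lp_norm 2 (\<lambda>x. f x - rep_l2 u x)"
      using norm_abs_l2[OF Lp_diff[OF f rep_l2_Lp], of u] f rep_l2_Lp[of u]
      by (simp add: abs_l2_diff abs_rep_l2 dist_norm norm_minus_commute)
    ultimately show "\<exists>g\<in>Domain X. Lp_norm 2 (\<lambda>x. f x - g x) < e" using u(2) by auto
  qed
  moreover have "adjoint_operator X = X" "X O X = L2.lift_graph G"
    using B by (simp_all add: XB adjoint_operator_lift lift_graph_relcomp sqrt_graph_def)
  moreover have "nonneg_operator X"
    using B unfolding nonneg_operator_def XB L2.lift_graph_def sqrt_graph_def by (auto simp: inner_abs_l2[symmetric])
  ultimately show "self_adjoint X \<and> nonneg_operator X \<and> X O X = L2.lift_graph G" by (simp add: self_adjoint_def)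
qed

section \<open>The form and the Yosida energies\<close>

context nonneg_symmetric
begin

definition B :: "('b \<times> 'b) set" where "B = (SOME B. sqrt_graph G B)"

lemma sqrt_B: "sqrt_graph G B"
  unfolding B_def by (rule someI_ex[OF sqrt_graph_exists])

lemmas B_sym = sqrt_graph_cases(1)[OF sqrt_B] and B_fun = sqrt_graph_cases(2)[OF sqrt_B]

lemma B_comp: "(u, v) \<in> G \<Longrightarrow> \<exists>z. (u, z) \<in> B \<and> (z, v) \<in> B"
  using sqrt_B unfolding sqrt_graph_def by blast

lemma form_on_G: assumes "(u, v) \<in> G" shows "\<exists>z. (u, z) \<in> B \<and> (norm z)\<^sup>2 = v \<bullet> u"
proof -
  obtain z where z: "(u, z) \<in> B" "(z, v) \<in> B" using B_comp[OF assms] by blast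
  then show ?thesis using B_sym[OF z(2) z(1)] by (auto simp: dot_square_norm)
qed

text \<open>The form of a bounded operator, finite for every \<open>y\<close>. Working with bounds
  on all these energies avoids having to show that slices of a function stay in the domain of the
  square root.\<close>

definition E :: "real \<Rightarrow> 'b \<Rightarrow> real" where "E \<mu> y = (1 / \<mu>) * ((y - J \<mu> y) \<bullet> y)"

lemma E_split:
  assumes "\<mu> > 0" and v_def: "v = (1 / \<mu>) *\<^sub>R (y - J \<mu> y)"
  shows "E \<mu> y = v \<bullet> J \<mu> y + \<mu> * (v \<bullet> v)"
proof -
  have "y = J \<mu> y + \<mu> *\<^sub>R v" using assms by simp
  then have "v \<bullet> y = v \<bullet> J \<mu> y + \<mu> * (v \<bullet> v)" by (metis inner_add_right inner_scaleR_right)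
  then show ?thesis by (simp add: E_def v_def)
qed

text \<open>With \<open>z\<close> the image of \<open>J \<mu> y\<close> under the root, symmetry of
  the root gives \<open>E \<mu> y = z \<bullet> w\<close>, while \<open>E_split\<close> gives
  \<open>E \<mu> y \<ge> z \<bullet> z\<close>. Cauchy-Schwarz then bounds \<open>norm z\<close> by
  \<open>norm w\<close>.\<close>

lemma E_le_form:
  assumes "\<mu> > 0" "(y, w) \<in> B"
  shows "E \<mu> y \<le> (norm w)\<^sup>2"
proof -
  define u v where "u = J \<mu> y" and "v = (1 / \<mu>) *\<^sub>R (y - u)"
  obtain z where z: "(u, z) \<in> B" "(z, v) \<in> B" using B_comp J_in[OF assms(1), of y] unfolding u_def v_def by blast
  have E1: "E \<mu> y = z \<bullet> w" using B_sym[OF z(2) assms(2)] by (simp add: E_def v_def u_def)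
  have "v \<bullet> u = z \<bullet> z" by (rule B_sym[OF z(2) z(1)])
  then have E2: "E \<mu> y \<ge> z \<bullet> z" using E_split[OF assms(1) v_def[unfolded u_def]] assms(1) by (simp add: u_def)
  have cs: "z \<bullet> w \<le> norm z * norm w" by (rule norm_cauchy_schwarz)
  have "norm z * norm z \<le> norm z * norm w" using E1 E2 cs by (simp add: dot_square_norm power2_eq_square)
  then have "norm z \<le> norm w" by (cases "norm z = 0") auto
  then have "norm z * norm w \<le> norm w * norm w" by (rule mult_right_mono) simp
  then show ?thesis using E1 cs by (simp add: power2_eq_square)
qed

text \<open>The Yosida energy is the Moreau envelope of the form, with minimizer
  \<open>u = J \<mu> y\<close>. Writing another competitor as \<open>(w + d, z + q)\<close> cancels
  the mixed terms and leaves the excess \<open>q \<bullet> d + (d \<bullet> d) / \<mu>\<close>,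
  which is nonnegative.\<close>

lemma E_variational:
  assumes "\<mu> > 0" "(u, v) \<in> G"
  shows "E \<mu> y \<le> v \<bullet> u + (1 / \<mu>) * ((y - u) \<bullet> (y - u))"
proof -
  define w z d q where "w = J \<mu> y" and "z = (1 / \<mu>) *\<^sub>R (y - w)" and "d = u - w" and "q = v - z"
  have wz: "(w, z) \<in> G" unfolding w_def z_def by (rule J_in[OF assms(1)])
  have dq: "(d, q) \<in> G" unfolding d_def q_def by (rule G_diff[OF assms(2) wz])
  have uv: "u = w + d" "v = z + q" by (simp_all add: d_def q_def)
  have yu: "y - u = \<mu> *\<^sub>R z - d" using assms(1) by (simp add: z_def d_def)
  have "v \<bullet> u = z \<bullet> w + 2 * (z \<bullet> d) + q \<bullet> d"
    using symmetric[OF dq wz] unfolding uv by (simp add: inner_add inner_commute)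
  moreover have "(1 / \<mu>) * ((y - u) \<bullet> (y - u)) = \<mu> * (z \<bullet> z) - 2 * (z \<bullet> d) + (1 / \<mu>) * (d \<bullet> d)"
    unfolding yu using assms(1) by (simp add: inner_diff inner_commute field_simps)
  moreover have "0 \<le> q \<bullet> d" using nonneg[OF dq] by (simp add: inner_commute)
  moreover have "0 \<le> (1 / \<mu>) * (d \<bullet> d)" using assms(1) by simp
  ultimately show ?thesis using E_split[OF assms(1) z_def[unfolded w_def]] by (simp add: w_def)
qed

text \<open>The minimizer for \<nu> is a competitor in the variational bound for \<mu>, where the
  penalty has the smaller weight \<open>1 / \<mu>\<close>.\<close>

lemma E_antimono: assumes "0 < \<nu>" "\<nu> \<le> \<mu>" shows "E \<mu> y \<le> E \<nu> y"
proof -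
  define u v where "u = J \<nu> y" and "v = (1 / \<nu>) *\<^sub>R (y - u)"
  have uv: "(u, v) \<in> G" unfolding u_def v_def by (rule J_in[OF assms(1)])
  have "E \<mu> y \<le> v \<bullet> u + (1 / \<mu>) * ((y - u) \<bullet> (y - u))" by (rule E_variational) (use assms uv in auto)
  also have "\<dots> \<le> v \<bullet> u + (1 / \<nu>) * ((y - u) \<bullet> (y - u))"
    using assms by (intro add_left_mono mult_right_mono frac_le) auto
  also have "\<dots> = v \<bullet> u + \<nu> * (v \<bullet> v)" using assms by (simp add: v_def)
  also have "\<dots> = E \<nu> y" using E_split[OF assms(1) v_def[unfolded u_def]] by (simp add: u_def)
  finally show ?thesis .
qed

lemma E_nonneg: assumes "0 < \<mu>" shows "0 \<le> E \<mu> y"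
proof -
  have "norm (J \<mu> y) * norm y \<le> norm y * norm y" by (intro mult_right_mono norm_J) simp
  then have "J \<mu> y \<bullet> y \<le> y \<bullet> y"
    using norm_cauchy_schwarz[of "J \<mu> y" y] by (simp add: dot_square_norm power2_eq_square)
  then show ?thesis using assms by (simp add: E_def inner_diff)
qed

lemma E_add: "E \<mu> (g + h) = E \<mu> g + E \<mu> h + (2 / \<mu>) * ((g - J \<mu> g) \<bullet> h)"
  using self_adjD[OF J_self_adj, of \<mu> h g]
  by (simp add: E_def J_add inner_add inner_diff inner_commute algebra_simps add_divide_distrib diff_divide_distrib)

lemma Jpow_self_adj: "(J \<mu> ^^ n) x \<bullet> y = x \<bullet> (J \<mu> ^^ n) y"
  by (induction n arbitrary: x y) (simp_all add: self_adjD[OF J_self_adj] funpow_swap1)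

text \<open>By symmetry half of the power can be moved to the other argument. What remains in the
  middle is the identity for even exponents and one nonnegative \<open>J \<mu>\<close> for odd
  ones.\<close>

lemma Jpow_nonneg: "0 \<le> (J \<mu> ^^ n) x \<bullet> x"
proof -
  define m where "m = n div 2"
  have "n = m + m \<or> n = Suc (m + m)" unfolding m_def by linarith
  then show ?thesis
  proof
    assume "n = m + m"
    then have "(J \<mu> ^^ n) x \<bullet> x = (J \<mu> ^^ m) x \<bullet> (J \<mu> ^^ m) x"
      by (simp add: funpow_add Jpow_self_adj)
    then show ?thesis by simp
  next
    assume "n = Suc (m + m)"
    then have "(J \<mu> ^^ n) x \<bullet> x = J \<mu> ((J \<mu> ^^ m) x) \<bullet> (J \<mu> ^^ m) x"
      using Jpow_self_adj[of m \<mu> "J \<mu> ((J \<mu> ^^ m) x)" x]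
      by (simp add: funpow_add funpow_swap1)
    then show ?thesis using J_nonneg by simp
  qed
qed

text \<open>The sequence \<open>(J\<^sup>k y) \<bullet> y\<close> is convex in \<open>k\<close>, so its decrements are largest at \<open>k = 0\<close>.\<close>

lemma Jpow_decrement: "(y - (J \<mu> ^^ n) y) \<bullet> y \<le> real n * ((y - J \<mu> y) \<bullet> y)"
proof -
  have conv: "(J \<mu> ^^ Suc k) y \<bullet> y - (J \<mu> ^^ Suc (Suc k)) y \<bullet> y \<le> (J \<mu> ^^ k) y \<bullet> y - (J \<mu> ^^ Suc k) y \<bullet> y" for k
  proof -
    have "0 \<le> (J \<mu> ^^ k) (y - J \<mu> y) \<bullet> (y - J \<mu> y)" by (rule Jpow_nonneg)
    also have "\<dots> = (J \<mu> ^^ k) y \<bullet> y - 2 * ((J \<mu> ^^ Suc k) y \<bullet> y) + (J \<mu> ^^ Suc (Suc k)) y \<bullet> y"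
    proof -
      have "(J \<mu> ^^ k) y \<bullet> J \<mu> y = (J \<mu> ^^ Suc k) y \<bullet> y" "(J \<mu> ^^ k) (J \<mu> y) \<bullet> J \<mu> y = (J \<mu> ^^ Suc (Suc k)) y \<bullet> y"
        using self_adjD[OF J_self_adj, of \<mu> "(J \<mu> ^^ k) y" y] self_adjD[OF J_self_adj, of \<mu> "(J \<mu> ^^ k) (J \<mu> y)" y]
        by (simp_all add: funpow_swap1)
      then show ?thesis by (simp add: linear_diff[OF linear_Jpow] inner_diff funpow_swap1)
    qed
    finally show ?thesis by simp
  qed
  have dec: "(J \<mu> ^^ k) y \<bullet> y - (J \<mu> ^^ Suc k) y \<bullet> y \<le> (y - J \<mu> y) \<bullet> y" for k
  proof (induction k)
    case (Suc k)
    then show ?case using conv[of k] by linarith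
  qed (simp add: inner_diff)
  show ?thesis
  proof (induction n)
    case (Suc n)
    then show ?case using dec[of n] by (simp add: inner_diff algebra_simps)
  qed simp
qed

lemma S_self_adj: "t \<ge> 0 \<Longrightarrow> S t x \<bullet> y = x \<bullet> S t y"
  using LIMSEQ_unique[OF tendsto_inner[OF V_tendsto_S[of t x] tendsto_const[of y]]]
    tendsto_inner[OF tendsto_const[of x] V_tendsto_S[of t y]]
  by (simp add: V_def Jpow_self_adj)

text \<open>\<open>2^n\<close> decrements of the step \<open>t / 2^n\<close>, each at most the first
  one, amount to \<open>t\<close> times the Yosida energy at that step. The uniform bound
  \<open>M\<close> stands for the value of the form and makes no claim that \<open>y\<close> lies in
  its domain.\<close>

lemma S_decrement:
  assumes "t > 0" and M: "\<And>\<mu>. \<mu> > 0 \<Longrightarrow> E \<mu> y \<le> M"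
  shows "(y - S t y) \<bullet> y \<le> t * M"
proof (rule LIMSEQ_le_const2)
  show "(\<lambda>n. (y - V n t y) \<bullet> y) \<longlonglongrightarrow> (y - S t y) \<bullet> y"
    using assms(1) by (intro tendsto_intros V_tendsto_S) simp
  have "(y - V n t y) \<bullet> y \<le> t * M" for n
  proof -
    let ?\<mu> = "t / 2 ^ n"
    have "(y - V n t y) \<bullet> y \<le> 2 ^ n * ((y - J ?\<mu> y) \<bullet> y)"
      using Jpow_decrement[where \<mu> = ?\<mu> and n = "2 ^ n"] by (simp add: V_def)
    also have "\<dots> = t * E ?\<mu> y" using assms(1) by (simp add: E_def)
    also have "\<dots> \<le> t * M" using assms by (intro mult_left_mono M) auto
    finally show ?thesis .
  qed
  then show "\<exists>N. \<forall>n\<ge>N. (y - V n t y) \<bullet> y \<le> t * M" by blast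
qed

end

section \<open>The form of an admissible operator under truncation\<close>

context admissible
begin

text \<open>Uniqueness of the root on classes is what gives meaning to the definite description in
  \<open>sqrt_operator\<close>.\<close>

lemma sqrt_L2_operator: "sqrt_operator (L2_operator A) = L2.lift_graph A2.B"
  unfolding sqrt_operator_def L2_operator sqrt_operator_iff
proof (rule the_equality)
  show "\<exists>B. L2.lift_graph A2.B = L2.lift_graph B \<and> sqrt_graph G2 B" using A2.sqrt_B by blast
  show "X = L2.lift_graph A2.B" if "\<exists>B. X = L2.lift_graph B \<and> sqrt_graph G2 B" for X
    using that A2.sqrt_graph_unique[OF A2.sqrt_B] by blast
qed

lemma dom_Q_iff: "f \<in> dom_Q A \<longleftrightarrow> f \<in> Lp 2 \<and> (\<exists>w. (abs_l2 f, w) \<in> A2.B)"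
proof
  assume "f \<in> Lp 2 \<and> (\<exists>w. (abs_l2 f, w) \<in> A2.B)"
  then obtain w where "f \<in> Lp 2" "(abs_l2 f, w) \<in> A2.B" by blast
  then have "(f, rep_l2 w) \<in> L2.lift_graph A2.B" by (simp add: L2.lift_graph_def rep_l2_Lp abs_rep_l2)
  then show "f \<in> dom_Q A" unfolding dom_Q_def sqrt_L2_operator by blast
qed (auto simp: dom_Q_def sqrt_L2_operator L2.lift_graph_def)

lemma Q_form_eq: assumes "f \<in> Lp 2" "(abs_l2 f, w) \<in> A2.B" shows "Q_form A f = (norm w)\<^sup>2"
proof -
  have "\<exists>g. (f, g) \<in> sqrt_operator (L2_operator A)"
    using assms unfolding sqrt_L2_operator by (intro exI[of _ "rep_l2 w"]) (simp add: L2.lift_graph_def rep_l2_Lp abs_rep_l2)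
  from someI_ex[OF this] obtain g where g: "g = (SOME g. (f, g) \<in> sqrt_operator (L2_operator A))" "(f, g) \<in> L2.lift_graph A2.B"
    unfolding sqrt_L2_operator by blast
  then have "abs_l2 g = w" "g \<in> Lp 2" using A2.B_fun[OF _ assms(2)] by (auto simp: L2.lift_graph_def)
  then show ?thesis unfolding Q_form_def g(1)[symmetric] using norm_abs_l2[of g] by simp
qed

definition energy :: "real \<Rightarrow> ('a \<Rightarrow> real) \<Rightarrow> real" where "energy \<mu> f = A2.E \<mu> (abs_l2 f)"

lemma energy_le_Q: "f \<in> dom_Q A \<Longrightarrow> \<mu> > 0 \<Longrightarrow> energy \<mu> f \<le> Q_form A f"
  using A2.E_le_form Q_form_eq unfolding dom_Q_iff energy_def by auto

lemma energy_nonneg: "\<mu> > 0 \<Longrightarrow> 0 \<le> energy \<mu> f"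
  unfolding energy_def by (rule A2.E_nonneg)

lemma J1_bounds:
  assumes "f \<in> Lp 1" "AE x in lborel. a \<le> f x \<and> f x \<le> b" "\<mu> > 0" "f \<in> Lp 2"
  shows "AE x in lborel. a \<le> rep_l2 (A2.J \<mu> (abs_l2 f)) x \<and> rep_l2 (A2.J \<mu> (abs_l2 f)) x \<le> b"
  using J1_dirichlet[OF assms(3,1,2)] coherent_J[OF coherent_abs[OF assms(1,4)], of \<mu>]
  unfolding coherent_def ae_eq_def by eventually_elim simp

lemma AE_rep_abs_l1: "f \<in> Lp 1 \<Longrightarrow> AE x in lborel. P (f x) \<Longrightarrow> AE x in lborel. P (rep_l1 (abs_l1 f) x)"
  using rep_abs_l1[of f] unfolding ae_eq_def by (auto elim: eventually_elim2)

text \<open>The Dirichlet property has two finite real bounds, so it speaks of bounded functions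
  only. Truncations are bounded and keep the sign, and nonnegativity survives limits in L1.\<close>

lemma J1_nonneg:
  assumes "f \<in> Lp 1" "AE x in lborel. 0 \<le> f x" "\<mu> > 0"
  shows "AE x in lborel. 0 \<le> rep_l1 (A1.J \<mu> (abs_l1 f)) x"
proof (rule l1_limit_AE_nonneg)
  show "(\<lambda>n. A1.J \<mu> (abs_l1 (trunc n f))) \<longlonglongrightarrow> A1.J \<mu> (abs_l1 f)"
    by (rule bounded_linear.tendsto[OF bounded_linear_contraction[OF A1.linear_J A1.norm_J] trunc_l1[OF assms(1)]])
  show "AE x in lborel. 0 \<le> rep_l1 (A1.J \<mu> (abs_l1 (trunc n f))) x" for n
  proof -
    have "AE x in lborel. 0 \<le> trunc n f x \<and> trunc n f x \<le> real (Suc n)"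
      using assms(2) by eventually_elim (auto simp: trunc_def)
    from J1_dirichlet[OF assms(3) Lb_Lp(1)[OF trunc_Lb[OF assms(1)]] this] show ?thesis by (auto elim: eventually_mono)
  qed
qed

lemma Jpow1_nonneg:
  assumes "f \<in> Lp 1" "AE x in lborel. 0 \<le> f x" "\<mu> > 0"
  shows "AE x in lborel. 0 \<le> rep_l1 ((A1.J \<mu> ^^ n) (abs_l1 f)) x"
proof (induction n)
  case (Suc n)
  from J1_nonneg[OF rep_l1_Lp this assms(3)] show ?case by (simp add: abs_rep_l1)
qed (use AE_rep_abs_l1[OF assms(1,2)] in simp)

lemma S1_nonneg:
  assumes "f \<in> Lp 1" "AE x in lborel. 0 \<le> f x" "t > 0"
  shows "AE x in lborel. 0 \<le> rep_l1 (A1.S t (abs_l1 f)) x"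
  by (rule l1_limit_AE_nonneg[OF A1.V_tendsto_S]) (use assms Jpow1_nonneg in \<open>auto simp: A1.V_def\<close>)

lemma Lp_min_max:
  assumes "f \<in> Lp p" "p = 1 \<or> p = 2" "c \<ge> 0"
  shows "(\<lambda>x. min (f x) c) \<in> Lp p" "(\<lambda>x. max (f x - c) 0) \<in> Lp p" "(\<lambda>x. max (- f x) 0) \<in> Lp p"
    "(\<lambda>x. \<bar>f x\<bar>) \<in> Lp p"
proof -
  have [measurable]: "f \<in> borel_measurable borel" using Lp_measurable[OF assms(1)] by simp
  have *: "g \<in> Lp p" if [measurable]: "g \<in> borel_measurable borel" and le: "\<And>x. \<bar>g x\<bar> \<le> \<bar>f x\<bar>" for g
    unfolding Lp_def
  proof (safe, simp, rule Bochner_Integration.integrable_bound)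
    show "integrable lborel (\<lambda>x. \<bar>f x\<bar> powr p)" using assms(1) by (simp add: Lp_def)
    show "AE x in lborel. norm (\<bar>g x\<bar> powr p) \<le> norm (\<bar>f x\<bar> powr p)"
      using le assms(2) by (intro always_eventually allI) (auto intro!: powr_mono2)
  qed measurable
  show "(\<lambda>x. min (f x) c) \<in> Lp p" "(\<lambda>x. max (f x - c) 0) \<in> Lp p" "(\<lambda>x. max (- f x) 0) \<in> Lp p" "(\<lambda>x. \<bar>f x\<bar>) \<in> Lp p"
    using assms(3) by (auto intro!: *)
qed

text \<open>For \<open>g = min f c\<close> and \<open>h = max (f - c) 0\<close> the energy of the
  sum exceeds the sum of the energies by a multiple of the pairing of \<open>g - J g\<close> with
  \<open>h\<close>. Where \<open>h\<close> is positive, \<open>g\<close> equals \<open>c\<close>,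
  and \<open>J g \<le> c\<close> by the Dirichlet property.\<close>

lemma energy_truncation:
  assumes f: "f \<in> Lp 1" "f \<in> Lp 2" "\<And>x. 0 \<le> f x" and c: "c \<ge> 0" and \<mu>: "\<mu> > 0"
  shows "energy \<mu> (\<lambda>x. min (f x) c) + energy \<mu> (\<lambda>x. max (f x - c) 0) \<le> energy \<mu> f"
proof -
  let ?g = "\<lambda>x. min (f x) c" and ?h = "\<lambda>x. max (f x - c) 0"
  have g: "?g \<in> Lp 1" "?g \<in> Lp 2" and h: "?h \<in> Lp 1" "?h \<in> Lp 2" using f c by (auto intro: Lp_min_max)
  define k where "k = rep_l2 (A2.J \<mu> (abs_l2 ?g))"
  have k: "k \<in> Lp 2" "abs_l2 k = A2.J \<mu> (abs_l2 ?g)" by (simp_all add: k_def rep_l2_Lp abs_rep_l2)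
  have "AE x in lborel. k x \<le> c"
    using J1_bounds[OF g(1) _ \<mu> g(2), of 0 c] f c unfolding k_def by auto
  then have "AE x in lborel. 0 \<le> (?g x - k x) * ?h x"
    by eventually_elim (auto simp: max_def min_def)
  then have "0 \<le> L2_inner (\<lambda>x. ?g x - k x) ?h" unfolding L2_inner_def by (rule integral_nonneg_AE)
  also have "\<dots> = (abs_l2 ?g - A2.J \<mu> (abs_l2 ?g)) \<bullet> abs_l2 ?h"
    using g h k by (simp add: inner_abs_l2[symmetric] abs_l2_diff Lp_diff)
  finally have "0 \<le> (abs_l2 ?g - A2.J \<mu> (abs_l2 ?g)) \<bullet> abs_l2 ?h" .
  moreover have "abs_l2 f = abs_l2 ?g + abs_l2 ?h"
  proof -
    have "f = (\<lambda>x. 1 * ?g x + 1 * ?h x)" by (auto simp: max_def min_def)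
    then have "abs_l2 f = abs_l2 (\<lambda>x. 1 * ?g x + 1 * ?h x)" by simp
    also have "\<dots> = abs_l2 ?g + abs_l2 ?h" unfolding abs_l2_lincomb[OF g(2) h(2)] by simp
    finally show ?thesis .
  qed
  ultimately show ?thesis using \<mu> by (simp add: energy_def A2.E_add)
qed

text \<open>With positive part \<open>g\<close> and negative part \<open>h\<close>, the energies of
  \<open>f\<close> and of its absolute value differ only in the sign of the mixed term. Since
  \<open>g h = 0\<close>, that term is minus the pairing of \<open>J g\<close> with
  \<open>h\<close>, and positivity of the resolvent settles its sign.\<close>

lemma energy_abs:
  assumes f: "f \<in> Lp 1" "f \<in> Lp 2" and \<mu>: "\<mu> > 0"
  shows "energy \<mu> (\<lambda>x. \<bar>f x\<bar>) \<le> energy \<mu> f"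
proof -
  let ?g = "\<lambda>x. max (f x) 0" and ?h = "\<lambda>x. max (- f x) 0"
  have g: "?g \<in> Lp 1" "?g \<in> Lp 2" using f Lp_min_max(2)[of f _ 0] by auto
  have h: "?h \<in> Lp 1" "?h \<in> Lp 2" using f Lp_min_max(3)[of f _ 0] by auto
  define k where "k = rep_l2 (A2.J \<mu> (abs_l2 ?g))"
  have k: "k \<in> Lp 2" "abs_l2 k = A2.J \<mu> (abs_l2 ?g)" by (simp_all add: k_def rep_l2_Lp abs_rep_l2)
  have "AE x in lborel. 0 \<le> rep_l1 (A1.J \<mu> (abs_l1 ?g)) x" by (rule J1_nonneg[OF g(1) _ \<mu>]) simp
  with coherent_J[OF coherent_abs[OF g], of \<mu>] have "AE x in lborel. 0 \<le> k x"
    unfolding coherent_def ae_eq_def k_def by eventually_elim simp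
  then have "AE x in lborel. 0 \<le> - ((?g x - k x) * ?h x)"
    by eventually_elim (auto simp: max_def mult_nonneg_nonpos)
  then have "0 \<le> - L2_inner (\<lambda>x. ?g x - k x) ?h"
    unfolding L2_inner_def integral_minus[symmetric] by (rule integral_nonneg_AE)
  also have "L2_inner (\<lambda>x. ?g x - k x) ?h = (abs_l2 ?g - A2.J \<mu> (abs_l2 ?g)) \<bullet> abs_l2 ?h"
    using g h k by (simp add: inner_abs_l2[symmetric] abs_l2_diff Lp_diff)
  finally have neg: "(abs_l2 ?g - A2.J \<mu> (abs_l2 ?g)) \<bullet> abs_l2 ?h \<le> 0" by simp
  have "abs_l2 f = abs_l2 (\<lambda>x. 1 * ?g x + (-1) * ?h x)" "abs_l2 (\<lambda>x. \<bar>f x\<bar>) = abs_l2 (\<lambda>x. 1 * ?g x + 1 * ?h x)"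
    by (auto intro!: arg_cong[where f = abs_l2] simp: max_def)
  then have eq: "abs_l2 f = abs_l2 ?g + (-1) *\<^sub>R abs_l2 ?h" "abs_l2 (\<lambda>x. \<bar>f x\<bar>) = abs_l2 ?g + abs_l2 ?h"
    unfolding abs_l2_lincomb[OF g(2) h(2)] by simp_all
  have "A2.E \<mu> ((-1) *\<^sub>R y) = A2.E \<mu> y" for y by (simp add: A2.E_def A2.J_scale[of \<mu> "-1", simplified] inner_diff)
  then have "energy \<mu> f - energy \<mu> (\<lambda>x. \<bar>f x\<bar>) = - (4 / \<mu>) * ((abs_l2 ?g - A2.J \<mu> (abs_l2 ?g)) \<bullet> abs_l2 ?h)"
    unfolding energy_def eq A2.E_add by simp
  also have "\<dots> \<ge> 0" using neg \<mu> by (intro mult_nonpos_nonpos) auto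
  finally show ?thesis by simp
qed

end

section \<open>Smoothing, Sobolev and Nash inequalities\<close>

text \<open>The choice \<open>t^(1 + \<kappa>) = F^2 / M\<close> makes
  \<open>t powr (- \<kappa>) * F^2\<close> and \<open>t * M\<close> both equal to the product on the
  right, whence the constant \<open>C + 1\<close>. If \<open>F\<close> or \<open>M\<close> vanishes
  there is no balance, and large or small times show that \<open>Y \<le> 0\<close>.\<close>

lemma optimize_time:
  fixes \<kappa> C F M Y :: real
  assumes pos: "\<kappa> > 0" "C > 0" "F \<ge> 0" "M \<ge> 0"
    and bd: "\<And>t. t > 0 \<Longrightarrow> Y \<le> C * t powr (- \<kappa>) * F\<^sup>2 + t * M"
  shows "Y \<le> (C + 1) * F powr (2 / (1 + \<kappa>)) * M powr (\<kappa> / (1 + \<kappa>))"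
proof (cases "F = 0 \<or> M = 0")
  case True
  have "Y \<le> 0"
  proof (rule ccontr)
    assume "\<not> Y \<le> 0"
    then have Y: "Y > 0" by simp
    show False
    proof (cases "M = 0")
      case M: True
      show False
      proof (cases "F = 0")
        case False
        \<comment> \<open>With \<open>t = r powr (1 / \<kappa>)\<close> the bound
          \<open>C t powr (- \<kappa>) F^2\<close> equals \<open>Y / 2\<close>, which contradicts
          positivity of \<open>Y\<close>.\<close>
        define r where "r = 2 * C * F\<^sup>2 / Y"
        have r: "r > 0" using Y pos False by (simp add: r_def)
        have "(r powr (1 / \<kappa>)) powr (- \<kappa>) = 1 / r" using r pos by (simp add: powr_powr powr_minus_divide)
        then have "Y \<le> C * (1 / r) * F\<^sup>2" using bd[of "r powr (1 / \<kappa>)"] r M by simp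
        also have "\<dots> = Y / 2" using Y pos False by (simp add: r_def)
        finally show False using Y by simp
      qed (use bd[of 1] M Y in simp)
    next
      case M: False
      then have "F = 0" using True by simp
      then show False using bd[of "Y / (2 * M)"] Y M pos by simp
    qed
  qed
  then show ?thesis using True by auto
next
  case False
  then have FM: "F > 0" "M > 0" using pos by auto
  define a b where "a = ln F" and "b = ln M"
  have ab: "F = exp a" "M = exp b" using FM by (simp_all add: a_def b_def)
  define t where "t = exp ((2 * a - b) / (1 + \<kappa>))"
  have k: "1 + \<kappa> \<noteq> 0" using pos by simp
  have e: "exp u powr v = exp (u * v)" for u v :: real by (simp add: powr_def mult.commute)
  have 1: "t powr (- \<kappa>) * F\<^sup>2 = F powr (2 / (1 + \<kappa>)) * M powr (\<kappa> / (1 + \<kappa>))"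
    unfolding t_def ab e exp_add[symmetric] exp_double[symmetric] using k by (simp add: divide_simps) (simp add: algebra_simps)
  have 2: "t * M = F powr (2 / (1 + \<kappa>)) * M powr (\<kappa> / (1 + \<kappa>))"
    unfolding t_def ab e exp_add[symmetric] using k by (simp add: divide_simps) (simp add: algebra_simps)
  show ?thesis using bd[of t] 1 2 by (simp add: t_def algebra_simps)
qed

lemma weighted_powr_le:
  fixes x y \<theta> :: real
  assumes "x \<ge> 0" "y \<ge> 0" "0 < \<theta>" "\<theta> < 1"
  shows "x powr \<theta> * y powr (1 - \<theta>) \<le> \<theta> * x + (1 - \<theta>) * y"
proof (cases "x = 0 \<or> y = 0")
  case False
  then show ?thesis using Youngs_inequality_0[of \<theta> "1 - \<theta>" x y] assms by simp
qed (use assms in auto)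

text \<open>A discrete Hoelder inequality: after division by \<open>T\<close> and \<open>M\<close>,
  weighted arithmetic and geometric means bound the sum by
  \<open>K * T powr (2 * \<theta>) * M powr (1 - \<theta>)\<close>. As
  \<open>2 * \<theta> < 1\<close>, the resulting power of \<open>s\<close> is absorbed into the left
  side, which produces the exponent \<open>1 / (1 - 2 * \<theta>)\<close>.\<close>

lemma level_sum_bound:
  fixes a m :: "nat \<Rightarrow> real"
  assumes nonneg: "\<And>j. 0 \<le> a j" "\<And>j. 0 \<le> m j" and K: "K \<ge> 0" and \<theta>: "0 < \<theta>" "2 * \<theta> < 1"
    and step: "\<And>j. a (Suc j) \<le> K * a j powr (2 * \<theta>) * m j powr (1 - \<theta>)"
    and M: "(\<Sum>j<n. m j) \<le> M"
  shows "(\<Sum>j<n. a (Suc j)) \<le> a 0 + (K * 2 powr (2 * \<theta>) * M powr (1 - \<theta>)) powr (1 / (1 - 2 * \<theta>))"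
proof -
  define s where "s = (\<Sum>j<n. a (Suc j))"
  define T where "T = a 0 + s"
  have s0: "s \<ge> 0" unfolding s_def by (intro sum_nonneg nonneg)
  have m_le: "m j \<le> M" if "j < n" for j
    using member_le_sum[of j "{..<n}" m] that nonneg M by force
  have a_le: "(\<Sum>j<n. a j) \<le> T"
  proof -
    have "(\<Sum>j<n. a j) \<le> (\<Sum>j<Suc n. a j)" using nonneg by simp
    also have "\<dots> = T" unfolding T_def s_def by (rule sum.lessThan_Suc_shift)
    finally show ?thesis .
  qed
  show ?thesis
  \<comment> \<open>Either the lowest level dominates and the claim is immediate, or
    \<open>T \<le> 2 * s\<close>; the latter is the origin of the factor
    \<open>2 powr (2 * \<theta>)\<close>.\<close>
  proof (cases "s \<le> a 0")
    case True
    then show ?thesis unfolding s_def[symmetric] by (simp add: add_increasing2)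
  next
    case False
    then have sp: "s > 0" and T: "T > 0" "T \<le> 2 * s" using s0 nonneg(1)[of 0] by (auto simp: T_def)
    have M0: "M > 0"
    proof (rule ccontr)
      assume "\<not> M > 0"
      then have "m j = 0" if "j < n" for j using m_le[OF that] nonneg(2)[of j] by linarith
      then have "a (Suc j) \<le> 0" if "j < n" for j using step[of j] that by simp
      then have "s \<le> 0" unfolding s_def by (intro sum_nonpos) auto
      then show False using sp by simp
    qed
    have summand: "a (Suc j) \<le> K * T powr (2 * \<theta>) * M powr (1 - \<theta>) * (\<theta> * (a j / T) + (1 - \<theta>) * (m j / M))" if j: "j < n" for j
    proof -
      have aT: "a j / T \<le> 1"
        using member_le_sum[of j "{..<n}" a] j nonneg a_le T by (force simp: divide_le_eq)
      have "a j powr (2 * \<theta>) * m j powr (1 - \<theta>)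
          = T powr (2 * \<theta>) * M powr (1 - \<theta>) * ((a j / T) powr (2 * \<theta>) * (m j / M) powr (1 - \<theta>))"
        using T M0 nonneg by (simp add: powr_divide)
      \<comment> \<open>The exponents \<open>2 * \<theta>\<close> and \<open>1 - \<theta>\<close>
        add up to more than 1. Reading the first as \<theta> applied to a square gives conjugate
        weights, and the square is dropped because \<open>a j / T \<le> 1\<close>.\<close>
      also have "(a j / T) powr (2 * \<theta>) = ((a j / T)\<^sup>2) powr \<theta>"
        using T nonneg(1)[of j] by (cases "a j = 0") (simp_all add: powr_powr[symmetric] powr_numeral)
      also have "((a j / T)\<^sup>2) powr \<theta> * (m j / M) powr (1 - \<theta>) \<le> \<theta> * (a j / T)\<^sup>2 + (1 - \<theta>) * (m j / M)"
        using nonneg M0 \<theta> by (intro weighted_powr_le) auto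
      also have "\<dots> \<le> \<theta> * (a j / T) + (1 - \<theta>) * (m j / M)"
      proof -
        have "(a j / T)\<^sup>2 \<le> a j / T"
          unfolding power2_eq_square using aT nonneg(1)[of j] T by (intro mult_left_le) auto
        then show ?thesis using \<theta> by (intro add_right_mono mult_left_mono) auto
      qed
      finally have "a j powr (2 * \<theta>) * m j powr (1 - \<theta>) \<le> T powr (2 * \<theta>) * M powr (1 - \<theta>) * (\<theta> * (a j / T) + (1 - \<theta>) * (m j / M))"
        by (simp add: mult_left_mono)
      from mult_left_mono[OF this K] show ?thesis using step[of j] by (simp add: mult.assoc)
    qed
    have "s \<le> (\<Sum>j<n. K * T powr (2 * \<theta>) * M powr (1 - \<theta>) * (\<theta> * (a j / T) + (1 - \<theta>) * (m j / M)))"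
      unfolding s_def by (intro sum_mono summand) simp
    also have "\<dots> = K * T powr (2 * \<theta>) * M powr (1 - \<theta>) * (\<theta> * ((\<Sum>j<n. a j) / T) + (1 - \<theta>) * ((\<Sum>j<n. m j) / M))"
      by (simp add: sum_distrib_left[symmetric] sum.distrib sum_divide_distrib[symmetric])
    also have "\<dots> \<le> K * T powr (2 * \<theta>) * M powr (1 - \<theta>) * (\<theta> * 1 + (1 - \<theta>) * 1)"
      using K \<theta> a_le M T M0 by (intro mult_left_mono add_mono) auto
    also have "\<dots> \<le> K * (2 * s) powr (2 * \<theta>) * M powr (1 - \<theta>)"
      using K T \<theta> by (simp add: mult_left_mono mult_right_mono powr_mono2)
    also have "\<dots> = (K * 2 powr (2 * \<theta>) * M powr (1 - \<theta>)) * s powr (2 * \<theta>)"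
      using sp by (simp add: powr_mult)
    finally have le: "s \<le> (K * 2 powr (2 * \<theta>) * M powr (1 - \<theta>)) * s powr (2 * \<theta>)" .
    have "s powr (1 - 2 * \<theta>) * s powr (2 * \<theta>) = s" using sp by (simp add: powr_add[symmetric])
    with le have "s powr (1 - 2 * \<theta>) * s powr (2 * \<theta>) \<le> (K * 2 powr (2 * \<theta>) * M powr (1 - \<theta>)) * s powr (2 * \<theta>)" by simp
    then have "s powr (1 - 2 * \<theta>) \<le> K * 2 powr (2 * \<theta>) * M powr (1 - \<theta>)" using sp by simp
    then have "(s powr (1 - 2 * \<theta>)) powr (1 / (1 - 2 * \<theta>)) \<le> (K * 2 powr (2 * \<theta>) * M powr (1 - \<theta>)) powr (1 / (1 - 2 * \<theta>))"
      using \<theta> by (intro powr_mono2) auto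
    then have "s \<le> (K * 2 powr (2 * \<theta>) * M powr (1 - \<theta>)) powr (1 / (1 - 2 * \<theta>))"
      using sp \<theta> by (simp add: powr_powr)
    then show ?thesis unfolding s_def[symmetric] using nonneg(1)[of 0] by simp
  qed
qed

text \<open>The constant \<open>L\<close> solves
  \<open>L / c = (L * 2 powr (- \<kappa>)) powr (1 + 1 / \<kappa>)\<close>, so the bound
  \<open>L * t powr (- \<kappa>)\<close> reproduces itself exactly when the time is doubled.\<close>

lemma doubling_decay:
  fixes Y :: "real \<Rightarrow> real"
  assumes \<kappa>: "\<kappa> > 0" and c: "c > 0" and nonneg: "\<And>t. t > 0 \<Longrightarrow> 0 \<le> Y t" and bd: "\<And>t. t > 0 \<Longrightarrow> Y t \<le> B"
    and step: "\<And>t. t > 0 \<Longrightarrow> t * c * Y (2 * t) powr (1 + 1 / \<kappa>) \<le> Y t" and t: "t > 0"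
  shows "Y t \<le> 2 powr (\<kappa> * (\<kappa> + 1)) * c powr (- \<kappa>) * t powr (- \<kappa>)"
proof -
  define L where "L = 2 powr (\<kappa> * (\<kappa> + 1)) * c powr (- \<kappa>)"
  have L: "L > 0" using c by (simp add: L_def)
  have double: "Y (2 * s) \<le> L * (2 * s) powr (- \<kappa>)" if s: "s > 0" and Ys: "Y s \<le> L * s powr (- \<kappa>)" for s
  proof -
    have "Y (2 * s) powr (1 + 1 / \<kappa>) \<le> L * s powr (- \<kappa>) / (s * c)"
      using step[OF s] Ys s c by (simp add: field_simps)
    also have "\<dots> = (L * (2 * s) powr (- \<kappa>)) powr (1 + 1 / \<kappa>)"
    proof -
      define u v where "u = ln s" and "v = ln c"
      have sc: "s = exp u" "c = exp v" using s c by (simp_all add: u_def v_def)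
      define l where "l = ln (2::real)"
      have two: "(2::real) = exp l" by (simp add: l_def)
      have e: "exp x powr y = exp (x * y)" for x y :: real by (simp add: powr_def mult.commute)
      show ?thesis unfolding L_def sc unfolding two
        unfolding e exp_add[symmetric] exp_diff[symmetric] using \<kappa> by (simp add: field_simps)
    qed
    finally have "Y (2 * s) powr (1 + 1 / \<kappa>) \<le> (L * (2 * s) powr (- \<kappa>)) powr (1 + 1 / \<kappa>)" .
    moreover have "(L * (2 * s) powr (- \<kappa>)) powr (1 + 1 / \<kappa>) < Y (2 * s) powr (1 + 1 / \<kappa>)"
      if "L * (2 * s) powr (- \<kappa>) < Y (2 * s)"
      using that L s \<kappa> by (intro powr_less_mono2) (auto intro: add_pos_pos)
    ultimately show ?thesis by linarith
  qed
  \<comment> \<open>At a sufficiently small time the claimed bound exceeds \<open>B\<close>, so the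
    doubling starts for free. For this reason \<open>B\<close> leaves no trace in the
    constant.\<close>
  have "\<exists>n. B * (t / 2 ^ n) powr \<kappa> < L"
  proof -
    have "(\<lambda>n. t * (1 / 2) ^ n) \<longlonglongrightarrow> t * 0" by (intro tendsto_intros LIMSEQ_power_zero) simp
    then have "(\<lambda>n. t / 2 ^ n) \<longlonglongrightarrow> 0" by (simp add: power_one_over)
    then have "(\<lambda>n. B * (t / 2 ^ n) powr \<kappa>) \<longlonglongrightarrow> B * 0 powr \<kappa>"
      using \<kappa> t by (intro tendsto_intros tendsto_powr') (auto intro!: always_eventually)
    then have "(\<lambda>n. B * (t / 2 ^ n) powr \<kappa>) \<longlonglongrightarrow> 0" by simp
    from order_tendstoD(2)[OF this L] show ?thesis by (auto simp: eventually_sequentially)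
  qed
  then obtain n where n: "B * (t / 2 ^ n) powr \<kappa> < L" by blast
  have "Y (t / 2 ^ n * 2 ^ k) \<le> L * (t / 2 ^ n * 2 ^ k) powr (- \<kappa>)" for k
  proof (induction k)
    case 0
    have s: "t / 2 ^ n > 0" using t by simp
    have "Y (t / 2 ^ n) * (t / 2 ^ n) powr \<kappa> \<le> B * (t / 2 ^ n) powr \<kappa>"
      using bd[OF s] by (intro mult_right_mono) auto
    then have "Y (t / 2 ^ n) * (t / 2 ^ n) powr \<kappa> \<le> L" using n by linarith
    moreover have "(t / 2 ^ n) powr \<kappa> > 0" using t by simp
    ultimately have "Y (t / 2 ^ n) \<le> L / (t / 2 ^ n) powr \<kappa>" by (simp add: pos_le_divide_eq)
    then show ?case by (simp add: powr_minus_divide)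
  next
    case (Suc k)
    from double[OF _ Suc] t show ?case by (simp add: mult.commute mult.left_commute)
  qed
  from this[of n] show ?thesis by (simp add: L_def)
qed

text \<open>The Hoelder inequality, obtained by integrating the weighted mean inequality for
  \<open>\<bar>f\<bar> / P\<close> and \<open>\<bar>f\<bar> powr q / R\<close>. The relation between
  \<theta> and \<open>q\<close> says \<open>a + q * (1 - a) = 2\<close> for
  \<open>a = 2 * \<theta>\<close>, so the pointwise product of powers is the square of
  \<open>f\<close>.\<close>

lemma Lp_interpolation:
  fixes f :: "'a::euclidean_space \<Rightarrow> real"
  assumes f: "f \<in> Lp 1" "f \<in> Lp q" and \<theta>: "0 < \<theta>" "\<theta> < 1" and q: "q > 1" "2 * \<theta> + 2 * (1 - \<theta>) / q = 1"
  shows "Lp_norm 2 f \<le> Lp_norm 1 f powr \<theta> * Lp_norm q f powr (1 - \<theta>)"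
proof -
  define a P R where "a = 2 * \<theta>" and "P = (LINT x|lborel. \<bar>f x\<bar>)" and "R = (LINT x|lborel. \<bar>f x\<bar> powr q)"
  have a: "0 < a" "a < 1" and a1: "1 - a = 2 * (1 - \<theta>) / q" 
    using \<theta> q by (auto simp: a_def) (smt (verit) divide_pos_pos)
  have [measurable]: "f \<in> borel_measurable borel" using Lp_measurable[OF f(1)] by simp
  have int: "integrable lborel (\<lambda>x. \<bar>f x\<bar>)" "integrable lborel (\<lambda>x. \<bar>f x\<bar> powr q)"
    using f by (auto simp: Lp1_iff) (simp add: Lp_def)
  have P0: "P \<ge> 0" "R \<ge> 0" by (simp_all add: P_def R_def)
  have exps: "(P powr a * R powr (1 - a)) powr (1/2) = Lp_norm 1 f powr \<theta> * Lp_norm q f powr (1 - \<theta>)"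
  proof -
    have "2 * (1 - \<theta>) / q * (1 / 2) = 1 / q * (1 - \<theta>)" using q(1) by (simp add: field_simps)
    then show ?thesis
      using P0 unfolding a1 Lp_norm_def P_def[symmetric] R_def[symmetric]
      by (simp only: powr_mult powr_ge_zero powr_powr) (simp add: a_def P_def field_simps)
  qed
  have "(LINT x|lborel. (f x)\<^sup>2) \<le> P powr a * R powr (1 - a)"
  proof (cases "P = 0 \<or> R = 0")
    case True
    have "AE x in lborel. f x = 0"
    proof (cases "P = 0")
      case True
      then show ?thesis using integral_nonneg_eq_0_iff_AE[OF int(1)] by (simp add: P_def)
    next
      case False
      with \<open>P = 0 \<or> R = 0\<close> have "R = 0" by simp
      then show ?thesis using integral_nonneg_eq_0_iff_AE[OF int(2)] by (simp add: R_def)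
    qed
    then have "(LINT x|lborel. (f x)\<^sup>2) = (LINT x::'a|lborel. 0)" by (intro integral_cong_AE) auto
    then show ?thesis by simp
  next
    case False
    then have PR: "P > 0" "R > 0" using P0 by auto
    have pt: "(f x)\<^sup>2 \<le> P powr a * R powr (1 - a) * (a * (\<bar>f x\<bar> / P) + (1 - a) * (\<bar>f x\<bar> powr q / R))" for x
    proof -
      have "a + q * (1 - a) = 2" unfolding a1 using q by (simp add: a_def)
      then have "(f x)\<^sup>2 = \<bar>f x\<bar> powr a * (\<bar>f x\<bar> powr q) powr (1 - a)"
        by (simp add: powr_powr powr_add[symmetric] powr_numeral)
      also have "\<dots> = P powr a * R powr (1 - a) * ((\<bar>f x\<bar> / P) powr a * (\<bar>f x\<bar> powr q / R) powr (1 - a))"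
        using PR by (simp add: powr_divide)
      also have "\<dots> \<le> P powr a * R powr (1 - a) * (a * (\<bar>f x\<bar> / P) + (1 - a) * (\<bar>f x\<bar> powr q / R))"
        using PR a by (intro mult_left_mono weighted_powr_le) auto
      finally show ?thesis .
    qed
    have "(LINT x|lborel. (f x)\<^sup>2) \<le> (LINT x|lborel. P powr a * R powr (1 - a) * (a * (\<bar>f x\<bar> / P) + (1 - a) * (\<bar>f x\<bar> powr q / R)))"
      by (rule integral_mono') (use int pt a PR in auto)
    also have "\<dots> = P powr a * R powr (1 - a) * (a * (P / P) + (1 - a) * (R / R))"
      using int by (simp add: P_def R_def)
    finally show ?thesis using PR by simp
  qed
  then have "sqrt (LINT x|lborel. (f x)\<^sup>2) \<le> sqrt (P powr a * R powr (1 - a))" by simp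
  also have "\<dots> = (P powr a * R powr (1 - a)) powr (1/2)" by (simp add: powr_half_sqrt)
  finally show ?thesis unfolding exps Lp_norm2 .
qed

section \<open>From smoothing to the Sobolev inequality\<close>

context admissible
begin

definition smoothing :: "real \<Rightarrow> real \<Rightarrow> bool" where
  "smoothing \<kappa> C \<longleftrightarrow> (\<forall>f\<in>Lp 1. \<forall>t>0. AE x in lborel. \<bar>heat_semigroup A t f x\<bar> \<le> C * t powr (- \<kappa>) * Lp_norm 1 f)"

lemma smoothing_pairing:
  assumes sm: "smoothing \<kappa> C" and C: "C \<ge> 0" and f: "f \<in> Lp 1" "f \<in> Lp 2" and t: "t > 0"
  shows "A2.S t (abs_l2 f) \<bullet> abs_l2 f \<le> C * t powr (- \<kappa>) * (Lp_norm 1 f)\<^sup>2"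
proof -
  define g where "g = rep_l2 (A2.S t (abs_l2 f))"
  have g: "g \<in> Lp 2" "abs_l2 g = A2.S t (abs_l2 f)" by (simp_all add: g_def rep_l2_Lp abs_rep_l2)
  have "coherent (A1.S t (abs_l1 f)) (A2.S t (abs_l2 f))" using coherent_S[OF coherent_abs[OF f]] t by simp
  then have "ae_eq (heat_semigroup A t f) g"
    using coherent_abs_iff[OF heat_semigroup(1) g(1)] heat_semigroup(2) f t by (simp add: g(2))
  then have "AE x in lborel. \<bar>g x\<bar> \<le> C * t powr (- \<kappa>) * Lp_norm 1 f"
  proof -
    have "AE x in lborel. \<bar>heat_semigroup A t f x\<bar> \<le> C * t powr (- \<kappa>) * Lp_norm 1 f"
      using sm f t unfolding smoothing_def by blast
    with \<open>ae_eq (heat_semigroup A t f) g\<close> show ?thesis unfolding ae_eq_def by eventually_elim simp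
  qed
  then have "AE x in lborel. g x * f x \<le> C * t powr (- \<kappa>) * Lp_norm 1 f * \<bar>f x\<bar>"
  proof eventually_elim
    case (elim x)
    have "g x * f x \<le> \<bar>g x\<bar> * \<bar>f x\<bar>" by (metis abs_ge_self abs_mult)
    also have "\<dots> \<le> C * t powr (- \<kappa>) * Lp_norm 1 f * \<bar>f x\<bar>" using elim by (rule mult_right_mono) simp
    finally show ?case .
  qed
  then have "L2_inner g f \<le> (LINT x|lborel. C * t powr (- \<kappa>) * Lp_norm 1 f * \<bar>f x\<bar>)"
    unfolding L2_inner_def using f by (intro integral_mono_AE Lp2_mult_integrable[OF g(1)]) (auto simp: Lp1_iff)
  also have "\<dots> = C * t powr (- \<kappa>) * (Lp_norm 1 f)\<^sup>2" by (simp add: Lp_norm1 power2_eq_square)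
  finally show ?thesis using inner_abs_l2[OF g(1) f(2)] g(2) by simp
qed

text \<open>The bound \<open>norm f ^ 2 \<le> C t powr (- \<kappa>) (Lp_norm 1 f)^2 + t M\<close> is optimized over \<open>t\<close>.\<close>

lemma smoothing_imp_nash:
  assumes sm: "smoothing \<kappa> C" and C: "C > 0" and \<kappa>: "\<kappa> > 0" and f: "f \<in> Lp 1" "f \<in> Lp 2"
    and M: "M \<ge> 0" "\<And>\<mu>. \<mu> > 0 \<Longrightarrow> energy \<mu> f \<le> M"
  shows "(Lp_norm 2 f)\<^sup>2 \<le> (C + 1) * Lp_norm 1 f powr (2 / (1 + \<kappa>)) * M powr (\<kappa> / (1 + \<kappa>))"
proof (rule optimize_time[OF \<kappa> C _ M(1)])
  show "0 \<le> Lp_norm 1 f" by (simp add: Lp_norm1)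
  fix t :: real assume t: "t > 0"
  let ?y = "abs_l2 f"
  have "(?y - A2.S t ?y) \<bullet> ?y \<le> t * M" using A2.S_decrement[OF t, of ?y M] M(2) by (simp add: energy_def)
  moreover have "A2.S t ?y \<bullet> ?y \<le> C * t powr (- \<kappa>) * (Lp_norm 1 f)\<^sup>2"
    using smoothing_pairing[OF sm _ f t] C by simp
  moreover have "(Lp_norm 2 f)\<^sup>2 = ?y \<bullet> ?y" using norm_abs_l2[OF f(2)] by (simp add: dot_square_norm)
  ultimately show "(Lp_norm 2 f)\<^sup>2 \<le> C * t powr (- \<kappa>) * (Lp_norm 1 f)\<^sup>2 + t * M" by (simp add: inner_diff)
qed


text \<open>Cutting \<open>max (f - c) 0\<close> at height \<open>c\<close> leaves the remainder
  \<open>max (f - 2 * c) 0\<close>, which is again of the same shape. Dyadic levels are thus those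
  at which \<open>energy_truncation\<close> can be iterated; the part of \<open>f\<close> below
  \<epsilon> is discarded.\<close>

lemma energy_levels:
  assumes f: "f \<in> Lp 1" "f \<in> Lp 2" "\<And>x. 0 \<le> f x" and \<epsilon>: "\<epsilon> > 0" and \<mu>: "\<mu> > 0"
  shows "(\<Sum>j<m. energy \<mu> (\<lambda>x. min (max (f x - \<epsilon> * 2 ^ j) 0) (\<epsilon> * 2 ^ j))) \<le> energy \<mu> f"
proof -
  have L: "(\<lambda>x. max (f x - c) 0) \<in> Lp 1" "(\<lambda>x. max (f x - c) 0) \<in> Lp 2" if "c \<ge> 0" for c
    using f that by (auto intro: Lp_min_max)
  have "(\<Sum>j<m. energy \<mu> (\<lambda>x. min (max (f x - \<epsilon> * 2 ^ j) 0) (\<epsilon> * 2 ^ j))) + energy \<mu> (\<lambda>x. max (f x - \<epsilon> * 2 ^ m) 0)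
    \<le> energy \<mu> f"
  proof (induction m)
    case 0
    show ?case
      using energy_truncation[OF f, of \<epsilon> \<mu>] energy_nonneg[OF \<mu>, of "\<lambda>x. min (f x) \<epsilon>"] \<epsilon> \<mu> by simp
  next
    case (Suc m)
    let ?c = "\<epsilon> * 2 ^ m"
    have c: "?c > 0" using \<epsilon> by simp
    have "(\<lambda>x. max (max (f x - ?c) 0 - ?c) 0) = (\<lambda>x. max (f x - \<epsilon> * 2 ^ Suc m) 0)"
      using c by (auto simp: max_def fun_eq_iff)
    then show ?case
      using energy_truncation[OF L(1,2), of ?c ?c \<mu>] c \<mu> Suc by simp
  qed
  then show ?thesis using energy_nonneg[OF \<mu>, of "\<lambda>x. max (f x - \<epsilon> * 2 ^ m) 0"] by linarith
qed

text \<open>Monotonicity turns the supremum over \<mu> into a limit along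
  \<open>1 / (i + 1)\<close>. Limits respect finite sums, so the bound on the sum of slice energies
  at each fixed \<mu> carries over to the sum of their suprema.\<close>

lemma energy_limit:
  assumes "\<And>\<mu>. \<mu> > 0 \<Longrightarrow> energy \<mu> f \<le> M"
  shows "\<exists>e. (\<lambda>i. energy (1 / real (Suc i)) f) \<longlonglongrightarrow> e \<and> 0 \<le> e \<and> (\<forall>\<mu>>0. energy \<mu> f \<le> e)"
proof -
  let ?e = "\<lambda>i. energy (1 / real (Suc i)) f"
  have inc: "incseq ?e"
    unfolding energy_def by (intro incseq_SucI A2.E_antimono) (auto simp: field_simps)
  have "Bseq ?e"
    using assms energy_nonneg by (intro BseqI'[of _ M]) (auto simp: abs_le_iff intro: order_trans[of _ 0])
  then obtain e where e: "?e \<longlonglongrightarrow> e" using inc by (auto simp: Bseq_monoseq_convergent incseq_imp_monoseq convergent_def dest!: Bseq_monoseq_convergent)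
  have ge: "?e i \<le> e" for i using incseq_le[OF inc e] .
  have "energy \<mu> f \<le> e" if \<mu>: "\<mu> > 0" for \<mu>
  proof -
    obtain i where "1 / real (Suc i) \<le> \<mu>"
      using nat_approx_posE[OF \<mu>] by (metis less_imp_le)
    then have "energy \<mu> f \<le> ?e i" unfolding energy_def by (intro A2.E_antimono) auto
    then show ?thesis using ge[of i] by linarith
  qed
  moreover have "0 \<le> e" using energy_nonneg[of "1 / real (Suc 0)" f] ge[of 0] by simp
  ultimately show ?thesis using e by blast
qed

text \<open>The truncation method: the Nash inequality is applied to the slices
  \<open>min (max (f - \<tau>) 0) \<tau>\<close> at the dyadic levels \<open>\<tau> = \<epsilon> 2\<^sup>j\<close>, whose energies add up to at most that of \<open>f\<close>.\<close>

lemma nash_imp_level_sum: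
  assumes \<kappa>: "\<kappa> > 1" and K: "K \<ge> 0"
    and nash: "\<And>f M. f \<in> Lp 1 \<Longrightarrow> f \<in> Lp 2 \<Longrightarrow> M \<ge> 0 \<Longrightarrow> (\<And>\<mu>. \<mu> > 0 \<Longrightarrow> energy \<mu> f \<le> M) \<Longrightarrow>
      (Lp_norm 2 f)\<^sup>2 \<le> K * Lp_norm 1 f powr (2 * \<theta>) * M powr (1 - \<theta>)"
    and \<theta>: "\<theta> = 1 / (1 + \<kappa>)" and q: "q = 2 * \<kappa> / (\<kappa> - 1)"
    and f: "f \<in> Lp 1" "f \<in> Lp 2" "\<And>x. 0 \<le> f x"
    and M: "\<And>\<mu>. \<mu> > 0 \<Longrightarrow> energy \<mu> f \<le> M" and \<epsilon>: "\<epsilon> > 0"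
  defines "\<tau> \<equiv> \<lambda>j. \<epsilon> * 2 ^ j"
  defines "vol \<equiv> \<lambda>j. LINT x|lborel. indicat_real {x. \<tau> j \<le> f x} x"
  shows "integrable lborel (\<lambda>x. indicat_real {x. \<tau> j \<le> f x} x)"
    and "(\<Sum>j<m. \<tau> (Suc j) powr q * vol (Suc j))
      \<le> \<epsilon> powr (q - 1) * Lp_norm 1 f + (2 powr q * K * 2 powr (2 * \<theta>) * M powr (1 - \<theta>)) powr (1 / (1 - 2 * \<theta>))"
proof -
  have [measurable]: "f \<in> borel_measurable borel" using Lp_measurable[OF f(1)] by simp
  have \<tau>: "\<tau> j > 0" "\<tau> (Suc j) = 2 * \<tau> j" for j using \<epsilon> by (auto simp: \<tau>_def)
  have int: "integrable lborel (\<lambda>x. indicat_real {x. \<tau> j \<le> f x} x)" for j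
  proof (rule Bochner_Integration.integrable_bound[of _ "\<lambda>x. f x / \<tau> j"])
    show "AE x in lborel. norm (indicat_real {x. \<tau> j \<le> f x} x) \<le> norm (f x / \<tau> j)"
      using \<tau>(1)[of j] f(3) by (intro always_eventually allI) (auto simp: indicator_def)
  qed (use f in \<open>auto simp: Lp1_iff\<close>)
  then show "integrable lborel (\<lambda>x. indicat_real {x. \<tau> j \<le> f x} x)" .
  have vol0: "vol j \<ge> 0" for j by (simp add: vol_def)
  define g where "g j x = min (max (f x - \<tau> j) 0) (\<tau> j)" for j x
  have g: "g j \<in> Lp 1" "g j \<in> Lp 2" for j
    unfolding g_def[abs_def] using f \<tau>(1)[of j] by (auto intro!: Lp_min_max less_imp_le)
  have sum_le: "(\<Sum>j<m. energy \<mu> (g j)) \<le> M" if "\<mu> > 0" for m \<mu>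
    using energy_levels[OF f \<epsilon> that, of m] M[OF that] by (simp add: g_def[abs_def] \<tau>_def)
  have "energy \<mu> (g j) \<le> M" if "\<mu> > 0" for j \<mu>
  proof -
    have "energy \<mu> (g j) \<le> (\<Sum>j<Suc j. energy \<mu> (g j))"
      using energy_nonneg[OF that] by (intro member_le_sum) auto
    then show ?thesis using sum_le[OF that, of "Suc j"] by linarith
  qed
  then have "\<forall>j. \<exists>e. (\<lambda>i. energy (1 / real (Suc i)) (g j)) \<longlonglongrightarrow> e \<and> 0 \<le> e \<and> (\<forall>\<mu>>0. energy \<mu> (g j) \<le> e)"
    using energy_limit by blast
  then obtain e where e: "\<And>j. (\<lambda>i. energy (1 / real (Suc i)) (g j)) \<longlonglongrightarrow> e j" "\<And>j. 0 \<le> e j"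
    "\<And>j \<mu>. \<mu> > 0 \<Longrightarrow> energy \<mu> (g j) \<le> e j" by metis
  have sum_e: "(\<Sum>j<m. e j) \<le> M"
  proof (rule LIMSEQ_le_const2)
    show "(\<lambda>i. \<Sum>j<m. energy (1 / real (Suc i)) (g j)) \<longlonglongrightarrow> (\<Sum>j<m. e j)" by (intro tendsto_sum e)
    show "\<exists>N. \<forall>n\<ge>N. (\<Sum>j<m. energy (1 / real (Suc n)) (g j)) \<le> M" using sum_le by simp
  qed
  \<comment> \<open>The slice \<open>g j\<close> equals \<open>\<tau> j\<close> where
    \<open>f\<close> reaches the next level and vanishes where \<open>f\<close> is below
    \<open>\<tau> j\<close>. Its two norms are therefore bounded from below and from above by
    measures of consecutive superlevel sets.\<close>
  have nash_j: "\<tau> j ^ 2 * vol (Suc j) \<le> K * (\<tau> j * vol j) powr (2 * \<theta>) * e j powr (1 - \<theta>)" for j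
  proof -
    have "\<tau> j ^ 2 * vol (Suc j) = (LINT x|lborel. \<tau> j ^ 2 * indicat_real {x. \<tau> (Suc j) \<le> f x} x)"
      by (simp add: vol_def)
    also have "\<dots> \<le> (LINT x|lborel. (g j x)\<^sup>2)"
    proof (rule integral_mono)
      show "\<tau> j ^ 2 * indicat_real {x. \<tau> (Suc j) \<le> f x} x \<le> (g j x)\<^sup>2" for x
        using \<tau>[of j] by (auto simp: indicator_def g_def)
    qed (use g int in \<open>auto simp: Lp2_iff\<close>)
    also have "\<dots> = (Lp_norm 2 (g j))\<^sup>2" by (simp add: Lp_norm2)
    also have "\<dots> \<le> K * Lp_norm 1 (g j) powr (2 * \<theta>) * e j powr (1 - \<theta>)"
      by (rule nash[OF g e(2) e(3)])
    also have "\<dots> \<le> K * (\<tau> j * vol j) powr (2 * \<theta>) * e j powr (1 - \<theta>)"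
    proof (intro mult_right_mono mult_left_mono powr_mono2 K)
      have "Lp_norm 1 (g j) \<le> (LINT x|lborel. \<tau> j * indicat_real {x. \<tau> j \<le> f x} x)"
        unfolding Lp_norm1
      proof (rule integral_mono)
        show "\<bar>g j x\<bar> \<le> \<tau> j * indicat_real {x. \<tau> j \<le> f x} x" for x
          using \<tau>[of j] by (auto simp: indicator_def g_def)
      qed (use g int in \<open>auto simp: Lp1_iff\<close>)
      then show "Lp_norm 1 (g j) \<le> \<tau> j * vol j" by (simp add: vol_def)
    qed (use \<theta> \<kappa> in \<open>auto simp: Lp_norm1\<close>)
    finally show ?thesis .
  qed
  have th: "0 < \<theta>" "2 * \<theta> < 1" unfolding \<theta> using \<kappa> by (auto simp: divide_less_eq)
  \<comment> \<open>This identity fixes \<open>q\<close>: with weights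
    \<open>\<tau> j powr q\<close> the surplus powers of \<open>\<tau> j\<close> in the Nash
    inequality for a slice are absorbed by \<open>a j powr (2 * \<theta>)\<close>.\<close>
  have qth: "q - 2 + 2 * \<theta> = q * (2 * \<theta>)"
  proof -
    have "\<kappa> - 1 \<noteq> 0" "1 + \<kappa> \<noteq> 0" using \<kappa> by auto
    then show ?thesis unfolding q \<theta> by (simp add: divide_simps)
  qed
  define a where "a j = \<tau> j powr q * vol j" for j
  have step: "a (Suc j) \<le> 2 powr q * K * a j powr (2 * \<theta>) * e j powr (1 - \<theta>)" for j
  proof -
    have "a (Suc j) = 2 powr q * \<tau> j powr (q - 2) * (\<tau> j ^ 2 * vol (Suc j))"
      using \<tau>(1)[of j] unfolding a_def \<tau>(2) by (simp add: powr_mult powr_diff powr_numeral)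
    also have "\<dots> \<le> 2 powr q * \<tau> j powr (q - 2) * (K * (\<tau> j * vol j) powr (2 * \<theta>) * e j powr (1 - \<theta>))"
      by (intro mult_left_mono nash_j) simp
    also have "\<dots> = 2 powr q * K * ((\<tau> j powr (q - 2) * \<tau> j powr (2 * \<theta>)) * vol j powr (2 * \<theta>)) * e j powr (1 - \<theta>)"
      using \<tau>(1)[of j] vol0 by (simp add: powr_mult)
    also have "\<tau> j powr (q - 2) * \<tau> j powr (2 * \<theta>) = (\<tau> j powr q) powr (2 * \<theta>)"
      by (simp add: powr_add[symmetric] powr_powr qth)
    also have "(\<tau> j powr q) powr (2 * \<theta>) * vol j powr (2 * \<theta>) = a j powr (2 * \<theta>)"
      using vol0 by (simp add: a_def powr_mult)
    finally show ?thesis .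
  qed
  have "(\<Sum>j<m. a (Suc j)) \<le> a 0 + (2 powr q * K * 2 powr (2 * \<theta>) * M powr (1 - \<theta>)) powr (1 / (1 - 2 * \<theta>))"
    by (rule level_sum_bound[OF _ e(2) _ th step sum_e]) (use vol0 K in \<open>auto simp: a_def\<close>)
  \<comment> \<open>Chebyshev's inequality at the lowest level. Since \<open>q > 1\<close>, this
    contribution disappears when \<epsilon> tends to 0.\<close>
  moreover have "a 0 \<le> \<epsilon> powr (q - 1) * Lp_norm 1 f"
  proof -
    have "\<epsilon> * vol 0 = (LINT x|lborel. \<epsilon> * indicat_real {x. \<tau> 0 \<le> f x} x)" by (simp add: vol_def)
    also have "\<dots> \<le> Lp_norm 1 f"
      unfolding Lp_norm1
    proof (rule integral_mono)
      show "\<epsilon> * indicat_real {x. \<tau> 0 \<le> f x} x \<le> \<bar>f x\<bar>" for x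
        using f(3)[of x] by (auto simp: indicator_def \<tau>_def)
    qed (use f int in \<open>auto simp: Lp1_iff\<close>)
    finally have "\<epsilon> powr (q - 1) * (\<epsilon> * vol 0) \<le> \<epsilon> powr (q - 1) * Lp_norm 1 f" by (rule mult_left_mono) simp
    moreover have "a 0 = \<epsilon> powr (q - 1) * (\<epsilon> * vol 0)"
      using \<epsilon> by (simp add: a_def \<tau>_def powr_diff)
    ultimately show ?thesis by simp
  qed
  ultimately show "(\<Sum>j<m. \<tau> (Suc j) powr q * vol (Suc j))
      \<le> \<epsilon> powr (q - 1) * Lp_norm 1 f + (2 powr q * K * 2 powr (2 * \<theta>) * M powr (1 - \<theta>)) powr (1 / (1 - 2 * \<theta>))"
    unfolding a_def by linarith
qed

text \<open>The level sums bound the integral over a range of values of \<open>f\<close> that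
  exhausts the positive half-line, and Fatou's lemma passes to all values. Membership in the target
  space is part of the claim, so the integral is taken in the extended nonnegative reals.\<close>

lemma nash_imp_sobolev:
  assumes \<kappa>: "\<kappa> > 1" and K: "K \<ge> 0"
    and nash: "\<And>f M. f \<in> Lp 1 \<Longrightarrow> f \<in> Lp 2 \<Longrightarrow> M \<ge> 0 \<Longrightarrow> (\<And>\<mu>. \<mu> > 0 \<Longrightarrow> energy \<mu> f \<le> M) \<Longrightarrow>
      (Lp_norm 2 f)\<^sup>2 \<le> K * Lp_norm 1 f powr (2 * \<theta>) * M powr (1 - \<theta>)"
    and \<theta>: "\<theta> = 1 / (1 + \<kappa>)" and q: "q = 2 * \<kappa> / (\<kappa> - 1)"
    and f: "f \<in> Lp 1" "f \<in> Lp 2" "\<And>x. 0 \<le> f x"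
    and M: "\<And>\<mu>. \<mu> > 0 \<Longrightarrow> energy \<mu> f \<le> M"
  shows "(\<integral>\<^sup>+x. ennreal (f x powr q) \<partial>lborel)
    \<le> ennreal (2 powr q * (2 powr q * K * 2 powr (2 * \<theta>) * M powr (1 - \<theta>)) powr (1 / (1 - 2 * \<theta>)))"
proof -
  have [measurable]: "f \<in> borel_measurable borel" using Lp_measurable[OF f(1)] by simp
  have q0: "q > 1" unfolding q using \<kappa> by (simp add: less_divide_eq)
  define R where "R = (2 powr q * K * 2 powr (2 * \<theta>) * M powr (1 - \<theta>)) powr (1 / (1 - 2 * \<theta>))"
  \<comment> \<open>The lowest level is \<open>\<epsilon> = 2^-n\<close> with \<open>2 n\<close>
    levels above it, so \<open>lo n\<close> tends to 0 and \<open>hi n = 2^(n+1)\<close> tends to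
    infinity. The factor 2 in \<open>lo\<close> is there because the level sums start at
    \<open>\<tau> 1\<close>.\<close>
  define lo hi where "lo n = (1::real) / 2 ^ n * 2" and "hi n = 1 / 2 ^ n * (2::real) ^ Suc (2 * n)" for n :: nat
  define u where "u n x = f x powr q * indicat_real {x. lo n \<le> f x \<and> f x < hi n} x" for n x
  have u_meas [measurable]: "u n \<in> borel_measurable borel" for n unfolding u_def by measurable
  have bound: "(\<integral>\<^sup>+x. ennreal (u n x) \<partial>lborel) \<le> ennreal (2 powr q * ((1 / 2 ^ n) powr (q - 1) * Lp_norm 1 f + R))" for n
  proof -
    define \<epsilon> where "\<epsilon> = 1 / (2::real) ^ n"
    have \<epsilon>: "\<epsilon> > 0" by (simp add: \<epsilon>_def)
    let ?I = "\<lambda>j x. indicat_real {x. \<epsilon> * 2 ^ j \<le> f x} x"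
    note lev = nash_imp_level_sum[OF \<kappa> K nash \<theta> q f M \<epsilon>]
    \<comment> \<open>On the shell between one level and its double, \<open>f x powr q\<close> is at
      most \<open>2 powr q\<close> times the value at the lower end. Each shell is enlarged to the
      superlevel set above that end.\<close>
    have pt: "f x powr q * indicat_real {x. \<epsilon> * 2 \<le> f x \<and> f x < \<epsilon> * 2 ^ Suc m} x
        \<le> 2 powr q * (\<Sum>j<m. (\<epsilon> * 2 ^ Suc j) powr q * ?I (Suc j) x)" for m x
    proof (induction m)
      case (Suc m)
      show ?case
      proof (cases "f x < \<epsilon> * 2 ^ Suc m")
        case True
        have "\<epsilon> * 2 ^ Suc m = 2 * (\<epsilon> * 2 ^ m)" "\<epsilon> * 2 ^ Suc (Suc m) = 4 * (\<epsilon> * 2 ^ m)" "0 < \<epsilon> * 2 ^ m"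
          using \<epsilon> by simp_all
        then have "f x < \<epsilon> * 2 ^ Suc (Suc m)" using True by linarith
        then show ?thesis using True Suc by (simp add: indicator_def algebra_simps add_increasing2)
      next
        case False
        have "f x powr q \<le> 2 powr q * (\<epsilon> * 2 ^ Suc m) powr q" if "f x < \<epsilon> * 2 ^ Suc (Suc m)"
        proof -
          have "f x powr q \<le> (2 * (\<epsilon> * 2 ^ Suc m)) powr q"
            using that f(3)[of x] q0 by (intro powr_mono2) auto
          then show ?thesis using \<epsilon> by (simp only: powr_mult)
        qed
        moreover have "0 \<le> (\<Sum>j<m. (\<epsilon> * 2 ^ Suc j) powr q * ?I (Suc j) x)" by (intro sum_nonneg) auto
        ultimately show ?thesis using False
          by (auto simp: indicator_def distrib_left simp del: power_Suc intro: add_increasing)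
      qed
    qed (auto simp: indicator_def)
    have "(\<integral>\<^sup>+x. ennreal (u n x) \<partial>lborel)
        \<le> (\<integral>\<^sup>+x. ennreal (2 powr q * (\<Sum>j<2 * n. (\<epsilon> * 2 ^ Suc j) powr q * ?I (Suc j) x)) \<partial>lborel)"
      using pt[of _ "2 * n"] by (intro nn_integral_mono ennreal_leI) (simp add: u_def lo_def hi_def \<epsilon>_def)
    also have "\<dots> = ennreal (LINT x|lborel. 2 powr q * (\<Sum>j<2 * n. (\<epsilon> * 2 ^ Suc j) powr q * ?I (Suc j) x))"
      by (intro nn_integral_eq_integral integrable_mult_right Bochner_Integration.integrable_sum lev(1)
          always_eventually allI mult_nonneg_nonneg sum_nonneg) auto
    also have "(LINT x|lborel. 2 powr q * (\<Sum>j<2 * n. (\<epsilon> * 2 ^ Suc j) powr q * ?I (Suc j) x))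
        = 2 powr q * (\<Sum>j<2 * n. (\<epsilon> * 2 ^ Suc j) powr q * (LINT x|lborel. ?I (Suc j) x))"
    proof -
      have "(LINT x|lborel. (\<Sum>j<2 * n. (\<epsilon> * 2 ^ Suc j) powr q * ?I (Suc j) x))
          = (\<Sum>j<2 * n. LINT x|lborel. (\<epsilon> * 2 ^ Suc j) powr q * ?I (Suc j) x)"
        by (rule Bochner_Integration.integral_sum) (intro integrable_mult_right lev(1))
      then show ?thesis by simp
    qed
    also have "ennreal \<dots> \<le> ennreal (2 powr q * (\<epsilon> powr (q - 1) * Lp_norm 1 f + R))"
      unfolding R_def by (intro ennreal_leI mult_left_mono lev(2)) simp_all
    finally show ?thesis by (simp add: \<epsilon>_def)
  qed
  have "(\<integral>\<^sup>+x. ennreal (f x powr q) \<partial>lborel) = (\<integral>\<^sup>+x. liminf (\<lambda>n. ennreal (u n x)) \<partial>lborel)"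
  proof (rule nn_integral_cong)
    fix x
    have "\<forall>\<^sub>F n in sequentially. u n x = f x powr q"
    proof (cases "f x = 0")
      case False
      then have fx: "f x > 0" using f(3)[of x] by simp
      have "lo \<longlonglongrightarrow> 0"
        using tendsto_mult_right_zero[OF LIMSEQ_power_zero[of "1/2::real"], of 2]
        by (simp add: lo_def[abs_def] power_one_over mult.commute)
      then have 1: "\<forall>\<^sub>F n in sequentially. lo n < f x" using fx by (rule order_tendstoD)
      have hi: "hi n = 2 ^ Suc n" for n
      proof -
        have e: "Suc (2 * n) = n + Suc n" by simp
        show ?thesis unfolding hi_def e power_add by simp
      qed
      obtain N :: nat where N: "f x < real N" using reals_Archimedean2 by blast
      have "f x < hi n" if "n \<ge> N" for n
      proof -
        have "real N \<le> real n" using that by simp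
        also have "real n < 2 ^ Suc n" by (rule less_le_trans[OF of_nat_less_two_power[of n]]) simp
        finally show ?thesis using N by (simp add: hi)
      qed
      then have 2: "\<forall>\<^sub>F n in sequentially. f x < hi n" by (auto simp: eventually_sequentially)
      show ?thesis using 1 2 by eventually_elim (simp add: u_def)
    qed (simp add: u_def)
    then have "(\<lambda>n. ennreal (u n x)) \<longlonglongrightarrow> ennreal (f x powr q)"
      by (intro tendsto_eventually) (auto elim: eventually_mono)
    then show "ennreal (f x powr q) = liminf (\<lambda>n. ennreal (u n x))"
      by (intro lim_imp_Liminf[symmetric]) auto
  qed
  also have "\<dots> \<le> liminf (\<lambda>n. \<integral>\<^sup>+x. ennreal (u n x) \<partial>lborel)"
    by (rule nn_integral_liminf) measurable
  also have "\<dots> \<le> liminf (\<lambda>n. ennreal (2 powr q * ((1 / 2 ^ n) powr (q - 1) * Lp_norm 1 f + R)))"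
    using bound by (intro Liminf_mono) auto
  also have "\<dots> = ennreal (2 powr q * R)"
  proof (intro lim_imp_Liminf)
    have "(\<lambda>n. (1 / 2) ^ n) \<longlonglongrightarrow> (0::real)" by (rule LIMSEQ_power_zero) simp
    then have "(\<lambda>n. 1 / 2 ^ n) \<longlonglongrightarrow> (0::real)" by (simp add: power_one_over)
    then have "(\<lambda>n. (1 / 2 ^ n) powr (q - 1)) \<longlonglongrightarrow> (0::real) powr (q - 1)"
      using q0 by (intro tendsto_powr') (auto intro!: always_eventually)
    then have "(\<lambda>n. 2 powr q * ((1 / 2 ^ n) powr (q - 1) * Lp_norm 1 f + R)) \<longlonglongrightarrow> 2 powr q * (0 powr (q - 1) * Lp_norm 1 f + R)"
      by (intro tendsto_add tendsto_mult tendsto_const) assumption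
    then show "(\<lambda>n. ennreal (2 powr q * ((1 / 2 ^ n) powr (q - 1) * Lp_norm 1 f + R))) \<longlonglongrightarrow> ennreal (2 powr q * R)"
      by (intro tendsto_ennrealI) simp
  qed simp
  finally show ?thesis by (simp add: R_def)
qed

text \<open>The truncation argument needs a nonnegative function; passing to the absolute value does
  not raise the energies, which stay below the form of \<open>f\<close>.\<close>

lemma smoothing_imp_sobolev:
  assumes sm: "smoothing \<kappa> C" and C: "C > 0" and \<kappa>: "\<kappa> > 1" and q: "q = 2 * \<kappa> / (\<kappa> - 1)"
  shows "\<exists>D>0. \<forall>f\<in>Lp 1 \<inter> dom_Q A. f \<in> Lp q \<and> Lp_norm q f \<le> D * Q_form A f powr (1 / 2)"
proof -
  define \<theta> where "\<theta> = 1 / (1 + \<kappa>)"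
  have th: "1 - \<theta> = \<kappa> / (1 + \<kappa>)" "1 / (1 - 2 * \<theta>) = (1 + \<kappa>) / (\<kappa> - 1)"
    using \<kappa> by (simp_all add: \<theta>_def field_simps)
  have q0: "q > 1" unfolding q using \<kappa> by (simp add: less_divide_eq)
  define K1 where "K1 = 2 powr q * (C + 1) * 2 powr (2 * \<theta>)"
  define D where "D = (2 powr q * K1 powr (1 / (1 - 2 * \<theta>))) powr (1 / q)"
  have "K1 > 0" using C by (simp add: K1_def)
  then have D: "D > 0" by (simp add: D_def)
  have "f \<in> Lp q \<and> Lp_norm q f \<le> D * Q_form A f powr (1 / 2)" if f: "f \<in> Lp 1" "f \<in> dom_Q A" for f
  proof -
    have f2: "f \<in> Lp 2" using f by (simp add: dom_Q_iff)
    have [measurable]: "f \<in> borel_measurable borel" using Lp_measurable[OF f(1)] by simp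
    let ?g = "\<lambda>x. \<bar>f x\<bar>" and ?M = "Q_form A f"
    have g: "?g \<in> Lp 1" "?g \<in> Lp 2" using f f2 by (auto intro: Lp_min_max(4)[of _ _ 0])
    have M: "energy \<mu> ?g \<le> ?M" if "\<mu> > 0" for \<mu>
      using energy_abs[OF f(1) f2 that] energy_le_Q[OF f(2) that] by linarith
    have "(\<integral>\<^sup>+x. ennreal (?g x powr q) \<partial>lborel)
        \<le> ennreal (2 powr q * (2 powr q * (C + 1) * 2 powr (2 * \<theta>) * ?M powr (1 - \<theta>)) powr (1 / (1 - 2 * \<theta>)))"
    proof (rule nash_imp_sobolev[OF \<kappa> _ _ \<theta>_def q g _ M])
      show "(Lp_norm 2 h)\<^sup>2 \<le> (C + 1) * Lp_norm 1 h powr (2 * \<theta>) * M powr (1 - \<theta>)"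
        if "h \<in> Lp 1" "h \<in> Lp 2" "0 \<le> M" "\<And>\<mu>. \<mu> > 0 \<Longrightarrow> energy \<mu> h \<le> M" for h M
        using smoothing_imp_nash[OF sm C _ that] \<kappa> th by (simp add: \<theta>_def)
    qed (use C in auto)
    also have "(2 powr q * (C + 1) * 2 powr (2 * \<theta>) * ?M powr (1 - \<theta>)) powr (1 / (1 - 2 * \<theta>))
        = K1 powr (1 / (1 - 2 * \<theta>)) * ?M powr (q / 2)"
    proof -
      \<comment> \<open>Homogeneity of the final inequality: the power \<open>q / 2\<close> of the
        form becomes \<open>1 / 2\<close> after the \<open>q\<close>-th root.\<close>
      have e: "(1 - \<theta>) * (1 / (1 - 2 * \<theta>)) = q / 2"
      proof -
        have "1 + \<kappa> \<noteq> 0" using \<kappa> by simp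
        then have "\<kappa> / (1 + \<kappa>) * ((1 + \<kappa>) / (\<kappa> - 1)) = \<kappa> / (\<kappa> - 1)" by simp
        moreover have "q / 2 = \<kappa> / (\<kappa> - 1)" unfolding q using \<kappa> by (simp add: field_simps)
        ultimately show ?thesis unfolding th by metis
      qed
      show ?thesis unfolding K1_def[symmetric] using \<open>K1 > 0\<close> by (simp only: powr_mult powr_powr e)
    qed
    finally have le: "(\<integral>\<^sup>+x. ennreal (?g x powr q) \<partial>lborel) \<le> ennreal (2 powr q * K1 powr (1 / (1 - 2 * \<theta>)) * ?M powr (q / 2))"
      by (simp add: mult.assoc)
    have int: "integrable lborel (\<lambda>x. ?g x powr q)"
      using le_less_trans[OF le ennreal_less_top] by (intro integrableI_bounded) auto
    then have "(LINT x|lborel. ?g x powr q) \<le> 2 powr q * K1 powr (1 / (1 - 2 * \<theta>)) * ?M powr (q / 2)"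
      using le by (simp add: nn_integral_eq_integral)
    then have "Lp_norm q f \<le> (2 powr q * K1 powr (1 / (1 - 2 * \<theta>)) * ?M powr (q / 2)) powr (1 / q)"
      unfolding Lp_norm_def using q0 by (intro powr_mono2) auto
    also have "\<dots> = D * ?M powr (1 / 2)" unfolding D_def using q0 by (simp add: powr_mult powr_powr)
    finally show ?thesis using int by (simp add: Lp_def)
  qed
  then show ?thesis using D by blast
qed

section \<open>From Sobolev to Nash and back to smoothing\<close>

lemma sobolev_imp_nash:
  assumes \<kappa>: "\<kappa> > 1" and q: "q = 2 * \<kappa> / (\<kappa> - 1)" and \<theta>: "\<theta> = 1 / (1 + \<kappa>)" and D: "D > 0"
    and sob: "\<And>f. f \<in> Lp 1 \<Longrightarrow> f \<in> dom_Q A \<Longrightarrow> f \<in> Lp q \<and> Lp_norm q f \<le> D * Q_form A f powr (1 / 2)"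
    and f: "f \<in> Lp 1" "f \<in> dom_Q A"
  shows "Lp_norm 2 f \<le> D powr (1 - \<theta>) * Lp_norm 1 f powr \<theta> * Q_form A f powr (1 / 2 * (1 - \<theta>))"
proof -
  have q0: "q > 1" unfolding q using \<kappa> by (simp add: less_divide_eq)
  have th: "0 < \<theta>" "\<theta> < 1" using \<kappa> by (auto simp: \<theta>)
  have "\<kappa> \<noteq> 0" "\<kappa> - 1 \<noteq> 0" "1 + \<kappa> \<noteq> 0" using \<kappa> by auto
  then have "2 * \<theta> + 2 * (1 - \<theta>) / q = 1" unfolding q \<theta> by (simp add: divide_simps) (simp add: algebra_simps)
  then have "Lp_norm 2 f \<le> Lp_norm 1 f powr \<theta> * Lp_norm q f powr (1 - \<theta>)"
    using sob[OF f] by (intro Lp_interpolation f th q0) auto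
  also have "\<dots> \<le> Lp_norm 1 f powr \<theta> * (D * Q_form A f powr (1 / 2)) powr (1 - \<theta>)"
    using sob[OF f] th by (intro mult_left_mono powr_mono2) (auto simp: Lp_norm_def)
  also have "\<dots> = D powr (1 - \<theta>) * Lp_norm 1 f powr \<theta> * Q_form A f powr (1 / 2 * (1 - \<theta>))"
    using D by (simp add: powr_mult powr_powr)
  finally show ?thesis .
qed


text \<open>A discrete form of Nash's differential inequality for \<open>(norm (S t y))^2\<close>; it is summed over the implicit
  Euler steps of the exponential formula, so no differentiability in time is needed.\<close>

lemma nash_decay:
  assumes \<kappa>: "\<kappa> > 0" and \<theta>: "\<theta> = 1 / (1 + \<kappa>)" and C: "C > 0"
    and nash: "\<And>f. f \<in> Lp 1 \<Longrightarrow> f \<in> dom_Q A \<Longrightarrow>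
      Lp_norm 2 f \<le> C * Lp_norm 1 f powr \<theta> * Q_form A f powr (1 / 2 * (1 - \<theta>))"
    and xy: "coherent x y" "norm x \<le> 1" and t: "t > 0"
  shows "t * (2 * C powr (- 2 * (1 + 1 / \<kappa>))) * ((norm (A2.S t y))\<^sup>2) powr (1 + 1 / \<kappa>) \<le> (norm y)\<^sup>2"
proof -
  \<comment> \<open>The reciprocal of \<open>1 - \<theta>\<close>: raised to this power, the squared
    Nash inequality becomes linear in the form.\<close>
  define p where "p = 1 + 1 / \<kappa>"
  have p: "p > 0" "(1 - \<theta>) * p = 1"
    using \<kappa> by (simp_all add: p_def \<theta> add_pos_pos) (simp add: field_simps add_pos_pos less_imp_neq[symmetric])
  define c where "c = C powr (- 2 * p)"
  have c: "c > 0" using C by (simp add: c_def)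
  \<comment> \<open>On the domain of the generator the form is \<open>u \<bullet> v\<close>, and the
    L1 norm is at most 1. The Nash inequality then bounds the dissipation
    \<open>u \<bullet> v\<close> from below by a power of the squared L2 norm.\<close>
  have form: "c * ((norm u)\<^sup>2) powr p \<le> u \<bullet> v" if uv: "(u, v) \<in> G2" and co: "coherent x' u" "norm x' \<le> 1" for u v x'
  proof -
    obtain f where f: "f \<in> Lp 1" "f \<in> Lp 2" "x' = abs_l1 f" "u = abs_l2 f" using co(1) by (rule coherentE)
    obtain z where z: "(u, z) \<in> A2.B" "(norm z)\<^sup>2 = v \<bullet> u" using A2.form_on_G[OF uv] by blast
    have dom: "f \<in> dom_Q A" using z f by (auto simp: dom_Q_iff)
    have Q: "Q_form A f = v \<bullet> u" using Q_form_eq[OF f(2)] z f by simp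
    have "norm u \<le> C * norm x' powr \<theta> * (v \<bullet> u) powr (1 / 2 * (1 - \<theta>))"
      using nash[OF f(1) dom] f Q by (simp add: norm_abs_l1 norm_abs_l2)
    also have "\<dots> \<le> C * 1 * (v \<bullet> u) powr (1 / 2 * (1 - \<theta>))"
      using co(2) C \<kappa> by (intro mult_right_mono mult_left_mono powr_le1) (auto simp: \<theta>)
    finally have "norm u ^ 2 \<le> (C * (v \<bullet> u) powr (1 / 2 * (1 - \<theta>))) ^ 2" by (intro power_mono) auto
    also have "\<dots> = C powr 2 * (v \<bullet> u) powr (1 - \<theta>)"
      using C by (simp add: power_mult_distrib powr_numeral) (simp add: power2_eq_square powr_add[symmetric])
    finally have "(norm u ^ 2) powr p \<le> (C powr 2 * (v \<bullet> u) powr (1 - \<theta>)) powr p"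
      using p by (intro powr_mono2) auto
    also have "\<dots> = C powr (2 * p) * (v \<bullet> u)"
    proof -
      have "0 \<le> v \<bullet> u" unfolding z(2)[symmetric] by simp
      then have "((v \<bullet> u) powr (1 - \<theta>)) powr p = v \<bullet> u" unfolding powr_powr p(2) by simp
      then show ?thesis using C by (simp only: powr_mult powr_powr)
    qed
    finally have "c * ((norm u)\<^sup>2) powr p \<le> c * (C powr (2 * p) * (v \<bullet> u))" using c by (intro mult_left_mono) auto
    also have "\<dots> = v \<bullet> u" using C by (simp add: c_def powr_minus field_simps)
    finally show ?thesis by (simp add: inner_commute)
  qed
  have V: "t * (2 * c) * ((norm (A2.V m t y))\<^sup>2) powr p \<le> (norm y)\<^sup>2" for m
  proof -
    define h where "h = t / 2 ^ m"
    have h: "h > 0" using t by (simp add: h_def)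
    define a where "a k = (norm ((A2.J h ^^ k) y))\<^sup>2" for k
    \<comment> \<open>One implicit Euler step reads \<open>w = u + h v\<close>. Expanding the square
      of \<open>w\<close> gives the loss \<open>2 h (u \<bullet> v)\<close>, the source of the
      factor \<open>2 * c\<close>, and a term in \<open>h^2\<close> of favourable sign.\<close>
    have step: "a (Suc k) + h * (2 * c) * a (Suc k) powr p \<le> a k" for k
    proof -
      define w u v where "w = (A2.J h ^^ k) y" and "u = A2.J h w" and "v = (1 / h) *\<^sub>R (w - u)"
      have uv: "(u, v) \<in> G2" unfolding u_def v_def by (rule A2.J_in[OF h])
      have w: "w = u + h *\<^sub>R v" using h by (simp add: v_def)
      have "coherent ((A1.J h ^^ Suc k) x) u" unfolding u_def w_def using coherent_Jpow[OF xy(1), where \<mu> = h and n = "Suc k"] by simp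
      moreover have "norm ((A1.J h ^^ Suc k) x) \<le> 1" using A1.norm_Jpow[where n = "Suc k" and \<mu> = h and f = x] xy(2) by linarith
      ultimately have "c * ((norm u)\<^sup>2) powr p \<le> u \<bullet> v" by (rule form[OF uv])
      then have "h * (2 * c) * ((norm u)\<^sup>2) powr p \<le> 2 * h * (u \<bullet> v)" using h by (simp add: mult.assoc)
      moreover have "(norm w)\<^sup>2 = (norm u)\<^sup>2 + 2 * h * (u \<bullet> v) + h\<^sup>2 * (v \<bullet> v)"
        unfolding w power2_norm_eq_inner by (simp add: inner_add inner_commute power2_eq_square algebra_simps)
      moreover have "h\<^sup>2 * (v \<bullet> v) \<ge> 0" by simp
      moreover have a: "a (Suc k) = (norm u)\<^sup>2" "a k = (norm w)\<^sup>2" by (simp_all add: a_def u_def w_def)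
      ultimately show ?thesis unfolding a by linarith
    qed
    have dec: "a (Suc k) \<le> a k" for k
    proof -
      have "0 \<le> h * (2 * c) * a (Suc k) powr p" using h c by simp
      then show ?thesis using step[of k] by linarith
    qed
    have mono: "a n \<le> a k" if "k \<le> n" for k n using lift_Suc_antimono_le[of a, OF dec that] .
    \<comment> \<open>The losses of all steps are bounded from below by the one at the smallest
      value \<open>a n\<close>. With \<open>n = 2^m\<close> steps the step lengths add up to
      \<open>t\<close>.\<close>
    have "a j + real j * h * (2 * c) * a n powr p \<le> a 0" if "j \<le> n" for j n
      using that
    proof (induction j)
      case (Suc j)
      have "a n powr p \<le> a (Suc j) powr p" using mono[OF Suc.prems] p by (intro powr_mono2) (auto simp: a_def)
      then have "h * (2 * c) * a n powr p \<le> h * (2 * c) * a (Suc j) powr p" using h c by (intro mult_left_mono) auto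
      then show ?case using step[of j] Suc by (simp add: algebra_simps)
    qed simp
    from this[of "2 ^ m" "2 ^ m"] have "a (2 ^ m) + t * (2 * c) * a (2 ^ m) powr p \<le> a 0" by (simp add: h_def)
    moreover have a_eq: "a (2 ^ m) = (norm (A2.V m t y))\<^sup>2" "a 0 = (norm y)\<^sup>2"
      by (simp_all add: a_def A2.V_def h_def)
    moreover have "0 \<le> (norm (A2.V m t y))\<^sup>2" by (rule zero_le_power2)
    ultimately show ?thesis unfolding a_eq by linarith
  qed
  have "(\<lambda>m. t * (2 * c) * ((norm (A2.V m t y))\<^sup>2) powr p) \<longlonglongrightarrow> t * (2 * c) * ((norm (A2.S t y))\<^sup>2) powr p"
    using t p by (intro tendsto_mult tendsto_const tendsto_powr' tendsto_power tendsto_norm A2.V_tendsto_S) auto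
  then have "t * (2 * c) * ((norm (A2.S t y))\<^sup>2) powr p \<le> (norm y)\<^sup>2"
    by (rule LIMSEQ_le_const2) (use V in blast)
  then show ?thesis by (simp add: c_def p_def)
qed

lemma coherent_scale: "coherent x y \<Longrightarrow> coherent (a *\<^sub>R x) (a *\<^sub>R y)"
  using coherent_lincomb[of x y x y a 0] by simp

lemma coherent_zero: "coherent 0 0"
  using coherent_abs[OF Lp_zero Lp_zero] by (simp add: abs_l1_zero abs_l2_zero)

text \<open>Applied to \<open>S s y\<close> over a further time \<open>s\<close>,
  \<open>nash_decay\<close> is the recursion of \<open>doubling_decay\<close>; the L1 norm stays at
  most 1 along the flow. The L1-L2 bound is then used twice over half the time, once on the datum
  and once on a test function, by symmetry of the semigroup.\<close>

lemma nash_imp_smoothing: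
  assumes \<kappa>: "\<kappa> > 0" and \<theta>: "\<theta> = 1 / (1 + \<kappa>)" and C: "C > 0"
    and nash: "\<And>f. f \<in> Lp 1 \<Longrightarrow> f \<in> dom_Q A \<Longrightarrow>
      Lp_norm 2 f \<le> C * Lp_norm 1 f powr \<theta> * Q_form A f powr (1 / 2 * (1 - \<theta>))"
  shows "\<exists>D>0. smoothing \<kappa> D"
proof -
  define c where "c = 2 * C powr (- 2 * (1 + 1 / \<kappa>))"
  define L where "L = 2 powr (\<kappa> * (\<kappa> + 1)) * c powr (- \<kappa>)"
  have c: "c > 0" using C by (simp add: c_def)
  have L: "L > 0" using c by (simp add: L_def)
  have unit: "(norm (A2.S t y))\<^sup>2 \<le> L * t powr (- \<kappa>)" if xy: "coherent x y" "norm x \<le> 1" and t: "t > 0" for x y t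
    unfolding L_def
  proof (rule doubling_decay[where Y = "\<lambda>t. (norm (A2.S t y))\<^sup>2" and B = "(norm y)\<^sup>2", OF \<kappa> c _ _ _ t])
    fix s :: real assume s: "s > 0"
    show "(norm (A2.S s y))\<^sup>2 \<le> (norm y)\<^sup>2" using A2.norm_S[of s y] s by (intro power_mono) auto
    have co: "coherent (A1.S s x) (A2.S s y)" using coherent_S[OF xy(1)] s by simp
    have no: "norm (A1.S s x) \<le> 1" using A1.norm_S[of s x] xy(2) s by simp
    have "s * c * ((norm (A2.S s (A2.S s y)))\<^sup>2) powr (1 + 1 / \<kappa>) \<le> (norm (A2.S s y))\<^sup>2"
      unfolding c_def by (rule nash_decay[OF \<kappa> \<theta> C]) (fact nash co no s)+
    then show "s * c * ((norm (A2.S (2 * s) y))\<^sup>2) powr (1 + 1 / \<kappa>) \<le> (norm (A2.S s y))\<^sup>2"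
      using A2.S_add[of s s y] s by simp
  qed simp
  have l1l2: "norm (A2.S t y) \<le> sqrt (L * t powr (- \<kappa>)) * norm x" if xy: "coherent x y" and t: "t > 0" for x y t
  proof (cases "x = 0")
    case True
    then have "y = 0" using coherent_unique[OF xy] coherent_zero by blast
    then show ?thesis using True A2.norm_S[of t 0] t by simp
  next
    case False
    have "(norm (A2.S t ((1 / norm x) *\<^sub>R y)))\<^sup>2 \<le> L * t powr (- \<kappa>)"
      by (rule unit[OF coherent_scale[OF xy] _ t]) (use False in simp)
    then have "norm (A2.S t ((1 / norm x) *\<^sub>R y)) \<le> sqrt (L * t powr (- \<kappa>))" by (rule real_le_rsqrt)
    then show ?thesis using False t by (simp add: linear_cmul[OF A2.linear_S] field_simps)
  qed
  define D where "D = L * 2 powr \<kappa>"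
  have D: "D > 0" using L by (simp add: D_def)
  have half: "L * (t / 2) powr (- \<kappa>) = D * t powr (- \<kappa>)" if "t > 0" for t
    using that by (simp add: D_def powr_divide powr_minus field_simps)
  have bounded: "AE s in lborel. \<bar>rep_l1 (A1.S t x) s\<bar> \<le> D * t powr (- \<kappa>) * norm x" if xy: "coherent x y" and t: "t > 0" for x y t
  proof (cases "x = 0")
    case True
    then have "A1.S t x = 0" using A1.norm_S[of t 0] t by simp
    then have "ae_eq (rep_l1 (A1.S t x)) (\<lambda>s. 0)" using rep_abs_l1[OF Lp_zero] by (simp add: abs_l1_zero)
    then show ?thesis unfolding ae_eq_def by eventually_elim (use True in simp)
  next
    case False
    define K where "K = D * t powr (- \<kappa>) * norm x"
    have K: "K > 0" using D t False by (simp add: K_def)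
    obtain z where z: "z \<in> Lp 1" "z \<in> Lp 2" "A1.S t x = abs_l1 z" "A2.S t y = abs_l2 z"
      using coherent_S[OF xy, of t] t by (auto elim: coherentE)
    have [measurable]: "z \<in> borel_measurable borel" using Lp_measurable[OF z(1)] by simp
    \<comment> \<open>The test function is the sign of \<open>z\<close> where the claimed bound
      fails. There \<open>z * g\<close> exceeds \<open>K * \<bar>g\<bar>\<close>, whereas the
      pairing shows that the integral of the excess is not positive, so the bad set is null.\<close>
    define g where "g s = (if \<bar>z s\<bar> > K then sgn (z s) else 0)" for s
    have [measurable]: "g \<in> borel_measurable borel" unfolding g_def[abs_def] by measurable
    have gb: "\<bar>g s\<bar> \<le> 1" "\<bar>g s\<bar> \<le> \<bar>z s\<bar> / K" for s
      using K by (auto simp: g_def sgn_real_def field_simps)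
    have g1: "g \<in> Lp 1"
      unfolding Lp1_iff
    proof (rule Bochner_Integration.integrable_bound)
      show "integrable lborel (\<lambda>s. z s / K)" using z(1) by (simp add: Lp1_iff)
      show "AE s in lborel. norm (g s) \<le> norm (z s / K)" using gb(2) K by (intro always_eventually) simp
    qed measurable
    have g2: "g \<in> Lp 2" by (rule Lp2_bounded(1)[OF g1, of 1]) (use gb(1) in simp)
    have "A2.S t y \<bullet> abs_l2 g = A2.S (t / 2) y \<bullet> A2.S (t / 2) (abs_l2 g)"
      using A2.S_add[of "t / 2" "t / 2" y] A2.S_self_adj[of "t / 2" "A2.S (t / 2) y" "abs_l2 g"] t by simp
    also have "\<dots> \<le> norm (A2.S (t / 2) y) * norm (A2.S (t / 2) (abs_l2 g))" by (rule norm_cauchy_schwarz)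
    also have "\<dots> \<le> (sqrt (L * (t / 2) powr (- \<kappa>)) * norm x) * (sqrt (L * (t / 2) powr (- \<kappa>)) * norm (abs_l1 g))"
      using t L by (intro mult_mono l1l2 xy coherent_abs g1 g2) auto
    also have "\<dots> = K * (LINT s|lborel. \<bar>g s\<bar>)"
    proof -
      have "sqrt (L * (t / 2) powr (- \<kappa>)) * sqrt (L * (t / 2) powr (- \<kappa>)) = D * t powr (- \<kappa>)"
        using L D half[OF t] by simp
      then have "(sqrt (L * (t / 2) powr (- \<kappa>)) * norm x) * (sqrt (L * (t / 2) powr (- \<kappa>)) * norm (abs_l1 g))
        = D * t powr (- \<kappa>) * (norm x * norm (abs_l1 g))" by (metis mult.assoc mult.left_commute)
      then show ?thesis by (simp add: K_def norm_abs_l1[OF g1] Lp_norm1 mult.assoc)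
    qed
    finally have "(LINT s|lborel. z s * g s) \<le> (LINT s|lborel. K * \<bar>g s\<bar>)"
      using inner_abs_l2[OF z(2) g2] by (simp add: z(4) L2_inner_def)
    then have "(LINT s|lborel. z s * g s - K * \<bar>g s\<bar>) \<le> 0"
      using Lp2_mult_integrable[OF z(2) g2] g1 by (simp add: Lp1_iff)
    moreover have nn: "0 \<le> z s * g s - K * \<bar>g s\<bar>" for s by (auto simp: g_def sgn_real_def)
    ultimately have "(LINT s|lborel. z s * g s - K * \<bar>g s\<bar>) = 0"
      by (intro antisym integral_nonneg_AE) auto
    then have "AE s in lborel. z s * g s - K * \<bar>g s\<bar> = 0"
      using Lp2_mult_integrable[OF z(2) g2] g1 nn
      by (subst (asm) integral_nonneg_eq_0_iff_AE) (auto simp: Lp1_iff)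
    then have "AE s in lborel. \<bar>z s\<bar> \<le> K"
      by eventually_elim (use K in \<open>auto simp: g_def sgn_real_def split: if_splits\<close>)
    with rep_abs_l1[OF z(1)] show ?thesis
      unfolding z(3) K_def ae_eq_def by eventually_elim simp
  qed
  have "AE s in lborel. \<bar>heat_semigroup A t f s\<bar> \<le> D * t powr (- \<kappa>) * Lp_norm 1 f" if f: "f \<in> Lp 1" and t: "t > 0" for f t
  proof -
    let ?K = "D * t powr (- \<kappa>) * Lp_norm 1 f"
    have "AE s in lborel. - ?K \<le> rep_l1 (A1.S t (abs_l1 f)) s \<and> rep_l1 (A1.S t (abs_l1 f)) s \<le> ?K"
    proof (rule l1_limit_AE_bounds)
      have "bounded_linear (A1.S t)" using A1.linear_S A1.norm_S t by (intro bounded_linear_contraction) auto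
      then show "(\<lambda>n. A1.S t (abs_l1 (trunc n f))) \<longlonglongrightarrow> A1.S t (abs_l1 f)"
        by (rule bounded_linear.tendsto[OF _ trunc_l1[OF f]])
      fix n
      have tr: "trunc n f \<in> Lp 1" "trunc n f \<in> Lp 2" using Lb_Lp[OF trunc_Lb[OF f]] by auto
      have "norm (abs_l1 (trunc n f)) \<le> Lp_norm 1 f"
        unfolding norm_abs_l1[OF tr(1)] Lp_norm1
        using f tr(1) trunc_bound(2)[of n f] by (intro integral_mono) (auto simp: Lp1_iff)
      then have le: "D * t powr (- \<kappa>) * norm (abs_l1 (trunc n f)) \<le> ?K" using D by (intro mult_left_mono) auto
      from bounded[OF coherent_abs[OF tr] t]
      show "AE s in lborel. - ?K \<le> rep_l1 (A1.S t (abs_l1 (trunc n f))) s \<and> rep_l1 (A1.S t (abs_l1 (trunc n f))) s \<le> ?K"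
        by eventually_elim (use le in linarith)
    qed
    moreover have "ae_eq (rep_l1 (A1.S t (abs_l1 f))) (heat_semigroup A t f)"
      using rep_abs_l1 heat_semigroup[of t f] f t by (metis less_imp_le)
    ultimately show ?thesis unfolding ae_eq_def by (auto elim: eventually_elim2)
  qed
  then show ?thesis using D unfolding smoothing_def by blast
qed

end

section \<open>Kernels of bounded operators from \<open>L\<^sup>1\<close> to \<open>L\<^sup>\<infinity>\<close>\<close>

text \<open>The cells of level \<open>n\<close> are the atoms of the algebra generated by \<open>E 0, \<dots>, E (n - 1)\<close>. In the
  application \<open>s n B\<close> is the image of the indicator of the cell \<open>C n B\<close>, and the cell averages
  \<open>Hn\<close> form a bounded martingale in the first variable, which converges in \<open>L\<^sup>2\<close>.\<close>

locale cell_martingale = finite_measure \<nu> for \<nu> :: "'a measure" +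
  fixes E :: "nat \<Rightarrow> 'a set" and s :: "nat \<Rightarrow> nat set \<Rightarrow> 'a \<Rightarrow> real" and K :: real
  assumes E_sets [measurable]: "E i \<in> sets \<nu>"
    and s_meas [measurable]: "s n B \<in> borel_measurable \<nu>"
    and s_nonneg: "0 \<le> s n B x"
    and s_le: "s n B x \<le> K * measure \<nu> {y \<in> space \<nu>. {i. i < n \<and> y \<in> E i} = B}"
    and s_refine: "n \<le> m \<Longrightarrow> B \<subseteq> {..<n} \<Longrightarrow>
      AE x in \<nu>. s n B x = (\<Sum>B' | B' \<subseteq> {..<m} \<and> B' \<inter> {..<n} = B. s m B' x)"
    and K: "0 \<le> K"
begin

definition C :: "nat \<Rightarrow> nat set \<Rightarrow> 'a set" where "C n B = {y \<in> space \<nu>. {i. i < n \<and> y \<in> E i} = B}"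

definition p :: "nat \<Rightarrow> nat set \<Rightarrow> real" where "p n B = measure \<nu> (C n B)"

text \<open>In its first variable this is the conditional expectation, given the cells of level
  \<open>n\<close>, of the kernel sought. On null cells division by zero makes it 0, which is
  consistent because \<open>s\<close> vanishes there by \<open>s_zero\<close>.\<close>

definition Hn :: "nat \<Rightarrow> 'a \<Rightarrow> 'a \<Rightarrow> real" where
  "Hn n x0 x = (\<Sum>B\<in>Pow {..<n}. indicat_real (C n B) x0 * (s n B x / p n B))"

lemma C_sets [measurable]: "C n B \<in> sets \<nu>"
proof -
  have "C n B = {y \<in> space \<nu>. (\<forall>i<n. y \<in> E i \<longleftrightarrow> i \<in> B) \<and> B \<subseteq> {..<n}}" by (auto simp: C_def)
  then show ?thesis by simp
qed

lemma p_nonneg: "0 \<le> p n B" by (simp add: p_def)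

lemma s_bound: "s n B x \<le> K * p n B" using s_le by (simp add: p_def C_def)

lemma s_zero: "p n B = 0 \<Longrightarrow> s n B x = 0" using s_bound[of n B x] s_nonneg[of n B x] by simp

lemma Hn_cell: assumes "x0 \<in> space \<nu>" shows "Hn n x0 x = s n {i. i < n \<and> x0 \<in> E i} x / p n {i. i < n \<and> x0 \<in> E i}"
proof -
  let ?B = "{i. i < n \<and> x0 \<in> E i}"
  have "Hn n x0 x = (\<Sum>B\<in>Pow {..<n}. if B = ?B then s n B x / p n B else 0)"
    unfolding Hn_def using assms by (intro sum.cong) (auto simp: indicator_def C_def)
  also have "\<dots> = s n ?B x / p n ?B" by (subst sum.delta) auto
  finally show ?thesis .
qed

lemma Hn_bounds: assumes "x0 \<in> space \<nu>" shows "0 \<le> Hn n x0 x" "Hn n x0 x \<le> K"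
proof -
  let ?B = "{i. i < n \<and> x0 \<in> E i}"
  show "0 \<le> Hn n x0 x" unfolding Hn_cell[OF assms] using s_nonneg p_nonneg by simp
  show "Hn n x0 x \<le> K"
    unfolding Hn_cell[OF assms] using s_bound[of n ?B x] p_nonneg[of n ?B] K
    by (cases "p n ?B = 0") (auto simp: divide_le_eq)
qed

lemma Hn_meas [measurable]: "(\<lambda>(x0, x). Hn n x0 x) \<in> borel_measurable (\<nu> \<Otimes>\<^sub>M \<nu>)"
  unfolding Hn_def by measurable

lemma C_disjoint: "n \<le> m \<Longrightarrow> B' \<subseteq> {..<m} \<Longrightarrow>
  indicat_real (C n B) y * indicat_real (C m B') y = (if B' \<inter> {..<n} = B then indicat_real (C m B') y else 0)"
  by (auto simp: indicator_def C_def)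

lemma integrable_C: "integrable \<nu> (indicat_real (C n B))"
  by (rule integrable_const_bound[of _ 1]) auto

text \<open>The martingale property: each finer cell contributes its average times its measure, that
  is \<open>s m B'\<close>, and by refinement these contributions add up to
  \<open>s n B\<close>.\<close>

lemma integral_C_Hn:
  assumes "n \<le> m" "B \<subseteq> {..<n}"
  shows "AE x in \<nu>. (LINT x0|\<nu>. indicat_real (C n B) x0 * Hn m x0 x) = s n B x"
  using s_refine[OF assms]
proof eventually_elim
  case (elim x)
  have "(LINT x0|\<nu>. indicat_real (C n B) x0 * Hn m x0 x)
      = (LINT x0|\<nu>. (\<Sum>B'\<in>Pow {..<m}. (if B' \<inter> {..<n} = B then s m B' x / p m B' else 0) * indicat_real (C m B') x0))"
    unfolding Hn_def sum_distrib_left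
    by (intro Bochner_Integration.integral_cong sum.cong refl)
      (use C_disjoint[OF assms(1)] in \<open>simp add: mult.assoc[symmetric]\<close>)
  also have "\<dots> = (\<Sum>B'\<in>Pow {..<m}. (if B' \<inter> {..<n} = B then s m B' x / p m B' else 0) * p m B')"
    by (subst Bochner_Integration.integral_sum) (auto simp: integrable_C p_def)
  also have "\<dots> = (\<Sum>B'\<in>Pow {..<m}. if B' \<inter> {..<n} = B then s m B' x else 0)"
    by (intro sum.cong) (auto simp: s_zero)
  also have "\<dots> = (\<Sum>B' | B' \<subseteq> {..<m} \<and> B' \<inter> {..<n} = B. s m B' x)"
    by (subst sum.inter_filter[symmetric]) (auto intro!: sum.cong)
  finally show ?case using elim by simp
qed

abbreviation Q :: "('a \<times> 'a) measure" where "Q \<equiv> \<nu> \<Otimes>\<^sub>M \<nu>"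

sublocale P: pair_sigma_finite \<nu> \<nu> ..

lemma finite_pair: "finite_measure (\<nu> \<Otimes>\<^sub>M \<nu>)"
  by (rule finite_measure_pair_measure) unfold_locales

lemma integrable_pair:
  fixes f :: "'a \<times> 'a \<Rightarrow> real"
  assumes "f \<in> borel_measurable (\<nu> \<Otimes>\<^sub>M \<nu>)" "\<And>x0 x. x0 \<in> space \<nu> \<Longrightarrow> x \<in> space \<nu> \<Longrightarrow> \<bar>f (x0, x)\<bar> \<le> c"
  shows "integrable (\<nu> \<Otimes>\<^sub>M \<nu>) f"
  by (rule finite_measure.integrable_const_bound[OF finite_pair, of _ c])
    (use assms in \<open>auto simp: space_pair_measure intro!: AE_I2\<close>)

lemma Hn_prod_bound: "x0 \<in> space \<nu> \<Longrightarrow> \<bar>Hn n x0 x * Hn m x0 x\<bar> \<le> K * K"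
  using Hn_bounds K by (auto simp: abs_mult intro!: mult_mono)

text \<open>Orthogonality of martingale increments. \<open>Hn n\<close> is a combination of
  indicators of cells of level \<open>n\<close>, and the integral of \<open>Hn m\<close> over such a
  cell does not depend on \<open>m \<ge> n\<close>.\<close>

lemma integral_Hn_Hn:
  assumes "n \<le> m"
  shows "(LINT z|Q. Hn n (fst z) (snd z) * Hn m (fst z) (snd z)) = (LINT z|Q. (Hn n (fst z) (snd z))\<^sup>2)"
proof -
  have inner: "AE x in \<nu>. (LINT x0|\<nu>. Hn n x0 x * Hn m x0 x) = (\<Sum>B\<in>Pow {..<n}. (s n B x / p n B) * s n B x)"
    if "n \<le> m" for m
  proof -
    have "AE x in \<nu>. \<forall>B\<in>Pow {..<n}. (LINT x0|\<nu>. indicat_real (C n B) x0 * Hn m x0 x) = s n B x"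
      using integral_C_Hn[OF that] by (subst AE_finite_all) auto
    then show ?thesis
    proof (eventually_elim, goal_cases)
      case (1 x)
      have int: "integrable \<nu> (\<lambda>x0. indicat_real (C n B) x0 * Hn m x0 x)" for B
      proof (rule integrable_const_bound[of _ K])
        show "AE x0 in \<nu>. norm (indicat_real (C n B) x0 * Hn m x0 x) \<le> K"
          using Hn_bounds K by (intro AE_I2) (auto simp: indicator_def)
        show "(\<lambda>x0. indicat_real (C n B) x0 * Hn m x0 x) \<in> borel_measurable \<nu>"
          unfolding Hn_def by measurable
      qed
      have "(LINT x0|\<nu>. Hn n x0 x * Hn m x0 x)
          = (LINT x0|\<nu>. (\<Sum>B\<in>Pow {..<n}. (s n B x / p n B) * (indicat_real (C n B) x0 * Hn m x0 x)))"
        by (intro Bochner_Integration.integral_cong refl) (unfold Hn_def[of n] sum_distrib_right, intro sum.cong refl, simp)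
      also have "\<dots> = (\<Sum>B\<in>Pow {..<n}. (s n B x / p n B) * (LINT x0|\<nu>. indicat_real (C n B) x0 * Hn m x0 x))"
        using int by (subst Bochner_Integration.integral_sum) auto
      also have "\<dots> = (\<Sum>B\<in>Pow {..<n}. (s n B x / p n B) * s n B x)"
        using 1 by (intro sum.cong) auto
      finally show ?case .
    qed
  qed
  have fub: "(LINT z|Q. Hn n (fst z) (snd z) * Hn m (fst z) (snd z)) = (LINT x|\<nu>. LINT x0|\<nu>. Hn n x0 x * Hn m x0 x)" for m
  proof -
    have "integrable (\<nu> \<Otimes>\<^sub>M \<nu>) (\<lambda>(x0, x). Hn n x0 x * Hn m x0 x)"
      by (rule integrable_pair[of _ "K * K"]) (use Hn_prod_bound in \<open>auto simp: split_beta'\<close>)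
    from P.integral_snd[OF this] show ?thesis by (simp add: split_beta')
  qed
  have meas: "(\<lambda>x. LINT x0|\<nu>. Hn n x0 x * Hn m x0 x) \<in> borel_measurable \<nu>" for m
    by (rule borel_measurable_lebesgue_integral) measurable
  have "(LINT x|\<nu>. LINT x0|\<nu>. Hn n x0 x * Hn m x0 x) = (LINT x|\<nu>. LINT x0|\<nu>. Hn n x0 x * Hn n x0 x)"
  proof (rule integral_cong_AE[OF meas meas])
    show "AE x in \<nu>. (LINT x0|\<nu>. Hn n x0 x * Hn m x0 x) = (LINT x0|\<nu>. Hn n x0 x * Hn n x0 x)"
      using inner[OF assms] inner[OF order_refl] by eventually_elim simp
  qed
  then show ?thesis using fub[of m] fub[of n] by (simp add: power2_eq_square)
qed

text \<open>By orthogonality the squared distance between two members is the difference of their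
  squared norms. These norms increase and are bounded, since the values lie between 0 and
  \<open>K\<close> on a finite measure space.\<close>

lemma Hn_cauchy:
  assumes e: "e > 0"
  shows "\<exists>N. \<forall>m\<ge>N. \<forall>n\<ge>N. (\<integral>\<^sup>+z. ennreal (\<bar>Hn m (fst z) (snd z) - Hn n (fst z) (snd z)\<bar> ^ 2) \<partial>Q) \<le> ennreal e"
proof -
  let ?H = "\<lambda>n z. Hn n (fst z) (snd z)"
  define \<alpha> where "\<alpha> n = (LINT z|Q. (?H n z)\<^sup>2)" for n
  have int: "integrable (\<nu> \<Otimes>\<^sub>M \<nu>) (\<lambda>z. ?H n z * ?H m z)" for n m
    by (rule integrable_pair[of _ "K * K"]) (use Hn_prod_bound Hn_meas in \<open>auto simp: split_beta'\<close>)
  have diff: "(LINT z|Q. (?H m z - ?H n z)\<^sup>2) = \<alpha> m - \<alpha> n"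
    and intd: "integrable (\<nu> \<Otimes>\<^sub>M \<nu>) (\<lambda>z. (?H m z - ?H n z)\<^sup>2)" if "n \<le> m" for m n
  proof -
    have eq: "(\<lambda>z. (?H m z - ?H n z)\<^sup>2) = (\<lambda>z. ?H m z * ?H m z - 2 * (?H n z * ?H m z) + ?H n z * ?H n z)"
      by (auto simp: power2_eq_square algebra_simps)
    show "integrable (\<nu> \<Otimes>\<^sub>M \<nu>) (\<lambda>z. (?H m z - ?H n z)\<^sup>2)"
      unfolding eq by (intro Bochner_Integration.integrable_add Bochner_Integration.integrable_diff integrable_mult_right int)
    have "(LINT z|Q. ?H m z * ?H m z - 2 * (?H n z * ?H m z) + ?H n z * ?H n z)
      = (LINT z|Q. ?H m z * ?H m z) - 2 * (LINT z|Q. ?H n z * ?H m z) + (LINT z|Q. ?H n z * ?H n z)"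
      using int by simp
    also have "\<dots> = \<alpha> m - \<alpha> n"
      using integral_Hn_Hn[OF that] by (simp add: \<alpha>_def power2_eq_square)
    finally show "(LINT z|Q. (?H m z - ?H n z)\<^sup>2) = \<alpha> m - \<alpha> n" unfolding eq .
  qed
  have mono: "incseq \<alpha>"
  proof (rule incseq_SucI)
    show "\<alpha> n \<le> \<alpha> (Suc n)" for n
    proof -
      have "0 \<le> (LINT z|Q. (?H (Suc n) z - ?H n z)\<^sup>2)" by simp
      then show ?thesis using diff[of n "Suc n"] by simp
    qed
  qed
  have "\<alpha> n \<le> K * K * measure (\<nu> \<Otimes>\<^sub>M \<nu>) (space (\<nu> \<Otimes>\<^sub>M \<nu>))" for n
  proof -
    have "\<alpha> n \<le> (LINT z|Q. K * K)"
      unfolding \<alpha>_def power2_eq_square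
    proof (rule integral_mono[OF int])
      show "integrable (\<nu> \<Otimes>\<^sub>M \<nu>) (\<lambda>z. K * K)" by (rule integrable_pair[of _ "\<bar>K * K\<bar>"]) auto
      show "?H n z * ?H n z \<le> K * K" if "z \<in> space (\<nu> \<Otimes>\<^sub>M \<nu>)" for z
        using Hn_prod_bound[of "fst z" n "snd z" n] that by (auto simp: space_pair_measure)
    qed
    then show ?thesis by (simp add: mult.commute)
  qed
  moreover have "0 \<le> \<alpha> n" for n by (simp add: \<alpha>_def)
  ultimately have "Bseq \<alpha>"
    by (intro BseqI'[of _ "K * K * measure (\<nu> \<Otimes>\<^sub>M \<nu>) (space (\<nu> \<Otimes>\<^sub>M \<nu>))"]) auto
  then have "convergent \<alpha>" using mono by (simp add: Bseq_monoseq_convergent incseq_imp_monoseq)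
  then have "Cauchy \<alpha>" by (rule convergent_Cauchy)
  then obtain N where N: "\<And>m n. m \<ge> N \<Longrightarrow> n \<ge> N \<Longrightarrow> norm (\<alpha> m - \<alpha> n) < e" using CauchyD e by blast
  have le: "(\<integral>\<^sup>+z. ennreal (\<bar>?H m z - ?H n z\<bar> ^ 2) \<partial>Q) \<le> ennreal e" if "N \<le> n" "n \<le> m" for m n
  proof -
    have "(\<integral>\<^sup>+z. ennreal (\<bar>?H m z - ?H n z\<bar> ^ 2) \<partial>Q) = ennreal (\<alpha> m - \<alpha> n)"
      using nn_integral_eq_integral[OF intd[OF that(2)]] diff[OF that(2)] by simp
    also have "\<dots> \<le> ennreal e" using N[of m n] that by (intro ennreal_leI) auto
    finally show ?thesis .
  qed
  have "(\<integral>\<^sup>+z. ennreal (\<bar>?H m z - ?H n z\<bar> ^ 2) \<partial>Q) \<le> ennreal e" if "N \<le> n" "N \<le> m" for m n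
  proof (cases "n \<le> m")
    case True
    then show ?thesis by (rule le[OF that(1)])
  next
    case False
    then show ?thesis using le[OF that(2), of n] by (simp add: power2_commute)
  qed
  then show ?thesis by blast
qed

theorem cell_kernel:
  obtains H where "(\<lambda>(x0, x). H x0 x) \<in> borel_measurable (\<nu> \<Otimes>\<^sub>M \<nu>)" "\<And>x0 x. 0 \<le> H x0 x \<and> H x0 x \<le> K"
    "\<And>n B. B \<subseteq> {..<n} \<Longrightarrow> AE x in \<nu>. (LINT x0|\<nu>. indicat_real (C n B) x0 * H x0 x) = s n B x"
proof -
  let ?H = "\<lambda>n z. Hn n (fst z) (snd z)"
  have Hm [measurable]: "?H n \<in> borel_measurable Q" for n using Hn_meas by (simp add: split_beta')
  obtain g where g [measurable]: "g \<in> borel_measurable Q"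
    "\<And>e. e > 0 \<Longrightarrow> \<exists>N. \<forall>n\<ge>N. (\<integral>\<^sup>+z. ennreal (\<bar>?H n z - g z\<bar> ^ 2) \<partial>Q) \<le> ennreal e"
    using riesz_fischer[of ?H Q 2, OF Hm _ Hn_cauchy] by auto
  \<comment> \<open>Clamping gives the bounds at every point. It does not increase the distance to
    \<open>Hn\<close>, whose values already lie between 0 and \<open>K\<close>.\<close>
  define H where "H x0 x = max 0 (min (g (x0, x)) K)" for x0 x
  have H_meas [measurable]: "(\<lambda>(x0, x). H x0 x) \<in> borel_measurable Q" unfolding H_def by measurable
  have H_bd: "0 \<le> H x0 x \<and> H x0 x \<le> K" for x0 x using K by (auto simp: H_def)
  have "AE x in \<nu>. (LINT x0|\<nu>. indicat_real (C n B) x0 * H x0 x) = s n B x" if B: "B \<subseteq> {..<n}" for n B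
  proof -
    define d where "d x = (LINT x0|\<nu>. indicat_real (C n B) x0 * H x0 x) - s n B x" for x
    have [measurable]: "(\<lambda>x. LINT x0|\<nu>. indicat_real (C n B) x0 * H x0 x) \<in> borel_measurable \<nu>"
      by (rule borel_measurable_lebesgue_integral) measurable
    have d_meas [measurable]: "d \<in> borel_measurable \<nu>" unfolding d_def[abs_def] by measurable
    define T where "T = measure Q (space Q)"
    have bound: "(\<integral>\<^sup>+x. ennreal \<bar>d x\<bar> \<partial>\<nu>) \<le> ennreal (e * T + e)" if e: "e > 0" for e
    proof -
      obtain N where N: "\<And>k. k \<ge> N \<Longrightarrow> (\<integral>\<^sup>+z. ennreal (\<bar>?H k z - g z\<bar> ^ 2) \<partial>Q) \<le> ennreal (e * e)"
        using g(2)[of "e * e"] e by auto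
      define k where "k = max n N"
      have kn: "n \<le> k" "N \<le> k" by (simp_all add: k_def)
      have "(\<integral>\<^sup>+x. ennreal \<bar>d x\<bar> \<partial>\<nu>) \<le> (\<integral>\<^sup>+x. (\<integral>\<^sup>+x0. ennreal \<bar>H x0 x - Hn k x0 x\<bar> \<partial>\<nu>) \<partial>\<nu>)"
      proof (rule nn_integral_mono_AE, use integral_C_Hn[OF kn(1) B] AE_space in eventually_elim)
        case (elim x)
        have x: "x \<in> space \<nu>" using elim by simp
        have [measurable]: "(\<lambda>x0. H x0 x) \<in> borel_measurable \<nu>" "(\<lambda>x0. Hn k x0 x) \<in> borel_measurable \<nu>"
          using measurable_compose[OF measurable_Pair2'[OF x] H_meas] measurable_compose[OF measurable_Pair2'[OF x] Hn_meas[of k]]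
          by simp_all
        have int: "integrable \<nu> (\<lambda>x0. indicat_real (C n B) x0 * H x0 x)" "integrable \<nu> (\<lambda>x0. indicat_real (C n B) x0 * Hn k x0 x)"
          using H_bd Hn_bounds K
          by (auto intro!: integrable_const_bound[of _ K] AE_I2 simp: indicator_def)
        have "d x = (LINT x0|\<nu>. indicat_real (C n B) x0 * H x0 x - indicat_real (C n B) x0 * Hn k x0 x)"
          using int elim by (simp add: d_def)
        then have "ennreal \<bar>d x\<bar> \<le> (\<integral>\<^sup>+x0. ennreal (norm (indicat_real (C n B) x0 * H x0 x - indicat_real (C n B) x0 * Hn k x0 x)) \<partial>\<nu>)"
          using integral_norm_bound_ennreal[OF Bochner_Integration.integrable_diff[OF int]] by simp
        also have "\<dots> \<le> (\<integral>\<^sup>+x0. ennreal \<bar>H x0 x - Hn k x0 x\<bar> \<partial>\<nu>)"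
          by (intro nn_integral_mono ennreal_leI) (auto simp: indicator_def)
        finally show ?case .
      qed
      also have "\<dots> = (\<integral>\<^sup>+z. ennreal \<bar>H (fst z) (snd z) - ?H k z\<bar> \<partial>Q)"
      proof -
        have [measurable]: "(\<lambda>z. H (fst z) (snd z)) \<in> borel_measurable Q" using H_meas by (simp add: split_beta')
        have "(\<lambda>z. ennreal \<bar>H (fst z) (snd z) - ?H k z\<bar>) \<in> borel_measurable Q" by measurable
        from P.nn_integral_snd[OF this] show ?thesis by simp
      qed
      \<comment> \<open>The inequality \<open>\<bar>a\<bar> \<le> e + a^2 / e\<close> converts
        convergence in L2 into convergence in L1 on a finite measure space. A squared distance below
        \<open>e * e\<close> contributes \<open>e\<close>, and the constant contributes
        \<open>e * T\<close>.\<close>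
      also have "\<dots> \<le> (\<integral>\<^sup>+z. ennreal (e + \<bar>?H k z - g z\<bar> ^ 2 / e) \<partial>Q)"
      proof (rule nn_integral_mono, rule ennreal_leI)
        fix z assume "z \<in> space Q"
        then have "0 \<le> ?H k z" "?H k z \<le> K" using Hn_bounds by (auto simp: space_pair_measure)
        then have "\<bar>H (fst z) (snd z) - ?H k z\<bar> \<le> \<bar>?H k z - g z\<bar>" by (auto simp: H_def)
        also have "\<dots> \<le> e + \<bar>?H k z - g z\<bar> ^ 2 / e"
        proof (cases "\<bar>?H k z - g z\<bar> \<le> e")
          case True
          then show ?thesis using e by (simp add: add_increasing2)
        next
          case False
          then have "\<bar>?H k z - g z\<bar> * e \<le> \<bar>?H k z - g z\<bar> ^ 2" unfolding power2_eq_square by (intro mult_left_mono) auto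
          then have "\<bar>?H k z - g z\<bar> \<le> \<bar>?H k z - g z\<bar> ^ 2 / e" using e by (simp add: pos_le_divide_eq)
          then show ?thesis using e by linarith
        qed
        finally show "\<bar>H (fst z) (snd z) - ?H k z\<bar> \<le> e + \<bar>?H k z - g z\<bar> ^ 2 / e" .
      qed
      also have "\<dots> = (\<integral>\<^sup>+z. ennreal e \<partial>Q) + (\<integral>\<^sup>+z. ennreal (1 / e) * ennreal (\<bar>?H k z - g z\<bar> ^ 2) \<partial>Q)"
        using e by (subst nn_integral_add[symmetric]) (auto simp: ennreal_plus[symmetric] ennreal_mult[symmetric] simp del: ennreal_plus)
      also have "\<dots> = ennreal e * emeasure Q (space Q) + ennreal (1 / e) * (\<integral>\<^sup>+z. ennreal (\<bar>?H k z - g z\<bar> ^ 2) \<partial>Q)"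
        by (simp add: nn_integral_cmult)
      also have "\<dots> \<le> ennreal e * emeasure Q (space Q) + ennreal (1 / e) * ennreal (e * e)"
        by (intro add_left_mono mult_left_mono N kn) auto
      also have "\<dots> = ennreal (e * T + e)"
        using e finite_measure.emeasure_eq_measure[OF finite_pair, of "space Q"]
        by (simp add: T_def ennreal_mult[symmetric] ennreal_plus[symmetric] del: ennreal_plus)
      finally show ?thesis .
    qed
    have "(\<integral>\<^sup>+x. ennreal \<bar>d x\<bar> \<partial>\<nu>) \<le> 0"
    proof (rule LIMSEQ_le_const)
      have "(\<lambda>i. ennreal (inverse (real (Suc i)) * T + inverse (real (Suc i)))) \<longlonglongrightarrow> ennreal (0 * T + 0)"
        by (intro tendsto_ennrealI tendsto_intros LIMSEQ_inverse_real_of_nat)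
      then show "(\<lambda>i. ennreal (inverse (real (Suc i)) * T + inverse (real (Suc i)))) \<longlonglongrightarrow> 0" by simp
      show "\<exists>N. \<forall>i\<ge>N. (\<integral>\<^sup>+x. ennreal \<bar>d x\<bar> \<partial>\<nu>) \<le> ennreal (inverse (real (Suc i)) * T + inverse (real (Suc i)))"
        using bound by simp
    qed
    then have "AE x in \<nu>. ennreal \<bar>d x\<bar> = 0" by (subst (asm) le_zero_eq, subst (asm) nn_integral_0_iff_AE) auto
    then show ?thesis by eventually_elim (simp add: d_def)
  qed
  with that[of H] H_meas H_bd show ?thesis by blast
qed

end

text \<open>Multiplying Lebesgue measure by such a weight gives a finite measure with the same null
  sets, on which bounded functions are square integrable. The bound by 1 serves another use, as an
  averaging density whose products with integrable functions remain integrable.\<close>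

lemma lborel_weight:
  obtains w :: "'a::euclidean_space \<Rightarrow> real"
  where "w \<in> borel_measurable borel" "\<And>x. 0 < w x" "\<And>x. w x \<le> 1" "integrable lborel w"
proof -
  obtain h :: "'a \<Rightarrow> ennreal" where h: "h \<in> borel_measurable lborel" "integral\<^sup>N lborel h \<noteq> \<infinity>"
    "\<And>x. 0 < h x \<and> h x < \<infinity>"
    using sigma_finite_measure.Ex_finite_integrable_function[OF sigma_finite_lborel] by auto
  have [measurable]: "h \<in> borel_measurable borel" using h(1) by simp
  define w where "w x = min 1 (enn2real (h x))" for x
  show ?thesis
  proof (rule that[of w])
    show [measurable]: "w \<in> borel_measurable borel" unfolding w_def[abs_def] by measurable
    show w0: "0 < w x" for x using h(3)[of x] by (simp add: w_def enn2real_positive_iff)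
    show "w x \<le> 1" for x by (simp add: w_def)
    have "ennreal (norm (w x)) \<le> h x" for x
    proof -
      have "ennreal (norm (w x)) \<le> ennreal (enn2real (h x))" using w0[of x] by (intro ennreal_leI) (simp add: w_def)
      also have "\<dots> = h x" using h(3)[of x] by (intro ennreal_enn2real) auto
      finally show ?thesis .
    qed
    then have "(\<integral>\<^sup>+x. ennreal (norm (w x)) \<partial>lborel) \<le> integral\<^sup>N lborel h" by (rule nn_integral_mono)
    also have "\<dots> < \<infinity>" using h(2) by (simp add: less_top)
    finally show "integrable lborel w" by (intro integrableI_bounded) simp_all
  qed
qed

lemma bounded_mult_integrable:
  fixes f g :: "'a::euclidean_space \<Rightarrow> real"
  assumes "f \<in> Lp 1" "g \<in> borel_measurable borel" "\<And>x. \<bar>g x\<bar> \<le> K"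
  shows "integrable lborel (\<lambda>x. g x * f x)" "\<bar>LINT x|lborel. g x * f x\<bar> \<le> K * Lp_norm 1 f"
proof -
  have [measurable]: "g \<in> borel_measurable borel" "f \<in> borel_measurable borel" using assms Lp_measurable[OF assms(1)] by auto
  have K: "0 \<le> K" using assms(3)[of undefined] by simp
  have int: "integrable lborel (\<lambda>x. K * \<bar>f x\<bar>)" using assms(1) by (simp add: Lp1_iff)
  have le: "\<bar>g x * f x\<bar> \<le> K * \<bar>f x\<bar>" for x using assms(3)[of x] by (simp add: abs_mult mult_right_mono)
  show i: "integrable lborel (\<lambda>x. g x * f x)"
    by (rule Bochner_Integration.integrable_bound[OF int]) (use le K in \<open>auto simp: abs_mult\<close>)
  have "\<bar>LINT x|lborel. g x * f x\<bar> \<le> (LINT x|lborel. \<bar>g x * f x\<bar>)" by (rule integral_abs_bound)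
  also have "\<dots> \<le> (LINT x|lborel. K * \<bar>f x\<bar>)" using i int le by (intro integral_mono) auto
  finally show "\<bar>LINT x|lborel. g x * f x\<bar> \<le> K * Lp_norm 1 f" by (simp add: Lp_norm1)
qed

section \<open>Kernels of positive operators from L1 to bounded functions\<close>

locale L1_Linf_operator =
  fixes S :: "('a::euclidean_space \<Rightarrow> real) \<Rightarrow> 'a \<Rightarrow> real" and K :: real
  assumes S_meas: "f \<in> Lp 1 \<Longrightarrow> S f \<in> borel_measurable borel"
    and S_lin: "f \<in> Lp 1 \<Longrightarrow> g \<in> Lp 1 \<Longrightarrow> AE x in lborel. S (\<lambda>x. a * f x + b * g x) x = a * S f x + b * S g x"
    and S_pos: "f \<in> Lp 1 \<Longrightarrow> (\<And>x. 0 \<le> f x) \<Longrightarrow> AE x in lborel. 0 \<le> S f x"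
    and S_bd: "f \<in> Lp 1 \<Longrightarrow> AE x in lborel. \<bar>S f x\<bar> \<le> K * Lp_norm 1 f"
    and K: "0 \<le> K"
begin

lemma S_sum:
  assumes "finite I" "\<And>i. i \<in> I \<Longrightarrow> f i \<in> Lp 1"
  shows "(\<lambda>x. \<Sum>i\<in>I. f i x) \<in> Lp 1 \<and> (AE x in lborel. S (\<lambda>x. \<Sum>i\<in>I. f i x) x = (\<Sum>i\<in>I. S (f i) x))"
  using assms
proof (induction I)
  case empty
  have "AE x in lborel. \<bar>S (\<lambda>x. 0) x\<bar> \<le> K * Lp_norm 1 (\<lambda>x::'a. 0)" by (rule S_bd[OF Lp_zero])
  then show ?case by (simp add: Lp_zero Lp_norm1)
next
  case (insert i I)
  have IH: "(\<lambda>x. \<Sum>i\<in>I. f i x) \<in> Lp 1" "AE x in lborel. S (\<lambda>x. \<Sum>i\<in>I. f i x) x = (\<Sum>i\<in>I. S (f i) x)"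
    using insert by auto
  have fi: "f i \<in> Lp 1" using insert by auto
  have "AE x in lborel. S (\<lambda>x. 1 * f i x + 1 * (\<Sum>i\<in>I. f i x)) x = 1 * S (f i) x + 1 * S (\<lambda>x. \<Sum>i\<in>I. f i x) x"
    by (rule S_lin[OF fi IH(1)])
  with IH(2) have "AE x in lborel. S (\<lambda>x. \<Sum>i\<in>insert i I. f i x) x = (\<Sum>i\<in>insert i I. S (f i) x)"
    by eventually_elim (use insert(1,2) in simp)
  moreover have "(\<lambda>x. \<Sum>i\<in>insert i I. f i x) \<in> Lp 1"
    using Lp_add[OF fi IH(1)] insert(1,2) by simp
  ultimately show ?case by blast
qed

definition represents :: "('a \<Rightarrow> 'a \<Rightarrow> real) \<Rightarrow> ('a \<Rightarrow> real) \<Rightarrow> bool" where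
  "represents H f \<longleftrightarrow> f \<in> Lp 1 \<and> (AE x in lborel. S f x = (LINT x0|lborel. H x0 x * f x0))"

lemma represents_lincomb:
  assumes H: "\<And>x. (\<lambda>x0. H x0 x) \<in> borel_measurable borel" "\<And>x0 x. \<bar>H x0 x\<bar> \<le> K"
    and fg: "represents H f" "represents H g"
  shows "represents H (\<lambda>x. a * f x + b * g x)"
proof -
  have L: "f \<in> Lp 1" "g \<in> Lp 1" using fg by (auto simp: represents_def)
  have "AE x in lborel. S f x = (LINT x0|lborel. H x0 x * f x0)" "AE x in lborel. S g x = (LINT x0|lborel. H x0 x * g x0)"
    using fg by (auto simp: represents_def)
  with S_lin[OF L, of a b] have "AE x in lborel. S (\<lambda>x. a * f x + b * g x) x = (LINT x0|lborel. H x0 x * (a * f x0 + b * g x0))"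
  proof eventually_elim
    case (elim x)
    have "(LINT x0|lborel. H x0 x * (a * f x0 + b * g x0)) = (LINT x0|lborel. a * (H x0 x * f x0) + b * (H x0 x * g x0))"
      by (intro Bochner_Integration.integral_cong refl) (simp add: algebra_simps)
    also have "\<dots> = a * (LINT x0|lborel. H x0 x * f x0) + b * (LINT x0|lborel. H x0 x * g x0)"
      using bounded_mult_integrable(1)[OF L(1) H(1,2)] bounded_mult_integrable(1)[OF L(2) H(1,2)] by simp
    finally show ?case using elim by simp
  qed
  then show ?thesis using Lp1_lincomb[OF L] by (simp add: represents_def)
qed

text \<open>Both sides are Lipschitz with constant \<open>K\<close> from L1 to bounded functions. A
  sequence involves only countably many null sets, so pointwise passage to the limit is
  legitimate.\<close>

lemma represents_limit:
  assumes H: "\<And>x. (\<lambda>x0. H x0 x) \<in> borel_measurable borel" "\<And>x0 x. \<bar>H x0 x\<bar> \<le> K"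
    and g: "\<And>k::nat. represents H (g k)" and f: "f \<in> Lp 1"
    and lim: "(\<lambda>k. Lp_norm 1 (\<lambda>x. g k x - f x)) \<longlonglongrightarrow> 0"
  shows "represents H f"
proof -
  have gL: "g k \<in> Lp 1" for k using g by (auto simp: represents_def)
  have dL: "(\<lambda>x. g k x - f x) \<in> Lp 1" for k using Lp_diff[OF gL f] by simp
  have ae: "AE x in lborel. S (\<lambda>x. g k x - f x) x = S (g k) x - S f x" for k
    using S_lin[OF gL[of k] f, of 1 "-1"] by simp
  have "AE x in lborel. \<forall>k. S (g k) x = (LINT x0|lborel. H x0 x * g k x0) \<and> \<bar>S (g k) x - S f x\<bar> \<le> K * Lp_norm 1 (\<lambda>x. g k x - f x)"
    unfolding AE_all_countable
  proof
    fix k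
    have "AE x in lborel. S (g k) x = (LINT x0|lborel. H x0 x * g k x0)" using g by (simp add: represents_def)
    with ae[of k] S_bd[OF dL[of k]]
    show "AE x in lborel. S (g k) x = (LINT x0|lborel. H x0 x * g k x0) \<and> \<bar>S (g k) x - S f x\<bar> \<le> K * Lp_norm 1 (\<lambda>x. g k x - f x)"
      by eventually_elim simp
  qed
  then have "AE x in lborel. S f x = (LINT x0|lborel. H x0 x * f x0)"
  proof eventually_elim
    case (elim x)
    have bd: "\<bar>S f x - (LINT x0|lborel. H x0 x * f x0)\<bar> \<le> 2 * K * Lp_norm 1 (\<lambda>x. g k x - f x)" for k
    proof -
      have "(LINT x0|lborel. H x0 x * (g k x0 - f x0)) = (LINT x0|lborel. H x0 x * g k x0) - (LINT x0|lborel. H x0 x * f x0)"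
        using bounded_mult_integrable(1)[OF gL H(1,2)] bounded_mult_integrable(1)[OF f H(1,2)] by (simp add: right_diff_distrib)
      then have "\<bar>(LINT x0|lborel. H x0 x * g k x0) - (LINT x0|lborel. H x0 x * f x0)\<bar> \<le> K * Lp_norm 1 (\<lambda>x. g k x - f x)"
        using bounded_mult_integrable(2)[OF dL[of k] H(1)[of x] H(2)] by simp
      then show ?thesis using elim[rule_format, of k] by linarith
    qed
    have "(\<lambda>k. 2 * K * Lp_norm 1 (\<lambda>x. g k x - f x)) \<longlonglongrightarrow> 0" by (rule tendsto_mult_right_zero[OF lim])
    then have "\<bar>S f x - (LINT x0|lborel. H x0 x * f x0)\<bar> \<le> 0" by (rule LIMSEQ_le_const) (use bd in blast)
    then show ?case by simp
  qed
  then show ?thesis using f by (simp add: represents_def)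
qed

text \<open>The martingale lives on the finite measure \<open>\<nu>\<close> with density
  \<open>w\<close>, while the kernel refers to Lebesgue measure. Testing \<open>S\<close> on
  \<open>w * f\<close> reconciles the two: integrating \<open>H * f\<close> against
  \<open>\<nu>\<close> is integrating \<open>H * (w * f)\<close> against
  \<open>lborel\<close>.\<close>

theorem kernel_exists:
  obtains H where "(\<lambda>(x0, x). H x0 x) \<in> borel_measurable (lborel \<Otimes>\<^sub>M lborel)"
    "\<And>x0 x. 0 \<le> H x0 x \<and> H x0 x \<le> K" "\<And>f. f \<in> Lp 1 \<Longrightarrow> represents H f"
proof -
  obtain w :: "'a \<Rightarrow> real" where w [measurable]: "w \<in> borel_measurable borel" and w0: "\<And>x. 0 < w x"
    and w_int: "integrable lborel w" by (rule lborel_weight) blast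
  define \<nu> where "\<nu> = density lborel (\<lambda>x. ennreal (w x))"
  have sets_\<nu> [measurable_cong]: "sets \<nu> = sets borel" and space_\<nu>: "space \<nu> = UNIV" by (simp_all add: \<nu>_def)
  have AE_\<nu>: "(AE x in \<nu>. P x) \<longleftrightarrow> (AE x in lborel. P x)" for P
    unfolding \<nu>_def by (subst AE_density) (auto simp: w0)
  have integral_\<nu>: "(LINT x|\<nu>. f x) = (LINT x|lborel. w x * f x)" if "f \<in> borel_measurable borel" for f :: "'a \<Rightarrow> real"
    unfolding \<nu>_def using that w0 by (subst integral_density) (auto intro: less_imp_le)
  have integrable_\<nu>: "integrable \<nu> f \<longleftrightarrow> integrable lborel (\<lambda>x. w x * f x)" if "f \<in> borel_measurable borel" for f :: "'a \<Rightarrow> real"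
    unfolding \<nu>_def using that w0 by (subst integrable_density) (auto intro: less_imp_le)
  have fin: "finite_measure \<nu>"
  proof (rule finite_measureI)
    have "emeasure \<nu> (space \<nu>) = (\<integral>\<^sup>+x. ennreal (w x) \<partial>lborel)" unfolding \<nu>_def by (simp add: emeasure_density)
    also have "\<dots> \<noteq> \<infinity>" using w_int w0 by (simp add: nn_integral_eq_integral less_imp_le)
    finally show "emeasure \<nu> (space \<nu>) \<noteq> \<infinity>" .
  qed
  have w1A: "(\<lambda>y. w y * indicat_real A y) \<in> Lp 1" if "A \<in> sets borel" for A
    unfolding Lp1_iff using integrable_mult_indicator[OF _ w_int, of A] that by (simp add: mult.commute)
  have norm_w1A: "Lp_norm 1 (\<lambda>y. w y * indicat_real A y) = measure \<nu> A" if A: "A \<in> sets borel" for A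
  proof -
    have "Lp_norm 1 (\<lambda>y. w y * indicat_real A y) = (LINT x|lborel. w x * indicat_real A x)"
      using w0 by (simp add: Lp_norm1 abs_mult less_imp_le)
    also have "\<dots> = (LINT x|\<nu>. indicat_real A x)" using A by (intro integral_\<nu>[symmetric] borel_measurable_indicator)
    also have "\<dots> = measure \<nu> (A \<inter> space \<nu>)" by (rule Bochner_Integration.integral_indicator)
    also have "\<dots> = measure \<nu> A" by (simp add: space_\<nu>)
    finally show ?thesis .
  qed
  obtain \<B> :: "'a set set" where \<B>: "countable \<B>" "topological_basis \<B>" using ex_countable_basis by blast
  \<comment> \<open>The cells come from a countable basis of the topology, so that together they
    generate the Borel sets. Adding \<open>UNIV\<close> ensures that there is something to
    enumerate.\<close>
  define E where "E = from_nat_into (insert UNIV \<B>)"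
  have rangeE: "range E = insert UNIV \<B>" unfolding E_def using \<B>(1) by (intro range_from_nat_into) auto
  have E_sets [measurable]: "E i \<in> sets borel" for i
  proof -
    have "E i \<in> insert UNIV \<B>" using rangeE by blast
    then show ?thesis using topological_basis_open[OF \<B>(2)] by auto
  qed
  define cell where "cell n B = {y. {i. i < n \<and> y \<in> E i} = B}" for n B
  have cell_sets [measurable]: "cell n B \<in> sets borel" for n B
  proof -
    have "cell n B = {y \<in> space borel. (\<forall>i<n. y \<in> E i \<longleftrightarrow> i \<in> B) \<and> B \<subseteq> {..<n}}" by (auto simp: cell_def)
    then show ?thesis by simp
  qed
  \<comment> \<open>The image of a weighted cell satisfies its bounds only almost everywhere.
    Clamping makes them hold everywhere, as \<open>cell_martingale\<close> requires, and changes it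
    only on a null set.\<close>
  define s where "s n B x = max 0 (min (S (\<lambda>y. w y * indicat_real (cell n B) y) x) (K * measure \<nu> (cell n B)))" for n B x
  have s_ae: "AE x in lborel. s n B x = S (\<lambda>y. w y * indicat_real (cell n B) y) x" for n B
  proof -
    have "AE x in lborel. 0 \<le> S (\<lambda>y. w y * indicat_real (cell n B) y) x"
      by (rule S_pos[OF w1A]) (auto simp: less_imp_le[OF w0])
    with S_bd[OF w1A[OF cell_sets[of n B]]] show ?thesis
      unfolding norm_w1A[OF cell_sets] by eventually_elim (auto simp: s_def)
  qed
  interpret cell_martingale \<nu> E s K
  proof (intro cell_martingale.intro fin cell_martingale_axioms.intro)
    show "E i \<in> sets \<nu>" for i by (simp add: sets_\<nu>)
    show "s n B \<in> borel_measurable \<nu>" for n B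
      unfolding s_def[abs_def] using S_meas[OF w1A[OF cell_sets]] by measurable
    show "0 \<le> s n B x" for n B x by (simp add: s_def)
    show "s n B x \<le> K * measure \<nu> {y \<in> space \<nu>. {i. i < n \<and> y \<in> E i} = B}" for n B x
      using K by (simp add: s_def space_\<nu> cell_def[symmetric])
    show "0 \<le> K" by (rule K)
    fix n m :: nat and B assume nm: "n \<le> m" and B: "B \<subseteq> {..<n}"
    let ?I = "{B'. B' \<subseteq> {..<m} \<and> B' \<inter> {..<n} = B}"
    have finI: "finite ?I" by (rule finite_subset[of _ "Pow {..<m}"]) auto
    have eq: "w y * indicat_real (cell n B) y = (\<Sum>B'\<in>?I. w y * indicat_real (cell m B') y)" for y
    proof -
      have "(\<Sum>B'\<in>?I. w y * indicat_real (cell m B') y) = (\<Sum>B'\<in>?I. if B' = {i. i < m \<and> y \<in> E i} then w y else 0)"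
        by (intro sum.cong) (auto simp: cell_def indicator_def)
      also have "\<dots> = (if {i. i < m \<and> y \<in> E i} \<in> ?I then w y else 0)" using finI by (simp add: sum.delta)
      also have "{i. i < m \<and> y \<in> E i} \<in> ?I \<longleftrightarrow> y \<in> cell n B" using nm by (auto simp: cell_def)
      finally show ?thesis by (simp add: indicator_def)
    qed
    have "AE x in lborel. S (\<lambda>y. \<Sum>B'\<in>?I. w y * indicat_real (cell m B') y) x = (\<Sum>B'\<in>?I. S (\<lambda>y. w y * indicat_real (cell m B') y) x)"
      using S_sum[OF finI, of "\<lambda>B' y. w y * indicat_real (cell m B') y"] w1A[OF cell_sets] by blast
    moreover have "AE x in lborel. \<forall>B'\<in>?I. s m B' x = S (\<lambda>y. w y * indicat_real (cell m B') y) x"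
      using s_ae by (subst AE_finite_all[OF finI]) blast
    ultimately show "AE x in \<nu>. s n B x = (\<Sum>B'\<in>?I. s m B' x)"
      using s_ae[of n B] unfolding AE_\<nu> eq[abs_def] by eventually_elim simp
  qed
  obtain H where H: "(\<lambda>(x0, x). H x0 x) \<in> borel_measurable (\<nu> \<Otimes>\<^sub>M \<nu>)" "\<And>x0 x. 0 \<le> H x0 x \<and> H x0 x \<le> K"
    "\<And>n B. B \<subseteq> {..<n} \<Longrightarrow> AE x in \<nu>. (LINT x0|\<nu>. indicat_real (C n B) x0 * H x0 x) = s n B x"
    by (rule cell_kernel) blast
  have C_cell: "C n B = cell n B" for n B by (simp add: C_def cell_def space_\<nu>)
  have Hm: "(\<lambda>(x0, x). H x0 x) \<in> borel_measurable (lborel \<Otimes>\<^sub>M lborel)"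
    using H(1) by (subst measurable_cong_sets[OF sets_pair_measure_cong refl]) (simp_all add: sets_\<nu>)
  have Hx: "(\<lambda>x0. H x0 x) \<in> borel_measurable borel" for x
    using measurable_compose[OF measurable_Pair2'[of x lborel lborel] Hm] by simp
  have Hb: "\<bar>H x0 x\<bar> \<le> K" for x0 x using H(2)[of x0 x] by simp
  note lincomb = represents_lincomb[of H, OF Hx Hb] and limit = represents_limit[of H, OF Hx Hb]
  have rep_cell: "represents H (\<lambda>y. w y * indicat_real (cell n B) y)" if "B \<subseteq> {..<n}" for n B
  proof -
    have "AE x in lborel. (LINT x0|\<nu>. indicat_real (cell n B) x0 * H x0 x) = s n B x"
      using H(3)[OF that] unfolding AE_\<nu> C_cell .
    with s_ae[of n B] have "AE x in lborel. S (\<lambda>y. w y * indicat_real (cell n B) y) x = (LINT x0|lborel. H x0 x * (w x0 * indicat_real (cell n B) x0))"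
    proof eventually_elim
      case (elim x)
      have "(LINT x0|\<nu>. indicat_real (cell n B) x0 * H x0 x) = (LINT x0|lborel. w x0 * (indicat_real (cell n B) x0 * H x0 x))"
        using Hx[of x] by (intro integral_\<nu>) measurable
      then show ?case using elim by (simp add: mult_ac)
    qed
    then show ?thesis using w1A[OF cell_sets] by (simp add: represents_def)
  qed
  have rep_sum: "represents H (\<lambda>y. \<Sum>i\<in>I. g i y)" if "finite I" "\<And>i. i \<in> I \<Longrightarrow> represents H (g i)" for I :: "nat set set" and g
    using that
  proof (induction I)
    case empty
    have "represents H (\<lambda>y. 0 * (w y * indicat_real (cell 0 {}) y) + 0 * (w y * indicat_real (cell 0 {}) y))"
      using rep_cell[of "{}" 0] by (intro lincomb) auto
    then show ?case by simp
  next
    case (insert i I)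
    then show ?case using lincomb[of "g i" "\<lambda>y. \<Sum>i\<in>I. g i y" 1 1] by simp
  qed
  define code where "code n y = {i. i < n \<and> y \<in> E i}" for n y
  \<comment> \<open>Finite unions of cells of one level. Refining to the larger of two levels makes
    the family stable under intersection; it contains the basis, and a pi-lambda argument extends
    representability from it to all Borel sets.\<close>
  define \<P> where "\<P> = {{y. code n y \<in> \<C>} | n \<C>. True}"
  have rep_\<P>: "represents H (\<lambda>y. w y * indicat_real A y)" if A: "A \<in> \<P>" for A
  proof -
    obtain n \<C> where A: "A = {y. code n y \<in> \<C>}" using A by (auto simp: \<P>_def)
    let ?I = "\<C> \<inter> Pow {..<n}"
    have eq: "w y * indicat_real A y = (\<Sum>B\<in>?I. w y * indicat_real (cell n B) y)" for y
    proof -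
      have "(\<Sum>B\<in>?I. w y * indicat_real (cell n B) y) = (\<Sum>B\<in>?I. if B = code n y then w y else 0)"
        by (intro sum.cong) (auto simp: cell_def code_def indicator_def)
      also have "\<dots> = (if code n y \<in> ?I then w y else 0)" by (simp add: sum.delta)
      finally show ?thesis by (auto simp: A code_def indicator_def)
    qed
    show ?thesis unfolding eq by (intro rep_sum rep_cell) auto
  qed
  have "Int_stable \<P>"
  proof (rule Int_stableI)
    have *: "{y. code n y \<in> \<C>} \<inter> {y. code m y \<in> \<D>} \<in> \<P>" if "n \<le> m" for n m \<C> \<D>
    proof -
      have "code n y = code m y \<inter> {..<n}" for y using that by (auto simp: code_def)
      then have "{y. code n y \<in> \<C>} \<inter> {y. code m y \<in> \<D>} = {y. code m y \<in> {B. B \<inter> {..<n} \<in> \<C>} \<inter> \<D>}" by auto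
      then show ?thesis unfolding \<P>_def by blast
    qed
    fix a b assume "a \<in> \<P>" "b \<in> \<P>"
    then obtain n m \<C> \<D> where ab: "a = {y. code n y \<in> \<C>}" "b = {y. code m y \<in> \<D>}" by (auto simp: \<P>_def)
    show "a \<inter> b \<in> \<P>"
      using *[of n m \<C> \<D>] *[of m n \<D> \<C>] unfolding ab by (cases "n \<le> m") (auto simp: Int_commute)
  qed
  have \<P>_sets: "A \<in> sets borel" if A: "A \<in> \<P>" for A
  proof -
    obtain n \<C> where A: "A = {y. code n y \<in> \<C>}" using A by (auto simp: \<P>_def)
    have "A = (\<Union>B\<in>\<C> \<inter> Pow {..<n}. cell n B)" by (auto simp: A cell_def code_def)
    then show ?thesis by (auto intro!: sets.finite_UN)
  qed
  have borel_\<P>: "sets (borel :: 'a measure) = sigma_sets UNIV \<P>"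
  proof
    have "\<B> \<subseteq> \<P>"
    proof
      fix b assume "b \<in> \<B>"
      then obtain i where "b = E i" using rangeE by (metis insertI2 rangeE image_iff)
      then have "b = {y. code (Suc i) y \<in> {B. i \<in> B}}" by (auto simp: code_def)
      then show "b \<in> \<P>" unfolding \<P>_def by blast
    qed
    then have "sigma_sets UNIV \<B> \<subseteq> sigma_sets UNIV \<P>" by (rule sigma_sets_mono')
    moreover have "sets (borel :: 'a measure) = sigma_sets UNIV \<B>"
      unfolding borel_eq_countable_basis[OF \<B>] by (rule sets_measure_of) simp
    ultimately show "sets borel \<subseteq> sigma_sets UNIV \<P>" by simp
    show "sigma_sets UNIV \<P> \<subseteq> sets borel"
      using \<P>_sets sets.sigma_sets_subset[of \<P> borel] by auto
  qed
  have rep_borel: "represents H (\<lambda>y. w y * indicat_real A y)" if "A \<in> sets borel" for A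
  proof -
    have "A \<in> sigma_sets UNIV \<P>" using that borel_\<P> by simp
    with \<open>Int_stable \<P>\<close> subset_UNIV[of \<P>, folded Pow_UNIV] show ?thesis
    proof (induction rule: sigma_sets_induct_disjoint)
      case (basic A)
      then show ?case by (rule rep_\<P>)
    next
      case empty
      have "{} = {y. code 0 y \<in> {}}" by simp
      then have "{} \<in> \<P>" unfolding \<P>_def by blast
      then show ?case by (rule rep_\<P>)
    next
      case (compl A)
      have "UNIV = {y. code 0 y \<in> UNIV}" by simp
      then have "UNIV \<in> \<P>" unfolding \<P>_def by blast
      then have "represents H (\<lambda>y. 1 * (w y * indicat_real UNIV y) + (-1) * (w y * indicat_real A y))"
        by (intro lincomb rep_\<P> compl)
      moreover have "(\<lambda>y. 1 * (w y * indicat_real UNIV y) + (-1) * (w y * indicat_real A y)) = (\<lambda>y. w y * indicat_real (UNIV - A) y)"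
        by (auto simp: indicator_def fun_eq_iff)
      ultimately show ?case by simp
    next
      case (union A)
      have A [measurable]: "A i \<in> sets borel" for i using union(2) borel_\<P> by auto
      define U where "U = (\<Union>i. A i)"
      have U [measurable]: "U \<in> sets borel" unfolding U_def by measurable
      define g where "g k y = (\<Sum>i<k. w y * indicat_real (A i) y)" for k y
      have g_eq: "g k y = w y * indicat_real (\<Union>i<k. A i) y" for k y
      proof -
        have "disjoint_family_on A {..<k}" using union(1) by (auto simp: disjoint_family_on_def)
        then have "indicat_real (\<Union>i<k. A i) y = (\<Sum>i<k. indicat_real (A i) y)" by (intro indicator_UN_disjoint) auto
        then show ?thesis by (simp add: g_def sum_distrib_left)
      qed
      have "represents H (g k)" for k
      proof (induction k)
        case 0
        have "represents H (\<lambda>y. 0 * (w y * indicat_real (A 0) y) + 0 * (w y * indicat_real (A 0) y))"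
          by (intro lincomb union)
        then show ?case by (simp add: g_def[abs_def])
      next
        case (Suc k)
        have "g (Suc k) = (\<lambda>y. 1 * g k y + 1 * (w y * indicat_real (A k) y))" by (simp add: g_def fun_eq_iff)
        then show ?case using lincomb[OF Suc union(3)[of k], of 1 1] by (simp only:)
      qed
      moreover have "(\<lambda>k. Lp_norm 1 (\<lambda>y. g k y - w y * indicat_real U y)) \<longlonglongrightarrow> 0"
      proof -
        have "(\<lambda>k. LINT y|lborel. \<bar>g k y - w y * indicat_real U y\<bar>) \<longlonglongrightarrow> (LINT y::'a|lborel. 0)"
        proof (rule integral_dominated_convergence[where w = "\<lambda>y. w y"])
          show "AE y in lborel. (\<lambda>k. \<bar>g k y - w y * indicat_real U y\<bar>) \<longlonglongrightarrow> 0"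
          proof (intro AE_I2 tendsto_rabs_zero)
            fix y
            have "\<forall>\<^sub>F k in sequentially. g k y - w y * indicat_real U y = 0"
            proof (cases "y \<in> U")
              case True
              then obtain i where "y \<in> A i" by (auto simp: U_def)
              then have "g k y - w y * indicat_real U y = 0" if "k \<ge> Suc i" for k
                using that True unfolding g_eq by (auto simp: indicator_def)
              then show ?thesis unfolding eventually_sequentially by blast
            next
              case False
              then show ?thesis unfolding g_eq by (auto simp: indicator_def U_def)
            qed
            then show "(\<lambda>k. g k y - w y * indicat_real U y) \<longlonglongrightarrow> 0" by (rule tendsto_eventually)
          qed
          show "AE y in lborel. norm \<bar>g k y - w y * indicat_real U y\<bar> \<le> w y" for k
            unfolding g_eq using w0 by (intro AE_I2) (auto simp: indicator_def U_def less_imp_le)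
        qed (use w_int in \<open>auto simp: g_def\<close>)
        then show ?thesis by (simp add: Lp_norm1)
      qed
      ultimately show ?case using limit[of g "\<lambda>y. w y * indicat_real U y"] w1A[OF U] unfolding U_def by blast
    qed
  qed
  have rep_\<nu>: "represents H (\<lambda>y. w y * f y)" if "integrable \<nu> f" for f :: "'a \<Rightarrow> real"
    using that
  proof (induct f rule: integrable_induct)
    case (base A c)
    have "represents H (\<lambda>y. c * (w y * indicat_real A y) + 0 * (w y * indicat_real A y))"
      using base by (intro lincomb rep_borel) (simp_all add: sets_\<nu>)
    then show ?case by (simp add: mult_ac)
  next
    case (add f g)
    then show ?case using lincomb[of "\<lambda>y. w y * f y" "\<lambda>y. w y * g y" 1 1] by (simp add: distrib_left)
  next
    case (lim f u)
    have f_meas [measurable]: "f \<in> borel_measurable borel" using borel_measurable_integrable[OF lim(5)] by (simp add: measurable_cong_sets[OF sets_\<nu> refl])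
    have u_meas [measurable]: "u i \<in> borel_measurable borel" for i
      using borel_measurable_integrable[OF lim(1)] by (simp add: measurable_cong_sets[OF sets_\<nu> refl])
    have wf: "integrable lborel (\<lambda>y. w y * f y)" using lim(5) integrable_\<nu>[OF f_meas] by simp
    show ?case
    proof (rule limit[of "\<lambda>i y. w y * u i y"])
      show "represents H (\<lambda>y. w y * u i y)" for i by (rule lim)
      show "(\<lambda>y. w y * f y) \<in> Lp 1" using wf by (simp add: Lp1_iff)
      have "(\<lambda>i. LINT y|lborel. \<bar>w y * u i y - w y * f y\<bar>) \<longlonglongrightarrow> (LINT y::'a|lborel. 0)"
      proof (rule integral_dominated_convergence[where w = "\<lambda>y. 3 * \<bar>w y * f y\<bar>"])
        show "AE y in lborel. (\<lambda>i. \<bar>w y * u i y - w y * f y\<bar>) \<longlonglongrightarrow> 0"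
          using lim(3) by (intro AE_I2 tendsto_rabs_zero LIM_zero tendsto_mult tendsto_const) (simp add: space_\<nu>)
        show "AE y in lborel. norm \<bar>w y * u i y - w y * f y\<bar> \<le> 3 * \<bar>w y * f y\<bar>" for i
        proof (intro AE_I2)
          fix y
          have "\<bar>u i y - f y\<bar> \<le> 3 * \<bar>f y\<bar>" using lim(4)[of y i] by (simp add: space_\<nu>)
          then have "w y * \<bar>u i y - f y\<bar> \<le> w y * (3 * \<bar>f y\<bar>)" using w0[of y] by (intro mult_left_mono) auto
          then show "norm \<bar>w y * u i y - w y * f y\<bar> \<le> 3 * \<bar>w y * f y\<bar>"
            using w0[of y] by (simp add: right_diff_distrib[symmetric] abs_mult)
        qed
      qed (use wf in auto)
      then show "(\<lambda>i. Lp_norm 1 (\<lambda>y. w y * u i y - w y * f y)) \<longlonglongrightarrow> 0" by (simp add: Lp_norm1)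
    qed
  qed
  have "represents H f" if f: "f \<in> Lp 1" for f
  proof -
    have [measurable]: "f \<in> borel_measurable borel" using Lp_measurable[OF f] by simp
    have eq: "w y * (f y / w y) = f y" for y using w0[of y] by simp
    \<comment> \<open>As \<open>w\<close> is positive everywhere, every integrable function has the
      form \<open>w\<close> times a function integrable for \<open>\<nu>\<close>.\<close>
    have "integrable \<nu> (\<lambda>y. f y / w y)" using f by (subst integrable_\<nu>) (simp_all only: eq, simp_all add: Lp1_iff)
    from rep_\<nu>[OF this] show ?thesis unfolding eq .
  qed
  with that[of H] Hm H(2) show ?thesis by blast
qed

end

section \<open>Translations and convolution kernels\<close>

lemma lborel_shift: "distr lborel lborel (\<lambda>x. x + c) = (lborel :: 'a::euclidean_space measure)"
  using lborel_distr_plus[of c] by (simp add: add.commute[of _ c] cong: distr_cong)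

lemma AE_lborel_shift:
  fixes c :: "'a::euclidean_space"
  assumes "AE x in lborel. P x" shows "AE x in lborel. P (x + c)"
  by (rule AE_distrD[of "\<lambda>x. x + c" lborel lborel]) (use assms in \<open>simp, simp only: lborel_shift\<close>)

lemma integral_lborel_shift:
  fixes f :: "'a::euclidean_space \<Rightarrow> real"
  assumes "f \<in> borel_measurable borel" shows "(LINT x|lborel. f (x + c)) = (LINT x|lborel. f x)"
  using integral_distr[of "\<lambda>x. x + c" lborel lborel f] assms by (simp add: lborel_shift)

lemma integrable_lborel_shift:
  fixes f :: "'a::euclidean_space \<Rightarrow> real"
  assumes "integrable lborel f" shows "integrable lborel (\<lambda>x. f (x + c))"
  using integrable_distr[of "\<lambda>x. x + c" lborel lborel f] assms by (simp add: lborel_shift)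

lemma Lp1_shift:
  fixes f :: "'a::euclidean_space \<Rightarrow> real"
  assumes "f \<in> Lp 1" shows "(\<lambda>x. f (x - c)) \<in> Lp 1" "Lp_norm 1 (\<lambda>x. f (x - c)) = Lp_norm 1 f"
proof -
  show "(\<lambda>x. f (x - c)) \<in> Lp 1" using integrable_lborel_shift[of f "- c"] assms by (simp add: Lp1_iff)
  show "Lp_norm 1 (\<lambda>x. f (x - c)) = Lp_norm 1 f"
    using integral_lborel_shift[of "\<lambda>x. \<bar>f x\<bar>" "- c"] Lp_measurable[OF assms] by (simp add: Lp_norm1)
qed

context L1_Linf_operator
begin

text \<open>A kernel of an operator commuting with translations need be translation invariant only almost
  everywhere; averaging it along the diagonal against a probability density \<open>\<phi>\<close> repairs this.\<close>

theorem convolution_kernel: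
  assumes Hm: "(\<lambda>(x0, x). H x0 x) \<in> borel_measurable (lborel \<Otimes>\<^sub>M lborel)"
    and Hb: "\<And>x0 x. 0 \<le> H x0 x \<and> H x0 x \<le> K" and rep: "\<And>f. f \<in> Lp 1 \<Longrightarrow> represents H f"
    and shift: "\<And>f y. f \<in> Lp 1 \<Longrightarrow> AE x in lborel. S (\<lambda>x. f (x - y)) x = S f (x - y)"
  obtains k where "k \<in> borel_measurable borel" "\<And>z. 0 \<le> k z \<and> k z \<le> K"
    "\<And>f. f \<in> Lp 1 \<Longrightarrow> represents (\<lambda>x0 x. k (x - x0)) f"
proof -
  obtain w :: "'a \<Rightarrow> real" where w [measurable]: "w \<in> borel_measurable borel" and w0: "\<And>x. 0 < w x"
    and w1: "\<And>x. w x \<le> 1" and w_int: "integrable lborel w" by (rule lborel_weight) blast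
  define c where "c = (LINT x|lborel. w x)"
  have c: "0 < c"
  proof -
    have "0 \<le> c" unfolding c_def using w0 by (intro integral_nonneg_AE) (auto simp: less_imp_le)
    moreover have "c \<noteq> 0"
    proof
      assume "c = 0"
      then have "AE x in lborel. w x = 0"
        using integral_nonneg_eq_0_iff_AE[OF w_int] w0 by (auto simp: c_def less_imp_le)
      then have "AE x::'a in lborel. False" by eventually_elim (use w0 in \<open>metis less_irrefl\<close>)
      then show False by (simp add: trivial_limit_def[symmetric] ae_filter_eq_bot_iff)
    qed
    ultimately show ?thesis by simp
  qed
  define \<phi> where "\<phi> x = w x / c" for x
  have \<phi> [measurable]: "\<phi> \<in> borel_measurable borel" unfolding \<phi>_def[abs_def] by measurable
  have \<phi>0: "0 \<le> \<phi> x" and \<phi>1: "\<phi> x \<le> 1 / c" for x using w0[of x] w1[of x] c by (auto simp: \<phi>_def divide_right_mono)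
  have \<phi>_int: "integrable lborel \<phi>" and \<phi>_one: "(LINT x|lborel. \<phi> x) = 1"
    using w_int c by (auto simp: \<phi>_def[abs_def] c_def)
  have \<phi>s_int: "integrable lborel (\<lambda>y. \<phi> (v + y))" and \<phi>s_one: "(LINT y|lborel. \<phi> (v + y)) = 1" for v
    using integrable_lborel_shift[OF \<phi>_int, of v] integral_lborel_shift[of \<phi> v] \<phi>_one by (simp_all add: add.commute)
  have Hm': "case_prod H \<in> borel_measurable (borel \<Otimes>\<^sub>M borel)"
    using Hm by (subst measurable_cong_sets[OF sets_pair_measure_cong refl]) auto
  have Hc [measurable]: "(\<lambda>z. H (a z) (b z)) \<in> borel_measurable M"
    if "a \<in> borel_measurable M" "b \<in> borel_measurable M" for a b and M :: "'z measure"
    using measurable_compose[OF measurable_Pair[OF that] Hm'] by simp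
  have K': "\<bar>H x0 x\<bar> \<le> K" for x0 x using Hb[of x0 x] by simp
  \<comment> \<open>The average of \<open>H\<close> over all pairs of points that differ by
    \<open>z\<close>, with weight \<phi> at the pole. It is a function of the difference by
    construction.\<close>
  define k where "k z = (LINT u|lborel. H u (u + z) * \<phi> u)" for z
  have k_int: "integrable lborel (\<lambda>u. H u (u + z) * \<phi> u)" for z
    using bounded_mult_integrable(1)[of \<phi> "\<lambda>u. H u (u + z)" K] \<phi>_int K' by (simp add: Lp1_iff)
  have k_meas [measurable]: "k \<in> borel_measurable borel"
    unfolding k_def[abs_def] by (rule lborel.borel_measurable_lebesgue_integral) measurable
  have k_bd: "0 \<le> k z \<and> k z \<le> K" for z
  proof
    show "0 \<le> k z" unfolding k_def using Hb \<phi>0 by (intro integral_nonneg_AE) auto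
    have "k z \<le> (LINT u|lborel. K * \<phi> u)" unfolding k_def
      using k_int \<phi>_int Hb \<phi>0 by (intro integral_mono) (auto intro: mult_right_mono)
    then show "k z \<le> K" using \<phi>_one by simp
  qed
  have "represents (\<lambda>x0 x. k (x - x0)) f" if f: "f \<in> Lp 1" for f
  proof -
    have f_meas [measurable]: "f \<in> borel_measurable borel" using Lp_measurable[OF f] by simp
    have f_int: "integrable lborel f" using f by (simp add: Lp1_iff)
    \<comment> \<open>\<open>R\<close> applies the kernel to \<open>f\<close> with weight
      \<open>\<phi> (v + y)\<close>, and \<open>F\<close> does so with the kernel translated by
      \<open>y\<close>. Invariance of the operator makes them equal for almost all \<open>x\<close>.
      Integrated over \<open>y\<close>, \<open>R\<close> loses the weight and \<open>F\<close> turns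
      the translated kernel into \<open>k\<close>.\<close>
    define R where "R y x = (LINT v|lborel. H v x * (\<phi> (v + y) * f v))" for y x
    define F where "F y x = (LINT v|lborel. H (v + y) (x + y) * (\<phi> (v + y) * f v))" for y x
    have R_meas: "(\<lambda>z. R (fst z) (snd z)) \<in> borel_measurable (lborel \<Otimes>\<^sub>M lborel)"
      unfolding R_def by (rule lborel.borel_measurable_lebesgue_integral) measurable
    have F_meas: "(\<lambda>z. F (fst z) (snd z)) \<in> borel_measurable (lborel \<Otimes>\<^sub>M lborel)"
      unfolding F_def by (rule lborel.borel_measurable_lebesgue_integral) measurable
    have "AE x in lborel. F y x = R y x" for y
    proof -
      let ?g = "\<lambda>v. \<phi> (v + y) * f v"
      have g: "?g \<in> Lp 1"
        using bounded_mult_integrable(1)[OF f, of "\<lambda>v. \<phi> (v + y)" "1 / c"] \<phi>0 \<phi>1 by (simp add: Lp1_iff)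
      have "AE x in lborel. S (\<lambda>x. ?g (x - y)) x = (LINT u|lborel. H u x * ?g (u - y))"
        using rep[OF Lp1_shift(1)[OF g, of y]] by (simp add: represents_def)
      with shift[OF g, of y] have "AE x in lborel. S ?g (x - y) = (LINT u|lborel. H u x * ?g (u - y))"
        by eventually_elim simp
      from AE_lborel_shift[OF this, of y]
      have 1: "AE x in lborel. S ?g x = (LINT u|lborel. H u (x + y) * ?g (u - y))" by simp
      have 2: "(LINT u|lborel. H u (x + y) * ?g (u - y)) = F y x" for x
        using integral_lborel_shift[of "\<lambda>u. H u (x + y) * ?g (u - y)" y] by (simp add: F_def)
      have 3: "AE x in lborel. S ?g x = R y x" using rep[OF g] by (simp add: represents_def R_def)
      from 1 3 show ?thesis unfolding 2 by eventually_elim simp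
    qed
    then have "AE y in lborel. AE x in lborel. F y x = R y x" by simp
    \<comment> \<open>The exceptional null set of \<open>x\<close> depends on \<open>y\<close>.
      Exchanging the quantifiers, by Fubini, allows integration over \<open>y\<close> at almost
      every fixed \<open>x\<close>.\<close>
    then have "AE x in lborel. AE y in lborel. F y x = R y x"
      by (subst (asm) lborel_pair.AE_commute) (use F_meas R_meas in measurable)
    moreover have "AE x in lborel. S f x = (LINT v|lborel. H v x * f v)" using rep[OF f] by (simp add: represents_def)
    ultimately have "AE x in lborel. S f x = (LINT v|lborel. k (x - v) * f v)"
    proof eventually_elim
      case (elim x)
      have swap: "(LINT y|lborel. LINT v|lborel. q v y * (\<phi> (v + y) * f v)) = (LINT v|lborel. (LINT y|lborel. q v y * \<phi> (v + y)) * f v)"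
        if q: "case_prod q \<in> borel_measurable (borel \<Otimes>\<^sub>M borel)" and qb: "\<And>v y. \<bar>q v y\<bar> \<le> K" for q
      proof -
        have int: "integrable (lborel \<Otimes>\<^sub>M lborel) (\<lambda>(v, y). \<phi> (v + y) * f v)"
        proof (rule lborel_pair.Fubini_integrable)
          show "(\<lambda>(v, y). \<phi> (v + y) * f v) \<in> borel_measurable (lborel \<Otimes>\<^sub>M lborel)" by measurable
          have "(LINT y|lborel. norm (\<phi> (v + y) * f v)) = \<bar>f v\<bar>" for v
            using \<phi>0 \<phi>s_one[of v] by (simp add: abs_mult)
          then show "integrable lborel (\<lambda>v. LINT y|lborel. norm (case (v, y) of (v, y) \<Rightarrow> \<phi> (v + y) * f v))"
            using f_int by simp
          show "AE v in lborel. integrable lborel (\<lambda>y. case (v, y) of (v, y) \<Rightarrow> \<phi> (v + y) * f v)"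
            using \<phi>s_int by simp
        qed
        have [measurable]: "(\<lambda>z. q (fst z) (snd z)) \<in> borel_measurable (lborel \<Otimes>\<^sub>M lborel)"
          using q by (subst measurable_cong_sets[OF sets_pair_measure_cong refl]) (auto simp: split_beta')
        have "integrable (lborel \<Otimes>\<^sub>M lborel) (\<lambda>(v, y). q v y * (\<phi> (v + y) * f v))"
        proof (rule Bochner_Integration.integrable_bound)
          show "integrable (lborel \<Otimes>\<^sub>M lborel) (\<lambda>z. K * norm (case z of (v, y) \<Rightarrow> \<phi> (v + y) * f v))"
            using int by (intro integrable_mult_right integrable_norm)
          show "(\<lambda>(v, y). q v y * (\<phi> (v + y) * f v)) \<in> borel_measurable (lborel \<Otimes>\<^sub>M lborel)" by measurable
          show "AE z in lborel \<Otimes>\<^sub>M lborel. norm (case z of (v, y) \<Rightarrow> q v y * (\<phi> (v + y) * f v))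
              \<le> norm (K * norm (case z of (v, y) \<Rightarrow> \<phi> (v + y) * f v))"
            using qb K by (intro AE_I2) (auto simp: abs_mult intro!: mult_right_mono)
        qed
        from lborel_pair.Fubini_integral[OF this] show ?thesis by (simp add: mult.assoc[symmetric])
      qed
      have "(LINT y|lborel. R y x) = (LINT v|lborel. H v x * f v)"
        unfolding R_def using swap[of "\<lambda>v y. H v x"] K' \<phi>s_one by simp
      moreover have "(LINT y|lborel. F y x) = (LINT v|lborel. k (x - v) * f v)"
      proof -
        have "(LINT y|lborel. F y x) = (LINT v|lborel. (LINT y|lborel. H (v + y) (x + y) * \<phi> (v + y)) * f v)"
          unfolding F_def using K' by (intro swap) measurable
        moreover have "(LINT y|lborel. H (v + y) (x + y) * \<phi> (v + y)) = k (x - v)" for v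
          using integral_lborel_shift[of "\<lambda>u. H u (u + (x - v)) * \<phi> u" v] by (simp add: k_def add.commute)
        ultimately show ?thesis by simp
      qed
      moreover have "(LINT y|lborel. F y x) = (LINT y|lborel. R y x)"
      proof (rule integral_cong_AE)
        show "(\<lambda>y. F y x) \<in> borel_measurable lborel" "(\<lambda>y. R y x) \<in> borel_measurable lborel"
          using measurable_compose[OF measurable_Pair2'[of x lborel lborel] F_meas]
            measurable_compose[OF measurable_Pair2'[of x lborel lborel] R_meas] by simp_all
        show "AE y in lborel. F y x = R y x" using elim by blast
      qed
      ultimately show ?case using elim by simp
    qed
    then show ?thesis using f by (simp add: represents_def)
  qed
  with that[of k] k_meas k_bd show ?thesis by blast
qed

end

section \<open>The heat kernel\<close>

context admissible
begin

definition shift :: "'a \<Rightarrow> 'a l1 \<Rightarrow> 'a l1" where "shift y x = abs_l1 (\<lambda>s. rep_l1 x (s - y))"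

lemma shift_abs:
  assumes f: "f \<in> Lp 1" shows "shift y (abs_l1 f) = abs_l1 (\<lambda>s. f (s - y))"
proof -
  have "AE s in lborel. rep_l1 (abs_l1 f) (s + - y) = f (s + - y)"
    by (rule AE_lborel_shift) (use rep_abs_l1[OF f] in \<open>simp add: ae_eq_def\<close>)
  then show ?thesis
    unfolding shift_def by (subst abs_l1_eq_iff[OF Lp1_shift(1)[OF rep_l1_Lp] Lp1_shift(1)[OF f]]) (simp add: ae_eq_def)
qed

lemma shift_lincomb: "shift y (a *\<^sub>R x + b *\<^sub>R z) = a *\<^sub>R shift y x + b *\<^sub>R shift y z"
proof (induction x rule: l1_induct)
  case (1 f)
  show ?case
  proof (induction z rule: l1_induct)
    case (1 g)
    with \<open>f \<in> Lp 1\<close> show ?case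
      using shift_abs[OF Lp1_lincomb[of f g a b], of y] abs_l1_lincomb[of f g a b]
        abs_l1_lincomb[OF Lp1_shift(1)[of f y] Lp1_shift(1)[of g y], of a b]
      by (simp add: shift_abs)
  qed
qed

lemma linear_shift: "linear (shift y)"
  by (rule linearI) (use shift_lincomb[of y 1 _ 1] shift_lincomb[of y _ _ 0] in auto)

lemma norm_shift: "norm (shift y x) = norm x"
  by (induction x rule: l1_induct) (simp add: shift_abs norm_abs_l1 Lp1_shift)

text \<open>Invariance says that translations preserve the graph, so they commute with resolvents,
  with their powers and, being isometries, with the limit.\<close>

lemma shift_S:
  assumes ti: "translation_invariant A" and t: "t \<ge> 0"
  shows "shift y (A1.S t x) = A1.S t (shift y x)"
proof -
  have "(shift y u, shift y v) \<in> G1" if uv: "(u, v) \<in> G1" for u v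
  proof -
    obtain f g where fg: "u = abs_l1 f" "v = abs_l1 g" "(f, g) \<in> A" using uv by (auto simp: G1_def)
    have "(\<lambda>x. f (x - y), \<lambda>x. g (x - y)) \<in> A" using ti fg(3) by (auto simp: translation_invariant_def)
    then show ?thesis using A_Lp[OF fg(3)] by (auto simp: fg shift_abs G1_def)
  qed
  then have J: "shift y (A1.J \<mu> z) = A1.J \<mu> (shift y z)" for \<mu> z by (rule A1.J_commute[OF _ linear_shift])
  have "shift y ((A1.J \<mu> ^^ n) z) = (A1.J \<mu> ^^ n) (shift y z)" for \<mu> n z by (induction n) (simp_all add: J)
  then have V: "shift y (A1.V n t x) = A1.V n t (shift y x)" for n by (simp add: A1.V_def)
  have "bounded_linear (shift y)"
    by (rule bounded_linear_contraction[OF linear_shift]) (simp add: norm_shift)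
  then have "(\<lambda>n. shift y (A1.V n t x)) \<longlonglongrightarrow> shift y (A1.S t x)"
    by (rule bounded_linear.tendsto) (rule A1.V_tendsto_S[OF t])
  then show ?thesis unfolding V by (rule LIMSEQ_unique) (rule A1.V_tendsto_S[OF t])
qed

lemma heat_semigroup_shift:
  assumes ti: "translation_invariant A" and t: "t \<ge> 0" and f: "f \<in> Lp 1"
  shows "AE x in lborel. heat_semigroup A t (\<lambda>x. f (x - y)) x = heat_semigroup A t f (x - y)"
proof -
  note hs = heat_semigroup[OF t]
  have "abs_l1 (heat_semigroup A t (\<lambda>x. f (x - y))) = shift y (abs_l1 (heat_semigroup A t f))"
    by (simp add: hs f Lp1_shift shift_S[OF ti t] shift_abs)
  also have "\<dots> = abs_l1 (\<lambda>x. heat_semigroup A t f (x - y))" by (rule shift_abs[OF hs(1)[OF f]])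
  finally show ?thesis
    using abs_l1_eq_iff[OF hs(1)[OF Lp1_shift(1)[OF f]] Lp1_shift(1)[OF hs(1)[OF f]]] by (simp add: ae_eq_def)
qed

lemma heat_semigroup_lincomb:
  assumes t: "t \<ge> 0" and f: "f \<in> Lp 1" and g: "g \<in> Lp 1"
  shows "AE x in lborel. heat_semigroup A t (\<lambda>x. a * f x + b * g x) x = a * heat_semigroup A t f x + b * heat_semigroup A t g x"
proof -
  note hs = heat_semigroup[OF t]
  have "abs_l1 (heat_semigroup A t (\<lambda>x. a * f x + b * g x)) = A1.S t (a *\<^sub>R abs_l1 f + b *\<^sub>R abs_l1 g)"
    by (simp add: hs(2) Lp1_lincomb f g abs_l1_lincomb)
  also have "\<dots> = a *\<^sub>R abs_l1 (heat_semigroup A t f) + b *\<^sub>R abs_l1 (heat_semigroup A t g)"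
    by (simp add: hs(2) f g linear_add[OF A1.linear_S[OF t]] linear_cmul[OF A1.linear_S[OF t]])
  also have "\<dots> = abs_l1 (\<lambda>x. a * heat_semigroup A t f x + b * heat_semigroup A t g x)"
    by (rule abs_l1_lincomb[OF hs(1)[OF f] hs(1)[OF g], symmetric])
  finally show ?thesis
    using abs_l1_eq_iff[OF hs(1)[OF Lp1_lincomb[OF f g]] Lp1_lincomb[OF hs(1)[OF f] hs(1)[OF g]]] by (simp add: ae_eq_def)
qed

lemma heat_semigroup_nonneg:
  assumes t: "t > 0" and f: "f \<in> Lp 1" "AE x in lborel. 0 \<le> f x"
  shows "AE x in lborel. 0 \<le> heat_semigroup A t f x"
proof -
  have t0: "t \<ge> 0" using t by simp
  note hs = heat_semigroup[OF t0 f(1)]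
  have "ae_eq (rep_l1 (A1.S t (abs_l1 f))) (heat_semigroup A t f)"
    unfolding hs(2)[symmetric] by (rule rep_abs_l1[OF hs(1)])
  with S1_nonneg[OF f t] show ?thesis unfolding ae_eq_def by eventually_elim simp
qed

lemma kernel_at_time:
  assumes sm: "smoothing \<kappa> C" and C: "C > 0" and t: "t > 0"
  shows "\<exists>h. (\<lambda>(x0, x). h x0 x) \<in> borel_measurable (lborel \<Otimes>\<^sub>M lborel) \<and>
    (\<forall>x0 x. 0 \<le> h x0 x \<and> h x0 x \<le> C * t powr (- \<kappa>)) \<and>
    (\<forall>f\<in>Lp 1. AE x in lborel. heat_semigroup A t f x = (LINT x0|lborel. h x0 x * f x0)) \<and>
    (translation_invariant A \<longrightarrow> (\<forall>x0 x. h x0 x = h 0 (x - x0)))"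
proof -
  have t0: "t \<ge> 0" using t by simp
  interpret L: L1_Linf_operator "heat_semigroup A t" "C * t powr (- \<kappa>)"
  proof
    show "heat_semigroup A t f \<in> borel_measurable borel" if "f \<in> Lp 1" for f
      using Lp_measurable[OF heat_semigroup(1)[OF t0 that]] by simp
    show "AE x in lborel. \<bar>heat_semigroup A t f x\<bar> \<le> C * t powr (- \<kappa>) * Lp_norm 1 f" if "f \<in> Lp 1" for f
      using sm t that by (simp add: smoothing_def)
  qed (use heat_semigroup_lincomb[OF t0] heat_semigroup_nonneg[OF t] C in auto)
  obtain H where H: "(\<lambda>(x0, x). H x0 x) \<in> borel_measurable (lborel \<Otimes>\<^sub>M lborel)"
    "\<And>x0 x. 0 \<le> H x0 x \<and> H x0 x \<le> C * t powr (- \<kappa>)" "\<And>f. f \<in> Lp 1 \<Longrightarrow> L.represents H f"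
    by (rule L.kernel_exists) blast
  show ?thesis
  \<comment> \<open>The convolution form is demanded of the kernel only for invariant operators; in
    the other case the bounded kernel from the martingale serves directly.\<close>
  proof (cases "translation_invariant A")
    case True
    obtain k where k: "k \<in> borel_measurable borel" "\<And>z. 0 \<le> k z \<and> k z \<le> C * t powr (- \<kappa>)"
      "\<And>f. f \<in> Lp 1 \<Longrightarrow> L.represents (\<lambda>x0 x. k (x - x0)) f"
    proof (rule L.convolution_kernel)
      show "AE x in lborel. heat_semigroup A t (\<lambda>x. f (x - y)) x = heat_semigroup A t f (x - y)" if "f \<in> Lp 1" for f y
        by (rule heat_semigroup_shift[OF True t0 that])
    qed (rule H that, assumption?)+
    have [measurable]: "k \<in> borel_measurable borel" by (rule k)
    have "(\<lambda>(x0, x). k (x - x0)) \<in> borel_measurable (lborel \<Otimes>\<^sub>M lborel)" by measurable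
    with k show ?thesis by (intro exI[of _ "\<lambda>x0 x. k (x - x0)"]) (auto simp: L.represents_def)
  next
    case False
    with H show ?thesis by (intro exI[of _ H]) (auto simp: L.represents_def)
  qed
qed

lemma smoothing_imp_heat_kernel:
  assumes sm: "smoothing \<kappa> C" and C: "C > 0"
  obtains H where "heat_kernel A H" "\<And>x0 x t. t > 0 \<Longrightarrow> 0 \<le> H x0 x t \<and> H x0 x t \<le> C * t powr (- \<kappa>)"
proof -
  from kernel_at_time[OF sm C] have "\<forall>t\<in>{0<..}. \<exists>h. (\<lambda>(x0, x). h x0 x) \<in> borel_measurable (lborel \<Otimes>\<^sub>M lborel) \<and>
    (\<forall>x0 x. 0 \<le> h x0 x \<and> h x0 x \<le> C * t powr (- \<kappa>)) \<and>
    (\<forall>f\<in>Lp 1. AE x in lborel. heat_semigroup A t f x = (LINT x0|lborel. h x0 x * f x0)) \<and>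
    (translation_invariant A \<longrightarrow> (\<forall>x0 x. h x0 x = h 0 (x - x0)))" by simp
  from bchoice[OF this] obtain h where
    h: "\<forall>t\<in>{0<..}. (\<lambda>(x0, x). h t x0 x) \<in> borel_measurable (lborel \<Otimes>\<^sub>M lborel) \<and>
    (\<forall>x0 x. 0 \<le> h t x0 x \<and> h t x0 x \<le> C * t powr (- \<kappa>)) \<and>
    (\<forall>f\<in>Lp 1. AE x in lborel. heat_semigroup A t f x = (LINT x0|lborel. h t x0 x * f x0)) \<and>
    (translation_invariant A \<longrightarrow> (\<forall>x0 x. h t x0 x = h t 0 (x - x0)))" by blast
  have hm: "(\<lambda>(x0, x). h t x0 x) \<in> borel_measurable (lborel \<Otimes>\<^sub>M lborel)"
    and hb: "0 \<le> h t x0 x \<and> h t x0 x \<le> C * t powr (- \<kappa>)"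
    and hr: "f \<in> Lp 1 \<Longrightarrow> AE x in lborel. heat_semigroup A t f x = (LINT x0|lborel. h t x0 x * f x0)"
    and ht: "translation_invariant A \<Longrightarrow> \<forall>x0 x. h t x0 x = h t 0 (x - x0)" if "t > 0" for t x0 x f
    using bspec[OF h, of t] that by simp_all
  \<comment> \<open>The convolution identity in \<open>heat_kernel\<close> ranges over all real
    \<open>t\<close>, so the kernel is set to 0 at times that are not positive.\<close>
  define H where "H x0 x t = (if t > 0 then h t x0 x else 0)" for x0 x t
  have hi: "integrable lborel (\<lambda>x0. h t x0 x * f x0)" if "t > 0" "f \<in> Lp 1" for t x f
  proof (rule bounded_mult_integrable(1)[OF that(2)])
    show "(\<lambda>x0. h t x0 x) \<in> borel_measurable borel"
      using measurable_compose[OF measurable_Pair2'[of x lborel lborel] hm[OF that(1)]] by simp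
    show "\<bar>h t x0 x\<bar> \<le> C * t powr (- \<kappa>)" for x0 using hb[OF that(1), of x0 x] by simp
  qed
  have "heat_kernel A H"
    unfolding heat_kernel_def
  proof (intro conjI allI impI ballI)
    fix t :: real assume t: "t > 0"
    then have Ht: "H x0 x t = h t x0 x" for x0 x by (simp add: H_def)
    show "(\<lambda>(x0, x). H x0 x t) \<in> borel_measurable (lborel \<Otimes>\<^sub>M lborel)" unfolding Ht by (rule hm[OF t])
    fix f :: "'a \<Rightarrow> real" assume f: "f \<in> Lp 1"
    from hr[OF t f] show "AE x in lborel. integrable lborel (\<lambda>x0. H x0 x t * f x0) \<and>
        heat_semigroup A t f x = (LINT x0|lborel. H x0 x t * f x0)"
      unfolding Ht by eventually_elim (use hi[OF t f] in blast)
  next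
    fix x0 x t assume "translation_invariant A"
    then show "H x0 x t = H 0 (x - x0) t" using ht[of t] unfolding H_def by metis
  qed
  moreover have "0 \<le> H x0 x t \<and> H x0 x t \<le> C * t powr (- \<kappa>)" if "t > 0" for x0 x t
    using hb[OF that] that by (simp add: H_def)
  ultimately show ?thesis by (rule that)
qed

lemma heat_kernel_imp_smoothing:
  assumes H: "heat_kernel A H" "\<And>x0 x t. t > 0 \<Longrightarrow> 0 \<le> H x0 x t \<and> H x0 x t \<le> C * t powr (- \<kappa>)"
  shows "smoothing \<kappa> C"
  unfolding smoothing_def
proof (intro ballI allI impI)
  fix f :: "'a \<Rightarrow> real" and t :: real assume f: "f \<in> Lp 1" and t: "t > 0"
  have hm: "(\<lambda>(x0, x). H x0 x t) \<in> borel_measurable (lborel \<Otimes>\<^sub>M lborel)" using H(1) t by (simp add: heat_kernel_def)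
  have bd: "\<bar>LINT x0|lborel. H x0 x t * f x0\<bar> \<le> C * t powr (- \<kappa>) * Lp_norm 1 f" for x
  proof (rule bounded_mult_integrable(2)[OF f])
    show "(\<lambda>x0. H x0 x t) \<in> borel_measurable borel"
      using measurable_compose[OF measurable_Pair2'[of x lborel lborel] hm] by simp
    show "\<bar>H x0 x t\<bar> \<le> C * t powr (- \<kappa>)" for x0 using H(2)[OF t, of x0 x] by simp
  qed
  have "AE x in lborel. heat_semigroup A t f x = (LINT x0|lborel. H x0 x t * f x0)"
    using H(1) f t by (simp add: heat_kernel_def)
  then show "AE x in lborel. \<bar>heat_semigroup A t f x\<bar> \<le> C * t powr (- \<kappa>) * Lp_norm 1 f"
    by eventually_elim (simp only: bd)
qed

end

section \<open>The equivalence of the four statements\<close>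

lemma Linf_norm_le_iff:
  assumes "f \<in> borel_measurable lborel"
  shows "Linf_norm f \<le> ereal c \<longleftrightarrow> (AE x in lborel. \<bar>f x\<bar> \<le> c)"
proof
  assume "Linf_norm f \<le> ereal c"
  moreover have "AE x in lborel. ereal \<bar>f x\<bar> \<le> Linf_norm f" unfolding Linf_norm_def by (rule esssup_AE)
  ultimately show "AE x in lborel. \<bar>f x\<bar> \<le> c" by (auto elim!: eventually_mono dest: order_trans)
next
  assume "AE x in lborel. \<bar>f x\<bar> \<le> c"
  then show "Linf_norm f \<le> ereal c" unfolding Linf_norm_def using assms by (intro esssup_I) auto
qed

theorem theorem6p1:
  fixes A :: "(real ^ 'n) operator" and N \<alpha> two_star \<theta> :: real
  assumes "CARD('n) \<ge> 3" and "N = real CARD('n)"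
    and "0 < \<alpha>" and "\<alpha> \<le> 2"
    and "two_star = 2 * N / (N - \<alpha>)"
    and "\<theta> = 1 / 2 * ((two_star - 2) / (two_star - 1))"
    and "admissible_operator A"
  shows
   "let
      smoothing = (\<exists>C>0. \<forall>u0\<in>Lp 1. \<forall>t>0.
        Linf_norm (heat_semigroup A t u0) \<le> ereal (C * t powr (- (N / \<alpha>)) * Lp_norm 1 u0));
      sobolev = (\<exists>C>0. \<forall>f\<in>Lp 1 \<inter> dom_Q A.
        f \<in> Lp two_star \<and> Lp_norm two_star f \<le> C * Q_form A f powr (1 / 2));
      nash = (\<exists>C>0. \<forall>f\<in>Lp 1 \<inter> dom_Q A.
        Lp_norm 2 f \<le> C * Lp_norm 1 f powr \<theta> * Q_form A f powr (1 / 2 * (1 - \<theta>)));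
      heat_kernel_bounds = (\<exists>H. heat_kernel A H \<and> (\<exists>C>0. \<forall>x0 x. \<forall>t>0.
        0 \<le> H x0 x t \<and> H x0 x t \<le> C * t powr (- (N / \<alpha>))))
    in (smoothing \<longleftrightarrow> sobolev) \<and> (sobolev \<longleftrightarrow> nash) \<and> (nash \<longleftrightarrow> heat_kernel_bounds)"
proof -
  interpret admissible A by unfold_locales (rule assms)
  define \<kappa> where "\<kappa> = N / \<alpha>"
  have N: "N \<ge> 3" using assms(1,2) by simp
  \<comment> \<open>The dimension is at least 3 and \<alpha> is at most 2. This makes 2^* finite and
    larger than 2, and gives \<open>2 * \<theta> < 1\<close>, on which the absorption in the level
    sums depends.\<close>
  have \<kappa>1: "\<kappa> > 1" using N assms(3,4) by (simp add: \<kappa>_def)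
  have N_eq: "N = \<kappa> * \<alpha>" using assms(3) by (simp add: \<kappa>_def)
  have q: "two_star = 2 * \<kappa> / (\<kappa> - 1)"
  proof -
    have "two_star = (2 * \<kappa> * \<alpha>) / ((\<kappa> - 1) * \<alpha>)" by (simp add: assms(5) N_eq algebra_simps)
    then show ?thesis using assms(3) by simp
  qed
  have "two_star - 2 = 2 / (\<kappa> - 1)" "two_star - 1 = (\<kappa> + 1) / (\<kappa> - 1)"
    using \<kappa>1 unfolding q by (simp_all add: field_simps)
  moreover have "(2 / a) / (b / a) = 2 / b" if "a \<noteq> 0" for a b :: real using that by simp
  from this[of "\<kappa> - 1" "\<kappa> + 1"] have "(2 / (\<kappa> - 1)) / ((\<kappa> + 1) / (\<kappa> - 1)) = 2 / (1 + \<kappa>)"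
    using \<kappa>1 by (simp only: add.commute)
  ultimately have \<theta>: "\<theta> = 1 / (1 + \<kappa>)" unfolding assms(6) by simp
  let ?smoothing = "\<exists>C>0. smoothing \<kappa> C"
  let ?sobolev = "\<exists>C>0. \<forall>f\<in>Lp 1 \<inter> dom_Q A. f \<in> Lp two_star \<and> Lp_norm two_star f \<le> C * Q_form A f powr (1 / 2)"
  let ?nash = "\<exists>C>0. \<forall>f\<in>Lp 1 \<inter> dom_Q A. Lp_norm 2 f \<le> C * Lp_norm 1 f powr \<theta> * Q_form A f powr (1 / 2 * (1 - \<theta>))"
  let ?kernel = "\<exists>H. heat_kernel A H \<and> (\<exists>C>0. \<forall>x0 x. \<forall>t>0. 0 \<le> H x0 x t \<and> H x0 x t \<le> C * t powr (- (N / \<alpha>)))"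
  have "Linf_norm (heat_semigroup A t u) \<le> ereal c \<longleftrightarrow> (AE x in lborel. \<bar>heat_semigroup A t u x\<bar> \<le> c)"
    if "t > 0" "u \<in> Lp 1" for t u c
    using Linf_norm_le_iff[OF Lp_measurable[OF heat_semigroup(1)]] that by simp
  then have sm: "(\<exists>C>0. \<forall>u0\<in>Lp 1. \<forall>t>0.
      Linf_norm (heat_semigroup A t u0) \<le> ereal (C * t powr (- (N / \<alpha>)) * Lp_norm 1 u0)) \<longleftrightarrow> ?smoothing"
    by (simp add: smoothing_def \<kappa>_def)
  have 1: ?sobolev if ?smoothing
    using that smoothing_imp_sobolev[OF _ _ \<kappa>1 q] by blast
  have 2: ?nash if ?sobolev
  proof -
    obtain D where D: "D > 0" "\<And>f. f \<in> Lp 1 \<inter> dom_Q A \<Longrightarrow> f \<in> Lp two_star \<and> Lp_norm two_star f \<le> D * Q_form A f powr (1 / 2)"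
      using \<open>?sobolev\<close> by blast
    have "Lp_norm 2 f \<le> D powr (1 - \<theta>) * Lp_norm 1 f powr \<theta> * Q_form A f powr (1 / 2 * (1 - \<theta>))" if "f \<in> Lp 1 \<inter> dom_Q A" for f
      using that D by (intro sobolev_imp_nash[OF \<kappa>1 q \<theta>]) auto
    then show ?thesis using D(1) by (intro exI[of _ "D powr (1 - \<theta>)"]) auto
  qed
  have 3: ?smoothing if ?nash
  proof -
    obtain D where D: "D > 0" "\<And>f. f \<in> Lp 1 \<inter> dom_Q A \<Longrightarrow>
        Lp_norm 2 f \<le> D * Lp_norm 1 f powr \<theta> * Q_form A f powr (1 / 2 * (1 - \<theta>))"
      using \<open>?nash\<close> by blast
    show ?thesis by (rule nash_imp_smoothing[OF _ \<theta> D(1) D(2)]) (use \<kappa>1 in auto)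
  qed
  have 4: ?kernel if ?smoothing
  proof -
    obtain C where C: "smoothing \<kappa> C" "C > 0" using \<open>?smoothing\<close> by blast
    obtain H where "heat_kernel A H" "\<And>x0 x t. t > 0 \<Longrightarrow> 0 \<le> H x0 x t \<and> H x0 x t \<le> C * t powr (- \<kappa>)"
      by (rule smoothing_imp_heat_kernel[OF C]) blast
    with C(2) show ?thesis unfolding \<kappa>_def by blast
  qed
  have 5: ?smoothing if ?kernel
  proof -
    obtain H C where "heat_kernel A H" "C > 0" "\<And>x0 x t. t > 0 \<Longrightarrow> 0 \<le> H x0 x t \<and> H x0 x t \<le> C * t powr (- \<kappa>)"
      using \<open>?kernel\<close> unfolding \<kappa>_def by blast
    with heat_kernel_imp_smoothing[of H C \<kappa>] show ?thesis by blast
  qed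
  from 1 2 3 4 5 show ?thesis unfolding Let_def sm by blast
qed

end
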